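(* Under the standing assumptions, assume $\alpha\in W^{2,\infty}(D)$ and let $T$ be the solution operator. Then $\mathrm{Range}(T)\subseteq\mathscr{D}(\Delta^2)$ and there is $C>0$ such that $\|Tf\|_{\mathscr{D}(\Delta^2)}\le C\|f\|_{L^2(D)}$ for all $f\in X(D)$.
   Context: Standing assumptions: $D\subset\mathbb{R}^d$, $d\in\{2,3\}$, is a bounded simply connected open set whose boundary $\partial D$ is either polygonal with no reentrant corners or of class $C^2$. The coefficients $\alpha,\beta\in L^\infty(D)$ are real-valued and there are positive constants with $\alpha_{\min}\le\alpha(x)\le\alpha_{\max}$ and $\beta_{\min}\le\beta(x)\le\beta_{\max}$ for a.e. $x\in D$. $X(D)=H^2(D)\cap H^1_0(D)$ with norm $\|u\|_{X(D)}=\|\Delta u\|_{L^2(D)}$. Forms $a(u,v)=\int_D\alpha\,\Delta u\,\Delta\overline{v}\,dx$, $b(u,v)=\int_D\beta\,u\,\overline{v}\,dx$. The solution operator $T:X(D)\to X(D)$ is defined by $a(Tf,v)=b(f,v)$ for all $v\in X(D)$. $W^{2,\infty}(D)$: functions in $L^\infty(D)$ with weak first and second derivatives in $L^\infty(D)$. Let $(\lambda_j,\phi_j)_{j\ge1}$ be the Dirichlet eigenpairs of the Laplacian on $D$: $-\Delta\phi_j=\lambda_j\phi_j$ in $D$, $\phi_j\in H^1_0(D)$, $\|\phi_j\|_{L^2(D)}=1$, $0<\lambda_1\le\lambda_2\le\cdots$, forming an orthonormal basis of $L^2(D)$. For $m\in\mathbb{N}$, $\mathscr{D}(\Delta^m)=\{f\in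 L^2(D):\sum_{j}\lambda_j^{2m}|(f,\phi_j)_{L^2(D)}|^2<\infty\}$ with norm $\|f\|^2_{\mathscr{D}(\Delta^m)}=\sum_{j=1}^\infty\lambda_j^{2m}|(f,\phi_j)_{L^2(D)}|^2$. *)

theory Defs
  imports "HOL-Analysis.Analysis"
begin

fun dderiv :: "'a::real_normed_vector list \<Rightarrow> ('a \<Rightarrow> 'b::real_normed_vector) \<Rightarrow> 'a \<Rightarrow> 'b" where
  "dderiv [] f = f"
| "dderiv (v # vs) f = (\<lambda>x. frechet_derivative (dderiv vs f) (at x) v)"

definition smooth :: "('a::euclidean_space \<Rightarrow> 'b::real_normed_vector) \<Rightarrow> bool" where
  "smooth f \<longleftrightarrow> (\<forall>vs. set vs \<subseteq> Basis \<longrightarrow> (\<forall>x. dderiv vs f differentiable (at x)))"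

definition tsupp :: "('a::euclidean_space \<Rightarrow> 'b::zero) \<Rightarrow> 'a set" where
  "tsupp f = closure {x. f x \<noteq> 0}"

definition test_fun :: "'a::euclidean_space set \<Rightarrow> ('a \<Rightarrow> complex) \<Rightarrow> bool" where
  "test_fun D \<phi> \<longleftrightarrow> smooth \<phi> \<and> compact (tsupp \<phi>) \<and> tsupp \<phi> \<subseteq> D"

definition L2 :: "'a::euclidean_space set \<Rightarrow> ('a \<Rightarrow> complex) set" where
  "L2 D = {u. u \<in> borel_measurable (lebesgue_on D) \<and>
               integrable (lebesgue_on D) (\<lambda>x. (cmod (u x))\<^sup>2)}"

definition L2norm :: "'a::euclidean_space set \<Rightarrow> ('a \<Rightarrow> complex) \<Rightarrow> real" where
  "L2norm D u = sqrt (LINT x|lebesgue_on D. (cmod (u x))\<^sup>2)"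

definition L2inner :: "'a::euclidean_space set \<Rightarrow> ('a \<Rightarrow> complex) \<Rightarrow> ('a \<Rightarrow> complex) \<Rightarrow> complex" where
  "L2inner D f g = (LINT x|lebesgue_on D. f x * cnj (g x))"

definition Linf :: "'a::euclidean_space set \<Rightarrow> ('a \<Rightarrow> complex) \<Rightarrow> bool" where
  "Linf D u \<longleftrightarrow> u \<in> borel_measurable (lebesgue_on D) \<and>
                 (\<exists>M. AE x in lebesgue_on D. cmod (u x) \<le> M)"

definition weak_deriv :: "'a::euclidean_space set \<Rightarrow> ('a \<Rightarrow> complex) \<Rightarrow> 'a \<Rightarrow> ('a \<Rightarrow> complex) \<Rightarrow> bool" where
  "weak_deriv D u i g \<longleftrightarrow> (\<forall>\<phi>. test_fun D \<phi> \<longrightarrow>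
      integrable (lebesgue_on D) (\<lambda>x. u x * dderiv [i] \<phi> x) \<and>
      integrable (lebesgue_on D) (\<lambda>x. g x * \<phi> x) \<and>
      (LINT x|lebesgue_on D. u x * dderiv [i] \<phi> x) = - (LINT x|lebesgue_on D. g x * \<phi> x))"

definition H1 :: "'a::euclidean_space set \<Rightarrow> ('a \<Rightarrow> complex) set" where
  "H1 D = {u \<in> L2 D. \<forall>i\<in>Basis. \<exists>g\<in>L2 D. weak_deriv D u i g}"

definition H2 :: "'a::euclidean_space set \<Rightarrow> ('a \<Rightarrow> complex) set" where
  "H2 D = {u \<in> L2 D. \<forall>i\<in>Basis. \<exists>g\<in>L2 D. weak_deriv D u i g \<and>
                         (\<forall>j\<in>Basis. \<exists>h\<in>L2 D. weak_deriv D g j h)}"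

definition H10 :: "'a::euclidean_space set \<Rightarrow> ('a \<Rightarrow> complex) set" where
  "H10 D = {u \<in> H1 D. \<exists>\<psi> :: nat \<Rightarrow> 'a \<Rightarrow> complex. (\<forall>n. test_fun D (\<psi> n)) \<and>
      ((\<lambda>n. LINT x|lebesgue_on D. (cmod (\<psi> n x - u x))\<^sup>2) \<longlonglongrightarrow> 0) \<and>
      (\<forall>i\<in>Basis. \<exists>g\<in>L2 D. weak_deriv D u i g \<and>
          ((\<lambda>n. LINT x|lebesgue_on D. (cmod (dderiv [i] (\<psi> n) x - g x))\<^sup>2) \<longlonglongrightarrow> 0))}"

definition XD :: "'a::euclidean_space set \<Rightarrow> ('a \<Rightarrow> complex) set" where
  "XD D = H2 D \<inter> H10 D"

definition lapc :: "('a::euclidean_space \<Rightarrow> complex) \<Rightarrow> 'a \<Rightarrow> complex" where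
  "lapc \<phi> x = (\<Sum>i\<in>Basis. dderiv [i, i] \<phi> x)"

definition weak_laplacian :: "'a::euclidean_space set \<Rightarrow> ('a \<Rightarrow> complex) \<Rightarrow> ('a \<Rightarrow> complex) \<Rightarrow> bool" where
  "weak_laplacian D u h \<longleftrightarrow> (\<forall>\<phi>. test_fun D \<phi> \<longrightarrow>
      integrable (lebesgue_on D) (\<lambda>x. u x * lapc \<phi> x) \<and>
      integrable (lebesgue_on D) (\<lambda>x. h x * \<phi> x) \<and>
      (LINT x|lebesgue_on D. u x * lapc \<phi> x) = (LINT x|lebesgue_on D. h x * \<phi> x))"

text \<open>The (a.e. unique) L^2 Laplacian of u.\<close>
definition Lap :: "'a::euclidean_space set \<Rightarrow> ('a \<Rightarrow> complex) \<Rightarrow> 'a \<Rightarrow> complex" where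
  "Lap D u = (SOME h. h \<in> L2 D \<and> weak_laplacian D u h)"

definition Xnorm :: "'a::euclidean_space set \<Rightarrow> ('a \<Rightarrow> complex) \<Rightarrow> real" where
  "Xnorm D u = L2norm D (Lap D u)"

definition aform :: "'a::euclidean_space set \<Rightarrow> ('a \<Rightarrow> real) \<Rightarrow> ('a \<Rightarrow> complex) \<Rightarrow> ('a \<Rightarrow> complex) \<Rightarrow> complex" where
  "aform D \<alpha> u v = (LINT x|lebesgue_on D. complex_of_real (\<alpha> x) * Lap D u x * cnj (Lap D v x))"

definition bform :: "'a::euclidean_space set \<Rightarrow> ('a \<Rightarrow> real) \<Rightarrow> ('a \<Rightarrow> complex) \<Rightarrow> ('a \<Rightarrow> complex) \<Rightarrow> complex" where
  "bform D \<beta> u v = (LINT x|lebesgue_on D. complex_of_real (\<beta> x) * u x * cnj (v x))"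

definition solution_operator :: "'a::euclidean_space set \<Rightarrow> ('a \<Rightarrow> real) \<Rightarrow> ('a \<Rightarrow> real)
     \<Rightarrow> (('a \<Rightarrow> complex) \<Rightarrow> ('a \<Rightarrow> complex)) \<Rightarrow> bool" where
  "solution_operator D \<alpha> \<beta> T \<longleftrightarrow>
     (\<forall>f\<in>XD D. T f \<in> XD D \<and> (\<forall>v\<in>XD D. aform D \<alpha> (T f) v = bform D \<beta> f v))"

definition bounded_coeff :: "'a::euclidean_space set \<Rightarrow> ('a \<Rightarrow> real) \<Rightarrow> real \<Rightarrow> real \<Rightarrow> bool" where
  "bounded_coeff D c cmin cmax \<longleftrightarrow> 0 < cmin \<and> c \<in> borel_measurable (lebesgue_on D) \<and>
     (AE x in lebesgue_on D. cmin \<le> c x \<and> c x \<le> cmax)"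

definition W2inf :: "'a::euclidean_space set \<Rightarrow> ('a \<Rightarrow> real) \<Rightarrow> bool" where
  "W2inf D \<alpha> \<longleftrightarrow> Linf D (\<lambda>x. complex_of_real (\<alpha> x)) \<and>
     (\<forall>i\<in>Basis. \<exists>g. Linf D g \<and> weak_deriv D (\<lambda>x. complex_of_real (\<alpha> x)) i g \<and>
        (\<forall>j\<in>Basis. \<exists>h. Linf D h \<and> weak_deriv D g j h))"

definition dirichlet_eigensystem :: "'a::euclidean_space set \<Rightarrow> (nat \<Rightarrow> real) \<Rightarrow> (nat \<Rightarrow> 'a \<Rightarrow> complex) \<Rightarrow> bool" where
  "dirichlet_eigensystem D lam phi \<longleftrightarrow>
     (\<forall>j. phi j \<in> H10 D \<and> weak_laplacian D (phi j) (\<lambda>x. - (complex_of_real (lam j) * phi j x))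
          \<and> L2norm D (phi j) = 1) \<and>
     0 < lam 0 \<and> mono lam \<and>
     (\<forall>j k. j \<noteq> k \<longrightarrow> L2inner D (phi j) (phi k) = 0) \<and>
     (\<forall>f\<in>L2 D. (\<forall>j. L2inner D f (phi j) = 0) \<longrightarrow> (AE x in lebesgue_on D. f x = 0))"

definition DomLap :: "'a::euclidean_space set \<Rightarrow> (nat \<Rightarrow> real) \<Rightarrow> (nat \<Rightarrow> 'a \<Rightarrow> complex) \<Rightarrow> nat
     \<Rightarrow> ('a \<Rightarrow> complex) set" where
  "DomLap D lam phi m = {f \<in> L2 D.
      summable (\<lambda>j. lam j ^ (2 * m) * (cmod (L2inner D f (phi j)))\<^sup>2)}"

definition DomLap_norm :: "'a::euclidean_space set \<Rightarrow> (nat \<Rightarrow> real) \<Rightarrow> (nat \<Rightarrow> 'a \<Rightarrow> complex) \<Rightarrow> nat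
     \<Rightarrow> ('a \<Rightarrow> complex) \<Rightarrow> real" where
  "DomLap_norm D lam phi m f = sqrt (\<Sum>j. lam j ^ (2 * m) * (cmod (L2inner D f (phi j)))\<^sup>2)"

definition C2_fun :: "('a::euclidean_space \<Rightarrow> real) \<Rightarrow> bool" where
  "C2_fun g \<longleftrightarrow> (\<exists>(g' :: 'a \<Rightarrow> ('a \<Rightarrow>\<^sub>L real)) (g'' :: 'a \<Rightarrow> ('a \<Rightarrow>\<^sub>L ('a \<Rightarrow>\<^sub>L real))).
      (\<forall>x. (g has_derivative blinfun_apply (g' x)) (at x)) \<and>
      (\<forall>x. (g' has_derivative blinfun_apply (g'' x)) (at x)) \<and>
      continuous_on UNIV g'')"

text \<open>Locally D lies below the graph of a C^2 function over the hyperplane orthogonal to e.\<close>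
definition C2_boundary :: "'a::euclidean_space set \<Rightarrow> bool" where
  "C2_boundary D \<longleftrightarrow> (\<forall>p\<in>frontier D. \<exists>r>0. \<exists>e g. norm e = 1 \<and> C2_fun g \<and>
      D \<inter> ball p r = {x \<in> ball p r. (x - p) \<bullet> e < g ((x - p) - ((x - p) \<bullet> e) *\<^sub>R e)})"

definition polygonal_no_reentrant :: "'a::euclidean_space set \<Rightarrow> bool" where
  "polygonal_no_reentrant D \<longleftrightarrow> polytope (closure D) \<and> convex D"

end

(* Write w = T f. For v in X(D) the weak form says that (alpha Lap w - q, Lap v) = 0, where q in H^1_0
   solves Lap q = beta f. Since Laplacians of functions of X(D) are dense in L^2(D), alpha Lap w = q, so
   Lap w = q / alpha lies in H^1_0 and has an L^2 Laplacian r with ||r|| <= C ||f||, because alpha is W^{2,infinity}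
   and bounded below. Testing twice with phi_j gives lam_j^2 (w, phi_j) = (r, phi_j), and Bessel's inequality
   finishes the proof. Density is H^2 regularity: for C^2 boundary by differentiating along flows that preserve the
   boundary; for a convex polytope by cutting off the set where two faces meet, the cutoff error being
   controlled because a barrier makes the solution vanish linearly at every face. *)
theory Submission
 imports Defs
begin

text \<open>Functions are handled through Borel representatives on the whole space that vanish off
  \<open>D\<close>, and membership in H^1_0 is the relation \<open>W D u G\<close>, which carries
  the gradient \<open>G\<close> as data; translations and flows then act by plain composition. Test
  functions are only C^1, because composition with a flow along a C^2 graph destroys smoothness. The
  flows keep the height above the graph and preserve Lebesgue measure exactly, so second differences
  produce no Jacobian terms.

  For a polytope the solution is not itself shown to lie in H^2. A cutoff at scale e around the
  edges has a Laplacian of size e^-2, the solution has size e there and the region has volume of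
  order e^2, so the error is merely bounded in L^2, not small. It is supported in a shrinking set,
  however, so its pairing with a fixed L^2 function tends to 0, and density needs no more. It
  suffices to treat right-hand sides that are C^1 with compact support; these are bounded, which is
  what makes a barrier available.\<close>

definition sqiM :: "'b measure => ('b => complex) => bool" where
 "sqiM M f \<longleftrightarrow> f : borel_measurable M & integrable M (%x. (cmod (f x))^2)"

definition nrmM :: "'b measure => ('b => complex) => real" where
 "nrmM M f = sqrt (LINT x|M. (cmod (f x))^2)"

abbreviation "sqi == sqiM lborel"
abbreviation "nrm == nrmM lborel"
abbreviation "intgl == integrable lborel"
abbreviation "mbl == borel_measurable borel"
abbreviation "lmbl == borel_measurable lborel"
abbreviation "cor == complex_of_real"
abbreviation AEl (binder "AEL " 10) where "AEl P == almost_everywhere lborel P"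
abbreviation evS (binder "EV " 10) where "evS P == eventually P sequentially"
abbreviation scaleR' (infixr "*R" 75) where "a *R b == a *\<^sub>R b"
abbreviation inner' (infix "*." 70) where "a *. b == a \<bullet> b"
lemmas mbl_cont = borel_measurable_continuous_onI
  and cont_sub = continuous_on_subset
abbreviation "null s == s \<longlonglongrightarrow> 0"
abbreviation sumB (binder "SB " 10) where "sumB f == sum f Basis"
lemmas bint_add = Bochner_Integration.integral_add
 and bint_cnj = Bochner_Integration.integral_cnj
 and bint_cong = Bochner_Integration.integral_cong
 and bint_diff = Bochner_Integration.integral_diff
 and bint_mult_right = Bochner_Integration.integral_mult_right
 and bint_mult_right_zero = Bochner_Integration.integral_mult_right_zero
 and bint_nonneg = Bochner_Integration.integral_nonneg
 and bint_sum = Bochner_Integration.integral_sum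
 and bintgl_bound = Bochner_Integration.integrable_bound
 and bintgl_diff = Bochner_Integration.integrable_diff
 and bintgl_sum = Bochner_Integration.integrable_sum

section \<open>Square-integrable functions: Cauchy-Schwarz, limits and completeness\<close>

lemma sqi_meas [measurable_dest]: "sqiM M f ==> f : borel_measurable M"
 and sqi_integrable: "sqiM M f ==> integrable M (%x. (cmod (f x))^2)"
 by (auto simp: sqiM_def)

lemma nrm_nonneg [simp]: "0 <= nrmM M f"
 by (simp add: nrmM_def)

lemma nrm_sq: "(nrmM M f)^2 = (LINT x|M. (cmod (f x))^2)"
 by (simp add: nrmM_def)

lemma sqi_bound:
 assumes f: "sqiM M f" and [measurable]: "g : borel_measurable M"
  and le: "AE x in M. cmod (g x) <= C * cmod (f x)" and C: "0 <= C"
 shows "sqiM M g" and "nrmM M g <= C * nrmM M f"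
proof -
 have sq: "AE x in M. (cmod (g x))^2 <= C^2 * (cmod (f x))^2"
  using le by eventually_elim (metis norm_ge_zero power_mono power_mult_distrib)
 have i: "integrable M (%x. C^2 * (cmod (f x))^2)"
  using sqi_integrable[OF f] by auto
 have "integrable M (%x. (cmod (g x))^2)"
  by (rule bintgl_bound[OF i]) (use sq in auto)
 then show g: "sqiM M g" by (simp add: sqiM_def)
 have "(nrmM M g)^2 <= (C * nrmM M f)^2"
  unfolding nrm_sq power_mult_distrib
  using integral_mono_AE[OF sqi_integrable[OF g] i sq] by simp
 then show "nrmM M g <= C * nrmM M f" using C by (auto intro: power2_le_imp_le)
qed

lemma sqi_mult_bounded:
 assumes "sqiM M f" "b : borel_measurable M" "AE x in M. cmod (b x) <= C" "0 <= C"
 shows "sqiM M (%x. b x * f x)" "nrmM M (%x. b x * f x) <= C * nrmM M f"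
proof -
 note [measurable] = sqi_meas[OF assms(1)] assms(2)
 have "AE x in M. cmod (b x * f x) <= C * cmod (f x)"
  using assms(3) by eventually_elim (simp add: norm_mult mult_right_mono)
 then show "sqiM M (%x. b x * f x)" "nrmM M (%x. b x * f x) <= C * nrmM M f"
  using sqi_bound[OF assms(1) _ _ assms(4), of "%x. b x * f x"] by auto
qed

lemma sqi_cmult: "sqiM M f ==> sqiM M (%x. c * f x)"
 by (rule sqi_mult_bounded(1)[where C = "cmod c"]) auto

lemma nrm_cmult: "nrmM M (%x. c * f x) = cmod c * nrmM M f"
 by (simp add: nrmM_def norm_mult power_mult_distrib real_sqrt_mult)

lemma sqi_zero [simp]: "sqiM M (%x. 0)" and nrm_zero [simp]: "nrmM M (%x. 0) = 0"
 by (simp_all add: sqiM_def nrmM_def)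

lemma sqi_uminus: "sqiM M f ==> sqiM M (%x. - f x)" by (simp add: sqiM_def)
lemma nrm_uminus: "nrmM M (%x. - f x) = nrmM M f" by (simp add: nrmM_def)

lemma sqi_cnj: "sqiM M f ==> sqiM M (%x. cnj (f x))"
 by (auto simp: sqiM_def intro: borel_measurable_continuous_on continuous_on_cnj)
lemma nrm_cnj: "nrmM M (%x. cnj (f x)) = nrmM M f" by (simp add: nrmM_def)

lemma sqi_add:
 assumes "sqiM M f" "sqiM M g" shows "sqiM M (%x. f x + g x)"
proof -
 note [measurable] = sqi_meas[OF assms(1)] sqi_meas[OF assms(2)]
 have i: "integrable M (%x. 2 * (cmod (f x))^2 + 2 * (cmod (g x))^2)"
  using assms by (auto simp: sqiM_def)
 have "(cmod (f x + g x))^2 <= 2 * (cmod (f x))^2 + 2 * (cmod (g x))^2" for x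
 proof -
  have "(cmod (f x + g x))^2 <= (cmod (f x) + cmod (g x))^2"
   by (intro power_mono norm_triangle_ineq) auto
  also have "... <= 2 * (cmod (f x))^2 + 2 * (cmod (g x))^2"
   using zero_le_power2[of "cmod (f x) - cmod (g x)"] by (simp add: power2_eq_square algebra_simps)
  finally show ?thesis .
 qed
 then have "integrable M (%x. (cmod (f x + g x))^2)"
  by (intro bintgl_bound[OF i]) auto
 then show ?thesis by (simp add: sqiM_def)
qed

lemma sqi_diff: "sqiM M f ==> sqiM M g ==> sqiM M (%x. f x - g x)"
 using sqi_add[OF _ sqi_uminus, of M f g] by simp

lemma sqi_sum: "(!!i. i : A ==> sqiM M (f i)) ==> sqiM M (%x. \<Sum>i\<in>A. f i x)"
 by (induction A rule: infinite_finite_induct) (auto intro: sqi_add)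

lemma sqi_mult:
 assumes "sqiM M f" "sqiM M g"
 shows "integrable M (%x. f x * g x)"
proof -
 note [measurable] = sqi_meas[OF assms(1)] sqi_meas[OF assms(2)]
 have i: "integrable M (%x. (cmod (f x))^2 + (cmod (g x))^2)"
  using assms by (auto simp: sqiM_def)
 have "cmod (f x * g x) <= (cmod (f x))^2 + (cmod (g x))^2" for x
 proof -
  have "2 * (cmod (f x) * cmod (g x)) <= (cmod (f x))^2 + (cmod (g x))^2"
   using zero_le_power2[of "cmod (f x) - cmod (g x)"] by (simp add: power2_eq_square algebra_simps)
  moreover have "0 <= cmod (f x) * cmod (g x)" by simp
  ultimately show ?thesis unfolding norm_mult by linarith
 qed
 then show ?thesis
  by (intro bintgl_bound[OF i]) auto
qed

text \<open>The integral of (t |f| - |g|)^2 is nonnegative for every real t; t =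
  \<open>nrmM M g / nrmM M f\<close> gives the product bound. When \<open>nrmM M f\<close> vanishes,
  the same inequality bounds a multiple t of the left side by a constant for all t, which forces the
  left side to be at most 0.\<close>

lemma integral_abs_mult_le_nrm:
 assumes "sqiM M f" "sqiM M g"
 shows "(LINT x|M. cmod (f x) * cmod (g x)) <= nrmM M f * nrmM M g"
proof -
 note [measurable] = sqi_meas[OF assms(1)] sqi_meas[OF assms(2)]
 have i: "integrable M (%x. cmod (f x) * cmod (g x))"
  using integrable_norm[OF sqi_mult[OF assms]] by (simp add: norm_mult)
 let ?I = "LINT x|M. cmod (f x) * cmod (g x)"
 have q: "2 * t * ?I <= t^2 * (nrmM M f)^2 + (nrmM M g)^2" for t :: real
 proof -
  have "2 * t * ?I = (LINT x|M. 2 * t * (cmod (f x) * cmod (g x)))" by simp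
  also have "... <= (LINT x|M. t^2 * (cmod (f x))^2 + (cmod (g x))^2)"
  proof (rule integral_mono)
   show "integrable M (%x. 2 * t * (cmod (f x) * cmod (g x)))" using i by auto
   show "integrable M (%x. t^2 * (cmod (f x))^2 + (cmod (g x))^2)" using assms by (auto simp: sqiM_def)
   fix x
   show "2 * t * (cmod (f x) * cmod (g x)) <= t^2 * (cmod (f x))^2 + (cmod (g x))^2"
    using zero_le_power2[of "t * cmod (f x) - cmod (g x)"]
    by (simp add: power2_eq_square algebra_simps)
  qed
  also have "... = t^2 * (nrmM M f)^2 + (nrmM M g)^2"
   using assms unfolding nrm_sq by (subst bint_add) (auto simp: sqiM_def)
  finally show ?thesis .
 qed
 have "?I <= nrmM M f * nrmM M g"
 proof (cases "nrmM M f = 0")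
  case True
  have "?I <= 0"
  proof (rule ccontr)
   assume "\<not> ?I <= 0"
   then have I: "?I > 0" by simp
   \<comment> \<open>This value of t makes the left side exceed the right side by exactly 1.\<close>
   have "2 * (((nrmM M g)^2 + 1) / (2 * ?I)) * ?I <= (nrmM M g)^2"
    using q[of "((nrmM M g)^2 + 1) / (2 * ?I)"] True by simp
   moreover have "2 * (((nrmM M g)^2 + 1) / (2 * ?I)) * ?I = (nrmM M g)^2 + 1"
    using I by (simp add: field_simps)
   ultimately show False by simp
  qed
  then show ?thesis using True by simp
 next
  case False
  then have p: "nrmM M f > 0" using nrm_nonneg[of M f] by linarith
  have "2 * (nrmM M g / nrmM M f) * ?I <= 2 * (nrmM M g)^2"
   using q[of "nrmM M g / nrmM M f"] p by (simp add: power_divide)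
  show ?thesis
  proof (cases "nrmM M g = 0")
   case True
   have "2 * t * ?I <= t^2 * (nrmM M f)^2" for t using q[of t] True by simp
   from this[of "?I / (nrmM M f)^2"] p have "?I^2 <= 0"
    by (simp add: field_simps power2_eq_square)
   then show ?thesis using True by simp
  next
   case False
   then have pg: "nrmM M g > 0" using nrm_nonneg[of M g] by linarith
   show ?thesis using \<open>2 * (nrmM M g / nrmM M f) * ?I <= 2 * (nrmM M g)^2\<close> p pg
    by (simp add: field_simps power2_eq_square)
  qed
 qed
 then show ?thesis .
qed

lemma Cauchy_Schwarz_nrm:
 assumes "sqiM M f" "sqiM M g"
 shows "cmod (LINT x|M. f x * g x) <= nrmM M f * nrmM M g"
proof -
 have "cmod (LINT x|M. f x * g x) <= (LINT x|M. cmod (f x * g x))" by simp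
 also have "... <= nrmM M f * nrmM M g"
  using integral_abs_mult_le_nrm[OF assms] by (simp add: norm_mult)
 finally show ?thesis .
qed

lemma nrm_triangle:
 assumes "sqiM M f" "sqiM M g"
 shows "nrmM M (%x. f x + g x) <= nrmM M f + nrmM M g"
proof (rule power2_le_imp_le)
 note [measurable] = sqi_meas[OF assms(1)] sqi_meas[OF assms(2)]
 have i: "integrable M (%x. cmod (f x) * cmod (g x))"
  using integrable_norm[OF sqi_mult[OF assms]] by (simp add: norm_mult)
 have i2: "integrable M (%x. (cmod (f x))^2 + (2 * (cmod (f x) * cmod (g x)) + (cmod (g x))^2))"
  using assms i by (auto simp: sqiM_def)
 have "(nrmM M (%x. f x + g x))^2 <= (LINT x|M. (cmod (f x))^2 + (2 * (cmod (f x) * cmod (g x)) + (cmod (g x))^2))"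
  unfolding nrm_sq
 proof (rule integral_mono[OF sqi_integrable[OF sqi_add[OF assms]] i2])
  fix x
  have "(cmod (f x + g x))^2 <= (cmod (f x) + cmod (g x))^2"
   by (intro power_mono norm_triangle_ineq) auto
  then show "(cmod (f x + g x))^2 <= (cmod (f x))^2 + (2 * (cmod (f x) * cmod (g x)) + (cmod (g x))^2)"
   by (simp add: power2_eq_square algebra_simps)
 qed
 also have "... = (nrmM M f)^2 + (2 * (LINT x|M. cmod (f x) * cmod (g x)) + (nrmM M g)^2)"
  unfolding nrm_sq using assms i
  by (subst bint_add; (subst bint_add)?)
    (auto simp: sqiM_def)
 also have "... <= (nrmM M f)^2 + (2 * (nrmM M f * nrmM M g) + (nrmM M g)^2)"
  using integral_abs_mult_le_nrm[OF assms] by simp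
 also have "... = (nrmM M f + nrmM M g)^2" by (simp add: power2_eq_square algebra_simps)
 finally show "(nrmM M (%x. f x + g x))^2 <= (nrmM M f + nrmM M g)^2" .
qed auto

lemma nrm_diff_triangle:
 assumes "sqiM M f" "sqiM M g"
 shows "nrmM M (%x. f x - g x) <= nrmM M f + nrmM M g"
 using nrm_triangle[OF assms(1) sqi_uminus[OF assms(2)]] by (simp add: nrm_uminus)

lemma nrm_minus_commute: "nrmM M (%x. f x - g x) = nrmM M (%x. g x - f x)"
 by (simp add: nrmM_def norm_minus_commute)

lemma nrm_triangle4:
 assumes "sqiM M f" "sqiM M g" "sqiM M h"
 shows "nrmM M (%x. f x - h x) <= nrmM M (%x. f x - g x) + nrmM M (%x. g x - h x)"
 using nrm_triangle[OF sqi_diff[OF assms(1,2)] sqi_diff[OF assms(2,3)]] by simp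

lemma nrm_triangle_sub:
 assumes "sqiM M f" "sqiM M g"
 shows "\<bar>nrmM M f - nrmM M g\<bar> <= nrmM M (%x. f x - g x)"
 using nrm_triangle4[OF assms(1,2), of "%x. 0"] nrm_triangle4[OF assms(2,1), of "%x. 0"]
  nrm_minus_commute[of M f g] by simp

lemma nrm_sum_le: "(!!i. i : A ==> sqiM M (f i)) ==> nrmM M (%x. \<Sum>i\<in>A. f i x) <= (\<Sum>i\<in>A. nrmM M (f i))"
proof (induction A rule: infinite_finite_induct)
 case (insert a A)
 then have "nrmM M (%x. f a x + (\<Sum>i\<in>A. f i x)) <= nrmM M (f a) + nrmM M (%x. (\<Sum>i\<in>A. f i x))"
  by (intro nrm_triangle sqi_sum) auto
 then show ?case using insert by auto
qed auto

lemma tendsto_nrm: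
 assumes "!!n. sqiM M (f n)" "sqiM M g" "null (%n. nrmM M (%x. f n x - g x))"
 shows "(%n. nrmM M (f n)) \<longlonglongrightarrow> nrmM M g"
proof (rule LIM_zero_cancel, rule tendsto_rabs_zero_cancel, rule tendsto_sandwich[OF _ _ tendsto_const assms(3)])
 show "EV n. 0 <= \<bar>nrmM M (f n) - nrmM M g\<bar>" by simp
 show "EV n. \<bar>nrmM M (f n) - nrmM M g\<bar> <= nrmM M (%x. f n x - g x)"
  by (rule always_eventually) (use nrm_triangle_sub[OF assms(1,2)] in auto)
qed

text \<open>Strong L^2 convergence of both factors passes to the integral of the product; this is
  how weak formulations are carried to the limit below.\<close>

lemma tendsto_nrm_mult:
 assumes "!!n. sqiM M (f n)" "sqiM M f'" "null (%n. nrmM M (%x. f n x - f' x))"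
  and "!!n. sqiM M (g n)" "sqiM M g'" "null (%n. nrmM M (%x. g n x - g' x))"
 shows "(%n. LINT x|M. f n x * g n x) \<longlonglongrightarrow> (LINT x|M. f' x * g' x)"
proof (rule LIM_zero_cancel)
 have b: "cmod ((LINT x|M. f n x * g n x) - (LINT x|M. f' x * g' x))
   <= nrmM M (%x. f n x - f' x) * nrmM M (g n) + nrmM M f' * nrmM M (%x. g n x - g' x)" for n
 proof -
  have "(LINT x|M. f n x * g n x) - (LINT x|M. f' x * g' x)
    = (LINT x|M. (f n x - f' x) * g n x) + (LINT x|M. f' x * (g n x - g' x))"
   using assms by (simp add: algebra_simps sqi_mult)
  then have "cmod ((LINT x|M. f n x * g n x) - (LINT x|M. f' x * g' x))
    <= cmod (LINT x|M. (f n x - f' x) * g n x) + cmod (LINT x|M. f' x * (g n x - g' x))"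
   by (metis norm_triangle_ineq)
  also have "... <= nrmM M (%x. f n x - f' x) * nrmM M (g n) + nrmM M f' * nrmM M (%x. g n x - g' x)"
   by (intro add_mono Cauchy_Schwarz_nrm assms sqi_diff)
  finally show ?thesis .
 qed
 have lim: "null (%n. nrmM M (%x. f n x - f' x) * nrmM M (g n) + nrmM M f' * nrmM M (%x. g n x - g' x))"
  using tendsto_add[OF tendsto_mult[OF assms(3) tendsto_nrm[OF assms(4,5,6)]]
     tendsto_mult[OF tendsto_const[of "nrmM M f'"] assms(6)]] by simp
 show "null (%n. (LINT x|M. f n x * g n x) - (LINT x|M. f' x * g' x))"
  by (rule Lim_null_comparison[OF _ lim]) (simp add: b)
qed

lemma nrm_eq_0_AE:
 assumes "sqiM M f" "nrmM M f = 0"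
 shows "AE x in M. f x = 0"
proof -
 have "(LINT x|M. (cmod (f x))^2) = 0" using assms(2) nrm_sq[of M f] by simp
 then have "AE x in M. (cmod (f x))^2 = 0"
  using integral_nonneg_eq_0_iff_AE[OF sqi_integrable[OF assms(1)]] by auto
 then show ?thesis by eventually_elim simp
qed

text \<open>Fatou's lemma for the squared moduli. The bound is required only eventually in n, which
  suits the tail of a Cauchy sequence.\<close>

lemma nrm_Fatou:
 assumes "!!n. sqiM M (f n)" "g : borel_measurable M"
  and lim: "AE x in M. (%n. f n x) \<longlonglongrightarrow> g x"
  and le: "EV n. nrmM M (f n) <= B" and B: "0 <= B"
 shows "sqiM M g" "nrmM M g <= B"
proof -
 note [measurable] = sqi_meas[OF assms(1)] assms(2)
 have e: "(\<integral>\<^sup>+x. ennreal ((cmod (f n x))^2) \<partial>M) = ennreal ((nrmM M (f n))^2)" for n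
  unfolding nrm_sq by (rule nn_integral_eq_integral) (use assms(1) in \<open>auto simp: sqiM_def\<close>)
 have "(\<integral>\<^sup>+x. ennreal ((cmod (g x))^2) \<partial>M) = (\<integral>\<^sup>+x. liminf (%n. ennreal ((cmod (f n x))^2)) \<partial>M)"
 proof (rule nn_integral_cong_AE)
  show "AE x in M. ennreal ((cmod (g x))^2) = liminf (%n. ennreal ((cmod (f n x))^2))"
   using lim
  proof eventually_elim
   case (elim x)
   then have "(%n. ennreal ((cmod (f n x))^2)) \<longlonglongrightarrow> ennreal ((cmod (g x))^2)"
    by (intro tendsto_ennrealI tendsto_intros)
   then show ?case using lim_imp_Liminf by (metis sequentially_bot)
  qed
 qed
 also have "... <= liminf (%n. \<integral>\<^sup>+x. ennreal ((cmod (f n x))^2) \<partial>M)"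
  by (rule nn_integral_liminf) auto
 also have "... <= ennreal (B^2)"
 proof -
  have "EV n. (\<integral>\<^sup>+x. ennreal ((cmod (f n x))^2) \<partial>M) <= ennreal (B^2)"
   using le unfolding e by eventually_elim (auto intro!: ennreal_leI power_mono)
  then have "liminf (%n. \<integral>\<^sup>+x. ennreal ((cmod (f n x))^2) \<partial>M) <= liminf (%n. ennreal (B^2))"
   by (rule Liminf_mono)
  then show ?thesis by (simp add: Liminf_const)
 qed
 finally have b: "(\<integral>\<^sup>+x. ennreal ((cmod (g x))^2) \<partial>M) <= ennreal (B^2)" .
 have i: "integrable M (%x. (cmod (g x))^2)"
  by (rule integrableI_nonneg) (use b in \<open>auto simp: less_top[symmetric] top_unique\<close>)
 then show "sqiM M g" by (simp add: sqiM_def)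
 have "ennreal ((nrmM M g)^2) = (\<integral>\<^sup>+x. ennreal ((cmod (g x))^2) \<partial>M)"
  unfolding nrm_sq by (rule nn_integral_eq_integral[symmetric]) (use i in auto)
 with b have "(nrmM M g)^2 <= B^2" by (metis ennreal_le_iff zero_le_power2)
 then show "nrmM M g <= B" using B by (rule power2_le_imp_le)
qed

text \<open>Vanishing outside a set of finite measure makes \<open>L\<^sup>2\<close>-Cauchy sequences \<open>L\<^sup>1\<close>-Cauchy.\<close>
lemma sqi_complete:
 assumes f: "!!n. sqiM M (f n)" and S: "S : sets M" "emeasure M S < \<infinity>"
  and off: "!!n x. x ~: S ==> f n x = 0"
  and C: "!!e. e > 0 ==> EX N. ALL i>=N. ALL j>=N. nrmM M (%x. f i x - f j x) < e"
 obtains g where "sqiM M g" "null (%n. nrmM M (%x. f n x - g x))" "!!x. x ~: S ==> g x = 0"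
proof -
 note [measurable] = sqi_meas[OF f] S(1)
 let ?I = "%x. indicator S x :: complex"
 have iS: "sqiM M ?I"
 proof -
  have "(%x. (cmod (?I x))^2) = (%x. indicator S x :: real)" by (auto simp: indicator_def)
  then show ?thesis using S by (simp add: sqiM_def)
 qed
 have fI: "f n = (%x. f n x * ?I x)" for n using off by (auto simp: indicator_def fun_eq_iff)
 have f1: "integrable M (f n)" for n
  using sqi_mult[OF f iS, of n] fI[of n] by simp
 have l1: "(LINT x|M. norm (f i x - f j x)) <= nrmM M (%x. f i x - f j x) * nrmM M ?I" for i j
 proof -
  have "(LINT x|M. norm (f i x - f j x)) = (LINT x|M. cmod (f i x - f j x) * cmod (?I x))"
   by (rule bint_cong) (auto simp: indicator_def off)
  then show ?thesis using integral_abs_mult_le_nrm[OF sqi_diff[OF f f] iS, of i j] by simp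
 qed
 \<comment> \<open>The L^1 Cauchy property yields a subsequence that converges almost everywhere.
   Its pointwise limit is the candidate, and Fatou applied to the differences
   \<open>f n x - f (r i) x\<close> returns L^2 convergence of the whole sequence.\<close>
 obtain r where r: "strict_mono r" "AE x in M. Cauchy (%i. f (r i) x)"
 proof (rule cauchy_L1_AE_cauchy_subseq[of M f])
  fix e :: real assume e: "e > 0"
  have "e / (nrmM M ?I + 1) > 0" using e by (simp add: add_nonneg_pos)
  then obtain N where N: "ALL i>=N. ALL j>=N. nrmM M (%x. f i x - f j x) < e / (nrmM M ?I + 1)" using C by blast
  show "EX N. ALL i>=N. ALL j>=N. LINT x|M. norm (f i x - f j x) < e"
  proof (intro exI[of _ N] allI impI)
   fix i j assume "N <= i" "N <= j"
   then have a: "nrmM M (%x. f i x - f j x) < e / (nrmM M ?I + 1)" using N by auto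
   have "nrmM M (%x. f i x - f j x) * nrmM M ?I <= nrmM M (%x. f i x - f j x) * (nrmM M ?I + 1)"
    by (intro mult_left_mono) auto
   also have "... < e"
    using a add_nonneg_pos[OF nrm_nonneg[of M ?I] zero_less_one] by (simp add: pos_less_divide_eq)
   finally show "LINT x|M. norm (f i x - f j x) < e" using l1[of i j] by linarith
  qed
 qed (use f1 in auto)
 define g where "g = (%x. lim (%i. f (r i) x))"
 have gm [measurable]: "g : borel_measurable M" unfolding g_def by measurable
 have glim: "AE x in M. (%i. f (r i) x) \<longlonglongrightarrow> g x"
  using r(2) unfolding g_def by eventually_elim (simp add: Cauchy_convergent convergent_LIMSEQ_iff[symmetric])
 have sub: "r i >= i" for i using r(1) by (rule seq_suble)
 have key: "EX N. ALL n>=N. sqiM M (%x. f n x - g x) & nrmM M (%x. f n x - g x) <= e" if e: "e > 0" for e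
 proof -
  obtain N where N: "ALL i>=N. ALL j>=N. nrmM M (%x. f i x - f j x) < e" using C[OF e] by blast
  show ?thesis
  proof (intro exI[of _ N] allI impI)
   fix n assume n: "n >= N"
   have lim: "AE x in M. (%i. f n x - f (r i) x) \<longlonglongrightarrow> f n x - g x"
    using glim by eventually_elim (intro tendsto_intros)
   have le: "\<forall>\<^sub>F i in sequentially. nrmM M (%x. f n x - f (r i) x) <= e"
    unfolding eventually_sequentially using N n sub by (meson le_trans less_imp_le)
   show "sqiM M (%x. f n x - g x) & nrmM M (%x. f n x - g x) <= e"
    using nrm_Fatou[OF sqi_diff[OF f f] _ lim le] e by auto
  qed
 qed
 obtain N where "sqiM M (%x. f N x - g x)" using key[of 1] by auto
 then have g: "sqiM M g" using sqi_diff[OF f[of N], of "%x. f N x - g x"] by simp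
 have conv: "null (%n. nrmM M (%x. f n x - g x))"
 proof (rule LIMSEQ_I)
  fix e :: real assume "e > 0"
  then show "EX no. ALL n>=no. norm (nrmM M (%x. f n x - g x) - 0) < e"
   using key[of "e/2"] by (smt (verit) field_sum_of_halves nrm_nonneg real_norm_def)
 qed
 \<comment> \<open>Off \<open>S\<close> all terms are 0, so the limit is 0 at every such point and
   not just almost everywhere.\<close>
 have g0: "g x = 0" if "x ~: S" for x
  using off[OF that] by (simp add: g_def lim_def) (auto simp: g_def LIMSEQ_const_iff)
 show ?thesis by (rule that[OF g conv g0])
qed

section \<open>Continuously differentiable functions and compact supports\<close>

abbreviation pd :: "('a::real_normed_vector => 'b::real_normed_vector) => 'a => 'a => 'b" where
 "pd f v x \<equiv> frechet_derivative f (at x) v"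

text \<open>Only the maps x -> \<open>pd f v x\<close> for fixed v have to be continuous; in finite
  dimension this amounts to continuity of the full derivative, and no operator norm enters.
  Differentiability is taken in a full neighbourhood of each point, which suits open sets.\<close>

definition C1_on :: "'a::euclidean_space set => ('a => 'b::real_normed_vector) => bool" where
 "C1_on S f \<longleftrightarrow> (ALL x:S. f differentiable (at x)) & (ALL v. continuous_on S (pd f v))"

abbreviation "C1u == C1_on UNIV"

lemma C1_onI:
 assumes "!!x. x : S ==> (f has_derivative f' x) (at x)" "!!v. continuous_on S (%x. f' x v)"
 shows "C1_on S f" "!!x v. x : S ==> pd f v x = f' x v"
proof -
 show *: "pd f v x = f' x v" if "x : S" for x v
  using frechet_derivative_at[OF assms(1)[OF that]] by simp
 have "continuous_on S (pd f v)" for v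
  using assms(2)[of v] by (rule continuous_on_eq) (simp add: *)
 then show "C1_on S f" using assms(1) by (auto simp: C1_on_def differentiable_def)
qed

lemma C1_on_has_derivative: "C1_on S f ==> x : S ==> (f has_derivative (%v. pd f v x)) (at x)"
 by (auto simp: C1_on_def frechet_derivative_works)

lemma C1_on_cont_pd: "C1_on S f ==> continuous_on S (pd f v)"
 by (auto simp: C1_on_def)

lemma C1_on_cont: "C1_on S f ==> continuous_on S f"
 by (meson C1_on_has_derivative continuous_at_imp_continuous_on has_derivative_continuous)

lemma C1_on_subset: "C1_on S f ==> T <= S ==> C1_on T f"
 by (meson C1_on_def cont_sub subsetD)

lemma pd_linear:
 assumes "C1_on S f" "x : S"
 shows "linear (%v. pd f v x)"
 using has_derivative_linear[OF C1_on_has_derivative[OF assms]] .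

lemma pd_Basis_sum:
 assumes "C1_on S f" "x : S"
 shows "pd f v x = (SB i. (v *. i) *R pd f i x)"
proof -
 have "pd f (SB i. (v *. i) *R i) x = (SB i. (v *. i) *R pd f i x)"
  by (simp add: linear_sum[OF pd_linear[OF assms]] linear_cmul[OF pd_linear[OF assms]])
 then show ?thesis by (simp add: euclidean_representation)
qed

text \<open>Both derivatives are chosen from the same predicate, so the equality holds even at
  points where the functions are not differentiable.\<close>

lemma pd_eq_of_open:
 assumes "open S" "x : S" "!!y. y : S ==> f y = g y"
 shows "pd f v x = pd g v x"
proof -
 have "(f has_derivative D) (at x) \<longleftrightarrow> (g has_derivative D) (at x)" for D
  using assms by (metis has_derivative_transform_within_open)
 then show ?thesis by (simp add: frechet_derivative_def)
qed

lemma C1_on_const [simp]: "C1_on S (%x. c)" and pd_const [simp]: "pd (%x. c) v x = 0"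
 using C1_onI[of UNIV "%x. c" "%x v. 0"] by (auto intro: C1_on_subset)

lemma C1_on_add:
 assumes "C1_on S f" "C1_on S g"
 shows "C1_on S (%x. f x + g x)" "x : S ==> pd (%x. f x + g x) v x = pd f v x + pd g v x"
 by (rule C1_onI[where f' = "%x v. pd f v x + pd g v x"]; auto intro!: has_derivative_add C1_on_has_derivative continuous_intros C1_on_cont_pd assms)+

lemma C1_on_diff:
 assumes "C1_on S f" "C1_on S g"
 shows "C1_on S (%x. f x - g x)" "x : S ==> pd (%x. f x - g x) v x = pd f v x - pd g v x"
 by (rule C1_onI[where f' = "%x v. pd f v x - pd g v x"]; auto intro!: has_derivative_diff C1_on_has_derivative continuous_intros C1_on_cont_pd assms)+

lemma C1_on_bl:
 assumes "C1_on S f" "bounded_linear L"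
 shows "C1_on S (%x. L (f x))" "x : S ==> pd (%x. L (f x)) v x = L (pd f v x)"
 by (rule C1_onI[where f' = "%x v. L (pd f v x)"]; auto intro!: bounded_linear.has_derivative[OF assms(2)] C1_on_has_derivative assms(1)
   bounded_linear.continuous_on[OF assms(2)] C1_on_cont_pd)+

lemma C1_on_mult:
 fixes f g :: "'a::euclidean_space => 'b::real_normed_algebra"
 assumes "C1_on S f" "C1_on S g"
 shows "C1_on S (%x. f x * g x)" "x : S ==> pd (%x. f x * g x) v x = f x * pd g v x + pd f v x * g x"
 by (rule C1_onI[where f' = "%x v. f x * pd g v x + pd f v x * g x"]; auto intro!: has_derivative_mult C1_on_has_derivative continuous_intros C1_on_cont_pd
    C1_on_cont[OF assms(1)] C1_on_cont[OF assms(2)] assms)+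

lemma C1_on_sum:
 assumes "!!i. i : A ==> C1_on S (f i)"
 shows "C1_on S (%x. \<Sum>i\<in>A. f i x)" "x : S ==> pd (%x. \<Sum>i\<in>A. f i x) v x = (\<Sum>i\<in>A. pd (f i) v x)"
 by (rule C1_onI[where f' = "%x v. \<Sum>i\<in>A. pd (f i) v x"]; auto intro!: has_derivative_sum C1_on_has_derivative continuous_intros C1_on_cont_pd assms)+

lemma C1_on_inverse:
 fixes f :: "'a::euclidean_space => 'b::real_normed_field"
 assumes "C1_on S f" "!!x. x : S ==> f x ~= 0"
 shows "C1_on S (%x. inverse (f x))" "x : S ==> pd (%x. inverse (f x)) v x = - (inverse (f x) * pd f v x * inverse (f x))"
 by (rule C1_onI[where f' = "%x v. - (inverse (f x) * pd f v x * inverse (f x))"]; auto intro!: Deriv.has_derivative_inverse C1_on_has_derivative continuous_intros C1_on_cont_pd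
    C1_on_cont[OF assms(1)] assms)+

lemma C1_on_comp_real:
 fixes f :: "'a::euclidean_space => real"
 assumes "C1_on S f" "!!x. x : S ==> (F has_real_derivative F' (f x)) (at (f x))"
  "continuous_on (f ` S) F'"
 shows "C1_on S (%x. F (f x))" "x : S ==> pd (%x. F (f x)) v x = F' (f x) * pd f v x"
proof -
 have d: "((%x. F (f x)) has_derivative (%v. F' (f x) * pd f v x)) (at x)" if "x : S" for x
  using has_derivative_compose[OF C1_on_has_derivative[OF assms(1) that],
    of F "%t. F' (f x) * t"] assms(2)[OF that]
  by (simp add: has_field_derivative_def)
 have c: "continuous_on S (%x. F' (f x) * pd f v x)" for v
  by (intro continuous_intros C1_on_cont_pd assms continuous_on_compose2[OF assms(3)] C1_on_cont) auto
 show "C1_on S (%x. F (f x))" "x : S ==> pd (%x. F (f x)) v x = F' (f x) * pd f v x"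
  using C1_onI[of S "%x. F (f x)" "%x v. F' (f x) * pd f v x"] d c by auto
qed

lemma C1_on_compose:
 fixes Fl :: "'a::euclidean_space => 'a"
 assumes "C1u f" "!!x. (Fl has_derivative Fl' x) (at x)" "!!v. continuous_on UNIV (%x. Fl' x v)"
 shows "C1u (%x. f (Fl x))" "pd (%x. f (Fl x)) v x = pd f (Fl' x v) (Fl x)"
proof -
 have d: "((%x. f (Fl x)) has_derivative (%v. pd f (Fl' x v) (Fl x))) (at x)" for x
  using has_derivative_compose[OF assms(2) C1_on_has_derivative[OF assms(1)]] by simp
 have co: "continuous_on UNIV Fl"
  using assms(2) by (meson continuous_at_imp_continuous_on has_derivative_continuous)
 have c: "continuous_on UNIV (%x. pd f (Fl' x v) (Fl x))" for v
  by (subst pd_Basis_sum[OF assms(1)])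
    (auto intro!: continuous_intros assms(3) continuous_on_compose2[OF C1_on_cont_pd[OF assms(1)]] co)
 show "C1u (%x. f (Fl x))" "pd (%x. f (Fl x)) v x = pd f (Fl' x v) (Fl x)"
  using C1_onI[of UNIV "%x. f (Fl x)" "%x v. pd f (Fl' x v) (Fl x)"] d c by auto
qed

text \<open>The test functions of the development. Smoothness would be lost under composition with a
  flow whose height function has only finitely many derivatives; \<open>C1c_mollify\<close> relates
  them to \<open>test_fun\<close>.\<close>

definition C1c :: "'a::euclidean_space set => ('a => complex) => bool" where
 "C1c D f \<longleftrightarrow> C1u f & (EX K. compact K & K <= D & (ALL x. x ~: K --> f x = 0))"

lemma C1c_C1: "C1c D f ==> C1u f" by (simp add: C1c_def)

lemma C1c_mono: "C1c D f ==> D <= E ==> C1c E f" by (auto simp: C1c_def)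

lemma C1c_off: "C1c D f ==> x ~: D ==> f x = 0" by (auto simp: C1c_def)

lemma pd_zero_off_closed:
 assumes "closed K" "!!x. x ~: K ==> f x = 0" "x ~: K"
 shows "pd f v x = 0"
 using pd_eq_of_open[of "- K" x f "%x. 0" v] assms by (auto simp: open_Compl)

lemma C1c_E:
 assumes "C1c D f"
 obtains K where "compact K" "K <= D" "!!x. x ~: K ==> f x = 0" "!!x v. x ~: K ==> pd f v x = 0"
proof -
 obtain K where K: "compact K" "K <= D" "!!x. x ~: K ==> f x = 0" using assms by (auto simp: C1c_def)
 show ?thesis by (rule that[OF K]) (use K pd_zero_off_closed[of K f] in \<open>auto simp: compact_imp_closed\<close>)
qed

lemma C1c_pd_off: "C1c D f ==> x ~: D ==> pd f v x = 0"
 by (metis C1c_E subsetD)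

lemma C1c_add: "C1c D f ==> C1c D g ==> C1c D (%x. f x + g x)"
proof (unfold C1c_def, elim conjE exE, intro conjI)
 fix K L assume a: "C1u f" "C1u g" "compact K" "K <= D" "ALL x. x ~: K --> f x = 0"
  "compact L" "L <= D" "ALL x. x ~: L --> g x = 0"
 show "C1u (%x. f x + g x)" using a C1_on_add by blast
 show "EX K. compact K & K <= D & (ALL x. x ~: K --> f x + g x = 0)"
  by (rule exI[of _ "K \<union> L"]) (use a in auto)
qed

lemma C1c_cmult: "C1c D f ==> C1c D (%x. c * f x)"
 by (auto simp: C1c_def intro: C1_on_bl bounded_linear_mult_right)

lemma C1c_uminus: "C1c D f ==> C1c D (%x. - f x)"
 using C1c_cmult[of D f "-1"] by simp

lemma C1c_diff: "C1c D f ==> C1c D g ==> C1c D (%x. f x - g x)"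
 using C1c_add[OF _ C1c_uminus, of D f g] by simp

lemma C1c_zero [simp]: "C1c D (%x. 0)"
 by (auto simp: C1c_def intro: exI[of _ "{}"])

lemma C1c_cnj: "C1c D f ==> C1c D (%x. cnj (f x))"
 by (auto simp: C1c_def intro: C1_on_bl bounded_linear_cnj)

lemma C1_cnj_pd: "C1u f ==> pd (%x. cnj (f x)) v x = cnj (pd f v x)"
 by (rule C1_on_bl) (auto intro: bounded_linear_cnj)

lemma C1_cmult_pd: "C1u f ==> pd (%x. c * f x) v x = c * pd f v x" for f :: "_ => complex"
 by (rule C1_on_bl) (auto intro: bounded_linear_mult_right)

text \<open>The open set \<open>D\<close> and the complement of \<open>K\<close> cover the space; on
  the first the extension is f, on the second it is 0.\<close>

lemma C1c_glue:
 assumes D: "open D" and f: "C1_on D f" and K: "compact K" "K <= D" "!!x. x : D - K ==> f x = 0"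
 shows "C1c D (%x. if x : D then f x else 0)"
  and "pd (%x. if x : D then f x else 0) v x = (if x : D then pd f v x else 0)"
proof -
 let ?g = "%x. if x : D then f x else 0"
 have oK: "open (-K)" using K by (simp add: compact_imp_closed open_Compl)
 have z: "pd f v x = 0" if "x : D - K" for x v
  using pd_eq_of_open[of "D - K" x f "%x. 0" v] that K D by (auto simp: open_Diff compact_imp_closed)
 have d: "(?g has_derivative (%v. if x : D then pd f v x else 0)) (at x)" for x
 proof (cases "x : D")
  case True
  have "(?g has_derivative (%v. pd f v x)) (at x)"
   by (rule has_derivative_transform_within_open[OF C1_on_has_derivative[OF f True] D True]) auto
  then show ?thesis using True by simp
 next
  case False
  have "((%x. 0) has_derivative (%v. 0)) (at x)" by simp
  then have "(?g has_derivative (%v. 0)) (at x)"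
   by (rule has_derivative_transform_within_open[OF _ oK]) (use False K in auto)
  then show ?thesis using False by simp
 qed
 have c: "continuous_on UNIV (%x. if x : D then pd f v x else 0)" for v
 proof -
  have "continuous_on (D \<union> - K) (%x. if x : D then pd f v x else 0)"
  proof (rule continuous_on_open_Un[OF D oK])
   show "continuous_on D (%x. if x : D then pd f v x else 0)"
    using C1_on_cont_pd[OF f] by (rule continuous_on_eq) auto
   show "continuous_on (-K) (%x. if x : D then pd f v x else 0)"
    using continuous_on_const[of "-K" 0] by (rule continuous_on_eq) (use z in auto)
  qed
  then show ?thesis using K(2) by (metis (no_types, lifting) Compl_partition Un_mono order_refl top.extremum_uniqueI)
 qed
 note * = C1_onI[of UNIV ?g "%x v. if x : D then pd f v x else 0", OF d c]
 show "C1c D ?g" using *(1) K by (auto simp: C1c_def)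
 show "pd ?g v x = (if x : D then pd f v x else 0)" using *(2) by auto
qed

lemma C1c_mult:
 assumes D: "open D" and f: "C1_on D f" and g: "C1c D g"
 shows "C1c D (%x. f x * g x)"
  and "x : D ==> pd (%x. f x * g x) v x = f x * pd g v x + pd f v x * g x"
proof -
 have gD: "C1_on D g" using g by (auto simp: C1c_def intro: C1_on_subset)
 note m = C1_on_mult[OF f gD]
 obtain K where K: "compact K" "K <= D" "!!x. x ~: K ==> g x = 0" using g by (auto simp: C1c_def)
 have e: "(%x. if x : D then f x * g x else 0) = (%x. f x * g x)"
  by (rule ext) (metis K(2,3) mult_zero_right subsetD)
 note gl = C1c_glue[OF D m(1) K(1,2)]
 show "C1c D (%x. f x * g x)" using gl(1) K unfolding e by auto
 show "pd (%x. f x * g x) v x = f x * pd g v x + pd f v x * g x" if "x : D" using m(2) that by auto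
qed

lemma C1c_bounded:
 assumes "C1c D f" obtains B where "B >= 0" "!!x. cmod (f x) <= B" "!!x v. cmod (pd f v x) <= B * norm v"
proof -
 obtain K where K: "compact K" "K <= D" "!!x. x ~: K ==> f x = 0" "!!x v. x ~: K ==> pd f v x = 0"
  using C1c_E[OF assms] by blast
 have f: "C1u f" using assms by (simp add: C1c_def)
 have bd: "EX B>=0. ALL x. cmod (g x) <= B" if "continuous_on UNIV g" "!!x. x ~: K ==> g x = 0" for g
 proof -
  have "bounded (g ` K)"
   using K(1) that(1) by (meson compact_continuous_image compact_imp_bounded cont_sub subset_UNIV)
  then obtain B where "ALL x:K. cmod (g x) <= B" by (auto simp: bounded_iff)
  then show ?thesis using that(2) by (intro exI[of _ "max B 0"]) (metis max.cobounded2 max.coboundedI1 norm_zero)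
 qed
 obtain B0 where B0: "B0 >= 0" "!!x. cmod (f x) <= B0" using bd[OF C1_on_cont[OF f] K(3)] by blast
 have "ALL i. EX B>=0. ALL x. cmod (pd f i x) <= B" using bd[OF C1_on_cont_pd[OF f] K(4)] by blast
 then obtain B where B: "!!i. B i >= 0" "!!i x. cmod (pd f i x) <= B i" by metis
 have "cmod (pd f v x) <= (SB i. B i) * norm v" for x v
 proof -
  have "cmod (pd f v x) <= (SB i. cmod ((v *. i) *R pd f i x))"
   by (subst pd_Basis_sum[OF f UNIV_I]) (rule norm_sum)
  also have "... <= (SB i. norm v * B i)"
   by (rule sum_mono) (auto intro!: mult_mono B Basis_le_norm)
  finally show ?thesis by (simp add: sum_distrib_left mult.commute)
 qed
 note c = this
 have S: "0 <= (SB i. B i)" by (simp add: sum_nonneg B)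
 show ?thesis
 proof (rule that)
  show "0 <= B0 + (SB i. B i)" using S B0 by simp
  show "cmod (f x) <= B0 + (SB i. B i)" for x using B0(2)[of x] S by linarith
  show "cmod (pd f v x) <= (B0 + (SB i. B i)) * norm v" for x v
   using c[of x v] mult_nonneg_nonneg[OF B0(1) norm_ge_zero[of v]] by (simp add: distrib_right)
 qed
qed

lemma C1c_Lipschitz:
 assumes "C1c D f" obtains L where "L >= 0" "!!x y. cmod (f x - f y) <= L * norm (x - y)"
proof -
 obtain B where B: "B >= 0" "!!x v. cmod (pd f v x) <= B * norm v" using C1c_bounded[OF assms] by metis
 have "cmod (f x - f y) <= B * norm (x - y)" for x y
  by (rule differentiable_bound[of UNIV f "%x v. pd f v x"])
    (use C1_on_has_derivative[OF C1c_C1[OF assms]] B in \<open>auto intro: onorm_bound\<close>)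
 then show ?thesis using B(1) that by blast
qed

lemma intgl_of_cont_supp:
 fixes f :: "'a::euclidean_space => 'b::{banach,second_countable_topology}"
 assumes "continuous_on UNIV f" "bounded S" "!!x. x ~: S ==> f x = 0"
 shows "intgl f"
proof -
 have "intgl (%x. indicator (closure S) x *R f x)"
  by (rule borel_integrable_compact) (use assms in \<open>auto intro: cont_sub\<close>)
 moreover have "(%x. indicator (closure S) x *R f x) = f"
  using assms(3) closure_subset[of S] by (auto simp: indicator_def fun_eq_iff)
 ultimately show ?thesis by simp
qed

lemma C1c_mbl [measurable_dest]: "C1c D f ==> f : mbl"
 by (intro mbl_cont C1_on_cont C1c_C1)

lemma C1c_pd_mbl: "C1c D f ==> pd f v : mbl"
 by (intro mbl_cont C1_on_cont_pd C1c_C1)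

lemma C1c_int:
 assumes "C1c D f"
 shows "intgl f" "intgl (pd f v)"
  "sqi f" "sqi (pd f v)"
proof -
 obtain K where K: "compact K" "K <= D" "!!x. x ~: K ==> f x = 0" "!!x v. x ~: K ==> pd f v x = 0"
  using C1c_E[OF assms] by blast
 have c: "continuous_on UNIV f" "continuous_on UNIV (pd f v)"
  using assms by (auto intro: C1_on_cont C1_on_cont_pd C1c_C1)
 note i = intgl_of_cont_supp[OF _ compact_imp_bounded[OF K(1)]]
 show "intgl f" "intgl (pd f v)" using i c K by blast+
 show "sqi f" "sqi (pd f v)" unfolding sqiM_def
  using C1c_mbl[OF assms] C1c_pd_mbl[OF assms, of v]
  by (auto intro!: i continuous_intros c simp: K)
qed

section \<open>Difference quotients and integration by parts\<close>

lemma integral_translation: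
 fixes f :: "'a::euclidean_space => 'b::{banach, second_countable_topology}"
 assumes [measurable]: "f : mbl"
 shows "(LBINT x. f (c + x)) = (LBINT x. f x)"
 by (subst (2) lborel_distr_plus[symmetric, of c]) (simp add: integral_distr)

text \<open>The increments h / (n + 1) form a sequence, so that dominated convergence applies to the
  quotients. The limit carries the factor h, which may be negative or 0.\<close>

lemma diff_quot_tendsto:
 fixes f :: "real => complex"
 assumes "(f has_vector_derivative d) (at 0)"
 shows "(%n. of_nat (Suc n) * (f (h / real (Suc n)) - f 0)) \<longlonglongrightarrow> of_real h * d"
proof (cases "h = 0")
 case True then show ?thesis by simp
next
 case False
 have "((%s. norm (f (0 + s) - f 0 - s *R d) / norm s) \<longlongrightarrow> 0) (at 0)"
  using assms unfolding has_vector_derivative_def has_derivative_at by auto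
 moreover have "filterlim (%n. h / real (Suc n)) (at 0) sequentially"
  using False LIMSEQ_inverse_real_of_nat[THEN tendsto_mult_left, of h]
  by (auto simp: filterlim_at divide_inverse)
 ultimately have l: "null (%n. norm (f (h / real (Suc n)) - f 0 - (h / real (Suc n)) *R d) / norm (h / real (Suc n)))"
  using filterlim_compose by fastforce
 have e: "norm (of_nat (Suc n) * (f (h / real (Suc n)) - f 0) - of_real h * d)
   = \<bar>h\<bar> * (norm (f (h / real (Suc n)) - f 0 - (h / real (Suc n)) *R d) / norm (h / real (Suc n)))" for n
 proof -
  let ?D = "f (h / real (Suc n)) - f 0" and ?N = "real (Suc n)"
  have "of_nat (Suc n) * ?D - of_real h * d = ?N *R (?D - (h / ?N) *R d)"
   by (simp add: scaleR_conv_of_real algebra_simps del: of_nat_Suc)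
  then have "norm (of_nat (Suc n) * ?D - of_real h * d) = \<bar>?N\<bar> * norm (?D - (h / ?N) *R d)"
   by (metis norm_scaleR)
  then show ?thesis unfolding norm_scaleR using False by (simp add: field_simps del: of_nat_Suc)
 qed
 show ?thesis
  by (rule LIM_zero_cancel, rule tendsto_norm_zero_cancel, unfold e) (use tendsto_mult_left[OF l, of "\<bar>h\<bar>"] in simp)
qed

lemma C1c_curve:
 assumes f: "C1u f" and c: "(c has_vector_derivative t) (at 0)"
 shows "((%s. f (c s)) has_vector_derivative pd f t (c 0)) (at 0)"
proof -
 have "((%s. f (c s)) has_derivative (%s. pd f (s *R t) (c 0))) (at 0)"
  using has_derivative_compose[OF c[unfolded has_vector_derivative_def] C1_on_has_derivative[OF f UNIV_I]] .
 then show ?thesis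
  unfolding has_vector_derivative_def by (simp add: linear_cmul[OF pd_linear[OF f UNIV_I]])
qed

lemma integrable_translation:
 fixes f :: "'a::euclidean_space => 'b::{banach, second_countable_topology}"
 assumes "intgl f"
 shows "intgl (%x. f (c + x))"
proof -
 have "integrable (distr lborel borel ((+) c)) f" using assms by (simp add: lborel_distr_plus)
 then show ?thesis using assms by (subst (asm) integrable_distr_eq) auto
qed

text \<open>The derivative is a limit of difference quotients, and each quotient integrates to 0 by
  translation invariance. Dominated convergence applies because f is Lipschitz and all shifted
  supports stay in one ball.\<close>

lemma integral_pd_eq_0:
 assumes f: "C1c D f" shows "(LBINT x. pd f v x) = 0"
proof -
 obtain L where L: "L >= 0" "!!x y. cmod (f x - f y) <= L * norm (x - y)" using C1c_Lipschitz[OF f] by metis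
 obtain K where K: "compact K" "!!x. x ~: K ==> f x = 0" using C1c_E[OF f] by metis
 obtain B where B: "!!x. x : K ==> norm x <= B" using compact_imp_bounded[OF K(1)] by (auto simp: bounded_iff)
 note [measurable] = C1c_mbl[OF f] C1c_pd_mbl[OF f]
 let ?s = "%n x. of_nat (Suc n) * (f ((1 / real (Suc n)) *R v + x) - f x)"
 let ?w = "%x. indicator (cball 0 (B + norm v)) x *R (L * norm v) :: real"
 have "(%n. LBINT x. ?s n x) \<longlonglongrightarrow> (LBINT x. pd f v x)"
 proof (rule integral_dominated_convergence[where w = ?w])
  show "intgl ?w" by (rule borel_integrable_compact) auto
  show "AEL x. (%n. ?s n x) \<longlonglongrightarrow> pd f v x"
  proof (rule AE_I2)
   fix x
   have "((%s. s *R v + x) has_vector_derivative v) (at 0)"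
    by (auto intro!: derivative_eq_intros)
   from C1c_curve[OF C1c_C1[OF f] this] diff_quot_tendsto[of "%s. f (s *R v + x)" _ 1]
   show "(%n. ?s n x) \<longlonglongrightarrow> pd f v x" by simp
  qed
  fix n
  show "AEL x. norm (?s n x) <= ?w x"
  proof (rule AE_I2)
   fix x
   have *: "cmod (?s n x) <= L * norm v"
   proof -
    have "cmod (?s n x) <= real (Suc n) * (L * norm ((1 / real (Suc n)) *R v))"
     unfolding norm_mult norm_of_nat using L(2)[of "(1 / real (Suc n)) *R v + x" x]
     by (intro mult_left_mono) auto
    then show ?thesis by simp
   qed
   show "norm (?s n x) <= ?w x"
   proof (cases "x : cball 0 (B + norm v)")
    case True then show ?thesis using * by simp
   next
    case False
    then have n: "norm x > B + norm v" by simp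
    have "norm ((1 / real (Suc n)) *R v) <= norm v" by (simp add: field_simps)
    then have "norm ((1 / real (Suc n)) *R v + x) > B"
     using n norm_triangle_ineq4[of "(1 / real (Suc n)) *R v + x" "(1 / real (Suc n)) *R v"] by simp
    moreover have "norm x > B" using n norm_ge_zero[of v] by linarith
    ultimately have "x ~: K" "(1 / real (Suc n)) *R v + x ~: K" using B by force+
    then show ?thesis using K(2) L(1) by simp
   qed
  qed
 qed measurable
 moreover have "(LBINT x. ?s n x) = 0" for n
 proof -
  have i: "intgl (%x. f ((1 / real (Suc n)) *R v + x))"
   using integrable_translation C1c_int(1)[OF f] by blast
  have "(LBINT x. ?s n x) = of_nat (Suc n) * ((LBINT x. f ((1 / real (Suc n)) *R v + x)) - (LBINT x. f x))"
   using i C1c_int(1)[OF f] by (simp del: of_nat_Suc)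
  then show ?thesis using integral_translation[of f] by simp
 qed
 ultimately have "(%n. 0) \<longlonglongrightarrow> (LBINT x. pd f v x)" by (simp only:)
 then show ?thesis by (simp add: LIMSEQ_const_iff)
qed

lemma integral_by_parts:
 assumes "open D" "C1_on D f" "C1c D g"
 shows "(LBINT x. (if x : D then f x * pd g v x else 0)) = - (LBINT x. (if x : D then pd f v x * g x else 0))"
proof -
 note m = C1c_mult[OF assms]
 obtain K where K: "compact K" "K <= D" "!!x. x ~: K ==> g x = 0" "!!x v. x ~: K ==> pd g v x = 0"
  using C1c_E[OF assms(3)] by blast
 let ?a = "%x. if x : D then f x * pd g v x else 0" and ?b = "%x. if x : D then pd f v x * g x else 0"
 have int: "intgl (%x. if x : D then h x else 0)" if "continuous_on D h" "!!x. x : D - K ==> h x = 0"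
  for h :: "'a => complex"
 proof -
  have "intgl (%x. indicator K x *R h x)"
   using borel_integrable_compact[OF K(1)] cont_sub[OF that(1) K(2)] by blast
  moreover have "(%x. indicator K x *R h x) = (%x. if x : D then h x else 0)"
   using K(2) that(2) by (auto simp: fun_eq_iff indicator_def)
  ultimately show ?thesis by simp
 qed
 have c: "continuous_on D f" "continuous_on D (pd f v)" "continuous_on D g" "continuous_on D (pd g v)"
  using assms by (auto intro: C1_on_cont C1_on_cont_pd cont_sub C1c_C1)
 have ia: "intgl ?a" by (rule int) (auto intro!: continuous_intros c simp: K)
 have ib: "intgl ?b" by (rule int) (auto intro!: continuous_intros c simp: K)
 have "pd (%x. f x * g x) v x = ?a x + ?b x" for x
  using m(2)[of x v] C1c_pd_off[OF m(1), of x v] by simp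
 then have "(LBINT x. ?a x + ?b x) = 0" using integral_pd_eq_0[OF m(1), of v] by simp
 then show ?thesis using ia ib by (simp add: eq_neg_iff_add_eq_0)
qed

lemma integral_tendsto_at_0:
 fixes F :: "real => 'a::euclidean_space => 'b::{banach, second_countable_topology}"
 assumes m: "!!h. F h : lmbl" "g : lmbl" and w: "intgl w"
  and b: "!!h x. h ~= 0 ==> \<bar>h\<bar> <= 1 ==> norm (F h x) <= w x"
  and lim: "!!x. ((%h. F h x) \<longlongrightarrow> g x) (at 0)"
 shows "((%h. LBINT x. F h x) \<longlongrightarrow> (LBINT x. g x)) (at 0)"
 unfolding tendsto_at_iff_sequentially o_def
proof (intro allI impI)
 fix X :: "nat => real" assume X0: "ALL i. X i : UNIV - {0}" and X: "X \<longlonglongrightarrow> 0"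
 obtain N where N: "ALL n>=N. norm (X n - 0) < 1" using LIMSEQ_D[OF X, of 1] by auto
 have "(%n. LBINT x. F (X (n + N)) x) \<longlonglongrightarrow> (LBINT x. g x)"
 proof (rule integral_dominated_convergence[OF m(2) m(1) w])
  show "AEL x. (%i. F (X (i + N)) x) \<longlonglongrightarrow> g x"
  proof (rule AE_I2)
   fix x
   have "(%i. F (X i) x) \<longlonglongrightarrow> g x"
    using lim[of x] X0 X unfolding tendsto_at_iff_sequentially o_def by auto
   then show "(%i. F (X (i + N)) x) \<longlonglongrightarrow> g x" by (rule LIMSEQ_ignore_initial_segment)
  qed
  show "AEL x. norm (F (X (i + N)) x) <= w x" for i
   using N X0 by (intro AE_I2 b) (auto intro!: less_imp_le)
 qed
 then show "(%n. LBINT x. F (X n) x) \<longlonglongrightarrow> (LBINT x. g x)"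
  by (rule LIMSEQ_offset)
qed

section \<open>Box bumps and measure-preserving shear flows\<close>

lemma has_real_derivative_max0_sq: "((%t. (max 0 t)^2) has_real_derivative 2 * max 0 t) (at t)"
proof -
 have "((%t::real. (max 0 t)^2) has_real_derivative 0) (at 0)"
  unfolding DERIV_def
 proof (rule Lim_null_comparison[where g = "%h. \<bar>h\<bar>"])
  show "\<forall>\<^sub>F h in at 0. norm (((max 0 (0 + h))^2 - (max 0 (0::real))^2) / h) <= \<bar>h\<bar>"
   by (rule always_eventually) (auto simp: max_def power2_eq_square)
 qed (auto intro!: tendsto_eq_intros)
 moreover have "((%t. (max 0 t)^2) has_real_derivative 2 * t) (at t)" if "t > 0" for t :: real
 proof (rule has_field_derivative_transform_within_open[of "%t. t^2" _ _ "{0<..}"])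
  show "((%t. t^2) has_real_derivative 2 * t) (at t)" by (auto intro!: derivative_eq_intros)
 qed (use that in auto)
 moreover have "((%t. (max 0 t)^2) has_real_derivative 0) (at t)" if "t < 0" for t :: real
 proof (rule has_field_derivative_transform_within_open[of "%t. 0" _ _ "{..<0}"])
  show "((%t. 0) has_real_derivative 0) (at t)" by (auto intro!: derivative_eq_intros)
 qed (use that in auto)
 ultimately show ?thesis by (cases "t = 0"; cases "t > 0") auto
qed

lemma C1_on_prod:
 fixes f :: "'i => 'a::euclidean_space => real"
 shows "(!!i. i : A ==> C1_on S (f i)) ==> C1_on S (%x. \<Prod>i\<in>A. f i x)"
 by (induction A rule: infinite_finite_induct) (auto intro: C1_on_mult)

text \<open>psi, a product of squared positive parts, is C^1 and positive exactly on the open box; n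
  psi / (1 + n psi) therefore increases to the indicator of that box.\<close>

lemma box_bump:
 fixes l u :: "'a::euclidean_space"
 obtains h :: "nat => 'a => real" where "!!n. C1u (h n)" "!!n x. 0 <= h n x" "!!n x. h n x <= 1"
  "!!n x. x ~: cbox l u ==> h n x = 0" "!!x. incseq (%n. h n x)"
  "!!x. (%n. h n x) \<longlonglongrightarrow> indicator (box l u) x"
proof -
 define m where "m = (%t::real. (max 0 t)^2)"
 define psi where "psi = (%x. \<Prod>b\<in>Basis. m ((x - l) *. b) * m ((u - x) *. b))"
 have m0: "m t >= 0" for t by (simp add: m_def)
 have mC: "C1u (%x. m (g x))" if "C1u g" for g :: "'a => real"
  unfolding m_def
  by (rule C1_on_comp_real(1)[OF that has_real_derivative_max0_sq]) (intro continuous_intros)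
 have lin: "C1u (%x::'a. (x - l) *. b)" "C1u (%x::'a. (u - x) *. b)" for b
  by (rule C1_onI[where f' = "%x v. v *. b"] C1_onI[where f' = "%x v. - (v *. b)"]; auto intro!: derivative_eq_intros continuous_intros)+
 have psiC: "C1u psi" unfolding psi_def
  by (intro C1_on_prod C1_on_mult(1) mC lin)
 have psi0: "psi x >= 0" for x unfolding psi_def by (intro prod_nonneg ballI mult_nonneg_nonneg m0)
 have psipos: "psi x > 0 \<longleftrightarrow> x : box l u" for x
 proof -
  have "psi x > 0 \<longleftrightarrow> psi x ~= 0" using psi0[of x] by auto
  also have "... \<longleftrightarrow> x : box l u"
   unfolding psi_def by (auto simp: m_def mem_box max_def inner_diff_left split: if_splits)
  finally show ?thesis .
 qed
 define h where "h = (%n x. real n * psi x / (1 + real n * psi x))"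
 have den: "1 + real n * psi x > 0" for n x using psi0[of x] by (simp add: add_pos_nonneg)
 show ?thesis
 proof (rule that[of h])
  show "C1u (h n)" for n unfolding h_def
  proof (rule C1_on_comp_real(1)[OF psiC, where F = "%y. real n * y / (1 + real n * y)" and F' = "%y. real n / (1 + real n * y)^2"])
   show "((%y. real n * y / (1 + real n * y)) has_real_derivative real n / (1 + real n * psi x)^2) (at (psi x))" for x
    using den[of n x] by (auto intro!: derivative_eq_intros simp: power2_eq_square field_simps)
   show "continuous_on (range psi) (%y. real n / (1 + real n * y)^2)"
    using den[of n] by (auto intro!: continuous_intros simp: less_imp_neq[symmetric])
  qed
  show "0 <= h n x" "h n x <= 1" for n x using den[of n x] psi0[of x] by (auto simp: h_def)
  show "h n x = 0" if "x ~: cbox l u" for n x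
   using that psipos[of x] psi0[of x] box_subset_cbox[of l u] by (auto simp: h_def)
  show "incseq (%n. h n x)" for x
  proof (rule incseq_SucI)
   fix n show "h n x <= h (Suc n) x"
    using den[of n x] den[of "Suc n" x] psi0[of x] unfolding h_def
    by (simp add: divide_le_eq le_divide_eq) (simp add: algebra_simps)
  qed
  show "(%n. h n x) \<longlonglongrightarrow> indicator (box l u) x" for x
  proof (cases "x : box l u")
   case True
   then have p: "psi x > 0" using psipos by simp
   have e: "h (Suc n) x = 1 / (inverse (real (Suc n)) / psi x + 1)" for n
   proof -
    have "y / (1 + y) = 1 / (1 / y + 1)" if "y > 0" for y :: real
     using that by (simp add: field_simps)
    moreover have "real (Suc n) * psi x > 0" using p by simp
    ultimately have "h (Suc n) x = 1 / (1 / (real (Suc n) * psi x) + 1)"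
     unfolding h_def by blast
    then show ?thesis by (simp add: divide_simps mult.commute del: of_nat_Suc)
   qed
   have "(%n. 1 / (inverse (real (Suc n)) / psi x + 1)) \<longlonglongrightarrow> 1 / (0 / psi x + 1)"
    by (intro tendsto_intros LIMSEQ_inverse_real_of_nat) (use p in auto)
   then have "(%n. h (Suc n) x) \<longlonglongrightarrow> 1" unfolding e by simp
   then show ?thesis using True by (auto intro: LIMSEQ_imp_Suc)
  next
   case False
   then have "psi x = 0" using psipos psi0[of x] by force
   then show ?thesis using False by (simp add: h_def)
  qed
 qed
qed

lemma C1c_of_real:
 assumes "C1u f" "compact K" "K <= D" "!!x. x ~: K ==> f x = 0"
 shows "C1c D (%x. cor (f x))"
 using C1_on_bl(1)[OF assms(1) bounded_linear_of_real] assms by (auto simp: C1c_def)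

text \<open>Preservation of the integrals of C^1 functions with compact support extends, by monotone
  convergence of the box bumps, to the volumes of open boxes, and these determine Lebesgue
  measure.\<close>

lemma lborel_distr_eqI:
 fixes Fl :: "'a::euclidean_space => 'a"
 assumes [measurable]: "Fl : mbl"
  and int: "!!f. C1c UNIV f ==> intgl (%x. f (Fl x))"
  and eq: "!!f. C1c UNIV f ==> (LBINT x. f (Fl x)) = (LBINT x. f x)"
 shows "distr lborel borel Fl = lborel"
proof (rule lborel_eqI[symmetric])
 fix l u :: 'a assume le: "!!b. b : Basis ==> l *. b <= u *. b"
 obtain h where h: "!!n. C1u (h n)" "!!n x. 0 <= h n x" "!!n x. h n x <= 1"
  "!!n x. x ~: cbox l u ==> h n x = (0::real)" "!!x. incseq (%n. h n x)"
  "!!x. (%n. h n x) \<longlonglongrightarrow> indicator (box l u) x" using box_bump[of l u] by metis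
 have hc: "C1c UNIV (%x. cor (h n x))" for n
  by (rule C1c_of_real[OF h(1), of "cbox l u"]) (use h(4) in auto)
 have [measurable]: "h n : mbl" for n
  by (intro mbl_cont C1_on_cont h)
 have nn: "(\<integral>\<^sup>+x. ennreal (h n (Fl x)) \<partial>lborel) = (\<integral>\<^sup>+x. ennreal (h n x) \<partial>lborel)" for n
 proof -
  have i: "intgl (%x. h n (Fl x))" "intgl (h n)"
   using int[OF hc[of n]] C1c_int(1)[OF hc[of n]] by (simp_all add: complex_of_real_integrable_eq)
  have "cor (LBINT x. h n (Fl x)) = cor (LBINT x. h n x)"
   using eq[OF hc[of n]] by simp
  then have "(LBINT x. h n (Fl x)) = (LBINT x. h n x)" by simp
  then show ?thesis using h(2) i by (simp add: nn_integral_eq_integral)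
 qed
 have lim: "(%n. \<integral>\<^sup>+x. ennreal (h n (g x)) \<partial>lborel) \<longlonglongrightarrow> (\<integral>\<^sup>+x. indicator (box l u) (g x) \<partial>lborel)"
  if [measurable]: "g : mbl" for g :: "'a => 'a"
 proof (rule nn_integral_LIMSEQ)
  show "incseq (%n x. ennreal (h n (g x)))"
   using h(5) by (auto simp: incseq_def le_fun_def intro!: ennreal_leI)
  show "(%n. ennreal (h n (g x))) \<longlonglongrightarrow> indicator (box l u) (g x)" for x
   using tendsto_ennrealI[OF h(6)[of "g x"]] by (simp add: ennreal_indicator)
 qed measurable
 have "(\<integral>\<^sup>+x. indicator (box l u) (Fl x) \<partial>lborel) = (\<integral>\<^sup>+x. indicator (box l u) x \<partial>lborel)"
  using LIMSEQ_unique[OF lim[of Fl], of "\<integral>\<^sup>+x. indicator (box l u) x \<partial>lborel"] lim[of "%x. x"] nn by simp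
 moreover have "emeasure (distr lborel borel Fl) (box l u) = (\<integral>\<^sup>+x. indicator (box l u) (Fl x) \<partial>lborel)"
  using nn_integral_distr[of Fl lborel borel "indicator (box l u)"]
   nn_integral_indicator[of "box l u" "distr lborel borel Fl"] by simp
 ultimately show "emeasure (distr lborel borel Fl) (box l u) = ennreal (\<Prod>b\<in>Basis. (u - l) *. b)"
  using le by (simp add: emeasure_lborel_box)
qed simp

lemma bounded_image_of_compact_param:
 fixes F :: "real => 'a::euclidean_space => 'a"
 assumes "compact K" "continuous_on UNIV (%p. F (fst p) (snd p))"
 shows "compact (\<Union>s\<in>{-a..a}. F s ` K)"
proof -
 have "(\<Union>s\<in>{-a..a}. F s ` K) = (%p. F (fst p) (snd p)) ` ({-a..a} \<times> K)" by force
 moreover have "compact ..."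
  by (intro compact_continuous_image compact_Times assms(1) compact_Icc) (use assms(2) cont_sub in blast)
 ultimately show ?thesis by simp
qed

lemma has_vector_derivative_iff_quotient:
 fixes f :: "real => 'b::real_normed_vector"
 shows "(f has_vector_derivative d) (at a) \<longleftrightarrow> ((%h. (f (a + h) - f a) /\<^sub>R h) \<longlongrightarrow> d) (at 0)"
proof -
 have e: "norm (f (a + h) - f a - h *R d) / norm h = norm ((f (a + h) - f a) /\<^sub>R h - d)" if "h ~= 0" for h
 proof -
  have "(f (a + h) - f a) /\<^sub>R h - d = (f (a + h) - f a - h *R d) /\<^sub>R h"
   using that by (simp add: scaleR_diff_right)
  then show ?thesis by (simp add: divide_inverse mult.commute)
 qed
 have "(f has_vector_derivative d) (at a) \<longleftrightarrow> ((%h. norm (f (a + h) - f a - h *R d) / norm h) \<longlongrightarrow> 0) (at 0)"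
  unfolding has_vector_derivative_def has_derivative_at by (simp add: bounded_linear_scaleR_left)
 also have "... \<longleftrightarrow> ((%h. norm ((f (a + h) - f a) /\<^sub>R h - d)) \<longlongrightarrow> 0) (at 0)"
  by (rule filterlim_cong) (use e in \<open>auto simp: eventually_at_filter intro!: always_eventually\<close>)
 also have "... \<longleftrightarrow> ((%h. (f (a + h) - f a) /\<^sub>R h) \<longlongrightarrow> d) (at 0)"
  by (simp add: tendsto_norm_zero_iff LIM_zero_iff)
 finally show ?thesis .
qed

text \<open>Since \<kappa> is constant along e, the map x -> x + s \<kappa>(x) e is the time-s flow
  of the divergence-free field \<kappa> e. Invariance of the measure is obtained by differentiating
  integrals in s, without computing a determinant.\<close>

locale vertical_shear =
 fixes \<kappa> :: "'a::euclidean_space => real" and e :: 'a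
 assumes kC: "C1u \<kappa>" and ke: "!!x s. \<kappa> (x + s *R e) = \<kappa> x"
begin

definition sh :: "real => 'a => 'a" where "sh s x = x + (s * \<kappa> x) *R e"

lemma sh_add: "sh s (sh r x) = sh (s + r) x"
 by (simp add: sh_def ke algebra_simps)

lemma sh_0 [simp]: "sh 0 x = x" by (simp add: sh_def)

lemma sh_cont: "continuous_on UNIV (%p. sh (fst p) (snd p))"
 unfolding sh_def
 by (intro continuous_intros continuous_on_compose2[OF C1_on_cont[OF kC]]) auto

lemma C1c_sh:
 assumes f: "C1c UNIV f" shows "C1c UNIV (%x. f (sh s x))"
proof -
 obtain K where K: "compact K" "!!x. x ~: K ==> f x = 0" using C1c_E[OF f] by metis
 have d: "(sh s has_derivative (%v. v + (s * pd \<kappa> v x) *R e)) (at x)" for x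
  unfolding sh_def[abs_def] by (auto intro!: derivative_eq_intros C1_on_has_derivative[OF kC])
 have 1: "C1u (%x. f (sh s x))"
  by (rule C1_on_compose(1)[OF C1c_C1[OF f] d]) (intro continuous_intros C1_on_cont_pd kC)
 have c: "compact (sh (-s) ` K)"
  by (intro compact_continuous_image K) (auto simp: sh_def intro!: continuous_intros cont_sub[OF C1_on_cont[OF kC]])
 have "f (sh s x) = 0" if "x ~: sh (-s) ` K" for x
 proof (rule K(2), rule)
  assume "sh s x : K"
  then have "sh (-s) (sh s x) : sh (-s) ` K" by blast
  then show False using that by (simp add: sh_add)
 qed
 then show ?thesis using 1 c by (auto simp: C1c_def)
qed

text \<open>The quotients converge to \<kappa> times the derivative of f along e. As \<kappa> does
  not change along e, this is the e-derivative of \<kappa> f, and its integral vanishes.\<close>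

lemma sh_deriv_0:
 assumes f: "C1c UNIV f"
 shows "((%h. LBINT x. (f (sh h x) - f x) /\<^sub>R h) \<longlongrightarrow> 0) (at 0)"
proof -
 obtain K where K: "compact K" "!!x. x ~: K ==> f x = 0" using C1c_E[OF f] by metis
 obtain L where L: "L >= 0" "!!x y. cmod (f x - f y) <= L * norm (x - y)" using C1c_Lipschitz[OF f] by metis
 define S where "S = (\<Union>s\<in>{-1..1}. sh s ` K)"
 have S: "compact S" unfolding S_def by (rule bounded_image_of_compact_param[OF K(1) sh_cont])
 have off: "f (sh h x) = 0" if "x ~: S" "\<bar>h\<bar> <= 1" for x h
 proof (rule K(2), rule)
  assume "sh h x : K"
  then have "sh (-h) (sh h x) : S" using that(2) by (auto simp: S_def intro!: bexI[of _ "-h"])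
  then show False using that(1) by (simp add: sh_add)
 qed
 have kc: "C1u (%x. cor (\<kappa> x))" by (rule C1_on_bl(1)[OF kC bounded_linear_of_real])
 have pdk: "pd \<kappa> e x = 0" for x
 proof -
  have "((%s. \<kappa> (x + s *R e)) has_derivative (%s. pd \<kappa> (s *R e) x)) (at 0)"
   by (rule has_derivative_compose[of "%s. x + s *R e" "%s. s *R e" 0 UNIV \<kappa>, simplified])
     (auto intro!: derivative_eq_intros C1_on_has_derivative[OF kC, simplified])
  then have "((%s. \<kappa> x) has_derivative (%s. pd \<kappa> (s *R e) x)) (at 0)" by (simp add: ke)
  then have "(%s. pd \<kappa> (s *R e) x) = (%s::real. 0)"
   using has_derivative_unique has_derivative_const by blast
  then show ?thesis by (metis scaleR_one)
 qed
 have pdkc: "pd (%x. cor (\<kappa> x)) e x = 0" for x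
  using C1_on_bl(2)[OF kC bounded_linear_of_real, of x e] pdk by simp
 note m = C1c_mult[OF open_UNIV kc f]
 have z: "(LBINT x. of_real (\<kappa> x) * pd f e x) = 0"
  using integral_pd_eq_0[OF m(1), of e] by (simp add: m(2) pdkc)
 have [measurable]: "f : mbl" "pd f e : mbl" "\<kappa> : mbl"
  using C1c_mbl[OF f] C1c_pd_mbl[OF f] mbl_cont[OF C1_on_cont[OF kC]] by auto
 have kb: "bounded (\<kappa> ` S)"
  using S C1_on_cont[OF kC] by (meson compact_continuous_image compact_imp_bounded cont_sub subset_UNIV)
 then obtain B where B: "!!x. x : S ==> \<bar>\<kappa> x\<bar> <= B" by (auto simp: bounded_iff)
 have "((%h. LBINT x. (f (sh h x) - f x) /\<^sub>R h) \<longlongrightarrow> (LBINT x. of_real (\<kappa> x) * pd f e x)) (at 0)"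
 proof (rule integral_tendsto_at_0)
  show "(%x. (f (sh h x) - f x) /\<^sub>R h) : lmbl" for h unfolding sh_def by measurable
  show "(%x. of_real (\<kappa> x) * pd f e x) : lmbl" by measurable
  show "intgl (%x. indicator S x *R (L * (B * norm e)))"
   by (rule borel_integrable_compact[OF S]) auto
  show "norm ((f (sh h x) - f x) /\<^sub>R h) <= indicator S x *R (L * (B * norm e))" if h: "h ~= 0" "\<bar>h\<bar> <= 1" for h x
  proof (cases "x : S")
   case True
   have "norm (f (sh h x) - f x) <= L * norm (sh h x - x)" by (rule L)
   also have "... = L * (\<bar>h\<bar> * \<bar>\<kappa> x\<bar> * norm e)" by (simp add: sh_def abs_mult)
   also have "... <= L * (\<bar>h\<bar> * B * norm e)"
    by (intro mult_left_mono mult_right_mono B True L) auto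
   finally show ?thesis using h True by (simp add: divide_simps mult_ac)
  next
   case False then show ?thesis using off[OF False h(2)] off[OF False, of 0] by simp
  qed
  show "((%h. (f (sh h x) - f x) /\<^sub>R h) \<longlongrightarrow> of_real (\<kappa> x) * pd f e x) (at 0)" for x
  proof -
   have "((%s. sh s x) has_vector_derivative \<kappa> x *R e) (at 0)"
    unfolding sh_def by (auto intro!: derivative_eq_intros)
   from C1c_curve[OF C1c_C1[OF f] this]
   have "((%s. f (sh s x)) has_vector_derivative of_real (\<kappa> x) * pd f e x) (at 0)"
    by (simp add: linear_cmul[OF pd_linear[OF C1c_C1[OF f] UNIV_I]] scaleR_conv_of_real)
   then show ?thesis unfolding has_vector_derivative_iff_quotient by simp
  qed
 qed
 then show ?thesis using z by simp
qed

text \<open>By the group law the derivative at any s is the derivative at 0 for f composed with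
  \<open>sh s\<close>, hence 0, and the integral is constant in s.\<close>

lemma integral_sh:
 assumes f: "C1c UNIV f" shows "(LBINT x. f (sh s x)) = (LBINT x. f x)"
proof -
 let ?I = "%s. LBINT x. f (sh s x)"
 have "(?I has_vector_derivative 0) (at s)" for s
 proof -
  have g: "C1c UNIV (%x. f (sh s x))" by (rule C1c_sh[OF f])
  have "(?I (s + h) - ?I s) /\<^sub>R h = (LBINT x. (f (sh s (sh h x)) - f (sh s x)) /\<^sub>R h)" for h
   using C1c_int(1)[OF C1c_sh[OF f]] by (simp add: sh_add)
  then show ?thesis unfolding has_vector_derivative_iff_quotient by (simp only:) (rule sh_deriv_0[OF g])
 qed
 then obtain c where "!!s. ?I s = c"
  using has_vector_derivative_zero_constant[of UNIV ?I] by auto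
 from this[of s] this[of 0] show ?thesis by simp
qed

lemma sh_measurable [measurable]: "sh s : mbl"
proof -
 have [measurable]: "\<kappa> : mbl"
  by (intro mbl_cont C1_on_cont kC)
 show ?thesis unfolding sh_def[abs_def] by measurable
qed

lemma distr_sh: "distr lborel borel (sh s) = lborel"
 by (rule lborel_distr_eqI) (auto intro: C1c_int C1c_sh integral_sh)

end

text \<open>When ga is the height of a graph over the hyperplane orthogonal to e and ta is
  orthogonal to e, \<open>Fl h\<close> moves a point by h ta and corrects its height so that its
  position relative to the graph is unchanged. With ga = 0 and e = 0 the flow is the translation by
  h ta, and the same lemmas then serve for coordinate shifts.\<close>

locale shear_flow =
 fixes ga :: "'a::euclidean_space => real" and e ta :: 'a
 assumes gC: "C1u ga" and ge: "!!x s. ga (x + s *R e) = ga x"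
begin

definition Fl :: "real => 'a => 'a" where
 "Fl h x = x + h *R ta + (ga (x + h *R ta) - ga x) *R e"

text \<open>The velocity field of the flow: the constant direction ta lifted to the tangent space of
  the graph.\<close>

definition t :: "'a => 'a" where "t x = ta + pd ga ta x *R e"

text \<open>The derivative of \<open>Fl h\<close> at x sends v to v + \<open>KFl h v x\<close> e.
  This is the only deviation from the identity, and it is of order h when the derivatives of ga are
  Lipschitz.\<close>

definition KFl :: "real => 'a => 'a => real" where
 "KFl h v x = pd ga v (x + h *R ta) - pd ga v x"

lemma flow_0 [simp]: "Fl 0 x = x" by (simp add: Fl_def)

lemma flow_add: "Fl h (Fl k x) = Fl (h + k) x"
proof -
 have 1: "ga (Fl k x) = ga (x + k *R ta)" by (simp add: Fl_def ge)
 have "Fl k x + h *R ta = (x + (h + k) *R ta) + (ga (x + k *R ta) - ga x) *R e"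
  by (simp add: Fl_def algebra_simps)
 then have 2: "ga (Fl k x + h *R ta) = ga (x + (h + k) *R ta)" by (simp only: ge)
 show ?thesis unfolding Fl_def[of h "Fl k x"] 1 2 by (simp add: Fl_def algebra_simps)
qed

lemma flow_cont: "continuous_on UNIV (%p. Fl (fst p) (snd p))"
 unfolding Fl_def
 by (intro continuous_intros continuous_on_compose2[OF C1_on_cont[OF gC]]) auto

lemma flow_cont1: "continuous_on S (Fl h)"
 unfolding Fl_def[abs_def]
 by (intro continuous_intros continuous_on_compose2[OF C1_on_cont[OF gC]]) auto

lemma flow_measurable [measurable]: "Fl h : mbl"
 by (intro mbl_cont flow_cont1)

lemma gamma_shift: "C1u (%x. ga (x + c))" "pd (%x. ga (x + c)) v x = pd ga v (x + c)"
proof -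
 have d: "((%x. x + c) has_derivative (%v. v)) (at x)" for x :: 'a by (auto intro!: derivative_eq_intros)
 show "C1u (%x. ga (x + c))" "pd (%x. ga (x + c)) v x = pd ga v (x + c)"
  using C1_on_compose[OF gC d] by auto
qed

lemma distr_flow: "distr lborel borel (Fl h) = lborel"
proof -
 \<comment> \<open>\<open>Fl h\<close> is the translation by h ta followed by the time-1 shear for
   this height difference; the argument of ga is shifted back because the shear acts on the
   translated point.\<close>
 interpret vertical_shear "%x. ga x - ga (x - h *R ta)" e
 proof
  show "C1u (%x. ga x - ga (x - h *R ta))"
   using C1_on_diff(1)[OF gC gamma_shift(1)[of "- (h *R ta)"]] by simp
  show "ga (x + s *R e) - ga (x + s *R e - h *R ta) = ga x - ga (x - h *R ta)" for x s
   using ge[of "x - h *R ta" s] ge[of x s] by (simp add: algebra_simps)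
 qed
 have "Fl h = sh 1 \<circ> (+) (h *R ta)"
  by (auto simp: Fl_def sh_def fun_eq_iff algebra_simps)
 then have "distr lborel borel (Fl h) = distr (distr lborel borel ((+) (h *R ta))) borel (sh 1)"
  by (simp add: distr_distr)
 then show ?thesis by (simp add: lborel_distr_plus distr_sh)
qed

lemma integrable_flow_iff:
 fixes f :: "'a => 'b::{banach, second_countable_topology}"
 assumes [measurable]: "f : mbl"
 shows "intgl (%x. f (Fl h x)) \<longleftrightarrow> intgl f"
 by (subst (2) distr_flow[of h, symmetric]) (simp add: integrable_distr_eq)

lemma integral_flow:
 fixes f :: "'a => 'b::{banach, second_countable_topology}"
 assumes [measurable]: "f : mbl"
 shows "(LBINT x. f (Fl h x)) = (LBINT x. f x)"
 by (subst (2) distr_flow[of h, symmetric]) (simp add: integral_distr)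

lemma sqi_flow: "sqi f ==> sqi (%x. f (Fl h x))"
 and nrm_flow: "sqi f ==> nrm (%x. f (Fl h x)) = nrm f"
proof -
 assume f: "sqi f"
 then have [measurable]: "f : mbl" using sqi_meas[OF f] by simp
 show "sqi (%x. f (Fl h x))"
  using f integrable_flow_iff[of "%x. (cmod (f x))^2" h] by (simp add: sqiM_def)
 show "nrm (%x. f (Fl h x)) = nrm f"
  using integral_flow[of "%x. (cmod (f x))^2" h] by (simp add: nrmM_def)
qed

lemma flow_deriv: "(Fl h has_derivative (%v. v + KFl h v x *R e)) (at x)"
 unfolding Fl_def[abs_def] KFl_def
 by (auto intro!: derivative_eq_intros C1_on_has_derivative[OF gC]
   has_derivative_compose[OF _ C1_on_has_derivative[OF gC UNIV_I]] simp: algebra_simps)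

lemma flow_C1_on:
 assumes "C1u f"
 shows "C1u (%x. f (Fl h x))"
  "pd (%x. f (Fl h x)) v x = pd f v (Fl h x) + KFl h v x *R pd f e (Fl h x)"
proof -
 have c: "continuous_on UNIV (%x. v + KFl h v x *R e)" for v
  unfolding KFl_def
  by (intro continuous_intros C1_on_cont_pd[OF gC] continuous_on_compose2[OF C1_on_cont_pd[OF gC]]) auto
 note * = C1_on_compose[OF assms flow_deriv c]
 show "C1u (%x. f (Fl h x))" by (rule *(1))
 show "pd (%x. f (Fl h x)) v x = pd f v (Fl h x) + KFl h v x *R pd f e (Fl h x)"
  using *(2)[of x v] pd_linear[OF assms UNIV_I, of "Fl h x"] by (simp add: linear_add linear_cmul)
qed

lemma C1c_flow:
 assumes f: "C1u f" and K: "compact K" "!!x. x ~: K ==> f x = 0" "Fl (-h) ` K <= D"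
 shows "C1c D (%x. f (Fl h x))"
 unfolding C1c_def
proof (intro conjI exI)
 show "C1u (%x. f (Fl h x))" by (rule flow_C1_on[OF f])
 show "compact (Fl (-h) ` K)" by (intro compact_continuous_image K flow_cont1)
 show "ALL x. x ~: Fl (-h) ` K --> f (Fl h x) = 0"
 proof (intro allI impI K(2) notI)
  fix x assume "x ~: Fl (-h) ` K" "Fl h x : K"
  then have "Fl (-h) (Fl h x) : Fl (-h) ` K" by blast
  then show False using \<open>x ~: Fl (-h) ` K\<close> by (simp add: flow_add)
 qed
qed (use K in auto)

lemma flow_curve: "((%s. Fl s x) has_vector_derivative t x) (at 0)"
proof -
 have "((%s. x + s *R ta) has_vector_derivative ta) (at 0)" by (auto intro!: derivative_eq_intros)
 then have "((%s. ga (x + s *R ta)) has_vector_derivative pd ga ta x) (at 0)"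
  using C1c_curve[OF gC, of "%s. x + s *R ta" ta] by simp
 then have "((%s. ga (x + s *R ta)) has_real_derivative pd ga ta x) (at 0)"
  by (simp add: has_real_derivative_iff_has_vector_derivative)
 then show ?thesis unfolding Fl_def t_def by (auto intro!: derivative_eq_intros)
qed

text \<open>Along a flow line the derivative is \<open>pd f (t y) y\<close> at the current point \<open>y\<close>, which is bounded
  because \<open>f\<close> has compact support.\<close>
lemma flow_diff_pointwise:
 assumes f: "C1c D f"
 obtains B where "B >= 0" "!!h x. cmod (f (Fl h x) - f x) <= B * \<bar>h\<bar>"
proof -
 have fC: "C1u f" by (rule C1c_C1[OF f])
 obtain K where K: "compact K" "!!x. x ~: K ==> f x = 0" "!!x v. x ~: K ==> pd f v x = 0" using C1c_E[OF f] by metis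
 have lin: "pd f (t x) x = pd f ta x + pd ga ta x *R pd f e x" for x
  using pd_linear[OF fC UNIV_I] by (simp add: t_def linear_add linear_cmul)
 have "continuous_on K (%x. pd f (t x) x)" unfolding lin
  by (intro continuous_intros cont_sub[OF C1_on_cont_pd[OF fC]] cont_sub[OF C1_on_cont_pd[OF gC]]) auto
 then have "bounded ((%x. pd f (t x) x) ` K)" using K(1) compact_continuous_image compact_imp_bounded by blast
 then obtain B where B: "!!x. x : K ==> cmod (pd f (t x) x) <= B" by (auto simp: bounded_iff)
 have B': "cmod (pd f (t x) x) <= max B 0" for x
  using B[of x] K(3)[of x "t x"] by (cases "x : K") (auto simp: le_max_iff_disj)
 have d: "((%s. f (Fl s x)) has_vector_derivative pd f (t (Fl s x)) (Fl s x)) (at s)" for s x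
 proof -
  have "((%r. f (Fl r (Fl s x))) has_vector_derivative pd f (t (Fl s x)) (Fl s x)) (at 0)"
   using C1c_curve[OF fC flow_curve] by simp
  then show ?thesis unfolding has_vector_derivative_iff_quotient by (simp add: flow_add add.commute)
 qed
 have "cmod (f (Fl h x) - f (Fl 0 x)) <= max B 0 * norm (h - 0)" for h x
  by (rule differentiable_bound[of UNIV _ "%s r. r *R pd f (t (Fl s x)) (Fl s x)"])
    (use d B' in \<open>auto simp: has_vector_derivative_def mult.commute mult_left_mono intro!: onorm_bound\<close>)
 then show ?thesis by (intro that[of "max B 0"]) auto
qed

lemma flow_diff_tendsto:
 assumes f: "C1c D f"
 shows "(%n. of_nat (Suc n) * (f (Fl (h / real (Suc n)) x) - f x)) \<longlonglongrightarrow> of_real h * pd f (t x) x"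
 using diff_quot_tendsto[OF C1c_curve[OF C1c_C1[OF f] flow_curve]] by simp

lemma flow_diff_supp:
 assumes f: "C1c D f"
 obtains S where "compact S" "!!x h. x ~: S ==> \<bar>h\<bar> <= a ==> f (Fl h x) = 0"
proof -
 obtain K where K: "compact K" "!!x. x ~: K ==> f x = 0" using C1c_E[OF f] by metis
 show ?thesis
 proof (rule that)
  show "compact (\<Union>s\<in>{-a..a}. Fl s ` K)" by (rule bounded_image_of_compact_param[OF K(1) flow_cont])
  fix x h assume x: "x ~: (\<Union>s\<in>{-a..a}. Fl s ` K)" and h: "\<bar>h\<bar> <= a"
  show "f (Fl h x) = 0"
  proof (rule K(2), rule)
   assume "Fl h x : K"
   then have "Fl (-h) (Fl h x) : (\<Union>s\<in>{-a..a}. Fl s ` K)" using h by (intro UN_I[of "-h"]) auto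
   then show False using x by (simp add: flow_add)
  qed
 qed
qed

text \<open>The flow is an isometry of L^2, so the norm w(h) of the difference of f along the flow
  is subadditive in h and w(h) <= (n + 1) w(h / (n + 1)). Letting n grow turns the right side into
  |h| times the norm of the derivative along the flow.\<close>

lemma nrm_flow_diff_C1c:
 assumes f: "C1c D f"
 shows "nrm (%x. f (Fl h x) - f x) <= \<bar>h\<bar> * nrm (%x. pd f (t x) x)"
  and "sqi (%x. pd f (t x) x)"
proof -
 have sf: "sqi f" by (rule C1c_int[OF f])
 let ?w = "%h. nrm (%x. f (Fl h x) - f x)"
 have sd: "sqi (%x. f (Fl h x) - f x)" for h by (intro sqi_diff sqi_flow sf)
 have sub: "?w (h + k) <= ?w h + ?w k" for h k
 proof -
  have "?w (h + k) <= nrm (%x. f (Fl (h + k) x) - f (Fl k x)) + ?w k"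
   by (intro nrm_triangle4 sqi_flow sf)
  also have "nrm (%x. f (Fl (h + k) x) - f (Fl k x)) = ?w h"
   using nrm_flow[OF sd[of h], of k] by (simp add: flow_add)
  finally show ?thesis .
 qed
 have mul: "?w (real n * h) <= real n * ?w h" for n h
 proof (induction n)
  case (Suc n)
  have "?w (real (Suc n) * h) = ?w (h + real n * h)" by (simp add: distrib_right)
  then show ?case using sub[of h "real n * h"] Suc by (simp add: distrib_right)
 qed simp
 define F where "F = (%n x. of_nat (Suc n) * (f (Fl (h / real (Suc n)) x) - f x))"
 have le: "?w h <= nrm (F n)" for n
  using mul[of "Suc n" "h / real (Suc n)"] unfolding F_def nrm_cmult by (simp del: of_nat_Suc)
 obtain B where B: "B >= 0" "!!h x. cmod (f (Fl h x) - f x) <= B * \<bar>h\<bar>" using flow_diff_pointwise[OF f] by metis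
 obtain S where S: "compact S" "!!x k. x ~: S ==> \<bar>k\<bar> <= \<bar>h\<bar> ==> f (Fl k x) = 0"
  using flow_diff_supp[OF f, of "\<bar>h\<bar>"] by metis
 have [measurable]: "f : mbl" "pd ga ta : mbl"
   "pd f ta : mbl" "pd f e : mbl"
  using f gC by (auto intro: C1c_mbl C1c_pd_mbl mbl_cont C1_on_cont_pd)
 have Fb: "cmod (F n x) <= indicator S x * (B * \<bar>h\<bar>)" for n x
 proof (cases "x : S")
  case True
  have "cmod (F n x) <= real (Suc n) * (B * \<bar>h / real (Suc n)\<bar>)"
   unfolding F_def norm_mult norm_of_nat by (intro mult_left_mono B) auto
  then show ?thesis using True by (simp del: of_nat_Suc)
 next
  case False
  have "\<bar>h / real (Suc n)\<bar> <= \<bar>h\<bar>" by (simp add: field_simps)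
  then show ?thesis using S(2)[OF False, of "h / real (Suc n)"] S(2)[OF False, of 0] False by (simp add: F_def)
 qed
 have lin: "pd f (t x) x = pd f ta x + pd ga ta x *R pd f e x" for x
  using pd_linear[OF C1c_C1[OF f] UNIV_I] by (simp add: t_def linear_add linear_cmul)
 have gm [measurable]: "(%x. pd f (t x) x) : lmbl" unfolding lin by measurable
 have lim: "(%n. LBINT x. (cmod (F n x))^2) \<longlonglongrightarrow> (LBINT x. (cmod (of_real h * pd f (t x) x))^2)"
 proof (rule integral_dominated_convergence[where w = "%x. indicator S x *R (B * \<bar>h\<bar>)^2"])
  show "intgl (%x. indicator S x *R (B * \<bar>h\<bar>)^2)" by (rule borel_integrable_compact[OF S(1)]) auto
  show "AEL x. (%n. (cmod (F n x))^2) \<longlonglongrightarrow> (cmod (of_real h * pd f (t x) x))^2"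
   unfolding F_def by (intro AE_I2 tendsto_intros flow_diff_tendsto[OF f])
  show "AEL x. norm ((cmod (F n x))^2) <= indicator S x *R (B * \<bar>h\<bar>)^2" for n
  proof (rule AE_I2)
   fix x have "(cmod (F n x))^2 <= (indicator S x * (B * \<bar>h\<bar>))^2" by (rule power_mono[OF Fb]) simp
   then show "norm ((cmod (F n x))^2) <= indicator S x *R (B * \<bar>h\<bar>)^2" by (auto simp: indicator_def)
  qed
  show "(%x. (cmod (F n x))^2) : lmbl" for n unfolding F_def by measurable
 qed measurable
 have "(%n. nrm (F n)) \<longlonglongrightarrow> nrm (%x. of_real h * pd f (t x) x)"
  unfolding nrmM_def using lim by (rule tendsto_real_sqrt)
 then have "?w h <= nrm (%x. of_real h * pd f (t x) x)"
  by (rule LIMSEQ_le_const) (use le in auto)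
 then show "?w h <= \<bar>h\<bar> * nrm (%x. pd f (t x) x)" by (simp add: nrm_cmult)
 obtain K where K: "compact K" "!!x v. x ~: K ==> pd f v x = 0" using C1c_E[OF f] by metis
 have "intgl (%x. (cmod (pd f (t x) x))^2)"
  by (rule intgl_of_cont_supp[OF _ compact_imp_bounded[OF K(1)]])
    (auto simp: K lin intro!: continuous_intros C1_on_cont_pd C1c_C1[OF f] gC)
 then show "sqi (%x. pd f (t x) x)" using gm by (simp add: sqiM_def)
qed

end

section \<open>The space H^1_0, weak Laplacians and the Poincare inequality\<close>

text \<open>H^1_0(D) as the closure of the C^1 functions with compact support in D, both u and its
  gradient being extended by 0. The gradient is a component of the relation, so none has to be
  chosen and limits can be stated for \<open>G\<close> directly.\<close>

definition W :: "'a::euclidean_space set => ('a => complex) => ('a => 'a => complex) => bool" where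
 "W D u G \<longleftrightarrow> sqi u & (ALL i:Basis. sqi (G i)) \<and>
   (ALL x. x ~: D --> u x = 0 & (ALL i:Basis. G i x = 0)) \<and>
   (EX psi. (ALL n. C1c D (psi n)) & (%n. nrm (%x. psi n x - u x)) \<longlonglongrightarrow> 0 \<and>
    (ALL i:Basis. (%n. nrm (%x. pd (psi n) i x - G i x)) \<longlonglongrightarrow> 0))"

definition dirG :: "('a::euclidean_space => 'a => complex) => 'a => 'a => complex" where
 "dirG G v x = (SB i. of_real (v *. i) * G i x)"

text \<open>For \<open>G\<close> the gradient of u this is the weak equation Delta u = f. The
  function u does not occur, so products and quotients can be treated through their
  gradients.\<close>

definition wlap :: "'a::euclidean_space set => ('a => 'a => complex) => ('a => complex) => bool" where
 "wlap D G f \<longleftrightarrow> (ALL ph. C1c D ph --> (SB i. LBINT x. G i x * pd ph i x) = - (LBINT x. f x * ph x))"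

lemma dirG_Basis: "i : Basis ==> dirG G i x = G i x"
proof -
 assume i: "i : Basis"
 have "dirG G i x = (SB j. if j = i then G i x else 0)"
  unfolding dirG_def by (rule sum.cong) (auto simp: inner_Basis i)
 then show ?thesis using i by simp
qed

lemma dirG_scale: "dirG G (c *R v) x = of_real c * dirG G v x"
 by (simp add: dirG_def sum_distrib_left mult.assoc)

lemma dirG_diff: "dirG G (v - w) x = dirG G v x - dirG G w x"
 by (simp add: dirG_def inner_diff_left left_diff_distrib sum_subtractf)

lemma pd_eq_dirG:
 assumes "C1u f" shows "pd f v x = dirG (pd f) v x"
 using pd_Basis_sum[OF assms UNIV_I, of x v] by (simp add: dirG_def scaleR_conv_of_real)

lemma WD:
 assumes "W D u G"
 shows "sqi u" "i : Basis ==> sqi (G i)" "x ~: D ==> u x = 0" "x ~: D ==> i : Basis ==> G i x = 0"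
 using assms by (auto simp: W_def)

lemma W_sqi_dirG: "W D u G ==> sqi (dirG G v)"
 unfolding dirG_def[abs_def] by (intro sqi_sum sqi_cmult WD)

lemma W_dirG_off: "W D u G ==> x ~: D ==> dirG G v x = 0"
 by (simp add: dirG_def WD)

lemma W_E:
 assumes "W D u G"
 obtains psi where "!!n. C1c D (psi n)" "null (%n. nrm (%x. psi n x - u x))"
  "!!v. (%n. nrm (%x. pd (psi n) v x - dirG G v x)) \<longlonglongrightarrow> 0"
proof -
 obtain psi where ps: "(ALL n. C1c D (psi n)) & (%n. nrm (%x. psi n x - u x)) \<longlonglongrightarrow> 0 \<and>
    (ALL i:Basis. (%n. nrm (%x. pd (psi n) i x - G i x)) \<longlonglongrightarrow> 0)"
  using assms unfolding W_def by blast
 have psi: "!!n. C1c D (psi n)" "null (%n. nrm (%x. psi n x - u x))"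
  "!!i. i : Basis ==> (%n. nrm (%x. pd (psi n) i x - G i x)) \<longlonglongrightarrow> 0"
  using ps by blast+
 have "null (%n. nrm (%x. pd (psi n) v x - dirG G v x))" for v
 proof (rule tendsto_sandwich[OF _ _ tendsto_const])
  show "EV n. nrm (%x. pd (psi n) v x - dirG G v x) <=
    (SB i. \<bar>v *. i\<bar> * nrm (%x. pd (psi n) i x - G i x))"
  proof (rule always_eventually, rule allI)
   fix n
   have eq: "(%x. pd (psi n) v x - dirG G v x) = (%x. SB i. of_real (v *. i) * (pd (psi n) i x - G i x))"
    by (simp add: pd_eq_dirG[OF C1c_C1[OF psi(1)], where v = v] dirG_def sum_subtractf right_diff_distrib)
   have "nrm (%x. pd (psi n) v x - dirG G v x) <= (SB i. nrm (%x. of_real (v *. i) * (pd (psi n) i x - G i x)))"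
    unfolding eq by (intro nrm_sum_le sqi_cmult sqi_diff C1c_int(4)[OF psi(1)] WD[OF assms])
   then show "nrm (%x. pd (psi n) v x - dirG G v x) <=
    (SB i. \<bar>v *. i\<bar> * nrm (%x. pd (psi n) i x - G i x))" by (simp add: nrm_cmult)
  qed
  show "null (%n. SB i. \<bar>v *. i\<bar> * nrm (%x. pd (psi n) i x - G i x))"
   by (rule tendsto_null_sum) (use psi(3) tendsto_mult_right_zero in blast)
 qed auto
 then show ?thesis using that psi by blast
qed

lemma WI:
 assumes "sqi u" "!!i. i : Basis ==> sqi (G i)" "!!x. x ~: D ==> u x = 0"
  "!!i x. i : Basis ==> x ~: D ==> G i x = 0" "!!n. C1c D (psi n)"
  "null (%n. nrm (%x. psi n x - u x))"
  "!!i. i : Basis ==> (%n. nrm (%x. pd (psi n) i x - G i x)) \<longlonglongrightarrow> 0"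
 shows "W D u G"
 using assms unfolding W_def by blast

lemma W_C1c:
 assumes "C1c D f" shows "W D f (pd f)"
 by (rule WI[where psi = "%n. f"])
   (simp_all add: assms C1c_int[OF assms] C1c_off[OF assms] C1c_pd_off[OF assms])

lemma W_lincomb:
 assumes "W D u G" "W D v H"
 shows "W D (%x. u x + c * v x) (%i x. G i x + c * H i x)"
proof -
 obtain psi where psi: "!!n. C1c D (psi n)" "null (%n. nrm (%x. psi n x - u x))"
  "!!v. (%n. nrm (%x. pd (psi n) v x - dirG G v x)) \<longlonglongrightarrow> 0" by (rule W_E[OF assms(1)]) (rule that; assumption)
 obtain ph where ph: "!!n. C1c D (ph n)" "null (%n. nrm (%x. ph n x - v x))"
  "!!v. (%n. nrm (%x. pd (ph n) v x - dirG H v x)) \<longlonglongrightarrow> 0" by (rule W_E[OF assms(2)]) (rule that; assumption)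
 have lim: "null (%n. nrm (%x. a n x + c * b n x - (a' x + c * b' x)))"
  if "!!n. sqi (a n)" "!!n. sqi (b n)" "sqi a'" "sqi b'"
   "null (%n. nrm (%x. a n x - a' x))" "null (%n. nrm (%x. b n x - b' x))" for a b a' b'
 proof (rule tendsto_sandwich[OF _ _ tendsto_const])
  show "EV n. nrm (%x. a n x + c * b n x - (a' x + c * b' x)) <=
   nrm (%x. a n x - a' x) + cmod c * nrm (%x. b n x - b' x)"
  proof (rule always_eventually, rule allI)
   fix n
   have "(%x. a n x + c * b n x - (a' x + c * b' x)) = (%x. (a n x - a' x) + c * (b n x - b' x))"
    by (simp add: algebra_simps)
   then show "nrm (%x. a n x + c * b n x - (a' x + c * b' x)) <=
   nrm (%x. a n x - a' x) + cmod c * nrm (%x. b n x - b' x)"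
    using nrm_triangle[of lborel "%x. a n x - a' x" "%x. c * (b n x - b' x)"] that
    by (simp add: sqi_diff sqi_cmult nrm_cmult)
  qed
  show "null (%n. nrm (%x. a n x - a' x) + cmod c * nrm (%x. b n x - b' x))"
   using tendsto_add[OF that(5) tendsto_mult_right_zero[OF that(6)]] by simp
 qed auto
 have pdl: "pd (%x. psi n x + c * ph n x) i x = pd (psi n) i x + c * pd (ph n) i x" for n i x
  using C1_on_add(2)[OF C1c_C1[OF psi(1)] C1c_C1[OF C1c_cmult[OF ph(1)]], of x n c n i]
   C1_cmult_pd[OF C1c_C1[OF ph(1)[of n]], of c x i] by simp
 show ?thesis
 proof (rule WI[where psi = "%n x. psi n x + c * ph n x"])
  show "C1c D (%x. psi n x + c * ph n x)" for n by (intro C1c_add C1c_cmult psi ph)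
  show "null (%n. nrm (%x. psi n x + c * ph n x - (u x + c * v x)))"
   by (rule lim) (simp_all add: C1c_int[OF psi(1)] C1c_int[OF ph(1)] WD(1)[OF assms(1)] WD(1)[OF assms(2)] psi(2) ph(2))
  fix i :: 'a assume i: "i : Basis"
  show "null (%n. nrm (%x. pd (%x. psi n x + c * ph n x) i x - (G i x + c * H i x)))"
   unfolding pdl by (rule lim) (use ph(3)[of i] psi(3)[of i] in \<open>simp_all add: i C1c_int[OF psi(1)] C1c_int[OF ph(1)] WD(2)[OF assms(1)] WD(2)[OF assms(2)] dirG_Basis\<close>)
 qed (simp_all add: sqi_add sqi_cmult WD[OF assms(1)] WD[OF assms(2)])
qed

lemma W_diff: "W D u G ==> W D v H ==> W D (%x. u x - v x) (%i x. G i x - H i x)"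
 using W_lincomb[of D u G v H "-1"] by simp

lemma W_cnj:
 assumes "W D u G" shows "W D (%x. cnj (u x)) (%i x. cnj (G i x))"
proof -
 obtain psi where psi: "!!n. C1c D (psi n)" "null (%n. nrm (%x. psi n x - u x))"
  "!!v. (%n. nrm (%x. pd (psi n) v x - dirG G v x)) \<longlonglongrightarrow> 0" by (rule W_E[OF assms(1)]) (rule that; assumption)
 have c: "nrm (%x. cnj (a x) - cnj (b x)) = nrm (%x. a x - b x)" for a b
  using nrm_cnj[of lborel "%x. a x - b x"] by simp
 show ?thesis
  by (rule WI[where psi = "%n x. cnj (psi n x)"])
    (use psi(3) in \<open>simp_all add: WD[OF assms] W_sqi_dirG[OF assms] W_dirG_off[OF assms] psi(2) C1c_cnj[OF psi(1)] sqi_cnj C1_cnj_pd[OF C1c_C1[OF psi(1)]] c flip: dirG_Basis[of _ G]\<close>)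
qed

lemma measurable_cont_mult:
 fixes th h :: "'a::euclidean_space => complex"
 assumes "open D" "continuous_on D th" "h : mbl" "!!x. x ~: D ==> h x = 0"
 shows "(%x. th x * h x) : mbl"
proof -
 have [measurable]: "(%x. indicator D x *R th x) : mbl"
  by (rule borel_measurable_continuous_on_indicator) (use assms in auto)
 note [measurable] = assms(3)
 have eq: "(%x. th x * h x) = (%x. (indicator D x *R th x) * h x)"
  using assms(4) by (auto simp: indicator_def fun_eq_iff)
 show ?thesis by (subst eq) measurable
qed

lemma sqi_cont_mult:
 fixes th h :: "'a::euclidean_space => complex"
 assumes "open D" "continuous_on D th" "sqi h" "!!x. x ~: D ==> h x = 0"
  "!!x. x : D ==> cmod (th x) <= B" "0 <= B"
 shows "sqi (%x. th x * h x)" "nrm (%x. th x * h x) <= B * nrm h"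
proof -
 have m: "(%x. th x * h x) : lmbl"
  using measurable_cont_mult[OF assms(1,2) _ assms(4)] sqi_meas[OF assms(3)] by simp
 have "cmod (th x * h x) <= B * cmod (h x)" for x
  using assms(4,5)[of x] by (cases "x : D") (auto simp: norm_mult mult_right_mono)
 then show "sqi (%x. th x * h x)" "nrm (%x. th x * h x) <= B * nrm h"
  using sqi_bound[OF assms(3) m _ assms(6)] by auto
qed

text \<open>The support of \<open>th\<close> may cut down the domain: \<open>C\<close> is closed and \<open>th\<close> vanishes off \<open>C\<close>.\<close>
lemma W_mult:
 assumes D: "open D" and th: "C1_on D th" and u: "W D u G"
  and B: "!!x. x : D ==> cmod (th x) <= B" "!!x i. x : D ==> i : Basis ==> cmod (pd th i x) <= B" "0 <= B"
  and C: "closed C" "C \<inter> D <= E" "!!x. x : D ==> x ~: C ==> th x = 0" and E: "E <= D"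
 shows "W E (%x. th x * u x) (%i x. th x * G i x + pd th i x * u x)"
proof -
 obtain psi where psi: "!!n. C1c D (psi n)" "null (%n. nrm (%x. psi n x - u x))"
  "!!v. (%n. nrm (%x. pd (psi n) v x - dirG G v x)) \<longlonglongrightarrow> 0" by (rule W_E[OF u]) (rule that; assumption)
 have c: "continuous_on D th" "continuous_on D (pd th i)" for i
  using th C1_on_cont C1_on_cont_pd by blast+
 have pz: "pd th i x = 0" if "x : D" "x ~: C" for i x
  using pd_eq_of_open[of "D - C" x th "%x. 0" i] that C(1,3) D by (auto simp: open_Diff)
 have dsq: "sqi (%x. psi n x - u x)" "!!i. i : Basis ==> sqi (%x. pd (psi n) i x - G i x)" for n
  by (intro sqi_diff C1c_int[OF psi(1)] WD[OF u]; assumption)+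
 have off: "x ~: D ==> psi n x - u x = 0" "x ~: D ==> i : Basis ==> pd (psi n) i x - G i x = 0" for n x i
  using C1c_off[OF psi(1)] C1c_pd_off[OF psi(1)] WD[OF u] by auto
 have pdm: "pd (%x. th x * psi n x) i x = th x * pd (psi n) i x + pd th i x * psi n x" for n i x
  using C1c_mult[OF D th psi(1)] C1c_pd_off[OF C1c_mult(1)[OF D th psi(1)]] C1c_off[OF psi(1)] C1c_pd_off[OF psi(1)]
  by (cases "x : D") auto
 show ?thesis
 proof (rule WI[where psi = "%n x. th x * psi n x"])
  show "sqi (%x. th x * u x)" by (rule sqi_cont_mult[OF D c(1)]) (use B WD[OF u] in auto)
  show "sqi (%x. th x * G i x + pd th i x * u x)" if "i : Basis" for i
   by (intro sqi_add sqi_cont_mult(1)[OF D c(1) _ _ B(1,3)] sqi_cont_mult(1)[OF D c(2) _ _ B(2,3)])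
     (use that B WD[OF u] in auto)
  show "th x * u x = 0" if "x ~: E" for x
   using that WD(3)[OF u] C by (cases "x : D") auto
  show "th x * G i x + pd th i x * u x = 0" if "x ~: E" "i : Basis" for i x
  proof (cases "x : D")
   case True
   then have "x ~: C" using that C(2) by blast
   then show ?thesis using C(3)[OF True] pz[OF True] by simp
  next
   case False then show ?thesis using WD(3,4)[OF u] that by simp
  qed
  show "C1c E (%x. th x * psi n x)" for n
  proof -
   obtain K where K: "compact K" "K <= D" "!!x. x ~: K ==> psi n x = 0" using C1c_E[OF psi(1)] by metis
   have "compact (K \<inter> C)" using K(1) C(1) by (rule compact_Int_closed)
   moreover have "K \<inter> C <= E" using K(2) C(2) by auto
   moreover have "th x * psi n x = 0" if "x ~: K \<inter> C" for x
    using that K(2,3) C(3) by (metis IntI mult_eq_0_iff subsetD)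
   ultimately show ?thesis using C1c_C1[OF C1c_mult(1)[OF D th psi(1)]] unfolding C1c_def by blast
  qed
  show "null (%n. nrm (%x. th x * psi n x - th x * u x))"
  proof (rule tendsto_sandwich[OF _ _ tendsto_const tendsto_mult_right_zero[OF psi(2), of B]])
   show "EV n. nrm (%x. th x * psi n x - th x * u x) <= B * nrm (%x. psi n x - u x)"
    unfolding right_diff_distrib[symmetric]
    by (intro always_eventually allI sqi_cont_mult(2)[OF D c(1) dsq(1) off(1) B(1,3)])
  qed auto
  fix i :: 'a assume i: "i : Basis"
  show "null (%n. nrm (%x. pd (%x. th x * psi n x) i x - (th x * G i x + pd th i x * u x)))"
  proof (rule tendsto_sandwich[OF _ _ tendsto_const])
   show "EV n. nrm (%x. pd (%x. th x * psi n x) i x - (th x * G i x + pd th i x * u x))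
     <= B * nrm (%x. pd (psi n) i x - G i x) + B * nrm (%x. psi n x - u x)"
   proof (intro always_eventually allI)
    fix n
    have "nrm (%x. pd (%x. th x * psi n x) i x - (th x * G i x + pd th i x * u x))
     = nrm (%x. th x * (pd (psi n) i x - G i x) + pd th i x * (psi n x - u x))"
     unfolding pdm by (simp add: algebra_simps)
    also have "... <= nrm (%x. th x * (pd (psi n) i x - G i x)) + nrm (%x. pd th i x * (psi n x - u x))"
     by (intro nrm_triangle sqi_cont_mult(1)[OF D c(1) dsq(2)[OF i] off(2)[OF _ i] B(1,3)]
        sqi_cont_mult(1)[OF D c(2) dsq(1) off(1) B(2)[OF _ i] B(3)])
    also have "... <= B * nrm (%x. pd (psi n) i x - G i x) + B * nrm (%x. psi n x - u x)"
     by (intro add_mono sqi_cont_mult(2)[OF D c(1) dsq(2)[OF i] off(2)[OF _ i] B(1,3)]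
        sqi_cont_mult(2)[OF D c(2) dsq(1) off(1) B(2)[OF _ i] B(3)])
    finally show "nrm (%x. pd (%x. th x * psi n x) i x - (th x * G i x + pd th i x * u x))
     <= B * nrm (%x. pd (psi n) i x - G i x) + B * nrm (%x. psi n x - u x)" .
   qed
   have "null (%n. nrm (%x. pd (psi n) i x - G i x))" using psi(3)[of i] i by (simp add: dirG_Basis)
   from tendsto_add[OF tendsto_mult_right_zero[OF this, of B] tendsto_mult_right_zero[OF psi(2), of B]]
   show "null (%n. B * nrm (%x. pd (psi n) i x - G i x) + B * nrm (%x. psi n x - u x))" by simp
  qed auto
 qed
qed

lemma W_weak_derivative:
 assumes D: "open D" and u: "W D u G" and ph: "C1c D ph"
 shows "(LBINT x. u x * pd ph v x) = - (LBINT x. dirG G v x * ph x)"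
proof -
 obtain psi where psi: "!!n. C1c D (psi n)" "null (%n. nrm (%x. psi n x - u x))"
  "!!v. (%n. nrm (%x. pd (psi n) v x - dirG G v x)) \<longlonglongrightarrow> 0" by (rule W_E[OF u]) (rule that; assumption)
 have e: "(LBINT x. psi n x * pd ph v x) = - (LBINT x. pd (psi n) v x * ph x)" for n
  using integral_by_parts[OF open_UNIV C1c_C1[OF psi(1)] C1c_mono[OF ph subset_UNIV], of n v] by simp
 have 1: "(%n. LBINT x. psi n x * pd ph v x) \<longlonglongrightarrow> (LBINT x. u x * pd ph v x)"
  by (rule tendsto_nrm_mult) (simp_all add: C1c_int[OF psi(1)] WD(1)[OF u] C1c_int[OF ph] psi(2))
 have 2: "(%n. LBINT x. pd (psi n) v x * ph x) \<longlonglongrightarrow> (LBINT x. dirG G v x * ph x)"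
  by (rule tendsto_nrm_mult) (simp_all add: C1c_int[OF psi(1)] W_sqi_dirG[OF u] C1c_int[OF ph] psi(3))
 show ?thesis using LIMSEQ_unique[OF 1[unfolded e] tendsto_minus[OF 2]] .
qed

text \<open>Density of the C^1 test functions extends the weak equation to test functions in H^1_0.
  This admits the solution itself, and its differences along a flow, as test functions.\<close>

lemma wlap_W:
 assumes G: "!!i. i : Basis ==> sqi (G i)" and f: "sqi f" and wl: "wlap D G f" and v: "W D v H"
 shows "(SB i. LBINT x. G i x * H i x) = - (LBINT x. f x * v x)"
proof -
 obtain psi where psi: "!!n. C1c D (psi n)" "null (%n. nrm (%x. psi n x - v x))"
  "!!i. (%n. nrm (%x. pd (psi n) i x - dirG H i x)) \<longlonglongrightarrow> 0" by (rule W_E[OF v]) (rule that; assumption)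
 have e: "(SB i. LBINT x. G i x * pd (psi n) i x) = - (LBINT x. f x * psi n x)" for n
  using wl psi(1) by (simp add: wlap_def)
 have 1: "(%n. SB i. LBINT x. G i x * pd (psi n) i x) \<longlonglongrightarrow> (SB i. LBINT x. G i x * H i x)"
 proof (rule tendsto_sum)
  fix i :: 'a assume i: "i : Basis"
  show "(%n. LBINT x. G i x * pd (psi n) i x) \<longlonglongrightarrow> (LBINT x. G i x * H i x)"
   by (rule tendsto_nrm_mult)
     (use psi(3)[of i] in \<open>simp_all add: i G C1c_int[OF psi(1)] WD(2)[OF v] dirG_Basis\<close>)
 qed
 have 2: "(%n. LBINT x. f x * psi n x) \<longlonglongrightarrow> (LBINT x. f x * v x)"
  by (rule tendsto_nrm_mult) (simp_all add: f C1c_int[OF psi(1)] WD(1)[OF v] psi(2))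
 show ?thesis using LIMSEQ_unique[OF 1[unfolded e] tendsto_minus[OF 2]] by simp
qed

text \<open>A shift by 2 R along a coordinate direction moves \<open>D\<close> off itself, so f and
  its shift are never both nonzero and the norm of their difference is at least that of f. The same
  difference is at most 2 R times the norm of the derivative.\<close>

lemma Poincare_C1c:
 assumes D: "bounded (D :: 'a::euclidean_space set)"
 obtains C where "C > 0" "!!f i. C1c D f ==> i : Basis ==> nrm f <= C * nrm (pd f i)"
proof -
 obtain R where R: "R > 0" "!!x. x : D ==> norm x < R" using D by (meson bounded_normE_less)
 show ?thesis
 proof (rule that[of "2 * R"])
  fix f and i :: 'a assume f: "C1c D f" and i: "i : Basis"
  interpret shear_flow "%x. 0" 0 i by standard auto
  have F: "Fl h x = x + h *R i" for h x by (simp add: Fl_def)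
  have sf: "sqi f" by (rule C1c_int[OF f])
  have disj: "f (Fl (2 * R) x) = 0 \<or> f x = 0" for x
  proof (rule ccontr)
   assume a: "\<not> ?thesis"
   then have "x : D" "Fl (2 * R) x : D" using C1c_off[OF f] by blast+
   then have "norm x < R" "norm (x + (2 * R) *R i) < R" using R F by auto
   then have "norm ((2 * R) *R i) < 2 * R" using norm_triangle_ineq4[of "x + (2 * R) *R i" x] by simp
   then show False using i R by simp
  qed
  have "(cmod (f (Fl (2 * R) x) - f x))^2 = (cmod (f (Fl (2 * R) x)))^2 + (cmod (f x))^2" for x
   using disj[of x] by auto
  then have "(nrm (%x. f (Fl (2 * R) x) - f x))^2 = (nrm (%x. f (Fl (2 * R) x)))^2 + (nrm f)^2"
   unfolding nrm_sq using sqi_integrable[OF sf] sqi_integrable[OF sqi_flow[OF sf]] by simp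
  then have "(nrm f)^2 <= (nrm (%x. f (Fl (2 * R) x) - f x))^2" by simp
  then have "nrm f <= nrm (%x. f (Fl (2 * R) x) - f x)" by (rule power2_le_imp_le) simp
  also have "... <= \<bar>2 * R\<bar> * nrm (%x. pd f (t x) x)" by (rule nrm_flow_diff_C1c[OF f])
  finally show "nrm f <= 2 * R * nrm (pd f i)" using R by (simp add: t_def)
 qed (use R in auto)
qed

lemma W_Poincare:
 assumes D: "bounded (D :: 'a::euclidean_space set)"
 obtains C where "C > 0" "!!u G i. W D u G ==> i : Basis ==> nrm u <= C * nrm (G i)"
proof -
 obtain C where C: "C > 0" "!!f i. C1c D f ==> i : Basis ==> nrm f <= C * nrm (pd f i)"
  using Poincare_C1c[OF D] by metis
 have "nrm u <= C * nrm (G i)" if u: "W D u G" and i: "i : Basis" for u G i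
 proof -
  obtain psi where psi: "!!n. C1c D (psi n)" "null (%n. nrm (%x. psi n x - u x))"
   "!!v. (%n. nrm (%x. pd (psi n) v x - dirG G v x)) \<longlonglongrightarrow> 0" by (rule W_E[OF u]) (rule that; assumption)
  have 1: "(%n. nrm (psi n)) \<longlonglongrightarrow> nrm u"
   by (rule tendsto_nrm) (simp_all add: C1c_int[OF psi(1)] WD(1)[OF u] psi(2))
  have 2: "(%n. nrm (pd (psi n) i)) \<longlonglongrightarrow> nrm (G i)"
   by (rule tendsto_nrm) (use psi(3)[of i] in \<open>simp_all add: i C1c_int[OF psi(1)] WD(2)[OF u] dirG_Basis\<close>)
  show ?thesis using LIMSEQ_le[OF 1 tendsto_mult_left[OF 2, of C]] C(2)[OF psi(1) i] by blast
 qed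
 then show ?thesis using that C by blast
qed

text \<open>The Poincare inequality makes the functions Cauchy along with their gradients; all
  limits exist by \<open>sqi_complete\<close>, since everything vanishes off the set
  \<open>D\<close> of finite measure.\<close>

lemma W_complete:
 assumes D: "bounded D" "open D" and psi: "!!n. C1c D (psi n)"
  and C: "!!i e. i : Basis ==> e > 0 ==> EX N. ALL n>=N. ALL m>=N. nrm (%x. pd (psi n) i x - pd (psi m) i x) < e"
 obtains u G where "W D u G" "null (%n. nrm (%x. psi n x - u x))"
  "!!i. i : Basis ==> (%n. nrm (%x. pd (psi n) i x - G i x)) \<longlonglongrightarrow> 0"
proof -
 have Ds: "D : sets lborel" "emeasure lborel D < \<infinity>"
  using emeasure_bounded_finite[OF D(1)] D(2) by auto
 obtain P where P: "P > 0" "!!f i. C1c D f ==> i : Basis ==> nrm f <= P * nrm (pd f i)"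
  using Poincare_C1c[OF D(1)] by metis
 obtain j :: 'a where j: "j : Basis" using nonempty_Basis by blast
 have pdd: "pd (%x. psi n x - psi m x) i x = pd (psi n) i x - pd (psi m) i x" for n m i x
  by (rule C1_on_diff(2)) (auto intro: C1c_C1 psi)
 obtain u where u: "sqi u" "null (%n. nrm (%x. psi n x - u x))" "!!x. x ~: D ==> u x = 0"
 proof (rule sqi_complete[OF _ Ds, of psi])
  fix e :: real assume "e > 0"
  then obtain N where N: "ALL n>=N. ALL m>=N. nrm (%x. pd (psi n) j x - pd (psi m) j x) < e / P"
   using C[OF j, of "e / P"] P by auto
  show "EX N. ALL i>=N. ALL j>=N. nrm (%x. psi i x - psi j x) < e"
  proof (intro exI[of _ N] allI impI)
   fix n m assume nm: "N <= n" "N <= m"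
   have "nrm (%x. psi n x - psi m x) <= P * nrm (%x. pd (psi n) j x - pd (psi m) j x)"
    using P(2)[OF C1c_diff[OF psi psi] j, of n m] by (simp add: pdd)
   also have "... < P * (e / P)" using N nm P by (intro mult_strict_left_mono) auto
   finally show "nrm (%x. psi n x - psi m x) < e" using P by simp
  qed
 qed (simp_all add: C1c_int[OF psi] C1c_off[OF psi])
 have "EX g. i : Basis --> sqi g & (%n. nrm (%x. pd (psi n) i x - g x)) \<longlonglongrightarrow> 0 & (ALL x. x ~: D --> g x = 0)" for i
 proof (cases "i : Basis")
  case True
  obtain g where "sqi g" "null (%n. nrm (%x. pd (psi n) i x - g x))" "!!x. x ~: D ==> g x = 0"
   by (rule sqi_complete[OF _ Ds, of "%n. pd (psi n) i"])
     (simp_all add: C[OF True] C1c_int[OF psi] C1c_pd_off[OF psi])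
  then show ?thesis by blast
 qed auto
 then have "EX G. ALL i. i : Basis --> sqi (G i) & (%n. nrm (%x. pd (psi n) i x - G i x)) \<longlonglongrightarrow> 0 & (ALL x. x ~: D --> G i x = 0)"
  by (intro choice allI)
 then obtain G where ps: "ALL i. i : Basis --> sqi (G i) & (%n. nrm (%x. pd (psi n) i x - G i x)) \<longlonglongrightarrow> 0 & (ALL x. x ~: D --> G i x = 0)"
  by blast
 have G: "!!i. i : Basis ==> sqi (G i)"
  "!!i. i : Basis ==> (%n. nrm (%x. pd (psi n) i x - G i x)) \<longlonglongrightarrow> 0" "!!i x. i : Basis ==> x ~: D ==> G i x = 0"
  using ps by blast+
 have "W D u G" by (rule WI[where psi = psi]) (simp_all add: u G psi)
 then show ?thesis using that u G by blast
qed

section \<open>Flows acting on H^1_0\<close>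

context shear_flow begin

text \<open>The chain rule gives the gradient of the composition, with \<open>KFl\<close> as its
  only new coefficient. The support of the composition is the image of the old one under
  \<open>Fl (-h)\<close>, which the hypothesis on \<open>E\<close> keeps inside
  \<open>D\<close>.\<close>

lemma W_flow:
 assumes z: "W E z G" and E: "!!x. x : E ==> Fl (-h) x : D"
  and M: "!!x i. x : D ==> i : Basis ==> \<bar>KFl h i x\<bar> <= M" "0 <= M"
 shows "W D (%x. z (Fl h x)) (%i x. G i (Fl h x) + of_real (KFl h i x) * dirG G e (Fl h x))"
proof -
 obtain psi where psi: "!!n. C1c E (psi n)" "null (%n. nrm (%x. psi n x - z x))"
  "!!v. (%n. nrm (%x. pd (psi n) v x - dirG G v x)) \<longlonglongrightarrow> 0" by (rule W_E[OF z]) (rule that; assumption)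
 have off: "Fl h x ~: E" if "x ~: D" for x
  using E[of "Fl h x"] that by (auto simp: flow_add)
 have [measurable]: "KFl h i : mbl" for i
  unfolding KFl_def[abs_def]
  by (intro mbl_cont continuous_intros C1_on_cont_pd[OF gC] 
    continuous_on_compose2[OF C1_on_cont_pd[OF gC]]) auto
 have bd: "sqi (%x. of_real (KFl h i x) * g (Fl h x))"
  "nrm (%x. of_real (KFl h i x) * g (Fl h x)) <= M * nrm g"
  if g: "sqi g" "!!x. x ~: E ==> g x = 0" and i: "i : Basis" for g i
 proof -
  have gh: "sqi (%x. g (Fl h x))" "nrm (%x. g (Fl h x)) = nrm g" using g sqi_flow nrm_flow by auto
  note [measurable] = sqi_meas[OF gh(1)]
  have "cmod (of_real (KFl h i x) * g (Fl h x)) <= M * cmod (g (Fl h x))" for x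
   using M(1)[OF _ i, of x] off[of x] g(2) by (cases "x : D") (auto simp: norm_mult mult_right_mono)
  then show "sqi (%x. of_real (KFl h i x) * g (Fl h x))"
  "nrm (%x. of_real (KFl h i x) * g (Fl h x)) <= M * nrm g"
   using sqi_bound[OF gh(1) _ _ M(2), of "%x. of_real (KFl h i x) * g (Fl h x)"] gh(2) by auto
 qed
 show ?thesis
 proof (rule WI[where psi = "%n x. psi n (Fl h x)"])
  show "sqi (%x. z (Fl h x))" by (intro sqi_flow WD[OF z])
  show "sqi (%x. G i (Fl h x) + of_real (KFl h i x) * dirG G e (Fl h x))" if "i : Basis" for i
   by (intro sqi_add sqi_flow bd WD[OF z] W_sqi_dirG[OF z] that) (auto simp: W_dirG_off[OF z])
  show "z (Fl h x) = 0" if "x ~: D" for x using WD(3)[OF z] off that by blast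
  show "G i (Fl h x) + of_real (KFl h i x) * dirG G e (Fl h x) = 0" if "i : Basis" "x ~: D" for i x
   using off that WD(4)[OF z] W_dirG_off[OF z] by simp
  show "C1c D (%x. psi n (Fl h x))" for n
  proof -
   obtain K where K: "compact K" "K <= E" "!!x. x ~: K ==> psi n x = 0" using C1c_E[OF psi(1)] by metis
   show ?thesis by (rule C1c_flow[OF C1c_C1[OF psi(1)] K(1,3)]) (use K(2) E in auto)
  qed
  have "(%n. nrm (%x. psi n (Fl h x) - z (Fl h x))) = (%n. nrm (%x. psi n x - z x))"
   using nrm_flow[OF sqi_diff[OF C1c_int(3)[OF psi(1)] WD(1)[OF z]]] by auto
  then show "null (%n. nrm (%x. psi n (Fl h x) - z (Fl h x)))" using psi(2) by simp
  fix i :: 'a assume i: "i : Basis"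
  have sd: "sqi (%x. pd (psi n) v x - dirG G v x)" for n v
   by (intro sqi_diff C1c_int[OF psi(1)] W_sqi_dirG[OF z])
  have sdo: "pd (psi n) v x - dirG G v x = 0" if "x ~: E" for n v x
   using that C1c_pd_off[OF psi(1)] W_dirG_off[OF z] by simp
  show "null (%n. nrm (%x. pd (%x. psi n (Fl h x)) i x - (G i (Fl h x) + of_real (KFl h i x) * dirG G e (Fl h x))))"
  proof (rule tendsto_sandwich[OF _ _ tendsto_const])
   show "EV n. nrm (%x. pd (%x. psi n (Fl h x)) i x - (G i (Fl h x) + of_real (KFl h i x) * dirG G e (Fl h x)))
    <= nrm (%x. pd (psi n) i x - dirG G i x) + M * nrm (%x. pd (psi n) e x - dirG G e x)"
   proof (intro always_eventually allI)
    fix n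
    have "nrm (%x. pd (%x. psi n (Fl h x)) i x - (G i (Fl h x) + of_real (KFl h i x) * dirG G e (Fl h x)))
     = nrm (%x. (pd (psi n) i (Fl h x) - dirG G i (Fl h x)) + of_real (KFl h i x) * (pd (psi n) e (Fl h x) - dirG G e (Fl h x)))"
     by (simp add: flow_C1_on(2)[OF C1c_C1[OF psi(1)]] dirG_Basis[OF i] scaleR_conv_of_real algebra_simps)
    also have "... <= nrm (%x. pd (psi n) i (Fl h x) - dirG G i (Fl h x)) + nrm (%x. of_real (KFl h i x) * (pd (psi n) e (Fl h x) - dirG G e (Fl h x)))"
     by (intro nrm_triangle bd(1)[OF sd sdo i] sqi_flow[OF sd])
    also have "... <= nrm (%x. pd (psi n) i x - dirG G i x) + M * nrm (%x. pd (psi n) e x - dirG G e x)"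
     by (intro add_mono bd(2)[OF sd sdo i] eq_refl nrm_flow[OF sd])
    finally show "nrm (%x. pd (%x. psi n (Fl h x)) i x - (G i (Fl h x) + of_real (KFl h i x) * dirG G e (Fl h x)))
    <= nrm (%x. pd (psi n) i x - dirG G i x) + M * nrm (%x. pd (psi n) e x - dirG G e x)" .
   qed
   show "null (%n. nrm (%x. pd (psi n) i x - dirG G i x) + M * nrm (%x. pd (psi n) e x - dirG G e x))"
    using tendsto_add[OF psi(3)[of i] tendsto_mult_right_zero[OF psi(3)[of e], of M]] by simp
  qed auto
 qed
qed

lemma nrm_flow_diff_W:
 assumes v: "W D v V" and M: "!!x. x : D ==> \<bar>pd ga ta x\<bar> <= M" "0 <= M"
 shows "nrm (%x. v (Fl h x) - v x) <= \<bar>h\<bar> * (nrm (dirG V ta) + M * nrm (dirG V e))"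
proof -
 obtain psi where psi: "!!n. C1c D (psi n)" "null (%n. nrm (%x. psi n x - v x))"
  "!!a. (%n. nrm (%x. pd (psi n) a x - dirG V a x)) \<longlonglongrightarrow> 0" by (rule W_E[OF v]) (rule that; assumption)
 have [measurable]: "pd ga ta : mbl"
  by (intro mbl_cont C1_on_cont_pd[OF gC])
 have le: "nrm (%x. psi n (Fl h x) - psi n x) <= \<bar>h\<bar> * (nrm (pd (psi n) ta) + M * nrm (pd (psi n) e))" for n
 proof -
  have lin: "pd (psi n) (t x) x = pd (psi n) ta x + of_real (pd ga ta x) * pd (psi n) e x" for x
   using pd_linear[OF C1c_C1[OF psi(1)] UNIV_I] by (simp add: t_def linear_add linear_cmul scaleR_conv_of_real)
  note s = C1c_int(4)[OF psi(1)]
  note [measurable] = sqi_meas[OF s]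
  have b: "cmod (of_real (pd ga ta x) * pd (psi n) e x) <= M * cmod (pd (psi n) e x)" for x
   using M(1)[of x] C1c_pd_off[OF psi(1), of x] by (cases "x : D") (auto simp: norm_mult mult_right_mono)
  note b' = sqi_bound[OF s[of n e] _ _ M(2), of "%x. of_real (pd ga ta x) * pd (psi n) e x"]
  have "nrm (%x. pd (psi n) (t x) x) <= nrm (pd (psi n) ta) + M * nrm (pd (psi n) e)"
   unfolding lin using nrm_triangle[OF s[of n ta] b'(1)] b'(2) b by force
  then show ?thesis using nrm_flow_diff_C1c(1)[OF psi(1), of n h] by (meson abs_ge_zero mult_left_mono order_trans)
 qed
 have sd: "sqi (%x. psi n x - v x)" for n by (intro sqi_diff C1c_int[OF psi(1)] WD[OF v])
 have 1: "(%n. nrm (%x. psi n (Fl h x) - psi n x)) \<longlonglongrightarrow> nrm (%x. v (Fl h x) - v x)"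
 proof (rule tendsto_nrm)
  show "null (%n. nrm (%x. psi n (Fl h x) - psi n x - (v (Fl h x) - v x)))"
  proof (rule tendsto_sandwich[OF _ _ tendsto_const])
   show "EV n. nrm (%x. psi n (Fl h x) - psi n x - (v (Fl h x) - v x)) <= nrm (%x. psi n x - v x) + nrm (%x. psi n x - v x)"
   proof (intro always_eventually allI)
    fix n
    have "nrm (%x. psi n (Fl h x) - psi n x - (v (Fl h x) - v x)) = nrm (%x. (psi n (Fl h x) - v (Fl h x)) - (psi n x - v x))"
     by (simp add: algebra_simps)
    also have "... <= nrm (%x. psi n (Fl h x) - v (Fl h x)) + nrm (%x. psi n x - v x)"
     by (rule nrm_diff_triangle[OF sqi_flow[OF sd] sd])
    finally show "nrm (%x. psi n (Fl h x) - psi n x - (v (Fl h x) - v x)) <= nrm (%x. psi n x - v x) + nrm (%x. psi n x - v x)"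
     using nrm_flow[OF sd] by simp
   qed
  qed (use tendsto_add[OF psi(2) psi(2)] in auto)
 qed (intro sqi_diff sqi_flow C1c_int[OF psi(1)] WD[OF v])+
 have 2: "(%n. nrm (pd (psi n) a)) \<longlonglongrightarrow> nrm (dirG V a)" for a
  by (rule tendsto_nrm) (simp_all add: C1c_int[OF psi(1)] W_sqi_dirG[OF v] psi(3))
 have "(%n. \<bar>h\<bar> * (nrm (pd (psi n) ta) + M * nrm (pd (psi n) e)))
   \<longlonglongrightarrow> \<bar>h\<bar> * (nrm (dirG V ta) + M * nrm (dirG V e))"
  by (intro tendsto_mult_left tendsto_add 2)
 then show ?thesis by (rule LIMSEQ_le[OF 1]) (use le in blast)
qed

end

section \<open>Smooth functions, cutoffs and mollification\<close>

text \<open>Induction on the list of directions keeps every iterated derivative in \<open>P\<close>.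
  Smoothness proofs thereby reduce to naming a class that contains its own partial
  derivatives.\<close>

lemma smooth_coinduct:
 assumes "P f" and "!!g x. P g ==> g differentiable (at x)" and "!!g i. P g ==> i : Basis ==> P (pd g i)"
 shows "smooth f"
proof -
 have "set vs <= Basis ==> P (dderiv vs f)" for vs
  by (induction vs) (use assms in auto)
 then show ?thesis using assms(2) by (auto simp: smooth_def)
qed

lemma smooth_differentiable: "smooth f ==> f differentiable (at x)"
 unfolding smooth_def by (metis dderiv.simps(1) empty_subsetI list.set(1))

lemma smooth_pd: assumes "smooth f" "i : Basis" shows "smooth (pd f i)"
proof -
 \<comment> \<open>The list is consumed from its end: the last direction is differentiated
   first.\<close>
 have e: "dderiv (vs @ [i]) f = dderiv vs (pd f i)" for vs
  by (induction vs) auto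
 have "dderiv vs (pd f i) differentiable (at x)" if "set vs <= Basis" for vs x
  using assms that unfolding smooth_def e[symmetric] by simp
 then show ?thesis by (auto simp: smooth_def)
qed

lemma smooth_C1_on:
 assumes "smooth f" shows "C1_on S f"
proof (rule C1_onI(1)[where f' = "%x v. pd f v x"])
 show d: "(f has_derivative (%v. pd f v x)) (at x)" for x
  using smooth_differentiable[OF assms, of x] by (simp add: frechet_derivative_works)
 show "continuous_on S (%x. pd f v x)" for v
 proof -
  have "pd f v x = (SB i. (v *. i) *R pd f i x)" for x
  proof -
   have "linear (%v. pd f v x)" using has_derivative_linear[OF d] .
   then have "pd f (SB i. (v *. i) *R i) x = (SB i. (v *. i) *R pd f i x)"
    by (simp add: linear_sum linear_cmul)
   then show ?thesis by (simp add: euclidean_representation)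
  qed
  moreover have "continuous_on S (pd f i)" if "i : Basis" for i
   using smooth_differentiable[OF smooth_pd[OF assms that]]
   by (meson continuous_at_imp_continuous_on differentiable_imp_continuous_within)
  ultimately show ?thesis by (simp add: continuous_on_sum continuous_on_scaleR)
 qed
qed

lemma smooth_affine:
 assumes "bounded_linear L" shows "smooth (%x. L x + c)"
proof (rule smooth_coinduct[where P = "%g. EX L c. bounded_linear L & g = (%x. L x + c)"])
 have d: "((%x. L x + c) has_derivative L) (at x)" if "bounded_linear L" for L :: "'a => 'b" and c x
  by (auto intro!: derivative_eq_intros bounded_linear_imp_has_derivative that)
 show "g differentiable (at x)" if "EX L c. bounded_linear L & g = (%x. L x + c)" for g :: "'a => 'b" and x
  using d that by (auto simp: differentiable_def)
 show "EX L c. bounded_linear L & pd g i = (%x. L x + c)" if g: "EX L c. bounded_linear L & g = (%x. L x + c)" for g :: "'a => 'b" and i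
 proof -
  obtain L c where L: "bounded_linear L" "g = (%x. L x + c)" using g by blast
  have "pd g i x = L i" for x using frechet_derivative_at[OF d[OF L(1), of c x]] L(2) by metis
  then show ?thesis by (intro exI[of _ "%x. 0"] exI[of _ "L i"]) auto
 qed
qed (use assms in blast)

lemma smooth_const [simp]: "smooth (%x. c)"
 using smooth_affine[OF bounded_linear_zero] by simp

lemma smooth_linear: "bounded_linear L ==> smooth L"
 using smooth_affine[of L 0] by simp

lemma smooth_bl:
 assumes "smooth f" "bounded_linear L" shows "smooth (%x. L (f x))"
proof (rule smooth_coinduct[where P = "%g. EX f. smooth f & g = (%x. L (f x))"])
 show "g differentiable (at x)" if "EX f. smooth f & g = (%x. L (f x))" for g and x :: 'a
  using that C1_on_bl(1)[OF smooth_C1_on assms(2)] unfolding C1_on_def by blast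
 show "EX f. smooth f & pd g i = (%x. L (f x))" if g: "EX f. smooth f & g = (%x. L (f x))" and i: "i : Basis" for g and i :: 'a
 proof -
  obtain f where f: "smooth f" "g = (%x. L (f x))" using g by blast
  have "pd g i x = L (pd f i x)" for x
   using C1_on_bl(2)[OF smooth_C1_on[OF f(1)] assms(2), of x UNIV] f(2) by simp
  then show ?thesis using smooth_pd[OF f(1) i] by blast
 qed
qed (use assms in blast)

text \<open>Formal closure of the smooth functions under algebraic operations and composition. By
  the product, quotient and chain rules it contains its own partial derivatives, so a single
  coinduction yields all closure properties.\<close>

inductive smooth_alg :: "('a::euclidean_space => real) => bool" where
 base: "smooth f ==> smooth_alg f"
| add: "smooth_alg f ==> smooth_alg g ==> smooth_alg (%x. f x + g x)"
| mult: "smooth_alg f ==> smooth_alg g ==> smooth_alg (%x. f x * g x)"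
| inv: "smooth_alg f ==> (!!x. f x ~= 0) ==> smooth_alg (%x. inverse (f x))"
| comp: "smooth_alg f ==> smooth (F :: real => real) ==> smooth_alg (%x. F (f x))"

lemma smooth_real_deriv:
 assumes "smooth (F :: real => real)"
 shows "(F has_real_derivative pd F 1 y) (at y)" "smooth (pd F 1)" "continuous_on S (pd F 1)"
proof -
 have C: "C1u F" using smooth_C1_on[OF assms] .
 have e: "pd F v y = v * pd F 1 y" for v
  using linear_cmul[OF pd_linear[OF C UNIV_I], of y v 1] by (simp only: real_scaleR_def mult_1_right)
 have "(F has_derivative (%v. pd F 1 y * v)) (at y)"
  by (rule has_derivative_eq_rhs[OF C1_on_has_derivative[OF C UNIV_I]]) (rule ext, rule trans[OF e mult.commute])
 then show "(F has_real_derivative pd F 1 y) (at y)" unfolding has_field_derivative_def .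
 show "smooth (pd F 1)" using smooth_pd[OF assms] by simp
 show "continuous_on S (pd F 1)" using C1_on_cont_pd[OF C] cont_sub by blast
qed

lemma smooth_alg_deriv:
 "smooth_alg f ==> C1u f & (ALL i:Basis. smooth_alg (pd f i))"
proof (induction rule: smooth_alg.induct)
 case (base f)
 then show ?case using smooth_C1_on smooth_pd smooth_alg.base by blast
next
 case (add f g)
 then have C: "C1u f" "C1u g" by auto
 have "pd (%x. f x + g x) i = (%x. pd f i x + pd g i x)" for i using C1_on_add(2)[OF C] by auto
 then show ?case using add C1_on_add(1)[OF C] by (auto intro: smooth_alg.add)
next
 case (mult f g)
 then have C: "C1u f" "C1u g" by auto
 have "pd (%x. f x * g x) i = (%x. f x * pd g i x + pd f i x * g x)" for i using C1_on_mult(2)[OF C] by auto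
 then show ?case using mult C1_on_mult(1)[OF C]
  by (auto intro!: smooth_alg.add[OF smooth_alg.mult smooth_alg.mult])
next
 case (inv f)
 then have C: "C1u f" by auto
 have "pd (%x. inverse (f x)) i = (%x. - 1 * (inverse (f x) * pd f i x * inverse (f x)))" for i
  using C1_on_inverse(2)[OF C inv(2)] by auto
 moreover have "smooth_alg (%x. - 1 * (inverse (f x) * pd f i x * inverse (f x)))" if "i : Basis" for i
  using inv that by (intro smooth_alg.mult smooth_alg.inv smooth_alg.base[OF smooth_const]) auto
 ultimately show ?case using C1_on_inverse(1)[OF C inv(2)] by simp
next
 case (comp f F)
 then have C: "C1u f" by auto
 note F = smooth_real_deriv[OF comp(2)]
 have "pd (%x. F (f x)) i = (%x. pd F 1 (f x) * pd f i x)" for i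
  using C1_on_comp_real(2)[OF C F(1) F(3)] by auto
 then show ?case using comp C1_on_comp_real(1)[OF C F(1) F(3)] smooth_alg.comp[OF comp(1) F(2)]
  by (auto intro!: smooth_alg.mult)
qed

lemma smooth_alg_imp_smooth: "smooth_alg f ==> smooth f"
 by (rule smooth_coinduct[where P = smooth_alg]) (use smooth_alg_deriv in \<open>auto simp: C1_on_def\<close>)

lemma smooth_add:
 fixes f g :: "'a::euclidean_space => real"
 assumes "smooth f" "smooth g" shows "smooth (%x. f x + g x)"
 by (rule smooth_alg_imp_smooth[OF smooth_alg.add[OF assms[THEN smooth_alg.base]]])

lemma smooth_mult:
 fixes f g :: "'a::euclidean_space => real"
 assumes "smooth f" "smooth g" shows "smooth (%x. f x * g x)"
 by (rule smooth_alg_imp_smooth[OF smooth_alg.mult[OF assms[THEN smooth_alg.base]]])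

lemma smooth_inverse:
 fixes f :: "'a::euclidean_space => real"
 assumes "smooth f" "!!x. f x ~= 0" shows "smooth (%x. inverse (f x))"
 by (rule smooth_alg_imp_smooth[OF smooth_alg.inv[OF smooth_alg.base[OF assms(1)] assms(2)]])

lemma smooth_comp:
 fixes f :: "'a::euclidean_space => real" and F :: "real => real"
 assumes "smooth f" "smooth F" shows "smooth (%x. F (f x))"
 by (rule smooth_alg_imp_smooth[OF smooth_alg.comp[OF smooth_alg.base[OF assms(1)] assms(2)]])

lemma smooth_diff: "smooth f ==> smooth g ==> smooth (%x. f x - g x)"
 for f g :: "'a::euclidean_space => real"
 using smooth_add[of f "%x. -1 * g x"] smooth_mult[OF smooth_const, of g "-1"] by simp

lemma smooth_inner: "smooth (%x. (x - p) *. a)"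
 using smooth_affine[OF bounded_linear_inner_left, of a "- (p *. a)"] by (simp add: inner_diff_left)

text \<open>For k = 0 this is the classical function exp(-1/s), flat at 0. The powers of 1/s are
  included because differentiation produces them, so that linear combinations of these functions are
  closed under derivatives.\<close>

definition eb :: "nat => real => real" where
 "eb k s = (if s > 0 then exp (- inverse s) * inverse s ^ k else 0)"

text \<open>Only s = 0 is delicate: with y = 1/h the quotient from the right is y^(k+1) / exp y,
  which tends to 0.\<close>

lemma eb_deriv: "(eb k has_real_derivative eb (k + 2) s - real k * eb (k + 1) s) (at s)"
proof -
 consider "s > 0" | "s < 0" | "s = 0" by linarith
 then show ?thesis
 proof cases
  case 1
  have e: "inverse s ^ (k + 1) = inverse s ^ (k - 1) * (inverse s * inverse s)" if "k > 0"
   using that by (cases k) auto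
  have "((%s. exp (- inverse s) * inverse s ^ k) has_real_derivative
    eb (k + 2) s - real k * eb (k + 1) s) (at s)"
   using 1 e by (cases "k = 0") (auto intro!: derivative_eq_intros simp: eb_def algebra_simps power2_eq_square)
  then show ?thesis
   by (rule has_field_derivative_transform_within_open[where S = "{0<..}"]) (use 1 in \<open>auto simp: eb_def\<close>)
 next
  case 2
  have "((%s. 0) has_real_derivative eb (k + 2) s - real k * eb (k + 1) s) (at s)"
   using 2 by (auto simp: eb_def)
  then show ?thesis
   by (rule has_field_derivative_transform_within_open[where S = "{..<0}"]) (use 2 in \<open>auto simp: eb_def\<close>)
 next
  case 3
  have "((%y::real. y ^ (k + 1) / exp y) \<longlongrightarrow> 0) at_top" by (rule tendsto_power_div_exp_0)
  then have l: "((%s. inverse s ^ (k + 1) / exp (inverse s)) \<longlongrightarrow> (0::real)) (at_right 0)"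
   using filterlim_compose filterlim_inverse_at_top_right by blast
  have r: "((%h. eb k h / h) \<longlongrightarrow> 0) (at_right 0)"
   by (rule Lim_transform_eventually[OF l])
     (auto simp: eventually_at_filter eb_def exp_minus divide_inverse power_add)
  have "((%h. eb k h / h) \<longlongrightarrow> 0) (at_left 0)"
   by (rule Lim_transform_eventually[of "%_. 0"]) (auto simp: eventually_at_filter eb_def)
  then have "((%h. eb k h / h) \<longlongrightarrow> 0) (at 0)" using r filterlim_split_at by blast
  then show ?thesis using 3 by (simp add: DERIV_def eb_def)
 qed
qed

inductive eb_span :: "(real => real) => bool" where
 single: "eb_span (%s. c * eb k s)"
| add: "eb_span f ==> eb_span g ==> eb_span (%s. f s + g s)"

lemma eb_span_deriv: "eb_span g ==> EX g'. eb_span g' & (ALL s. (g has_real_derivative g' s) (at s))"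
proof (induction rule: eb_span.induct)
 case (single c k)
 have "((%s. c * eb k s) has_real_derivative c * eb (k + 2) s + (- c * real k) * eb (k + 1) s) (at s)" for s
  using DERIV_cmult[OF eb_deriv[of k s], of c] by (simp add: algebra_simps)
 then show ?case using eb_span.add[OF eb_span.single[of c "k + 2"] eb_span.single[of "- c * real k" "k + 1"]] by blast
next
 case (add f g)
 then obtain f' g' where *: "eb_span f'" "ALL s. (f has_real_derivative f' s) (at s)"
  "eb_span g'" "ALL s. (g has_real_derivative g' s) (at s)" by (elim exE conjE)
 then have "ALL s. ((%s. f s + g s) has_real_derivative f' s + g' s) (at s)" by (intro allI DERIV_add) auto
 then show ?case using eb_span.add[OF *(1,3)] by blast
qed

lemma smooth_eb: "smooth (eb k)"
proof (rule smooth_coinduct[where P = eb_span])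
 show "eb_span (eb k)" using eb_span.single[of 1 k] by simp
 show "g differentiable (at x)" if "eb_span g" for g x
  using eb_span_deriv[OF that] by (meson real_differentiable_def)
 show "eb_span (pd g i)" if g: "eb_span g" and i: "i : Basis" for g and i :: real
 proof -
  obtain g' where g': "eb_span g'" "!!s. (g has_real_derivative g' s) (at s)" using eb_span_deriv[OF g] by blast
  have "pd g i s = g' s" for s
   using frechet_derivative_at[OF g'(2)[unfolded has_field_derivative_def]] i by (metis Basis_real_def mult.right_neutral singletonD)
  then have "pd g i = g'" by auto
  then show ?thesis using g' by simp
 qed
qed

lemma eb_pos: "eb 0 s >= 0" "eb 0 s > 0 \<longleftrightarrow> s > 0" "s <= 0 ==> eb 0 s = 0" by (auto simp: eb_def)

definition step :: "real => real" where
 "step s = eb 0 s * inverse (eb 0 s + eb 0 (1 - s))"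

lemma step_den: "eb 0 s + eb 0 (1 - s) > 0"
 using eb_pos(1)[of s] eb_pos(1)[of "1 - s"] eb_pos(2)[of s] eb_pos(2)[of "1 - s"]
 by (cases "s > 0") (auto simp: add_pos_nonneg add_nonneg_pos)

lemma step_facts: "s <= 0 ==> step s = 0" "s >= 1 ==> step s = 1" "0 <= step s" "step s <= 1"
proof -
 show "s <= 0 ==> step s = 0" by (simp add: step_def eb_pos)
 show "step s = 1" if "s >= 1"
 proof -
  have "eb 0 (1 - s) = 0" "eb 0 s > 0" using that eb_pos(2)[of s] eb_pos(3)[of "1 - s"] by auto
  then show ?thesis unfolding step_def by simp
 qed
 show "0 <= step s" using step_den[of s] eb_pos(1)[of s] by (simp add: step_def)
 show "step s <= 1" using step_den[of s] eb_pos(1)[of "1 - s"] by (simp add: step_def divide_le_eq flip: divide_inverse)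
qed

lemma smooth_step: "smooth step"
 unfolding step_def[abs_def]
 by (intro smooth_mult smooth_inverse smooth_add smooth_eb smooth_comp[OF _ smooth_eb] smooth_diff
    smooth_const smooth_linear bounded_linear_ident) (metis less_numeral_extra(3) step_den)

lemma smooth_sq_dist: "smooth (%x. (norm (x - p))^2)"
proof -
 have s: "smooth (%x. \<Sum>i\<in>A. ((x - p) *. i) * ((x - p) *. i))" if "finite A" for A
  using that
 proof induction
  case (insert a F)
  then show ?case using smooth_add[OF smooth_mult[OF smooth_inner smooth_inner] insert(3)] by simp
 qed simp
 have e: "(norm (x - p))^2 = (SB i. ((x - p) *. i) * ((x - p) *. i))" for x
  by (simp only: power2_norm_eq_inner euclidean_inner[of "x - p" "x - p"])
 show ?thesis unfolding e by (rule s) simp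
qed

lemma plateau:
 fixes p :: "'a::euclidean_space" assumes "r > 0"
 obtains ze :: "'a => real" where "smooth ze" "!!x. 0 <= ze x" "!!x. ze x <= 1"
  "!!x. norm (x - p) <= r ==> ze x = 1" "!!x. norm (x - p) >= 2 * r ==> ze x = 0"
proof (rule that)
 \<comment> \<open>The argument is at least 1 for |x - p| <= r and nonpositive from |x - p| = sqrt 2
   r on, in particular from 2 r on.\<close>
 let ?z = "%x. step (2 - (norm (x - p))^2 * inverse (r^2))"
 show "smooth ?z" by (intro smooth_comp[OF _ smooth_step] smooth_diff smooth_mult smooth_const smooth_sq_dist)
 fix x
 show "0 <= ?z x" "?z x <= 1" by (rule step_facts)+
 show "?z x = 1" if "norm (x - p) <= r"
 proof (rule step_facts(2))
  have "(norm (x - p))^2 <= r^2" using that by (intro power_mono) auto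
  then show "1 <= 2 - (norm (x - p))^2 * inverse (r^2)" using assms by (simp add: field_simps)
 qed
 show "?z x = 0" if "norm (x - p) >= 2 * r"
 proof (rule step_facts(1))
  have "(2 * r)^2 <= (norm (x - p))^2" using that assms by (intro power_mono) auto
  then have "4 * r^2 <= (norm (x - p))^2" by (simp add: power_mult_distrib)
  moreover have "r^2 >= 0" by simp
  ultimately have "2 * r^2 <= (norm (x - p))^2" by linarith
  then show "2 - (norm (x - p))^2 * inverse (r^2) <= 0" using assms by (simp add: field_simps)
 qed
qed

text \<open>The normalized radial bump. Evenness is recorded because it moves a convolution from one
  factor of an integral to the other.\<close>

lemma mollifier:
 assumes "r > 0"
 obtains ro :: "'a::euclidean_space => real" where "smooth ro" "!!x. ro x >= 0" "!!x. norm x > r ==> ro x = 0"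
  "(LBINT x. ro x) = 1" "intgl ro" "!!x. ro (- x) = ro x"
proof -
 let ?b = "%x::'a. eb 0 (1 - (norm (x - 0))^2 * inverse (r^2))"
 have s: "smooth ?b" by (intro smooth_comp[OF _ smooth_eb] smooth_diff smooth_mult smooth_const smooth_sq_dist)
 have pos: "?b x > 0 \<longleftrightarrow> norm x < r" for x
 proof -
  have "?b x > 0 \<longleftrightarrow> (norm x)^2 < r^2" using assms by (simp add: eb_pos(2) field_simps)
  also have "... \<longleftrightarrow> norm x < r"
   using power_strict_mono[of "norm x" r 2] power_mono[of r "norm x" 2] assms by (cases "norm x < r") (auto simp: not_less)
  finally show ?thesis .
 qed
 have b0: "?b x >= 0" for x by (rule eb_pos)
 have c: "continuous_on UNIV ?b" using C1_on_cont[OF smooth_C1_on[OF s]] .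
 have i: "intgl ?b"
 proof (rule intgl_of_cont_supp[OF c bounded_ball])
  fix x :: 'a assume "x ~: ball 0 r"
  then show "?b x = 0" using pos[of x] b0[of x] by auto
 qed
 define I where "I = (LBINT x. ?b x)"
 \<comment> \<open>A vanishing integral would make the bump zero almost everywhere, but it is
   positive on a ball of positive volume.\<close>
 have "I > 0"
 proof (rule ccontr)
  assume "\<not> I > 0"
  moreover have "I >= 0" unfolding I_def by (rule integral_nonneg_AE) (rule AE_I2, rule b0)
  ultimately have "I = 0" by simp
  then have "AEL x. ?b x = 0"
   using integral_nonneg_eq_0_iff_AE[OF i] b0 by (simp add: I_def)
  then have "AEL x. x ~: ball (0::'a) r" by eventually_elim (use pos in force)
  then have "emeasure lborel (ball (0::'a) r) = 0"
   by (subst (asm) AE_iff_measurable[where N = "ball 0 r"]) auto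
  then show False using content_ball_pos[OF assms, of "0::'a"] by (simp add: measure_def)
 qed
 show ?thesis
 proof (rule that[of "%x. inverse I * ?b x"])
  show "smooth (%x. inverse I * ?b x)" by (intro smooth_mult smooth_const s)
  show "inverse I * ?b x >= 0" for x using \<open>I > 0\<close> b0 by simp
  show "inverse I * ?b x = 0" if "norm x > r" for x using pos[of x] b0[of x] that by auto
  show "(LBINT x. inverse I * ?b x) = 1" using \<open>I > 0\<close> by (simp add: I_def)
  show "intgl (%x. inverse I * ?b x)" using i by simp
 qed simp
qed

lemma compact_cball_nbhd:
 fixes K :: "'a::euclidean_space set"
 assumes "compact K" shows "compact (\<Union>x\<in>K. cball x r)"
proof -
 have 1: "cball x r = (\<Union>y\<in>cball 0 r. {x + y})" for x :: 'a
  using cball_translation[of x 0 r] by (metis UNION_singleton_eq_range add.right_neutral)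
 have e: "(\<Union>x\<in>K. cball x r) = (\<Union>x\<in>K. \<Union>y\<in>cball 0 r. {x + y})" by (intro SUP_cong refl 1)
 show ?thesis unfolding e by (rule compact_sums'[OF assms compact_cball])
qed

definition conv :: "('a::euclidean_space => complex) => ('a => complex) => 'a => complex" where
 "conv v ro x = (LBINT y. v y * ro (x - y))"

lemma integrable_mult_C1c_shift:
 assumes v: "intgl v" and g: "g : mbl" "!!x. cmod (g x) <= B"
 shows "intgl (%y. v y * g (x - y))"
proof -
 note [measurable] = borel_measurable_integrable[OF v] g(1)
 have i: "intgl (%y. B * cmod (v y))" using v by auto
 have "cmod (v y * g (x - y)) <= B * cmod (v y)" for y
  unfolding norm_mult using g(2)[of "x - y"] by (metis mult.commute mult_left_mono norm_ge_zero)
 then show ?thesis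
  by (intro bintgl_bound[OF i]) (auto intro!: AE_I2 intro: order_trans[OF _ abs_ge_self])
qed

text \<open>Dominated convergence for the remainder divided by the length of the increment: the
  Lipschitz constant and the derivative bound of the kernel dominate it by (L + B) |v|, so
  integrability of v is enough.\<close>

lemma conv_has_derivative:
 assumes v: "intgl v" and ro: "C1c UNIV ro"
 shows "(conv v ro has_derivative (%h. conv v (pd ro h) x)) (at x)"
proof -
 have C: "C1u ro" by (rule C1c_C1[OF ro])
 obtain B where B: "B >= 0" "!!x. cmod (ro x) <= B" "!!x v. cmod (pd ro v x) <= B * norm v" using C1c_bounded[OF ro] by metis
 obtain L where L: "L >= 0" "!!x y. cmod (ro x - ro y) <= L * norm (x - y)" using C1c_Lipschitz[OF ro] by metis
 note [measurable] = borel_measurable_integrable[OF v] C1c_mbl[OF ro] C1c_pd_mbl[OF ro]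
 have i1: "intgl (%y. v y * ro (z - y))" for z
  by (rule integrable_mult_C1c_shift[OF v]) (auto intro: B)
 have i2: "intgl (%y. v y * pd ro h (z - y))" for z h
  by (rule integrable_mult_C1c_shift[OF v]) (auto intro: B)
 have lin: "linear (%h. conv v (pd ro h) x)"
 proof (rule linearI)
  show "conv v (pd ro (a + b)) x = conv v (pd ro a) x + conv v (pd ro b) x" for a b
   unfolding conv_def using i2 linear_add[OF pd_linear[OF C UNIV_I]]
   by (simp add: distrib_left)
  show "conv v (pd ro (c *R b)) x = c *R conv v (pd ro b) x" for c b
   unfolding conv_def using i2 linear_cmul[OF pd_linear[OF C UNIV_I]]
   by simp
 qed
 have lim: "((%h. norm (conv v ro (x + h) - conv v ro x - conv v (pd ro h) x) / norm h) \<longlongrightarrow> 0) (at 0)"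
  unfolding tendsto_at_iff_sequentially o_def
 proof (intro allI impI)
  fix X :: "nat => 'a" assume X0: "ALL i. X i : UNIV - {0}" and X: "X \<longlonglongrightarrow> 0"
  define F where "F = (%n y. v y * ((ro (x + X n - y) - ro (x - y) - pd ro (X n) (x - y)) /\<^sub>R norm (X n)))"
  have eq: "conv v ro (x + X n) - conv v ro x - conv v (pd ro (X n)) x = norm (X n) *R (LBINT y. F n y)" for n
  proof -
   have "conv v ro (x + X n) - conv v ro x - conv v (pd ro (X n)) x
     = (LBINT y. v y * ro (x + X n - y) - v y * ro (x - y) - v y * pd ro (X n) (x - y))"
    unfolding conv_def using i1 i2 by simp
   also have "... = (LBINT y. norm (X n) *R F n y)"
    using X0 by (intro bint_cong) (auto simp: F_def algebra_simps)
   finally show ?thesis by simp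
  qed
  have "(%n. LBINT y. F n y) \<longlonglongrightarrow> (LINT y|(lborel::'a measure). 0)"
  proof (rule integral_dominated_convergence[where w = "%y. (L + B) * cmod (v y)"])
   show "intgl (%y. (L + B) * cmod (v y))" using v by auto
   show "AEL y. (%n. F n y) \<longlonglongrightarrow> 0"
   proof (rule AE_I2)
    fix y
    have "((%h. norm (ro (x - y + h) - ro (x - y) - pd ro h (x - y)) / norm h) \<longlongrightarrow> 0) (at 0)"
     using C1_on_has_derivative[OF C, of "x - y"] unfolding has_derivative_at by auto
    then have "null (%n. norm (ro (x - y + X n) - ro (x - y) - pd ro (X n) (x - y)) / norm (X n))"
     using X0 X unfolding tendsto_at_iff_sequentially o_def by blast
    then have "null (%n. (ro (x + X n - y) - ro (x - y) - pd ro (X n) (x - y)) /\<^sub>R norm (X n))"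
    proof -
     assume l: "null (%n. norm (ro (x - y + X n) - ro (x - y) - pd ro (X n) (x - y)) / norm (X n))"
     have a: "x + X n - y = x - y + X n" for n by simp
     have e: "norm ((ro (x + X n - y) - ro (x - y) - pd ro (X n) (x - y)) /\<^sub>R norm (X n))
      = norm (ro (x - y + X n) - ro (x - y) - pd ro (X n) (x - y)) / norm (X n)"
      for n unfolding a norm_scaleR by (simp only: divide_inverse_commute abs_inverse abs_norm_cancel)
     show ?thesis by (rule tendsto_norm_zero_cancel) (use l e in presburger)
    qed
    then show "null (%n. F n y)" unfolding F_def by (rule tendsto_mult_right_zero)
   qed
   show "AEL y. norm (F n y) <= (L + B) * cmod (v y)" for n
   proof (rule AE_I2)
    fix y
    have "norm (ro (x + X n - y) - ro (x - y) - pd ro (X n) (x - y)) <= L * norm (X n) + B * norm (X n)"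
     using norm_triangle_ineq4[of "ro (x + X n - y) - ro (x - y)" "pd ro (X n) (x - y)"]
      L(2)[of "x + X n - y" "x - y"] B(3)[of "x - y" "X n"] by simp
    then have "inverse (norm (X n)) * norm (ro (x + X n - y) - ro (x - y) - pd ro (X n) (x - y))
      <= inverse (norm (X n)) * (L * norm (X n) + B * norm (X n))"
     by (rule mult_left_mono) simp
    also have "... = L + B" using X0 by (simp add: field_simps)
    finally have "norm ((ro (x + X n - y) - ro (x - y) - pd ro (X n) (x - y)) /\<^sub>R norm (X n)) <= L + B"
     by simp
    then show "norm (F n y) <= (L + B) * cmod (v y)"
     unfolding F_def norm_mult by (metis mult.commute mult_left_mono norm_ge_zero)
   qed
   show "F n : lmbl" for n unfolding F_def by measurable
  qed simp
  then have "null (%n. norm (LBINT y. F n y))" by (simp add: tendsto_norm_zero)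
  then show "null (%n. norm (conv v ro (x + X n) - conv v ro x - conv v (pd ro (X n)) x) / norm (X n))"
   unfolding eq using X0 by simp
 qed
 show ?thesis unfolding has_derivative_at using lim lin by (simp add: linear_conv_bounded_linear)
qed

lemma smooth_compact_C1c:
 assumes "smooth ro" "compact K" "K <= D" "!!x. x ~: K ==> ro x = 0" shows "C1c D ro"
 using assms smooth_C1_on[OF assms(1)] by (auto simp: C1c_def)

text \<open>The convolutions of v with smooth kernels that vanish off \<open>K\<close> form a class
  closed under partial derivatives, the derivative falling on the kernel.\<close>

lemma smooth_conv:
 assumes v: "intgl v" and ro: "smooth ro" "compact K" "!!x. x ~: K ==> ro x = 0"
 shows "smooth (conv v ro)" and "pd (conv v ro) h x = conv v (pd ro h) x"
proof -
 show "pd (conv v ro) h x = conv v (pd ro h) x"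
  using frechet_derivative_at[OF conv_has_derivative[OF v smooth_compact_C1c[OF ro(1,2) subset_UNIV ro(3)]], of x] by metis
 show "smooth (conv v ro)"
 proof (rule smooth_coinduct[where P = "%g. EX ro. smooth ro & (ALL x. x ~: K --> ro x = 0) & g = conv v ro"])
  show "EX ro'. smooth ro' & (ALL x. x ~: K --> ro' x = 0) & conv v ro = conv v ro'" using ro by blast
  fix g assume "EX ro. smooth ro & (ALL x. x ~: K --> ro x = 0) & g = conv v ro"
  then obtain ro where r: "smooth ro" "!!x. x ~: K ==> ro x = 0" "g = conv v ro" by blast
  have d: "(g has_derivative (%h. conv v (pd ro h) x)) (at x)" for x
   unfolding r(3) by (rule conv_has_derivative[OF v smooth_compact_C1c[OF r(1) ro(2) subset_UNIV r(2)]])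
  then show "g differentiable (at x)" for x by (auto simp: differentiable_def)
  fix i :: 'a assume i: "i : Basis"
  have "pd g i = conv v (pd ro i)"
   by (rule ext) (rule fun_cong[OF frechet_derivative_at[OF d], symmetric])
  moreover have "pd ro i x = 0" if "x ~: K" for x
   using pd_zero_off_closed[of K ro x] that r(2) ro(2) compact_imp_closed by blast
  ultimately show "EX ro. smooth ro & (ALL x. x ~: K --> ro x = 0) & pd g i = conv v ro"
   using smooth_pd[OF r(1) i] by blast
 qed
qed

lemma distr_lborel_uminus: "distr lborel borel uminus = (lborel :: 'a::euclidean_space measure)"
proof -
 have e: "(%x::'a. 0 + (SB j. (- 1 * (x *. j)) *R j)) = uminus"
  by (simp add: fun_eq_iff sum_negf euclidean_representation)
 show ?thesis
  using lborel_affine_euclidean[of "%_. -1" "0::'a"] unfolding e by (simp add: density_1)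
qed

lemma integral_reflect:
 fixes f :: "'a::euclidean_space => 'b::{banach, second_countable_topology}"
 assumes [measurable]: "f : mbl"
 shows "(LBINT y. f (x - y)) = (LBINT y. f y)"
proof -
 have "(LBINT y. f (x - y)) = (LINT y|distr lborel borel uminus. f (x + y))"
  by (simp add: integral_distr)
 then show ?thesis by (simp add: distr_lborel_uminus integral_translation)
qed

lemma conv_commute:
 assumes [measurable]: "v : mbl" "ro : mbl"
 shows "conv v ro x = (LBINT y. v (x - y) * ro y)"
 unfolding conv_def using integral_reflect[of "%y. v y * ro (x - y)" x] by simp

text \<open>The convolution at x is an average of the values of v within distance r of x. It is used
  with c = v x for approximation errors and with c = 0 for uniform bounds.\<close>

lemma conv_approx:
 fixes v :: "'a::euclidean_space => complex"
 assumes v: "v : mbl" and ro: "!!x. ro x >= 0" "!!x. norm x > r ==> ro x = 0" "(LBINT x. ro x) = 1"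
  "intgl ro" and b: "!!y. norm y <= r ==> cmod (v (x - y) - c) <= d"
 shows "cmod (conv v (%x. of_real (ro x)) x - c) <= d"
proof -
 note [measurable] = v borel_measurable_integrable[OF ro(4)]
 have le: "cmod ((v (x - y) - c) * of_real (ro y)) <= d * ro y" for y
  using b[of y] ro(1,2)[of y] by (cases "norm y > r") (auto simp: norm_mult mult_right_mono)
 have i: "intgl (%y. d * ro y)" using ro(4) by auto
 have i1: "intgl (%y. (v (x - y) - c) * of_real (ro y))"
  by (rule bintgl_bound[OF i]) (use le order_trans[OF le abs_ge_self] in auto)
 have i2: "intgl (%y. c * of_real (ro y))" using ro(4) by auto
 have "(LBINT y. c * cor (ro y)) = c" using ro(3,4) by simp
 then have "conv v (%x. of_real (ro x)) x - c = (LBINT y. (v (x - y) - c) * of_real (ro y))"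
  using bint_add[OF i1 i2]
  by (subst conv_commute) (simp_all add: algebra_simps)
 also have "cmod ... <= (LBINT y. cmod ((v (x - y) - c) * of_real (ro y)))" by simp
 also have "... <= (LBINT y. d * ro y)"
  by (rule integral_mono[OF integrable_norm[OF i1] i le])
 also have "... = d" using ro(3) by simp
 finally show ?thesis .
qed

lemma nrm_le_sup:
 assumes [measurable]: "g : mbl" and K: "compact K" and off: "!!x. x ~: K ==> g x = 0"
  and le: "!!x. cmod (g x) <= d" "0 <= d"
 shows "nrm g <= d * sqrt (measure lborel K)"
proof -
 have [measurable]: "K : sets borel" using borel_closed[OF compact_imp_closed[OF K]] .
 have fin: "emeasure lborel K < \<infinity>" using K by (rule emeasure_compact_finite)
 have iK: "intgl (indicator K :: 'a => real)" using fin by simp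
 have sI: "sqi (%x. indicator K x)"
 proof -
  have "(%x. (cmod (indicator K x))^2) = (%x. indicator K x :: real)" by (auto simp: indicator_def)
  then show ?thesis using iK by (simp add: sqiM_def)
 qed
 have nI: "nrm (%x. indicator K x) = sqrt (measure lborel K)"
 proof -
  have "(%x. (cmod (indicator K x))^2) = (%x. indicator K x :: real)" by (auto simp: indicator_def)
  then show ?thesis by (simp add: nrmM_def)
 qed
 have "cmod (g x) <= d * cmod (indicator K x)" for x
  using le off[of x] by (cases "x : K") auto
 then show ?thesis using sqi_bound(2)[OF sI _ _ le(2), of g] nI by auto
qed

text \<open>Uniform continuity on the closed unit neighbourhood of the support; if neither x nor x -
  y lies in the support, both derivatives vanish.\<close>

lemma C1c_pd_uniform:
 assumes f: "C1c D f" and "e > 0"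
 obtains d where "d > 0" "!!x y i. i : Basis ==> norm y <= d ==> cmod (pd f i (x - y) - pd f i x) <= e"
proof -
 obtain K where K: "compact K" "!!x v. x ~: K ==> pd f v x = 0" using C1c_E[OF f] by metis
 define K' where "K' = (\<Union>x\<in>K. cball x 1)"
 have K': "compact K'" unfolding K'_def by (rule compact_cball_nbhd[OF K(1)])
 have one: "EX d>0. ALL x y. norm y <= d --> cmod (pd f i (x - y) - pd f i x) <= e" for i
 proof -
  have "uniformly_continuous_on K' (pd f i)"
   using K' C1_on_cont_pd[OF C1c_C1[OF f]] by (meson compact_uniformly_continuous cont_sub subset_UNIV)
  then obtain d where d: "d > 0" "ALL x:K'. ALL x':K'. dist x' x < d --> dist (pd f i x') (pd f i x) < e"
   using \<open>e > 0\<close> unfolding uniformly_continuous_on_def by blast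
  show ?thesis
  proof (intro exI conjI allI impI)
   show "min (d/2) 1 > 0" using d by simp
   fix x y :: 'a assume y: "norm y <= min (d/2) 1"
   show "cmod (pd f i (x - y) - pd f i x) <= e"
   proof (cases "x : K \<or> x - y : K")
    case True
    moreover have "x : cball x 1" "x - y : cball x 1" "x : cball (x - y) 1" "x - y : cball (x - y) 1"
     using y by (simp_all add: dist_norm)
    ultimately have "x : K' & x - y : K'" unfolding K'_def by blast
    moreover have "dist (x - y) x < d" using y d by (simp add: dist_norm)
    ultimately show ?thesis using d(2) by (metis dist_norm less_imp_le)
   next
    case False then show ?thesis using K(2) \<open>e > 0\<close> by simp
   qed
  qed
 qed
 then have "ALL i. EX d>0. ALL x y. norm y <= d --> cmod (pd f i (x - y) - pd f i x) <= e" by blast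
 from choice[OF this] obtain d where d: "!!i. d i > 0" "!!i x y. norm y <= d i ==> cmod (pd f i (x - y) - pd f i x) <= e"
  by blast
 show ?thesis
 proof (rule that)
  show "Min (d ` Basis) > 0" using d(1) by (subst Min_gr_iff) auto
  show "cmod (pd f i (x - y) - pd f i x) <= e" if "i : Basis" "norm y <= Min (d ` Basis)" for x y i
  proof (rule d(2))
   show "norm y <= d i" using that by (meson Min_le finite_Basis finite_imageI image_eqI order_trans)
  qed
 qed
qed

text \<open>The convolutions and their gradients converge uniformly and live on one compact
  neighbourhood of the support, hence they converge in L^2. This is the bridge between smooth and
  C^1 test functions.\<close>

lemma C1c_mollify:
 fixes D :: "'a::euclidean_space set"
 assumes D: "open D" and f: "C1c D f"
 obtains psi where "!!n. test_fun D (psi n)" "!!n. C1c D (psi n)" "null (%n. nrm (%x. psi n x - f x))"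
  "!!i. i : Basis ==> (%n. nrm (%x. pd (psi n) i x - pd f i x)) \<longlonglongrightarrow> 0"
proof -
 obtain K where K: "compact K" "K <= D" "!!x. x ~: K ==> f x = 0" "!!x v. x ~: K ==> pd f v x = 0" using C1c_E[OF f] by metis
 obtain r0 where r0: "r0 > 0" "(\<Union>x\<in>K. cball x r0) <= D"
  using compact_subset_open_imp_cball_epsilon_subset[OF K(1) D K(2)] by metis
 define K' where "K' = (\<Union>x\<in>K. cball x r0)"
 have K': "compact K'" "K <= K'"
 proof -
  show "compact K'" unfolding K'_def by (rule compact_cball_nbhd[OF K(1)])
  show "K <= K'" unfolding K'_def using r0 by force
 qed
 have ex: "EX psi. test_fun D psi & C1c D psi & nrm (%x. psi x - f x) <= e * sqrt (measure lborel K') \<and>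
   (ALL i:Basis. nrm (%x. pd psi i x - pd f i x) <= e * sqrt (measure lborel K'))" if e: "e > 0" for e
 proof -
  obtain d where d: "d > 0" "!!x y i. i : Basis ==> norm y <= d ==> cmod (pd f i (x - y) - pd f i x) <= e"
   using C1c_pd_uniform[OF f e] by metis
  obtain L where L: "L >= 0" "!!x y. cmod (f x - f y) <= L * norm (x - y)" using C1c_Lipschitz[OF f] by metis
  \<comment> \<open>r0 keeps the support in \<open>D\<close>, d controls the gradient, and e / (L +
    1) controls the function through its Lipschitz constant, the 1 covering L = 0.\<close>
  define r where "r = min r0 (min d (e / (L + 1)))"
  have r: "r > 0" "r <= r0" "r <= d" "L * r <= e"
  proof -
   show "r > 0" unfolding r_def using r0 d e L by simp
   show "r <= r0" "r <= d" unfolding r_def by auto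
   have "r <= e / (L + 1)" unfolding r_def by auto
   then have "r * (L + 1) <= e" using L by (simp add: pos_le_divide_eq)
   then show "L * r <= e" using \<open>r > 0\<close> by (simp add: algebra_simps)
  qed
  obtain ro :: "'a => real" where ro: "smooth ro" "!!x. ro x >= 0" "!!x. norm x > r ==> ro x = 0"
   "(LBINT x. ro x) = 1" "intgl ro" "!!x. ro (- x) = ro x" using mollifier[OF r(1)] by metis
  define et where "et = (%x. cor (ro x))"
  have et: "smooth et" unfolding et_def by (rule smooth_bl[OF ro(1) bounded_linear_of_real])
  have et0: "et x = 0" if "x ~: cball 0 r" for x using that ro(3) by (simp add: et_def)
  note fi = C1c_int[OF f]
  note sm = smooth_conv[OF fi(1) et compact_cball[of 0 r] et0]
  have etc: "C1c UNIV et" by (rule smooth_compact_C1c[OF et compact_cball subset_UNIV et0])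
  have supp: "conv f et x = 0" if "x ~: K'" for x
  proof -
   have z: "f y * et (x - y) = 0" for y
   proof (cases "y : K")
    case True
    then have "x ~: cball y r0" using that unfolding K'_def by blast
    then have "x - y ~: cball 0 r" using r by (auto simp: dist_norm norm_minus_commute)
    then show ?thesis using et0 by simp
   qed (simp add: K)
   show ?thesis unfolding conv_def by (simp add: z)
  qed
  have C: "C1c D (conv f et)" 
   by (rule smooth_compact_C1c[OF sm(1) K'(1) _ supp]) (use r0 K'_def in blast)+
  have T: "test_fun D (conv f et)"
  proof -
   have "{x. conv f et x ~= 0} <= K'" using supp by blast
   then have s: "tsupp (conv f et) <= K'" unfolding tsupp_def using K'(1) by (simp add: closure_minimal compact_imp_closed)
   moreover have "compact (tsupp (conv f et))"
    using s K'(1) unfolding tsupp_def by (metis closed_closure compact_Int_closed inf.absorb_iff2 inf_commute)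
   ultimately show ?thesis using sm(1) r0 unfolding test_fun_def K'_def by blast
  qed
  \<comment> \<open>The derivative falls on the kernel; integration by parts in y, with one sign
    from the reflection x - y and one from the formula, moves it to f.\<close>
  have pdc: "pd (conv f et) i x = conv (pd f i) et x" for i x
  proof -
   have d1: "((%y. x - y) has_derivative (%v. - v)) (at y)" for y :: 'a by (auto intro!: derivative_eq_intros)
   note cc = C1_on_compose[OF C1c_C1[OF etc] d1]
   have pe: "pd (%y. et (x - y)) i y = - pd et i (x - y)" for y
    using cc(2)[of y i] linear_neg[OF pd_linear[OF C1c_C1[OF etc] UNIV_I]] by (simp add: continuous_intros)
   have "(LBINT y. f y * pd et i (x - y)) = - (LBINT y. f y * pd (%y. et (x - y)) i y)"
    unfolding pe by simp
   also have "... = (LBINT y. et (x - y) * pd f i y) "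
    using integral_by_parts[OF open_UNIV cc(1) C1c_mono[OF f subset_UNIV], where v = i] 
    by (simp add: mult.commute continuous_intros)
   finally show ?thesis using sm(2)[where h = i and x = x] unfolding conv_def[of f "pd et i"] conv_def[of "pd f i"] by (simp add: mult.commute)
  qed
  have b1: "cmod (conv f et x - f x) <= e" for x
   unfolding et_def
  proof (rule conv_approx[OF C1c_mbl[OF f] ro(2-5)])
   fix y :: 'a assume y: "norm y <= r"
   have "cmod (f (x - y) - f x) <= L * norm y" using L(2)[of "x - y" x] by simp
   also have "... <= L * r" using y L(1) by (rule mult_left_mono)
   finally show "cmod (f (x - y) - f x) <= e" using r(4) by simp
  qed
  have b2: "cmod (pd (conv f et) i x - pd f i x) <= e" if "i : Basis" for x i
   unfolding pdc unfolding et_def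
   by (rule conv_approx[OF C1c_pd_mbl[OF f] ro(2-5)]) (use d(2)[OF that] r(3) in auto)
  have off2: "pd (conv f et) i x = 0" if "x ~: K'" for i x
   by (rule pd_zero_off_closed[OF compact_imp_closed[OF K'(1)] supp that])
  have off3: "f x = 0" "pd f i x = 0" if "x ~: K'" for i x using that K(3,4) K'(2) by blast+
  show ?thesis
  proof (intro exI[of _ "conv f et"] conjI ballI T C nrm_le_sup K'(1))
   show "(%x. conv f et x - f x) : mbl"
    using C1c_mbl[OF C] C1c_mbl[OF f] by measurable
   show "(%x. pd (conv f et) i x - pd f i x) : mbl" for i
    using C1c_pd_mbl[OF C] C1c_pd_mbl[OF f] by measurable
  qed (simp_all add: b1 b2 e[THEN less_imp_le] supp off2 off3)
 qed
 let ?e = "%n. inverse (real (Suc n))"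
 have "ALL n. EX psi. test_fun D psi & C1c D psi & nrm (%x. psi x - f x) <= ?e n * sqrt (measure lborel K') \<and>
   (ALL i:Basis. nrm (%x. pd psi i x - pd f i x) <= ?e n * sqrt (measure lborel K'))"
  by (rule allI, rule ex) simp
 from choice[OF this] obtain psi where ps: "ALL n. test_fun D (psi n) & C1c D (psi n) & nrm (%x. psi n x - f x) <= ?e n * sqrt (measure lborel K') \<and>
   (ALL i:Basis. nrm (%x. pd (psi n) i x - pd f i x) <= ?e n * sqrt (measure lborel K'))" by blast
 have z: "null (%n. ?e n * sqrt (measure lborel K'))"
  by (rule tendsto_mult_left_zero[OF LIMSEQ_inverse_real_of_nat])
 show ?thesis
 proof (rule that)
  show "test_fun D (psi n)" "C1c D (psi n)" for n using ps by blast+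
  show "null (%n. nrm (%x. psi n x - f x))"
   by (rule tendsto_sandwich[OF _ _ tendsto_const z]) (use ps in auto)
  show "null (%n. nrm (%x. pd (psi n) i x - pd f i x))" if "i : Basis" for i
   by (rule tendsto_sandwich[OF _ _ tendsto_const z]) (use ps that in auto)
 qed
qed

section \<open>Fundamental lemma, Riesz representation and the Dirichlet problem\<close>

lemma mult_cnj_cmod_sq: "z * cnj z = cor ((cmod z)^2)"
 by (rule complex_norm_square[symmetric])

text \<open>Boxes form an intersection-stable generator, so the integral of f vanishes on every
  Borel set. Applied to the sets where Re (c f) > 0 for c = 1, -1, i, -i, this leaves only f =
  0.\<close>

lemma AE_zero_of_box_integrals:
 fixes f :: "'a::euclidean_space => complex"
 assumes f: "intgl f" and box: "!!a b. (LINT x:box a b|lborel. f x) = 0" and all: "(LBINT x. f x) = 0"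
 shows "AEL x. f x = 0"
proof -
 note [measurable] = borel_measurable_integrable[OF f]
 have si: "set_integrable lborel A f" if "A : sets borel" for A
  unfolding set_integrable_def using f that by (intro integrable_mult_indicator) auto
 have P: "(LINT x:A|lborel. f x) = 0" if "A : sets borel" for A
 proof -
  let ?E = "range (%(a, b). box a b::'a set)"
  have bs: "sets borel = sigma_sets UNIV ?E" by (simp add: borel_eq_box)
  have "Int_stable ?E" by (auto simp: Int_stable_def box_Int_box)
  moreover have "?E <= Pow UNIV" by simp
  moreover have "A : sigma_sets UNIV ?E" using that bs by simp
  ultimately show ?thesis
  proof (induction rule: sigma_sets_induct_disjoint)
   case (basic A) then show ?case using box by auto
  next
   case empty show ?case by (simp add: set_lebesgue_integral_def)
  next
   case (compl A)
   then have A: "A : sets borel" using bs by simp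
   have "(LINT x:UNIV - A|lborel. f x) = (LBINT x. f x - indicator A x *R f x)"
    unfolding set_lebesgue_integral_def by (rule bint_cong) (auto simp: indicator_def)
   also have "... = 0" using f si[OF A] compl all unfolding set_integrable_def set_lebesgue_integral_def by simp
   finally show ?case .
  next
   case (union A)
   have A: "!!i. A i : sets borel" using union(2) bs by auto
   have "(LINT x:(\<Union>i. A i)|lborel. f x) = (\<Sum>i. (LINT x:A i|lborel. f x))"
   proof (rule lebesgue_integral_countable_add)
    show "A i \<inter> A j = {}" if "i ~= j" for i j using union(1) that by (auto simp: disjoint_family_on_def)
   qed (use A si in auto)
   then show ?case using union(3) by simp
  qed
 qed
 have le: "AEL x. Re (c * f x) <= 0" for c
 proof -
  define A where "A = {x. Re (c * f x) > 0}"
  have A: "A : sets borel" unfolding A_def by measurable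
  have i: "intgl (%x. indicator A x *R f x)" using si[OF A] by (simp add: set_integrable_def)
  have i2: "intgl (%x. Re (c * (indicator A x *R f x)))"
   using i by (intro integrable_Re integrable_mult_right)
  have "(LBINT x. Re (c * (indicator A x *R f x))) = Re (c * (LINT x:A|lborel. f x))"
   unfolding set_lebesgue_integral_def integral_Re[OF integrable_mult_right[OF i]]
   by (subst bint_mult_right[OF i]) (rule refl)
  then have z: "(LBINT x. Re (c * (indicator A x *R f x))) = 0" using P[OF A] by simp
  have "AEL x. Re (c * (indicator A x *R f x)) = 0"
   using z integral_nonneg_eq_0_iff_AE[OF i2] by (auto simp: A_def indicator_def)
  then show ?thesis by eventually_elim (auto simp: A_def indicator_def not_less split: if_splits)
 qed
 show ?thesis using le[of 1] le[of "-1"] le[of \<i>] le[of "-\<i>"]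
  by eventually_elim (simp add: complex_eq_iff)
qed

lemma sqi_indicator:
 assumes "A : sets M" "emeasure M A < \<infinity>" shows "sqiM M (%x. indicator A x)"
proof -
 have "(%x. (cmod (indicator A x))^2) = (%x. indicator A x :: real)" by (auto simp: indicator_def)
 then show ?thesis using assms by (simp add: sqiM_def)
qed

text \<open>The box bumps turn the hypothesis into vanishing integrals over all open boxes whose
  closed box lies in \<open>D\<close>, and countably many of these cover \<open>D\<close>.\<close>

lemma fundamental_lemma:
 fixes D :: "'a::euclidean_space set"
 assumes D: "open D" and g: "sqi g" and z: "!!ph. C1c D ph ==> (LBINT x. g x * ph x) = 0"
 shows "AEL x. x : D --> g x = 0"
proof -
 note [measurable] = sqi_meas[OF g]
 have ib: "intgl (%x. indicator A x *R g x)" if "A : sets borel" "bounded A" for A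
 proof -
  have "sqi (%x. indicator A x)"
   using that emeasure_bounded_finite[OF that(2)] by (intro sqi_indicator) auto
  from sqi_mult[OF this g] show ?thesis by (simp add: indicator_scaleR_eq_if indicator_times_eq_if)
 qed
 have b: "(LINT x:box l u|lborel. g x) = 0" if lu: "cbox l u <= D" for l u
 proof -
  obtain h where h: "!!n. C1u (h n)" "!!n x. 0 <= h n x" "!!n x. h n x <= 1"
   "!!n x. x ~: cbox l u ==> h n x = (0::real)" "!!x. incseq (%n. h n x)"
   "!!x. (%n. h n x) \<longlonglongrightarrow> indicator (box l u) x" using box_bump[of l u] by metis
  have hc: "C1c D (%x. cor (h n x))" for n
   by (rule C1c_of_real[OF h(1) compact_cbox lu h(4)])
  have [measurable]: "h n : mbl" for n
   by (intro mbl_cont C1_on_cont h)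
  have "(%n. LBINT x. g x * cor (h n x)) \<longlonglongrightarrow> (LBINT x. indicator (box l u) x *R g x)"
  proof (rule integral_dominated_convergence[where w = "%x. norm (indicator (cbox l u) x *R g x)"])
   show "intgl (%x. norm (indicator (cbox l u) x *R g x))" by (intro integrable_norm ib) auto
   show "AEL x. (%n. g x * cor (h n x)) \<longlonglongrightarrow> indicator (box l u) x *R g x"
   proof (rule AE_I2)
    fix x
    have "(%n. g x * cor (h n x)) \<longlonglongrightarrow> g x * cor (indicator (box l u) x)"
     by (intro tendsto_intros h(6))
    then show "(%n. g x * cor (h n x)) \<longlonglongrightarrow> indicator (box l u) x *R g x"
     by (simp add: scaleR_conv_of_real mult.commute)
   qed
   show "AEL x. norm (g x * cor (h n x)) <= norm (indicator (cbox l u) x *R g x)" for n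
   proof (rule AE_I2)
    fix x
    show "norm (g x * cor (h n x)) <= norm (indicator (cbox l u) x *R g x)"
     using h(2)[of n x] h(3)[of n x] h(4)[of x n]
     by (cases "x : cbox l u") (auto simp: norm_mult mult_left_le)
   qed
  qed measurable
  then show ?thesis using z[OF hc] by (simp add: set_lebesgue_integral_def LIMSEQ_const_iff)
 qed
 have ae: "AEL x. x : box l u --> g x = 0" if lu: "cbox l u <= D" for l u
 proof -
  have "AEL x. indicator (box l u) x *R g x = 0"
  proof (rule AE_zero_of_box_integrals)
   show "intgl (%x. indicator (box l u) x *R g x)" by (rule ib) auto
   show "(LBINT x. indicator (box l u) x *R g x) = 0" using b[OF lu] by (simp add: set_lebesgue_integral_def)
   fix a' b' :: 'a
   let ?l = "SB i. max (a' *. i) (l *. i) *R i" and ?u = "SB i. min (b' *. i) (u *. i) *R i"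
   have i: "box a' b' \<inter> box l u = box ?l ?u" by (rule box_Int_box)
   have "cbox ?l ?u <= D" using lu Int_interval[of a' b' l u] by auto
   from b[OF this] have "(LBINT x. indicator (box a' b' \<inter> box l u) x *R g x) = 0"
    unfolding i by (simp add: set_lebesgue_integral_def)
   then show "(LINT x:box a' b'|lborel. indicator (box l u) x *R g x) = 0"
    by (simp add: set_lebesgue_integral_def indicator_inter_arith)
  qed
  then show ?thesis by eventually_elim (auto simp: indicator_def split: if_splits)
 qed
 define \<F> where "\<F> = {box l u | l u :: 'a. cbox l u <= D}"
 obtain \<F>' where F': "\<F>' <= \<F>" "countable \<F>'" "\<Union>\<F>' = \<Union>\<F>"
  by (rule Lindelof[of \<F>]) (auto simp: \<F>_def)
 have cov: "D <= \<Union>\<F>"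
 proof
  fix x assume "x : D"
  then obtain a b where "x : box a b" "cbox a b <= D" using open_contains_cbox[OF D] by metis
  then show "x : \<Union>\<F>" unfolding \<F>_def by blast
 qed
 have "AEL x. ALL B:\<F>'. x : B --> g x = 0"
  using F'(1,2) ae by (subst AE_ball_countable) (auto simp: \<F>_def)
 moreover have "D <= \<Union>\<F>'" using cov F'(3) by simp
 ultimately show ?thesis by (elim eventually_mono) blast
qed

text \<open>Minimising \<open>B u u - 2 l u\<close>: the parallelogram law makes a minimising sequence Cauchy.\<close>
lemma quadratic_minimization:
 fixes B :: "('a => complex) => ('a => complex) => real" and l :: "('a => complex) => real"
 assumes V0: "V (%x. 0)" and V: "!!u v c. V u ==> V v ==> V (%x. u x + of_real c * v x)"
  and Bl: "!!u v w c. V u ==> V v ==> V w ==> B (%x. u x + of_real c * v x) w = B u w + c * B v w"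
  and Bs: "!!u v. V u ==> V v ==> B u v = B v u" and Bp: "!!u. V u ==> 0 <= B u u"
  and ll: "!!u v c. V u ==> V v ==> l (%x. u x + of_real c * v x) = l u + c * l v"
  and lb: "!!u. V u ==> \<bar>l u\<bar> <= C * sqrt (B u u)"
 obtains s where "!!n. V (s n)"
  "!!e. e > 0 ==> EX N. ALL n>=N. ALL m>=N. B (%x. s n x - s m x) (%x. s n x - s m x) < e"
  "!!v. V v ==> (%n. B (s n) v) \<longlonglongrightarrow> l v"
proof -
 have Br: "B w (%x. u x + of_real c * v x) = B w u + c * B w v" if "V u" "V v" "V w" for u v w c
  using Bl[OF that] Bs[OF V[OF that(1,2)] that(3)] Bs[OF that(1,3)] Bs[OF that(2,3)] by simp
 define J where "J = (%u. B u u - 2 * l u)"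
 have Jexp: "J (%x. u x + of_real c * v x) = J u + 2 * c * (B u v - l v) + c^2 * B v v" if "V u" "V v" for u v c
 proof -
  note w = V[OF that, of c]
  show ?thesis
   unfolding J_def Bl[OF that w] Br[OF that that(1)] Br[OF that that(2)] ll[OF that] Bs[OF that(2,1)]
   by (simp add: power2_eq_square algebra_simps)
 qed
 have low: "- (C^2) <= J u" if "V u" for u
 proof -
  have b: "(sqrt (B u u))^2 = B u u" using Bp[OF that] by simp
  have "- (C^2) <= (sqrt (B u u))^2 - 2 * (C * sqrt (B u u))"
   using zero_le_power2[of "sqrt (B u u) - C"] by (simp add: power2_eq_square algebra_simps)
  then show ?thesis unfolding J_def b using lb[OF that] by linarith
 qed
 define m where "m = Inf (J ` {u. V u})"
 have bdd: "bdd_below (J ` {u. V u})" using low by (auto intro!: bdd_belowI[of _ "- (C^2)"])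
 have mle: "m <= J u" if "V u" for u unfolding m_def using bdd that by (intro cInf_lower) auto
 define de where "de = (%n. inverse (real (Suc n)))"
 have de: "de n > 0" for n by (simp add: de_def)
 have de0: "de \<longlonglongrightarrow> 0" unfolding de_def by (rule LIMSEQ_inverse_real_of_nat)
 have "EX u. V u & J u < m + de n" for n
 proof -
  have "Inf (J ` {u. V u}) < m + de n" unfolding m_def[symmetric] using de[of n] by simp
  then show ?thesis using cInf_lessD[of "J ` {u. V u}" "m + de n"] V0 by blast
 qed
 then have "ALL n. EX u. V u & J u < m + de n" by blast
 from choice[OF this] obtain s where s: "!!n. V (s n)" "!!n. J (s n) < m + de n" by blast
 have diff: "V (%x. u x - v x)" if "V u" "V v" for u v using V[OF that, of "-1"] by simp
 have par: "B (%x. u x - v x) (%x. u x - v x) <= 2 * (J u - m) + 2 * (J v - m)" if uv: "V u" "V v" for u v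
 proof -
  let ?d = "%x. u x - v x"
  have d: "V ?d" by (rule diff[OF uv])
  have "v = (%x. u x + of_real (-1) * ?d x)" by auto
  then have Jv: "J v = J u - 2 * (B u ?d - l ?d) + B ?d ?d" using Jexp[OF uv(1) d, of "-1"] by simp
  \<comment> \<open>The midpoint of u and v still has energy at least m; together with
    \<open>Jv\<close> this is the parallelogram estimate.\<close>
  have "m <= J u + 2 * (- (1/2)) * (B u ?d - l ?d) + (1/2)^2 * B ?d ?d"
   using mle[OF V[OF uv(1) d, of "- (1/2)"]] Jexp[OF uv(1) d, of "- (1/2)"] by (simp add: power2_eq_square)
  then show ?thesis using Jv by (simp add: power2_eq_square)
 qed
 have conv: "(%n. B (s n) v) \<longlonglongrightarrow> l v" if v: "V v" for v
 proof -
  \<comment> \<open>With a the defect \<open>B (s n) v - l v\<close>, adding - a / b times v lowers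
    \<open>J\<close> by at least a^2 / b, which cannot exceed the distance of \<open>J (s n)\<close>
    from its infimum. The added 1 keeps b positive when \<open>B v v\<close> is 0.\<close>
  let ?b = "B v v + 1"
  have b: "?b > 0" "B v v >= 0" using Bp[OF v] by auto
  have sb: "norm (B (s n) v - l v) <= sqrt (?b * de n)" for n
  proof -
   let ?a = "B (s n) v - l v"
   have 1: "m <= J (s n) + 2 * (- ?a / ?b) * ?a + (- ?a / ?b)^2 * B v v"
    using mle[OF V[OF s(1) v, of n "- ?a / ?b"]] Jexp[OF s(1) v, of n "- ?a / ?b"] by simp
   have 2: "(- ?a / ?b)^2 * B v v <= (- ?a / ?b)^2 * ?b" by (intro mult_left_mono) auto
   have "2 * (- a / c) * a + (- a / c)^2 * c = - (a^2 / c)" if "c > 0" for a c :: real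
    using that by (simp add: power2_eq_square field_simps)
   from this[OF b(1)] have 3: "2 * (- ?a / ?b) * ?a + (- ?a / ?b)^2 * ?b = - (?a^2 / ?b)" .
   have "?a^2 / ?b <= de n" using 1 2 3 s(2)[of n] by linarith
   then have "?a^2 <= ?b * de n" using b(1) by (simp only: pos_divide_le_eq mult.commute)
   then have "sqrt (?a^2) <= sqrt (?b * de n)" by (rule real_sqrt_le_mono)
   then show ?thesis by (simp only: real_sqrt_abs real_norm_def)
  qed
  have lim: "null (%n. sqrt (?b * de n))"
   using tendsto_real_sqrt[OF tendsto_mult_right_zero[OF de0, of ?b]] by simp
  have "null (%n. B (s n) v - l v)"
   by (rule Lim_null_comparison[OF always_eventually[OF allI[OF sb]] lim])
  then show ?thesis by (rule LIM_zero_cancel)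
 qed
 have cau: "EX N. ALL n>=N. ALL k>=N. B (%x. s n x - s k x) (%x. s n x - s k x) < e" if e: "e > 0" for e
 proof -
  have "EV n. de n < e / 4" using order_tendstoD(2)[OF de0, of "e/4"] e by simp
  then obtain N where N: "!!n. n >= N ==> de n < e / 4" by (auto simp: eventually_sequentially)
  show ?thesis
  proof (intro exI[of _ N] allI impI)
   fix n k assume "N <= n" "N <= k"
   then have "de n < e / 4" "de k < e / 4" using N by auto
   then show "B (%x. s n x - s k x) (%x. s n x - s k x) < e"
   proof -
    have "J (s n) - m < e / 4" "J (s k) - m < e / 4"
     using \<open>de n < e / 4\<close> \<open>de k < e / 4\<close> s(2)[of n] s(2)[of k] by linarith+
    then have "2 * (J (s n) - m) + 2 * (J (s k) - m) < e" by argo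
    then show ?thesis using par[OF s(1) s(1), of n k] by (rule le_less_trans[rotated])
   qed
  qed
 qed
 show ?thesis by (rule that[OF s(1) cau conv])
qed

text \<open>The real part of the L^2 pairing is minimized over the test functions themselves, and
  only the limit of the minimizing sequence leaves them. Testing with i v recovers the imaginary
  part.\<close>

lemma C1c_Riesz:
 fixes D :: "'a::euclidean_space set" and l :: "('a => complex) => complex"
 assumes D: "open D" "bounded D"
  and ll: "!!u v c. C1c D u ==> C1c D v ==> l (%x. u x + c * v x) = l u + c * l v"
  and lb: "!!u. C1c D u ==> cmod (l u) <= C * nrm u"
 obtains h where "sqi h" "!!x. x ~: D ==> h x = 0" "!!u. C1c D u ==> l u = (LBINT x. h x * u x)"
proof -
 define B where "B = (%(u::'a => complex) v. Re (LBINT x. u x * cnj (v x)))"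
 have sq: "sqi u" "sqi (%x. cnj (u x))" if "C1c D u" for u
  using that by (auto intro: C1c_int sqi_cnj)
 have BB: "B u u = (nrm u)^2" for u
 proof -
  have "(%x. u x * cnj (u x)) = (%x. cor ((cmod (u x))^2))" by (rule ext) (rule mult_cnj_cmod_sq)
  then show ?thesis unfolding B_def nrm_sq by (simp only: integral_complex_of_real Re_complex_of_real)
 qed
 have int: "intgl (%x. u x * cnj (v x))" if "C1c D u" "C1c D v" for u v
  using sqi_mult sq that by blast
 obtain s where s: "!!n. C1c D (s n)"
  "!!e. e > 0 ==> EX N. ALL n>=N. ALL m>=N. B (%x. s n x - s m x) (%x. s n x - s m x) < e"
  "!!v. C1c D v ==> (%n. B (s n) v) \<longlonglongrightarrow> Re (l v)"
 proof (rule quadratic_minimization[of "C1c D" B "%v. Re (l v)" C])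
  show "C1c D (%x. u x + of_real c * v x)" if "C1c D u" "C1c D v" for u v c
   by (intro C1c_add C1c_cmult that)
  show "B (%x. u x + of_real c * v x) w = B u w + c * B v w" if "C1c D u" "C1c D v" "C1c D w" for u v w c
   unfolding B_def using int[OF that(1,3)] int[OF that(2,3)] by (simp add: distrib_right mult.assoc)
  show "B u v = B v u" if "C1c D u" "C1c D v" for u v
  proof -
   have "(LBINT x. v x * cnj (u x)) = cnj (LBINT x. u x * cnj (v x))"
    using bint_cnj[of lborel "%x. u x * cnj (v x)"] by (simp add: mult.commute)
   then show ?thesis unfolding B_def by simp
  qed
  show "0 <= B u u" for u by (simp add: BB)
  show "Re (l (%x. u x + of_real c * v x)) = Re (l u) + c * Re (l v)" if "C1c D u" "C1c D v" for u v c
   using ll[OF that, of "of_real c"] by simp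
  show "\<bar>Re (l u)\<bar> <= C * sqrt (B u u)" if "C1c D u" for u
   using lb[OF that] abs_Re_le_cmod[of "l u"] by (simp add: BB)
 qed auto
 have Ds: "D : sets lborel" "emeasure lborel D < \<infinity>" using emeasure_bounded_finite[OF D(2)] D(1) by auto
 obtain g where g: "sqi g" "null (%n. nrm (%x. s n x - g x))" "!!x. x ~: D ==> g x = 0"
 proof (rule sqi_complete[OF sq(1)[OF s(1)] Ds C1c_off[OF s(1)]])
  fix e :: real assume e: "e > 0"
  obtain N where N: "ALL n>=N. ALL m>=N. B (%x. s n x - s m x) (%x. s n x - s m x) < e^2" using s(2)[of "e^2"] e by auto
  show "EX N. ALL i>=N. ALL j>=N. nrm (%x. s i x - s j x) < e"
   using N e unfolding BB by (meson less_imp_le power2_less_imp_less)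
 qed (assumption | rule that)+
 have lim: "(%n. LBINT x. s n x * cnj (v x)) \<longlonglongrightarrow> (LBINT x. g x * cnj (v x))" if "C1c D v" for v
  by (rule tendsto_nrm_mult) (simp_all add: g sq[OF s(1)] sq[OF that])
 have re: "Re (LBINT x. g x * cnj (v x)) = Re (l v)" if "C1c D v" for v
  using LIMSEQ_unique[OF s(3)[OF that, unfolded B_def] tendsto_Re[OF lim[OF that]]] by simp
 have l0: "l (%x. 0) = 0" using lb[OF C1c_zero] by simp
 have eq: "l v = (LBINT x. cnj (g x) * v x)" if v: "C1c D v" for v
 proof -
  have igv: "intgl (%x. g x * cnj (v x))" by (rule sqi_mult[OF g(1) sq(2)[OF v]])
  have c: "(LBINT x. cnj (g x) * v x) = cnj (LBINT x. g x * cnj (v x))"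
   by (subst bint_cnj[symmetric]) simp
  have "l (%x. \<i> * v x) = \<i> * l v" using ll[OF C1c_zero v, of \<i>] l0 by simp
  moreover have "(LBINT x. g x * cnj (\<i> * v x)) = - \<i> * (LBINT x. g x * cnj (v x))"
   using igv by (simp add: mult.left_commute[of _ \<i>])
  ultimately have "Im (LBINT x. g x * cnj (v x)) = - Im (l v)" using re[OF C1c_cmult[OF v, of \<i>]] by simp
  then show ?thesis unfolding c using re[OF v] by (simp add: complex_eq_iff)
 qed
 show ?thesis by (rule that[of "%x. cnj (g x)"]) (use g sqi_cnj eq in auto)
qed

text \<open>The equation is tested with the conjugate of its own solution, and Cauchy-Schwarz bounds
  the right side.\<close>

lemma wlap_energy:
 assumes D: "open D" and q: "W D q Q" and F: "sqi F" and wl: "wlap D Q F"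
 shows "(SB i. (nrm (Q i))^2) <= nrm F * nrm q"
proof -
 have "(SB i. LBINT x. Q i x * cnj (Q i x)) = - (LBINT x. F x * cnj (q x))"
  by (rule wlap_W[OF WD(2)[OF q] F wl W_cnj[OF q]])
 moreover have "(LBINT x. Q i x * cnj (Q i x)) = cor ((nrm (Q i))^2)" for i
  unfolding nrm_sq mult_cnj_cmod_sq by (rule integral_complex_of_real)
 ultimately have "cor (SB i. (nrm (Q i))^2) = - (LBINT x. F x * cnj (q x))" by simp
 then have "\<bar>SB i. (nrm (Q i))^2\<bar> = cmod (LBINT x. F x * cnj (q x))"
  by (drule_tac arg_cong[where f = cmod]) (simp only: norm_of_real norm_minus_cancel)
 also have "... <= nrm F * nrm (%x. cnj (q x))" by (rule Cauchy_Schwarz_nrm[OF F sqi_cnj[OF WD(1)[OF q]]])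
 finally show ?thesis by (simp add: nrm_cnj)
qed

text \<open>The Dirichlet energy is minimized over C^1 functions with compact support. A Cauchy
  sequence in energy has Cauchy gradients, so \<open>W_complete\<close> supplies the limit; the
  bounds combine the energy identity with the Poincare inequality.\<close>

lemma Dirichlet_solve:
 fixes D :: "'a::euclidean_space set"
 assumes D: "open D" "bounded D"
 obtains C where "C > 0" "!!F. sqi F ==> EX q Q. W D q Q & wlap D Q F & nrm q <= C * nrm F \<and>
   (ALL i:Basis. nrm (Q i) <= C * nrm F)"
proof -
 obtain P where P: "P > 0" "!!u G i. W D u G ==> i : Basis ==> nrm u <= P * nrm (G i)"
  using W_Poincare[OF D(2)] by metis
 obtain j :: 'a where j: "j : Basis" using nonempty_Basis by blast
 have main: "EX q Q. W D q Q & wlap D Q F" if F: "sqi F" for F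
 proof -
  \<comment> \<open>The minus sign is that of \<open>wlap\<close>, where the right-hand side appears
    after one integration by parts.\<close>
  define l where "l = (%v. - (LBINT x. F x * cnj (v x)))"
  define Bc where "Bc = (%(u::'a => complex) v. SB i. LBINT x. pd u i x * cnj (pd v i x))"
  define B where "B = (%u v. Re (Bc u v))"
  have sq: "sqi u" "sqi (%x. cnj (u x))" "sqi (pd u i)" "sqi (%x. cnj (pd u i x))" if "C1c D u" for u i
   using that by (auto intro: C1c_int sqi_cnj)
  have BB: "B u u = (SB i. (nrm (pd u i))^2)" for u
  proof -
   have "(%x. pd u i x * cnj (pd u i x)) = (%x. cor ((cmod (pd u i x))^2))" for i
    by (rule ext) (rule mult_cnj_cmod_sq)
   then show ?thesis unfolding B_def Bc_def nrm_sq by (simp only: integral_complex_of_real Re_complex_of_real Re_sum)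
  qed
  have Bj: "nrm (pd u i) <= sqrt (B u u)" if "i : Basis" for u i
   unfolding BB using that by (intro real_le_rsqrt member_le_sum) auto
  have int: "intgl (%x. pd u i x * cnj (pd v i x))" if "C1c D u" "C1c D v" for u v i
   using sqi_mult sq that by blast
  have intF: "intgl (%x. F x * cnj (v x))" if "C1c D v" for v
   using sqi_mult[OF F] sq that by blast
  have pdl: "pd (%x. u x + c * v x) i x = pd u i x + c * pd v i x" if "C1c D u" "C1c D v" for u v c i x
   using C1_on_add(2)[OF C1c_C1[OF that(1)] C1c_C1[OF C1c_cmult[OF that(2)]], of x c i]
    C1_cmult_pd[OF C1c_C1[OF that(2)], of c x i] by simp
  have l0: "l (%x. u x + c * v x) = l u + cnj c * l v" if "C1c D u" "C1c D v" for u v c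
   unfolding l_def using intF[OF that(1)] intF[OF that(2)]
   by (simp add: distrib_left mult.left_commute[of _ "cnj c"])
  obtain s where s: "!!n. C1c D (s n)"
   "!!e. e > 0 ==> EX N. ALL n>=N. ALL m>=N. B (%x. s n x - s m x) (%x. s n x - s m x) < e"
   "!!v. C1c D v ==> (%n. B (s n) v) \<longlonglongrightarrow> Re (l v)"
  proof (rule quadratic_minimization[of "C1c D" B "%v. Re (l v)" "nrm F * P"])
   show "C1c D (%x. u x + of_real c * v x)" if "C1c D u" "C1c D v" for u v c
    by (intro C1c_add C1c_cmult that)
   show "B (%x. u x + of_real c * v x) w = B u w + c * B v w" if "C1c D u" "C1c D v" "C1c D w" for u v w c
    unfolding B_def Bc_def pdl[OF that(1,2)] using int[OF that(1,3)] int[OF that(2,3)]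
    by (simp add: distrib_right mult.assoc sum.distrib sum_distrib_left)
   show "B u v = B v u" if "C1c D u" "C1c D v" for u v
   proof -
    have "(LBINT x. pd v i x * cnj (pd u i x)) = cnj (LBINT x. pd u i x * cnj (pd v i x))" for i
     using bint_cnj[of lborel "%x. pd u i x * cnj (pd v i x)"] by (simp add: mult.commute)
    then show ?thesis unfolding B_def Bc_def by simp
   qed
   show "0 <= B u u" for u unfolding BB by (intro sum_nonneg) auto
   show "Re (l (%x. u x + of_real c * v x)) = Re (l u) + c * Re (l v)" if "C1c D u" "C1c D v" for u v c
    using l0[OF that, of "of_real c"] by simp
   show "\<bar>Re (l u)\<bar> <= nrm F * P * sqrt (B u u)" if u: "C1c D u" for u
   proof -
    have "\<bar>Re (l u)\<bar> <= cmod (l u)" by (rule abs_Re_le_cmod)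
    also have "... <= nrm F * nrm u"
     unfolding l_def using Cauchy_Schwarz_nrm[OF F sq(2)[OF u]] by (simp add: nrm_cnj)
    also have "... <= nrm F * (P * sqrt (B u u))"
     using P(2)[OF W_C1c[OF u] j] Bj[OF j, of u] P(1)
     by (intro mult_left_mono) (auto intro: order_trans mult_left_mono)
    finally show ?thesis by (simp add: mult.assoc)
   qed
  qed auto
  have pdd: "pd (%x. s n x - s m x) i x = pd (s n) i x - pd (s m) i x" for n m i x
   by (rule C1_on_diff(2)) (auto intro: C1c_C1 s)
  obtain q Q where q: "W D q Q" "null (%n. nrm (%x. s n x - q x))"
   "!!i. i : Basis ==> (%n. nrm (%x. pd (s n) i x - Q i x)) \<longlonglongrightarrow> 0"
  proof (rule W_complete[OF D(2,1) s(1)])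
   fix i :: 'a and e :: real assume i: "i : Basis" and e: "e > 0"
   obtain N where N: "ALL n>=N. ALL m>=N. B (%x. s n x - s m x) (%x. s n x - s m x) < e^2" using s(2)[of "e^2"] e by auto
   show "EX N. ALL n>=N. ALL m>=N. nrm (%x. pd (s n) i x - pd (s m) i x) < e"
   proof (intro exI[of _ N] allI impI)
    fix n m assume "N <= n" "N <= m"
    then have "sqrt (B (%x. s n x - s m x) (%x. s n x - s m x)) < e" using N e by (intro real_less_lsqrt) auto
    then show "nrm (%x. pd (s n) i x - pd (s m) i x) < e"
     using Bj[OF i, of "%x. s n x - s m x"] by (simp add: pdd)
   qed
  qed (rule that; assumption)
  have re: "Re (SB i. LBINT x. Q i x * cnj (pd v i x)) = Re (l v)" if v: "C1c D v" for v
  proof -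
   have "(%n. Bc (s n) v) \<longlonglongrightarrow> (SB i. LBINT x. Q i x * cnj (pd v i x))"
    unfolding Bc_def
    by (intro tendsto_sum tendsto_nrm_mult) (simp_all add: q sq[OF s(1)] sq[OF v] WD[OF q(1)])
   from LIMSEQ_unique[OF s(3)[OF v, unfolded B_def] tendsto_Re[OF this]] show ?thesis by simp
  qed
  have "wlap D Q F" unfolding wlap_def
  proof (intro allI impI)
   fix ph :: "'a => complex" assume ph: "C1c D ph"
   have v: "C1c D (%x. cnj (ph x))" by (rule C1c_cnj[OF ph])
   let ?S = "SB i. LBINT x. Q i x * pd ph i x" and ?T = "LBINT x. F x * ph x"
   have r: "Re ?S = Re (- ?T)" using re[OF v] by (simp add: C1_cnj_pd[OF C1c_C1[OF ph]] l_def)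
   have iv: "C1c D (%x. cnj (\<i> * ph x))" by (rule C1c_cnj[OF C1c_cmult[OF ph]])
   have pdi: "pd (%x. cnj (\<i> * ph x)) i x = cnj (\<i> * pd ph i x)" for i x
    using C1_cnj_pd[OF C1c_C1[OF C1c_cmult[OF ph, of \<i>]], of x i] C1_cmult_pd[OF C1c_C1[OF ph], of \<i> x i] by simp
   have "Re (\<i> * ?S) = Re (- (\<i> * ?T))"
    using re[OF iv] sqi_mult[OF F sq(1)[OF ph]] sqi_mult[OF WD(2)[OF q(1)] sq(3)[OF ph]]
    unfolding pdi l_def by (simp add: mult.left_commute[of _ \<i>] sum_distrib_left[symmetric])
   then show "?S = - ?T" using r by (simp add: complex_eq_iff)
  qed
  then show ?thesis using q(1) by blast
 qed
 \<comment> \<open>P bounds the derivatives and P * P the function; the sum serves for both.\<close>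
 show ?thesis
 proof (rule that[of "P + P * P"])
  show "P + P * P > 0" using P(1) by (simp add: add_pos_pos)
  fix F :: "'a => complex" assume F: "sqi F"
  obtain q Q where q: "W D q Q" "wlap D Q F" using main[OF F] by blast
  have qle: "nrm q <= P * nrm (Q j)" by (rule P(2)[OF q(1) j])
  note en = wlap_energy[OF D(1) q(1) F q(2)]
  have sq: "(nrm (Q i))^2 <= nrm F * (P * nrm (Q j))" if "i : Basis" for i
  proof -
   have "(nrm (Q i))^2 <= (SB i. (nrm (Q i))^2)" using that by (intro member_le_sum) auto
   also have "... <= nrm F * nrm q" by (rule en)
   also have "... <= nrm F * (P * nrm (Q j))" by (rule mult_left_mono[OF qle]) simp
   finally show ?thesis .
  qed
  have Qj: "nrm (Q j) <= P * nrm F"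
  proof (cases "nrm (Q j) = 0")
   case False
   then have "0 < nrm (Q j)" using nrm_nonneg[of lborel "Q j"] by linarith
   moreover have "nrm (Q j) * nrm (Q j) <= (P * nrm F) * nrm (Q j)"
    using sq[OF j] by (simp only: power2_eq_square mult_ac)
   ultimately show ?thesis by (metis mult_right_le_imp_le)
  qed (use P(1) in auto)
  have Qi: "nrm (Q i) <= P * nrm F" if "i : Basis" for i
  proof (rule power2_le_imp_le)
   have "(nrm (Q i))^2 <= nrm F * (P * (P * nrm F))"
    using sq[OF that] Qj P(1) by (meson less_imp_le mult_left_mono nrm_nonneg order_trans)
   then show "(nrm (Q i))^2 <= (P * nrm F)^2" by (simp add: power2_eq_square mult_ac)
  qed (use P(1) in auto)
  have "nrm q <= P * (P * nrm F)" using qle Qj P(1) by (meson less_imp_le mult_left_mono order_trans)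
  moreover have "P * nrm F >= 0" "P * (P * nrm F) >= 0" using P(1) by auto
  ultimately show "EX q Q. W D q Q & wlap D Q F & nrm q <= (P + P * P) * nrm F \<and>
   (ALL i:Basis. nrm (Q i) <= (P + P * P) * nrm F)"
   using q Qi by (intro exI[of _ q] exI[of _ Q]) (force simp: distrib_right mult.assoc)
 qed
qed

section \<open>Tangential difference quotients and local second derivatives\<close>

lemma W_mono: "W E z G ==> E <= D ==> W D z G"
 unfolding W_def by (meson C1c_mono subsetD)

lemma nrm_dirG_le:
 assumes "!!i. i : Basis ==> sqi (G i)" and N: "!!i. i : Basis ==> nrm (G i) <= N"
 shows "nrm (dirG G (a::'a::euclidean_space)) <= norm a * (real DIM('a) * N)"
proof -
 have "nrm (dirG G a) <= (SB i. nrm (%x. of_real (a *. i) * G i x))"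
  unfolding dirG_def[abs_def] by (intro nrm_sum_le sqi_cmult assms)
 also have "... <= (\<Sum>i\<in>(Basis::'a set). norm a * N)"
  unfolding nrm_cmult norm_of_real by (intro sum_mono mult_mono N Basis_le_norm) auto
 finally show ?thesis by (simp add: algebra_simps)
qed

context shear_flow begin

text \<open>The derivative of \<open>Fl (-h)\<close> at \<open>Fl h x\<close> inverts v -> v + k(v)
  e, and the inverse is v -> v - k(v) e because ga is constant along e.\<close>

lemma KFl_inverse: "KFl (-h) i (Fl h x) = - KFl h i x"
proof -
 have inv: "pd ga i (y + s *R e) = pd ga i y" for y s
  using gamma_shift(2)[of "s *R e" y i] by (simp add: ge)
 have 1: "pd ga i (Fl h x) = pd ga i (x + h *R ta)" unfolding Fl_def by (rule inv)
 have "Fl h x + (-h) *R ta = x + (ga (x + h *R ta) - ga x) *R e" by (simp add: Fl_def)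
 then have 2: "pd ga i (Fl h x + (-h) *R ta) = pd ga i x" by (simp only: inv)
 show ?thesis unfolding KFl_def[of "-h"] 1 2 by (simp add: KFl_def)
qed

lemma pd_gamma_e: "pd ga e x = 0"
proof -
 have "((%s. ga (x + s *R e)) has_derivative (%s. pd ga (s *R e) x)) (at 0)"
  by (rule has_derivative_compose[of "%s. x + s *R e" "%s. s *R e" 0 UNIV ga, simplified])
    (auto intro!: derivative_eq_intros C1_on_has_derivative[OF gC, simplified])
 then have "((%s. ga x) has_derivative (%s. pd ga (s *R e) x)) (at 0)" by (simp add: ge)
 then have "(%s. pd ga (s *R e) x) = (%s::real. 0)"
  using has_derivative_unique has_derivative_const by blast
 then show ?thesis by (metis scaleR_one)
qed

text \<open>The equation is tested with v, the difference of z along \<open>Fl h\<close>, and with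
  v', minus its difference along \<open>Fl (-h)\<close>; both lie in H^1_0(D) by
  \<open>stab\<close>. A change of variables in the second and a subtraction leave the energy of v
  on one side. On the other stand f paired with v - v', itself a difference of v along the flow, and
  terms containing \<open>KFl\<close>. All of these are at most a constant times |h| times the
  square root of the energy; one such root cancels, and the bound is linear in h.\<close>

lemma flow_energy_estimate:
 assumes D: "open D" and z: "W E z G" and ED: "E <= D" and f: "sqi f" and wl: "wlap D G f"
  and h0: "h0 > 0" and stab: "!!h x. \<bar>h\<bar> <= h0 ==> x : E ==> Fl h x : D"
  and M: "!!x h i. x : D ==> \<bar>h\<bar> <= h0 ==> i : Basis ==> \<bar>KFl h i x\<bar> <= M * \<bar>h\<bar>"
   "!!x. x : D ==> \<bar>pd ga ta x\<bar> <= M" "0 <= M"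
 obtains C where "C >= 0" "!!h i. \<bar>h\<bar> <= h0 ==> i : Basis ==> nrm (%x. G i (Fl h x) - G i x) <= C * \<bar>h\<bar>"
proof -
 let ?d = "real DIM('a)"
 have zD: "W D z G" by (rule W_mono[OF z ED])
 have Gs: "sqi (G i)" if "i : Basis" for i using WD(2)[OF z that] .
 have dGs: "sqi (dirG G a)" for a by (rule W_sqi_dirG[OF z])
 define g where "g = (SB i. nrm (G i))"
 have g: "nrm (G i) <= g" if "i : Basis" for i unfolding g_def using that by (intro member_le_sum) auto
 have g0: "g >= 0" unfolding g_def by (intro sum_nonneg) auto
 define g' where "g' = norm e * (?d * g)"
 have g': "nrm (dirG G e) <= g'" unfolding g'_def by (rule nrm_dirG_le[OF Gs g])
 have g'0: "g' >= 0" unfolding g'_def using g0 by simp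
 \<comment> \<open>Three contributions: f against the second difference, and the two errors in which
   \<open>KFl\<close> multiplies a derivative of z.\<close>
 define K where "K = nrm f * (norm ta * ?d + M * (norm e * ?d)) + ?d * (M * g * (norm e * ?d)) + ?d * (M * g')"
 have K0: "K >= 0" unfolding K_def using M(3) g0 g'0 by (intro add_nonneg_nonneg mult_nonneg_nonneg) auto
 have Kb: "sqi (%x. of_real (KFl h i x) * a (Fl h x))"
  "nrm (%x. of_real (KFl h i x) * a (Fl h x)) <= M * \<bar>h\<bar> * nrm a"
  if "sqi a" "!!x. x ~: E ==> a x = 0" "i : Basis" "\<bar>h\<bar> <= h0" for h i a
 proof -
  have ah: "sqi (%x. a (Fl h x))" "nrm (%x. a (Fl h x)) = nrm a" using that(1) sqi_flow nrm_flow by auto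
  have [measurable]: "KFl h i : mbl"
   unfolding KFl_def[abs_def]
   by (intro mbl_cont continuous_intros C1_on_cont_pd[OF gC]
     continuous_on_compose2[OF C1_on_cont_pd[OF gC]]) auto
  note [measurable] = sqi_meas[OF ah(1)]
  have "cmod (of_real (KFl h i x) * a (Fl h x)) <= M * \<bar>h\<bar> * cmod (a (Fl h x))" for x
  proof (cases "Fl h x : E")
   case True
   have "x : D" using stab[of "-h" "Fl h x"] True that(4) by (simp add: flow_add)
   then show ?thesis using M(1)[OF _ that(4,3), of x] by (simp add: norm_mult mult_right_mono)
  qed (simp add: that(2))
  then show "sqi (%x. of_real (KFl h i x) * a (Fl h x))"
  "nrm (%x. of_real (KFl h i x) * a (Fl h x)) <= M * \<bar>h\<bar> * nrm a"
   using sqi_bound[OF ah(1), of "%x. of_real (KFl h i x) * a (Fl h x)" "M * \<bar>h\<bar>"] ah(2) M(3) by auto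
 qed
 have main: "nrm (%x. G i (Fl h x) - G i x) <= (K + M * g') * \<bar>h\<bar>" if h: "\<bar>h\<bar> <= h0" and i0: "i : Basis" for h i
 proof -
  have h': "\<bar>-h\<bar> <= h0" using h by simp
  define A where "A = (%i x. G i (Fl h x) + of_real (KFl h i x) * dirG G e (Fl h x))"
  define V where "V = (%i x. A i x - G i x)"
  define v where "v = (%x. z (Fl h x) - z x)"
  define U where "U = (%i x. G i x - (G i (Fl (-h) x) + of_real (KFl (-h) i x) * dirG G e (Fl (-h) x)))"
  define v' where "v' = (%x. z x - z (Fl (-h) x))"
  have Wz: "W D (%x. z (Fl s x)) (%i x. G i (Fl s x) + of_real (KFl s i x) * dirG G e (Fl s x))" if s: "\<bar>s\<bar> <= h0" for s
  proof (rule W_flow[OF z, where M = "M * \<bar>s\<bar>"])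
   show "Fl (-s) x : D" if "x : E" for x using stab[of "-s"] s that by simp
  qed (use M(1)[OF _ s] M(3) in auto)
  have Wv: "W D v V" unfolding v_def V_def A_def by (rule W_diff[OF Wz[OF h] zD])
  have Wv': "W D v' U" unfolding v'_def U_def by (rule W_diff[OF zD Wz[OF h']])
  have Vs: "sqi (V i)" if "i : Basis" for i using WD(2)[OF Wv that] .
  have Us: "sqi (U i)" if "i : Basis" for i using WD(2)[OF Wv' that] .
  have e1: "(SB i. LBINT x. G i x * cnj (V i x)) = - (LBINT x. f x * cnj (v x))"
   by (rule wlap_W[OF Gs f wl W_cnj[OF Wv]])
  have e2: "(SB i. LBINT x. G i x * cnj (U i x)) = - (LBINT x. f x * cnj (v' x))"
   by (rule wlap_W[OF Gs f wl W_cnj[OF Wv']])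
  have Ve: "dirG V e x = dirG G e (Fl h x) - dirG G e x" for x
  proof -
   \<comment> \<open>The sum is \<open>KFl\<close> in the direction e, which vanishes because ga
     does not change along e.\<close>
   have "(SB i. (e *. i) * KFl h i x) = 0"
    using pd_Basis_sum[OF gC UNIV_I, of "x + h *R ta" e] pd_Basis_sum[OF gC UNIV_I, of x e]
    by (simp add: KFl_def right_diff_distrib sum_subtractf pd_gamma_e)
   then have z0: "(SB i. cor (e *. i) * of_real (KFl h i x)) = 0"
    by (metis (no_types, lifting) of_real_0 of_real_mult of_real_sum sum.cong)
   have "dirG V e x = dirG G e (Fl h x) + (SB i. cor (e *. i) * of_real (KFl h i x)) * dirG G e (Fl h x) - dirG G e x"
   proof -
    have "(SB i. of_real (e *. i) * (a i + k i * c - b i)) =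
     (SB i. of_real (e *. i) * a i) + (SB i. of_real (e *. i) * k i) * c - (SB i. of_real (e *. i) * b i)"
     for a b k :: "'a => complex" and c
     by (simp add: algebra_simps sum.distrib sum_subtractf sum_distrib_left)
    from this[of "%i. G i (Fl h x)" "%i. of_real (KFl h i x)" "dirG G e (Fl h x)" "%i. G i x"]
    show ?thesis by (simp only: dirG_def V_def A_def)
   qed
   then show ?thesis by (simp add: z0)
  qed
  \<comment> \<open>At the point \<open>Fl h x\<close> the gradient of v' is that of v at x up to a
    \<open>KFl\<close> term; this is what the change of variables in \<open>dec\<close>
    uses.\<close>
  have UV: "U i (Fl h x) = V i x - of_real (KFl h i x) * dirG V e x" for i x
   unfolding U_def V_def A_def Ve[unfolded V_def A_def] by (simp add: KFl_inverse flow_add algebra_simps)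
  define N where "N = sqrt (SB i. (nrm (V i))^2)"
  have N0: "N >= 0" unfolding N_def by (intro real_sqrt_ge_zero sum_nonneg) auto
  have VN: "nrm (V i) <= N" if "i : Basis" for i
   unfolding N_def using that by (intro real_le_rsqrt member_le_sum) auto
  have VaN: "nrm (dirG V a) <= norm a * (?d * N)" for a by (rule nrm_dirG_le[OF Vs VN])
  have dVs: "sqi (dirG V a)" for a by (rule W_sqi_dirG[OF Wv])
  have N2: "cor (N^2) = (SB i. LBINT x. V i x * cnj (V i x))"
  proof -
   have "N^2 = (SB i. (nrm (V i))^2)" unfolding N_def by (intro real_sqrt_pow2 sum_nonneg) auto
   then show ?thesis unfolding nrm_sq mult_cnj_cmod_sq integral_complex_of_real by (simp only: of_real_sum)
  qed
  let ?k = "%i a x. cor (KFl h i x) * a (Fl h x)"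
  have kG: "sqi (?k i (G j))" "nrm (?k i (G j)) <= M * \<bar>h\<bar> * g" if "i : Basis" "j : Basis" for i j
   using Kb(1)[OF Gs[OF that(2)] WD(4)[OF z _ that(2)] that(1) h]
    order_trans[OF Kb(2)[OF Gs[OF that(2)] WD(4)[OF z _ that(2)] that(1) h] mult_left_mono[OF g[OF that(2)]]] M(3)
   by simp_all
  have ke: "sqi (?k i (dirG G e))" "nrm (?k i (dirG G e)) <= M * \<bar>h\<bar> * g'" if "i : Basis" for i
   using Kb(1)[OF dGs W_dirG_off[OF z] that h] order_trans[OF Kb(2)[OF dGs W_dirG_off[OF z] that h] mult_left_mono[OF g']] M(3)
   by simp_all
  have dec: "(LBINT x. V i x * cnj (V i x)) = (LBINT x. G i x * cnj (U i x)) + (LBINT x. ?k i (G i) x * cnj (dirG V e x))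
    + (LBINT x. ?k i (dirG G e) x * cnj (V i x)) - (LBINT x. G i x * cnj (V i x))" if i: "i : Basis" for i
  proof -
   note [measurable] = sqi_meas[OF Gs[OF i]] sqi_meas[OF sqi_cnj[OF Us[OF i]]]
   have "(LBINT x. G i x * cnj (U i x)) = (LBINT x. G i (Fl h x) * cnj (U i (Fl h x)))"
    using integral_flow[of "%x. G i x * cnj (U i x)" h] by simp
   also have "... = (LBINT x. G i (Fl h x) * cnj (V i x) - ?k i (G i) x * cnj (dirG V e x))"
    unfolding UV by (simp add: algebra_simps)
   also have "... = (LBINT x. G i (Fl h x) * cnj (V i x)) - (LBINT x. ?k i (G i) x * cnj (dirG V e x))"
    by (intro bint_diff sqi_mult sqi_cnj sqi_flow Gs i Vs kG dVs)
   finally have 1: "(LBINT x. G i (Fl h x) * cnj (V i x)) = (LBINT x. G i x * cnj (U i x)) + (LBINT x. ?k i (G i) x * cnj (dirG V e x))"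
    by simp
   have "(LBINT x. V i x * cnj (V i x)) = (LBINT x. G i (Fl h x) * cnj (V i x) + ?k i (dirG G e) x * cnj (V i x) - G i x * cnj (V i x))"
    by (rule bint_cong) (auto simp: V_def A_def algebra_simps)
   also have "... = (LBINT x. G i (Fl h x) * cnj (V i x)) + (LBINT x. ?k i (dirG G e) x * cnj (V i x)) - (LBINT x. G i x * cnj (V i x))"
   proof -
    have "intgl (%x. G i (Fl h x) * cnj (V i x))" "intgl (%x. ?k i (dirG G e) x * cnj (V i x))"
     "intgl (%x. G i x * cnj (V i x))"
     by (intro sqi_mult sqi_cnj sqi_flow Gs i Vs ke)+
    then show ?thesis by simp
   qed
   finally show ?thesis unfolding 1 .
  qed
  have fv: "(LBINT x. f x * cnj (v x)) - (LBINT x. f x * cnj (v' x)) = (LBINT x. f x * cnj (v x - v' x))"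
   using sqi_mult[OF f sqi_cnj[OF WD(1)[OF Wv]]] sqi_mult[OF f sqi_cnj[OF WD(1)[OF Wv']]]
   by (simp add: algebra_simps)
  have "cor (N^2) = (LBINT x. f x * cnj (v x - v' x))
    + (SB i. LBINT x. ?k i (G i) x * cnj (dirG V e x)) + (SB i. LBINT x. ?k i (dirG G e) x * cnj (V i x))"
   unfolding N2 using e1 e2 fv by (simp add: dec sum.distrib sum_subtractf)
  then have "N^2 = cmod ((LBINT x. f x * cnj (v x - v' x))
    + (SB i. LBINT x. ?k i (G i) x * cnj (dirG V e x)) + (SB i. LBINT x. ?k i (dirG G e) x * cnj (V i x)))"
   by (metis abs_power2 norm_of_real)
  also have "... <= cmod (LBINT x. f x * cnj (v x - v' x))
    + (SB i. cmod (LBINT x. ?k i (G i) x * cnj (dirG V e x))) + (SB i. cmod (LBINT x. ?k i (dirG G e) x * cnj (V i x)))"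
   by (intro norm_triangle_mono norm_sum order_refl)
  also have "... <= nrm f * (\<bar>h\<bar> * (norm ta * (?d * N) + M * (norm e * (?d * N))))
    + (\<Sum>i\<in>(Basis::'a set). M * \<bar>h\<bar> * g * (norm e * (?d * N))) + (\<Sum>i\<in>(Basis::'a set). M * \<bar>h\<bar> * g' * N)"
  proof (intro add_mono sum_mono)
   \<comment> \<open>v' is v transported by the flow, so v - v' is a first difference of v and
     contributes one factor |h|.\<close>
   have vv': "v' x = v (Fl (-h) x)" for x by (simp add: v_def v'_def flow_add)
   have "nrm (%x. v x - v' x) = nrm (%x. v (Fl (-h) x) - v x)"
    unfolding vv' by (rule nrm_minus_commute)
   also have "... <= \<bar>-h\<bar> * (nrm (dirG V ta) + M * nrm (dirG V e))"
    by (rule nrm_flow_diff_W[OF Wv M(2,3)])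
   also have "... <= \<bar>h\<bar> * (norm ta * (?d * N) + M * (norm e * (?d * N)))"
    unfolding abs_minus_cancel by (intro mult_left_mono add_mono VaN M) auto
   finally have b: "nrm (%x. v x - v' x) <= \<bar>h\<bar> * (norm ta * (?d * N) + M * (norm e * (?d * N)))" .
   have "cmod (LBINT x. f x * cnj (v x - v' x)) <= nrm f * nrm (%x. cnj (v x - v' x))"
    by (intro Cauchy_Schwarz_nrm f sqi_cnj sqi_diff WD(1)[OF Wv] WD(1)[OF Wv'])
   also have "... <= nrm f * (\<bar>h\<bar> * (norm ta * (?d * N) + M * (norm e * (?d * N))))"
    unfolding nrm_cnj by (rule mult_left_mono[OF b]) simp
   finally show "cmod (LBINT x. f x * cnj (v x - v' x)) <= nrm f * (\<bar>h\<bar> * (norm ta * (?d * N) + M * (norm e * (?d * N))))" .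
   fix i :: 'a assume i: "i : Basis"
   have "cmod (LBINT x. ?k i (G i) x * cnj (dirG V e x)) <= nrm (?k i (G i)) * nrm (%x. cnj (dirG V e x))"
    by (intro Cauchy_Schwarz_nrm kG i sqi_cnj dVs)
   also have "... <= M * \<bar>h\<bar> * g * (norm e * (?d * N))"
    unfolding nrm_cnj using M(3) g0 by (intro mult_mono kG i VaN) auto
   finally show "cmod (LBINT x. ?k i (G i) x * cnj (dirG V e x)) <= M * \<bar>h\<bar> * g * (norm e * (?d * N))" .
   have "cmod (LBINT x. ?k i (dirG G e) x * cnj (V i x)) <= nrm (?k i (dirG G e)) * nrm (%x. cnj (V i x))"
    by (intro Cauchy_Schwarz_nrm ke i sqi_cnj Vs)
   also have "... <= M * \<bar>h\<bar> * g' * N"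
    unfolding nrm_cnj using M(3) g'0 by (intro mult_mono ke i VN) auto
   finally show "cmod (LBINT x. ?k i (dirG G e) x * cnj (V i x)) <= M * \<bar>h\<bar> * g' * N" .
  qed
  also have "... = K * \<bar>h\<bar> * N" unfolding K_def by (simp add: algebra_simps)
  finally have "N^2 <= K * \<bar>h\<bar> * N" .
  then have NK: "N <= K * \<bar>h\<bar>"
  proof (cases "N = 0")
   case False
   then have "N > 0" using N0 by simp
   moreover have "N * N <= (K * \<bar>h\<bar>) * N" using \<open>N^2 <= K * \<bar>h\<bar> * N\<close> by (simp only: power2_eq_square)
   ultimately show ?thesis by (metis mult_right_le_imp_le)
  qed (use K0 in simp)
  have "(%x. G i (Fl h x) - G i x) = (%x. V i x - ?k i (dirG G e) x)" by (simp add: V_def A_def fun_eq_iff)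
  then have "nrm (%x. G i (Fl h x) - G i x) <= nrm (V i) + nrm (?k i (dirG G e))"
   using nrm_diff_triangle[OF Vs[OF i0] ke(1)[OF i0]] by simp
  also have "... <= K * \<bar>h\<bar> + M * \<bar>h\<bar> * g'" by (intro add_mono order_trans[OF VN[OF i0] NK] ke i0)
  finally show ?thesis by (simp add: algebra_simps)
 qed
 show ?thesis by (rule that[of "K + M * g'"]) (use main K0 M(3) g'0 in auto)
qed

lemma flow_diff_integral_tendsto:
 assumes ph: "C1c D ph" and a: "sqi a"
 shows "(%n. LBINT x. a x * (of_nat (Suc n) * (ph (Fl (h / real (Suc n)) x) - ph x)))
  \<longlonglongrightarrow> (LBINT x. a x * (of_real h * pd ph (t x) x))"
proof -
 note [measurable] = sqi_meas[OF a] C1c_mbl[OF ph] sqi_meas[OF nrm_flow_diff_C1c(2)[OF ph]]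
 obtain B where B: "B >= 0" "!!h x. cmod (ph (Fl h x) - ph x) <= B * \<bar>h\<bar>" using flow_diff_pointwise[OF ph] by metis
 obtain S where S: "compact S" "!!x k. x ~: S ==> \<bar>k\<bar> <= \<bar>h\<bar> ==> ph (Fl k x) = 0"
  using flow_diff_supp[OF ph, of "\<bar>h\<bar>"] by metis
 have iS: "sqi (%x. indicator S x)"
  using emeasure_compact_finite[OF S(1)] borel_closed[OF compact_imp_closed[OF S(1)]] by (intro sqi_indicator) auto
 let ?k = "%n. h / real (Suc n)"
 have kb: "\<bar>?k n\<bar> <= \<bar>h\<bar>" for n by (simp add: field_simps)
 define F where "F = (%n x. a x * (of_nat (Suc n) * (ph (Fl (?k n) x) - ph x)))"
 have "(%n. LBINT x. F n x) \<longlonglongrightarrow> (LBINT x. a x * (of_real h * pd ph (t x) x))"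
 proof (rule integral_dominated_convergence[where w = "%x. norm (a x * indicator S x) * (B * \<bar>h\<bar>)"])
  show "intgl (%x. norm (a x * indicator S x) * (B * \<bar>h\<bar>))"
   by (intro integrable_mult_left integrable_norm sqi_mult[OF a iS])
  show "AEL x. (%n. F n x) \<longlonglongrightarrow> a x * (of_real h * pd ph (t x) x)"
   unfolding F_def by (intro AE_I2 tendsto_mult_left flow_diff_tendsto[OF ph])
  show "AEL x. norm (F n x) <= norm (a x * indicator S x) * (B * \<bar>h\<bar>)" for n
  proof (rule AE_I2)
   fix x
   show "norm (F n x) <= norm (a x * indicator S x) * (B * \<bar>h\<bar>)"
   proof (cases "x : S")
    case True
    have "cmod (of_nat (Suc n) * (ph (Fl (?k n) x) - ph x)) <= real (Suc n) * (B * \<bar>?k n\<bar>)"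
     unfolding norm_mult norm_of_nat by (intro mult_left_mono B) auto
    also have "... = B * \<bar>h\<bar>" by (simp del: of_nat_Suc)
    finally have *: "cmod (of_nat (Suc n) * (ph (Fl (?k n) x) - ph x)) <= B * \<bar>h\<bar>" .
    show ?thesis using mult_left_mono[OF *, of "cmod (a x)"] True unfolding F_def by (simp add: norm_mult del: of_nat_Suc)
   next
    case False
    then show ?thesis using S(2)[OF False kb[of n]] S(2)[OF False, of 0] by (simp add: F_def)
   qed
  qed
  show "F n : lmbl" for n unfolding F_def by measurable
 qed measurable
 then show ?thesis unfolding F_def .
qed

text \<open>The derivative of ph along the flow is a limit of difference quotients, and invariance
  of the measure moves each difference from ph to a, where it is bounded by assumption. Hence a has
  a weak derivative along the flow in L^2, expressed as a bounded functional.\<close>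

lemma flow_weak_derivative_bound:
 assumes ph: "C1c D ph" and a: "sqi a" and h1: "h1 > 0" and C: "C >= 0"
  "!!h. \<bar>h\<bar> <= h1 ==> nrm (%x. a (Fl h x) - a x) <= C * \<bar>h\<bar>"
 shows "cmod (LBINT x. a x * (pd ph ta x + of_real (pd ga ta x) * pd ph e x)) <= C * nrm ph"
proof -
 have fs: "sqi ph" by (rule C1c_int[OF ph])
 have lin: "pd ph (t x) x = pd ph ta x + of_real (pd ga ta x) * pd ph e x" for x
  using pd_linear[OF C1c_C1[OF ph] UNIV_I] by (simp add: t_def linear_add linear_cmul scaleR_conv_of_real)
 \<comment> \<open>The negative step becomes the positive step h1 / (n + 1) once the shift has moved
   to a.\<close>
 let ?k = "%n. - h1 / real (Suc n)"
 define F where "F = (%n x. a x * (of_nat (Suc n) * (ph (Fl (?k n) x) - ph x)))"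
 have lim: "(%n. LBINT x. F n x) \<longlonglongrightarrow> (LBINT x. a x * (of_real (- h1) * pd ph (t x) x))"
  unfolding F_def by (rule flow_diff_integral_tendsto[OF ph a])
 note [measurable] = sqi_meas[OF a] C1c_mbl[OF ph]
 have bd: "cmod (LBINT x. F n x) <= C * h1 * nrm ph" for n
 proof -
  let ?h = "h1 / real (Suc n)"
  have hb: "\<bar>?h\<bar> <= h1" using h1 by (simp add: field_simps)
  have i1: "intgl (%x. a x * ph x)" by (rule sqi_mult[OF a fs])
  have i2: "intgl (%x. a x * ph (Fl (?k n) x))" by (rule sqi_mult[OF a sqi_flow[OF fs]])
  have i3: "intgl (%x. a (Fl ?h x) * ph x)" by (rule sqi_mult[OF sqi_flow[OF a] fs])
  have "(LBINT x. F n x) = of_nat (Suc n) * (LBINT x. a x * ph (Fl (?k n) x) - a x * ph x)"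
   unfolding F_def by (simp add: algebra_simps flip: bint_mult_right_zero)
  also have "(LBINT x. a x * ph (Fl (?k n) x) - a x * ph x) = (LBINT x. a x * ph (Fl (?k n) x)) - (LBINT x. a x * ph x)"
   by (rule bint_diff[OF i2 i1])
  also have "(LBINT x. a x * ph (Fl (?k n) x)) = (LBINT x. a (Fl ?h x) * ph x)"
   using integral_flow[of "%x. a x * ph (Fl (?k n) x)" ?h] by (simp add: flow_add)
  also have "... - (LBINT x. a x * ph x) = (LBINT x. (a (Fl ?h x) - a x) * ph x)"
   unfolding left_diff_distrib by (rule bint_diff[OF i3 i1, symmetric])
  finally have "cmod (LBINT x. F n x) = real (Suc n) * cmod (LBINT x. (a (Fl ?h x) - a x) * ph x)"
   by (simp only: norm_mult norm_of_nat)
  also have "... <= real (Suc n) * ((C * \<bar>?h\<bar>) * nrm ph)"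
   by (intro mult_left_mono order_trans[OF Cauchy_Schwarz_nrm] mult_right_mono C(2) hb sqi_diff sqi_flow a fs) auto
  also have "... = C * h1 * nrm ph" using h1 by (simp del: of_nat_Suc)
  finally show ?thesis .
 qed
 have "cmod (LBINT x. a x * (of_real (- h1) * pd ph (t x) x)) <= C * h1 * nrm ph"
  by (rule LIMSEQ_le_const2[OF tendsto_norm[OF lim]]) (use bd in blast)
 moreover have "(LBINT x. a x * (of_real (- h1) * pd ph (t x) x)) = of_real (- h1) * (LBINT x. a x * pd ph (t x) x)"
  by (simp only: mult.left_commute[of _ "of_real (- h1)"] bint_mult_right_zero)
 ultimately have "h1 * cmod (LBINT x. a x * pd ph (t x) x) <= h1 * (C * nrm ph)"
  using h1 by (simp add: norm_mult algebra_simps)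
 then show ?thesis using h1 unfolding lin by simp
qed

end

text \<open>Second derivatives of C^1 functions need not exist. The derivative along b is therefore
  replaced by difference quotients, integration by parts along a is applied to these, and the shift
  is moved to the other function.\<close>

lemma mixed_partials_C1c:
 assumes z: "C1c D z" and psi: "C1c D psi"
 shows "(LBINT x. pd z a x * pd psi b x) = (LBINT x. pd z b x * pd psi a x)"
proof -
 interpret shear_flow "%x. 0" 0 b by standard auto
 have F: "Fl h x = x + h *R b" for h x by (simp add: Fl_def)
 have T: "t x = b" for x by (simp add: t_def)
 have C: "C1u z" "C1u psi" using z psi by (auto intro: C1c_C1)
 let ?k = "%n. 1 / real (Suc n)"
 have 1: "(%n. LBINT x. pd z a x * (of_nat (Suc n) * (psi (Fl (?k n) x) - psi x))) \<longlonglongrightarrow> (LBINT x. pd z a x * pd psi b x)"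
  using flow_diff_integral_tendsto[OF psi C1c_int(4)[OF z, of a], of 1] by (simp add: T)
 have 2: "(%n. LBINT x. pd psi a x * (of_nat (Suc n) * (z (Fl (- 1 / real (Suc n)) x) - z x))) \<longlonglongrightarrow> - (LBINT x. pd psi a x * pd z b x)"
  using flow_diff_integral_tendsto[OF z C1c_int(4)[OF psi, of a], of "-1"] by (simp add: T)
 have e: "(LBINT x. pd z a x * (of_nat (Suc n) * (psi (Fl (?k n) x) - psi x)))
   = - (LBINT x. pd psi a x * (of_nat (Suc n) * (z (Fl (- 1 / real (Suc n)) x) - z x)))" for n
 proof -
  let ?N = "of_nat (Suc n) :: complex"
  have dC: "C1u (%x. psi (Fl (?k n) x))" "pd (%x. psi (Fl (?k n) x)) a x = pd psi a (Fl (?k n) x)" for x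
   using flow_C1_on[OF C(2), of "?k n"] by (simp_all add: KFl_def)
  have "(LBINT x. (psi (Fl (?k n) x) - psi x) * pd z a x) = - (LBINT x. (pd psi a (Fl (?k n) x) - pd psi a x) * z x)"
   using integral_by_parts[OF open_UNIV C1_on_diff(1)[OF dC(1) C(2)] C1c_mono[OF z subset_UNIV], of a]
   by (simp only: UNIV_I if_True C1_on_diff(2)[OF dC(1) C(2) UNIV_I] dC(2))
  also have "(LBINT x. (pd psi a (Fl (?k n) x) - pd psi a x) * z x) = (LBINT x. pd psi a (Fl (?k n) x) * z x) - (LBINT x. pd psi a x * z x)"
   unfolding left_diff_distrib
   by (intro bint_diff sqi_mult sqi_flow C1c_int[OF z] C1c_int[OF psi])
  also have "(LBINT x. pd psi a (Fl (?k n) x) * z x) = (LBINT x. pd psi a x * z (Fl (- 1 / real (Suc n)) x))"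
   using integral_flow[of "%x. pd psi a x * z (Fl (- 1 / real (Suc n)) x)" "?k n"]
    C1c_mbl[OF z] C1c_pd_mbl[OF psi] by (simp add: flow_add)
  also have "... - (LBINT x. pd psi a x * z x) = (LBINT x. pd psi a x * (z (Fl (- 1 / real (Suc n)) x) - z x))"
   unfolding right_diff_distrib
   by (intro bint_diff[symmetric] sqi_mult sqi_flow C1c_int[OF z] C1c_int[OF psi])
  finally have "(LBINT x. pd z a x * (psi (Fl (?k n) x) - psi x)) = - (LBINT x. pd psi a x * (z (Fl (- 1 / real (Suc n)) x) - z x))"
   by (simp add: mult.commute)
  then show ?thesis by (simp only: mult.left_commute[of _ ?N] bint_mult_right_zero mult_minus_right)
 qed
 show ?thesis using LIMSEQ_unique[OF 1[unfolded e] tendsto_minus[OF 2]] by (simp add: mult.commute)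
qed

lemma W_mixed_partials:
 assumes z: "W D z G" and ph: "C1c D ph"
 shows "(LBINT x. dirG G a x * pd ph b x) = (LBINT x. dirG G b x * pd ph a x)"
proof -
 obtain psi where psi: "!!n. C1c D (psi n)" "null (%n. nrm (%x. psi n x - z x))"
  "!!v. (%n. nrm (%x. pd (psi n) v x - dirG G v x)) \<longlonglongrightarrow> 0" by (rule W_E[OF z]) (rule that; assumption)
 have l: "(%n. LBINT x. pd (psi n) a x * pd ph b x) \<longlonglongrightarrow> (LBINT x. dirG G a x * pd ph b x)" for a b
  by (rule tendsto_nrm_mult) (simp_all add: C1c_int[OF psi(1)] W_sqi_dirG[OF z] C1c_int[OF ph] psi(3))
 show ?thesis using LIMSEQ_unique[OF l[of a b, unfolded mixed_partials_C1c[OF psi(1) ph, of _ a b]] l] .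
qed

lemma C1_on_bounded_set:
 fixes f :: "'a::euclidean_space => 'b::real_normed_vector"
 assumes f: "continuous_on UNIV f" and S: "bounded S"
 obtains B where "B >= 0" "!!x. x : S ==> norm (f x) <= B"
proof -
 have "compact (closure S)" using S by simp
 then have "bounded (f ` closure S)"
  using f by (meson compact_continuous_image compact_imp_bounded cont_sub subset_UNIV)
 then obtain B where "!!x. x : closure S ==> norm (f x) <= B" by (auto simp: bounded_iff)
 then show ?thesis using closure_subset[of S] by (intro that[of "max B 0"]) (auto simp: le_max_iff_disj)
qed

lemma C1_on_Lipschitz_bounded:
 fixes f :: "'a::euclidean_space => 'b::real_normed_vector"
 assumes f: "C1u f"
 obtains L where "L >= 0" "!!x y. norm x <= R ==> norm y <= R ==> norm (f x - f y) <= L * norm (x - y)"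
proof -
 have "ALL i. EX B>=0. ALL x:cball 0 R. norm (pd f i x) <= B"
  using C1_on_bounded_set[OF C1_on_cont_pd[OF f] bounded_cball, of 0 R] by metis
 from choice[OF this] obtain B where B: "!!i. B i >= 0" "!!i x. x : cball 0 R ==> norm (pd f i x) <= B i" by blast
 have le: "norm (pd f v x) <= (SB i. B i) * norm v" if "x : cball 0 R" for v x
 proof -
  have "norm (pd f v x) <= (SB i. norm ((v *. i) *R pd f i x))"
   by (subst pd_Basis_sum[OF f UNIV_I]) (rule norm_sum)
  also have "... <= (SB i. norm v * B i)"
   unfolding norm_scaleR by (intro sum_mono mult_mono B that) (auto simp: Basis_le_norm)
  finally show ?thesis by (simp add: sum_distrib_left mult.commute)
 qed
 have "norm (f x - f y) <= (SB i. B i) * norm (x - y)" if "norm x <= R" "norm y <= R" for x y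
 proof (rule differentiable_bound[of "cball 0 R" f "%x v. pd f v x"])
  show "(f has_derivative (%v. pd f v x)) (at x within cball 0 R)" for x
   by (rule has_derivative_at_withinI[OF C1_on_has_derivative[OF f UNIV_I]])
  show "onorm (%v. pd f v x) <= (SB i. B i)" if "x : cball 0 R" for x
   by (rule onorm_bound[OF _ le[OF that]]) (intro sum_nonneg B)
 qed (use that in simp_all)
 then show ?thesis by (intro that[of "SB i. B i"]) (auto intro: sum_nonneg B)
qed

text \<open>When the functional integrates g against \<open>pd ph j\<close>, boundedness says that g
  has a weak j-derivative in L^2. Functionals can be added and multiplied by C^1 functions before
  any representative is produced.\<close>

definition bf :: "'a::euclidean_space set => (('a => complex) => complex) => bool" where
 "bf D F \<longleftrightarrow> (EX C. ALL ph. C1c D ph --> cmod (F ph) <= C * nrm ph)"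

lemma bf_cong: "bf D F ==> (!!ph. C1c D ph ==> F' ph = F ph) ==> bf D F'"
 unfolding bf_def by metis

lemma bf_add: assumes "bf D F" "bf D G" shows "bf D (%ph. F ph + G ph)"
proof -
 obtain C C' where "!!ph. C1c D ph ==> cmod (F ph) <= C * nrm ph" "!!ph. C1c D ph ==> cmod (G ph) <= C' * nrm ph"
  using assms unfolding bf_def by blast
 then have "cmod (F ph + G ph) <= (C + C') * nrm ph" if "C1c D ph" for ph
  using that norm_triangle_ineq[of "F ph" "G ph"] by (fastforce simp: distrib_right)
 then show ?thesis unfolding bf_def by blast
qed

lemma bf_cmult: assumes "bf D F" shows "bf D (%ph. c * F ph)"
proof -
 obtain C where "!!ph. C1c D ph ==> cmod (F ph) <= C * nrm ph" using assms unfolding bf_def by blast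
 then have "cmod (c * F ph) <= (cmod c * C) * nrm ph" if "C1c D ph" for ph
  using that by (simp add: norm_mult mult.assoc mult_left_mono)
 then show ?thesis unfolding bf_def by blast
qed

lemma bf_zero: "bf D (%ph. 0)" unfolding bf_def by (intro exI[of _ 0]) simp

lemma bf_diff: "bf D F ==> bf D G ==> bf D (%ph. F ph - G ph)"
 using bf_add[OF _ bf_cmult, of D F G "-1"] by simp

lemma bf_sum: "(!!i. i : A ==> bf D (F i)) ==> bf D (%ph. \<Sum>i\<in>A. F i ph)"
 by (induction A rule: infinite_finite_induct) (auto intro: bf_zero bf_add)

lemma bf_L2:
 assumes "sqi g" shows "bf D (%ph. LBINT x. g x * ph x)"
 unfolding bf_def using Cauchy_Schwarz_nrm[OF assms C1c_int(3)] by blast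

lemma bf_mult:
 assumes D: "open D" "bounded D" and th: "C1u th" and F: "bf D F"
 shows "bf D (%ph. F (%x. th x * ph x))"
proof -
 obtain C where C: "!!ph. C1c D ph ==> cmod (F ph) <= C * nrm ph" using F unfolding bf_def by blast
 obtain B where B: "B >= 0" "!!x. x : D ==> cmod (th x) <= B" using C1_on_bounded_set[OF C1_on_cont[OF th] D(2)] by metis
 have "cmod (F (%x. th x * ph x)) <= (max C 0 * B) * nrm ph" if ph: "C1c D ph" for ph
 proof -
  have "cmod (F (%x. th x * ph x)) <= C * nrm (%x. th x * ph x)"
   by (rule C[OF C1c_mult(1)[OF D(1) C1_on_subset[OF th subset_UNIV] ph]])
  also have "... <= max C 0 * nrm (%x. th x * ph x)" by (intro mult_right_mono) auto
  also have "... <= max C 0 * (B * nrm ph)"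
   by (intro mult_left_mono sqi_cont_mult(2)[OF D(1) cont_sub[OF C1_on_cont[OF th]]] C1c_int[OF ph] C1c_off[OF ph] B) auto
  finally show ?thesis by (simp add: mult.assoc)
 qed
 then show ?thesis unfolding bf_def by blast
qed

text \<open>Each coordinate direction i has a part \<open>ta i\<close> orthogonal to e, and its flow
  moves along \<open>ta i\<close> + th_i e, with th_i the slope of the graph. The energy estimate
  bounds the second derivatives in which one direction is such a field, so modulo bounded
  functionals the derivative along \<open>ta i\<close> may be replaced by - th_i times that along e.
  In the equation this leaves the factor 1 + sum th_i^2 in front of the second derivative along e;
  it is at least 1 and can be divided out, after which the other derivatives follow.\<close>

lemma local_second_derivatives:
 fixes e :: "'a::euclidean_space"
 assumes D: "open D" "bounded D" and e: "norm e = 1"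
  and ga: "C1u ga" "!!v. C1u (pd ga v)" "!!x s. ga (x + s *R e) = ga x"
  and z: "W E z G" and ED: "E <= D" and f: "sqi f" and wl: "wlap D G f"
  and stab: "!!i. i : Basis ==> EX h0>0. ALL h x. \<bar>h\<bar> <= h0 --> x : E --> shear_flow.Fl ga e (i - (i *. e) *R e) h x : D"
  and ij: "i : Basis" "j : Basis"
 shows "bf D (%ph. LBINT x. G i x * pd ph j x)"
proof -
 define ta where "ta = (%i. i - (i *. e) *R e)"
 define th where "th = (%i x. cor (pd ga (ta i) x))"
 define I where "I = (%c a ph. LBINT x. dirG G c x * pd ph a x)"
 have zD: "W D z G" by (rule W_mono[OF z ED])
 have Gs: "sqi (G i)" if "i : Basis" for i using WD(2)[OF z that] .
 have dGs: "sqi (dirG G c)" for c by (rule W_sqi_dirG[OF z])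
 have thC: "C1u (th i)" for i unfolding th_def by (rule C1_on_bl(1)[OF ga(2) bounded_linear_of_real])
 have pdinv: "pd ga v (x + s *R e) = pd ga v x" for v x s
 proof -
  interpret shear_flow ga e 0 by standard (use ga in auto)
  show ?thesis using gamma_shift(2)[of "s *R e" x v] by (simp add: ga(3))
 qed
 \<comment> \<open>The slope does not change along e, so multiplication by it commutes with the
   derivative along e.\<close>
 have the: "pd (th i) e x = 0" for i x
 proof -
  interpret shear_flow "pd ga (ta i)" e 0 by standard (use ga pdinv in auto)
  show ?thesis unfolding th_def by (subst C1_on_bl(2)[OF ga(2) bounded_linear_of_real UNIV_I]) (simp add: pd_gamma_e)
 qed
 obtain R where R: "!!x. x : D ==> norm x <= R" using D(2) by (auto simp: bounded_iff)
 \<comment> \<open>The energy estimate, turned into an L^2 bound for the derivative of any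
   \<open>dirG G c\<close> along the i-th flow field.\<close>
 have star: "bf D (%ph. LBINT x. dirG G c x * (pd ph (ta i) x + th i x * pd ph e x))" if i: "i : Basis" for i c
 proof -
  interpret shear_flow ga e "ta i" by standard (use ga in auto)
  obtain h0 where h0: "h0 > 0" "!!h x. \<bar>h\<bar> <= h0 ==> x : E ==> Fl h x : D" using stab[OF i] unfolding ta_def by blast
  have "ALL k. EX L>=0. ALL x y. norm x <= R + norm (ta i) --> norm y <= R + norm (ta i) --> norm (pd ga k x - pd ga k y) <= L * norm (x - y)"
   using C1_on_Lipschitz_bounded[OF ga(2)] by metis
  from choice[OF this] obtain L where L: "!!k. L k >= 0" "!!k x y. norm x <= R + norm (ta i) ==> norm y <= R + norm (ta i) ==> norm (pd ga k x - pd ga k y) <= L k * norm (x - y)"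
   by blast
  obtain B where B: "B >= 0" "!!x. x : D ==> norm (pd ga (ta i) x) <= B" using C1_on_bounded_set[OF C1_on_cont[OF ga(2)] D(2)] by metis
  \<comment> \<open>B bounds the slope of the graph, the second summand the Lipschitz constants of
    the derivatives of ga times the length of \<open>ta i\<close>; one M serves both.\<close>
  define M where "M = B + (SB k. L k) * norm (ta i)"
  have S0: "(SB k. L k) >= 0" by (intro sum_nonneg L)
  have M0: "M >= 0" unfolding M_def using B S0 by simp
  define h1 where "h1 = min h0 1"
  obtain C where C: "C >= 0" "!!h k. \<bar>h\<bar> <= h1 ==> k : Basis ==> nrm (%x. G k (Fl h x) - G k x) <= C * \<bar>h\<bar>"
  proof (rule flow_energy_estimate[OF D(1) z ED f wl, of h1 M])
   show "h1 > 0" using h0 by (simp add: h1_def)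
   show "Fl h x : D" if "\<bar>h\<bar> <= h1" "x : E" for h x using h0(2) that by (simp add: h1_def)
   show "\<bar>KFl h k x\<bar> <= M * \<bar>h\<bar>" if "x : D" "\<bar>h\<bar> <= h1" "k : Basis" for x h k
   proof -
    have h: "\<bar>h\<bar> <= 1" using that(2) by (simp add: h1_def)
    have "norm (h *R ta i) <= norm (ta i)" using h by (simp add: mult_left_le_one_le)
    then have "norm (x + h *R ta i) <= R + norm (ta i)" "norm x <= R + norm (ta i)"
     using R[OF that(1)] norm_triangle_ineq[of x "h *R ta i"] norm_ge_zero[of "ta i"] by linarith+
    from L(2)[OF this, of k] have "\<bar>KFl h k x\<bar> <= L k * (\<bar>h\<bar> * norm (ta i))" by (simp add: KFl_def)
    also have "... <= (SB k. L k) * (\<bar>h\<bar> * norm (ta i))"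
     using that(3) L(1) by (intro mult_right_mono member_le_sum) auto
    also have "... <= M * \<bar>h\<bar>" unfolding M_def using B(1) by (simp add: mult_ac mult_left_mono)
    finally show ?thesis .
   qed
   show "\<bar>pd ga (ta i) x\<bar> <= M" if "x : D" for x
    using B(2)[OF that] S0 unfolding M_def by (simp add: add_increasing2)
  qed (use M0 in auto)
  have a: "nrm (%x. dirG G c (Fl h x) - dirG G c x) <= (norm c * (real DIM('a) * C)) * \<bar>h\<bar>" if "\<bar>h\<bar> <= h1" for h
  proof -
   have eq: "(%x. dirG G c (Fl h x) - dirG G c x) = dirG (%k x. G k (Fl h x) - G k x) c"
    by (simp add: dirG_def fun_eq_iff right_diff_distrib sum_subtractf)
   have "nrm (dirG (%k x. G k (Fl h x) - G k x) c) <= norm c * (real DIM('a) * (C * \<bar>h\<bar>))"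
   proof (rule nrm_dirG_le)
    fix k :: 'a assume k: "k : Basis"
    show "sqi (%x. G k (Fl h x) - G k x)" by (intro sqi_diff sqi_flow Gs k)
    show "nrm (%x. G k (Fl h x) - G k x) <= C * \<bar>h\<bar>" by (rule C(2)[OF that k])
   qed
   then show ?thesis unfolding eq by (simp add: mult_ac)
  qed
  show ?thesis unfolding bf_def th_def
   using flow_weak_derivative_bound[OF _ dGs, of D _ h1 "norm c * (real DIM('a) * C)" c] a h0(1) C(1)
   by (intro exI[of _ "norm c * (real DIM('a) * C)"]) (auto simp: h1_def)
 qed
 have Ia: "I c (a + b) ph = I c a ph + I c b ph" "I c (s *R a) ph = of_real s * I c a ph" if "C1c D ph" for c a b ph s
 proof -
  note li = pd_linear[OF C1c_C1[OF that] UNIV_I]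
  have i: "intgl (%x. dirG G c x * pd ph v x)" for v by (intro sqi_mult dGs C1c_int[OF that])
  show "I c (a + b) ph = I c a ph + I c b ph" unfolding I_def using i by (simp add: linear_add[OF li] distrib_left)
  show "I c (s *R a) ph = of_real s * I c a ph"
   unfolding I_def by (simp add: linear_cmul[OF li] scaleR_conv_of_real mult.left_commute[of _ "of_real s"])
 qed
 have Is: "I a b ph = I b a ph" if "C1c D ph" for a b ph unfolding I_def by (rule W_mixed_partials[OF zD that])
 have Im: "I c e (%x. th' x * ph x) = (LBINT x. dirG G c x * (th' x * pd ph e x))"
  if "C1c D ph" "C1u th'" "!!x. pd th' e x = 0" for c ph th'
  unfolding I_def using C1_on_mult(2)[OF that(2) C1c_C1[OF that(1)] UNIV_I] that(3) by simp
 have thc: "C1c D (%x. th i x * ph x)" if "C1c D ph" for ph i by (rule C1c_mult(1)[OF D(1) C1_on_subset[OF thC subset_UNIV] that])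
 have s1: "bf D (%ph. I c (ta i) ph + I c e (%x. th i x * ph x))" if i: "i : Basis" for c i
 proof (rule bf_cong[OF star[OF i, of c]])
  fix ph :: "'a => complex" assume p: "C1c D ph"
  have "intgl (%x. dirG G c x * pd ph (ta i) x)" by (intro sqi_mult dGs C1c_int[OF p])
  moreover have "intgl (%x. dirG G c x * (th i x * pd ph e x))"
  proof -
   have "intgl (%x. dirG G c x * pd (%x. th i x * ph x) e x)" by (intro sqi_mult dGs C1c_int(4)[OF thc[OF p]])
   then show ?thesis by (simp add: C1_on_mult(2)[OF thC C1c_C1[OF p] UNIV_I] the)
  qed
  ultimately show "I c (ta i) ph + I c e (%x. th i x * ph x) = (LBINT x. dirG G c x * (pd ph (ta i) x + th i x * pd ph e x))"
   unfolding Im[OF p thC the] unfolding I_def by (simp add: distrib_left)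
 qed
 have s3: "bf D (%ph. I (ta i) e ph + I e e (%x. th i x * ph x))" if i: "i : Basis" for i
  by (rule bf_cong[OF s1[OF i, of e]]) (simp add: Is[of _ "ta i" e])
 \<comment> \<open>The replacement of \<open>ta i\<close> by - th_i e is made in both slots; the
   symmetry of mixed derivatives, used for \<open>s3\<close>, gives access to the second
   one.\<close>
 have s5: "bf D (%ph. I (ta i) (ta i) ph - I e e (%x. th i x * (th i x * ph x)))" if i: "i : Basis" for i
  by (rule bf_cong[OF bf_diff[OF s1[OF i, of "ta i"] bf_mult[OF D thC s3[OF i], of i]]]) simp
 have eB: "(SB i. (i *. e) *R i) = e" by (simp add: inner_commute[of _ e] euclidean_representation)
 have e1: "(SB i. (i *. e) * (i *. e)) = 1"
 proof -
  have "(SB i. (i *. e) * (i *. e)) = e *. e"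
   by (subst (3) euclidean_inner) (simp add: inner_commute)
  then show ?thesis using e by (simp add: norm_eq_1)
 qed
 \<comment> \<open>The rank-one forms of the vectors \<open>ta i\<close>, summed over i, and that of
   e add up to the identity, so the Laplacian splits into tangential and normal parts.\<close>
 have s6: "(SB i. I (ta i) (ta i) ph) + I e e ph = - (LBINT x. f x * ph x)" if p: "C1c D ph" for ph
 proof -
  note li = pd_linear[OF C1c_C1[OF p] UNIV_I]
  have pw: "(SB i. dirG G (ta i) x * pd ph (ta i) x) + dirG G e x * pd ph e x = (SB i. G i x * pd ph i x)" for x
  proof -
   have a: "dirG G (ta i) x = G i x - of_real (i *. e) * dirG G e x" if "i : Basis" for i
    using that by (simp add: ta_def dirG_diff dirG_scale dirG_Basis)
   have b: "pd ph (ta i) x = pd ph i x - of_real (i *. e) * pd ph e x" for i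
    by (simp add: ta_def linear_diff[OF li] linear_cmul[OF li] scaleR_conv_of_real)
   have c: "(SB i. cor (i *. e) * G i x) = dirG G e x" by (simp add: dirG_def inner_commute[of _ e])
   have d: "(SB i. cor (i *. e) * pd ph i x) = pd ph e x"
    using pd_eq_dirG[OF C1c_C1[OF p], of x e] by (simp add: dirG_def inner_commute[of _ e])
   have f: "(SB i. cor (i *. e) * cor (i *. e)) = 1"
    using e1 by (simp only: of_real_mult[symmetric] of_real_sum[symmetric] of_real_1)
   have "(SB i. dirG G (ta i) x * pd ph (ta i) x) = (SB i. G i x * pd ph i x
     - (of_real (i *. e) * G i x) * pd ph e x - dirG G e x * (of_real (i *. e) * pd ph i x)
     + (of_real (i *. e) * of_real (i *. e)) * (dirG G e x * pd ph e x))"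
    by (rule sum.cong) (simp_all add: a b algebra_simps)
   also have "... = (SB i. G i x * pd ph i x) - dirG G e x * pd ph e x - dirG G e x * pd ph e x + dirG G e x * pd ph e x"
    by (simp only: sum.distrib sum_subtractf sum_distrib_right[symmetric] sum_distrib_left[symmetric] c d f mult_1_left)
   finally show ?thesis by simp
  qed
  have i: "intgl (%x. dirG G c x * pd ph v x)" for c v by (intro sqi_mult dGs C1c_int[OF p])
  have i': "intgl (%x. G k x * pd ph k x)" if "k : Basis" for k by (intro sqi_mult Gs that C1c_int[OF p])
  have "(SB i. I (ta i) (ta i) ph) + I e e ph = (LBINT x. (SB i. dirG G (ta i) x * pd ph (ta i) x) + dirG G e x * pd ph e x)"
   unfolding I_def using i by simp
  also have "... = (SB i. LBINT x. G i x * pd ph i x)" unfolding pw using i' by simp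
  finally show ?thesis using wl p unfolding wlap_def by simp
 qed
 define F where "F = (%ph. I e e ph + (SB i. I e e (%x. th i x * (th i x * ph x))))"
 have bF: "bf D F"
 proof (rule bf_cong[OF bf_diff[OF bf_cmult[OF bf_L2[OF f], of D "-1"] bf_sum[of Basis D, OF s5]]])
  fix ph :: "'a => complex" assume p: "C1c D ph"
  show "F ph = - 1 * (LBINT x. f x * ph x) - (SB i. I (ta i) (ta i) ph - I e e (%x. th i x * (th i x * ph x)))"
  proof -
   have al: "y + w = - 1 * z - (x - w)" if "x + y = - z" for x y z w :: complex using that by algebra
   show ?thesis unfolding F_def sum_subtractf by (rule al[OF s6[OF p]])
  qed
 qed
 define q where "q = (%x. 1 + (SB i. th i x * th i x))"
 have qC: "C1u q" and qe: "pd q e x = 0" for x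
 proof -
  have m: "C1u (%x. th i x * th i x)" "pd (%x. th i x * th i x) e x = 0" for i x
   using C1_on_mult[OF thC[of i] thC[of i]] the by simp_all
  note s = C1_on_sum[of Basis UNIV "%i x. th i x * th i x", OF m(1)]
  note a = C1_on_add[OF C1_on_const[of UNIV 1] s(1)]
  show "C1u q" unfolding q_def by (rule a(1))
  show "pd q e x = 0" unfolding q_def by (simp add: a(2) s(2) m(2) C1_on_const)
 qed
 have q0: "q x ~= 0" for x
 proof -
  have "q x = cor (1 + (SB i. (pd ga (ta i) x)^2))" by (simp add: q_def th_def power2_eq_square)
  moreover have "1 + (SB i. (pd ga (ta i) x)^2) > 0" by (intro add_pos_nonneg sum_nonneg) auto
  ultimately show ?thesis by (metis less_numeral_extra(3) of_real_eq_0_iff)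
 qed
 define ro where "ro = (%x. inverse (q x))"
 have roC: "C1u ro" "pd ro e x = 0" for x
  unfolding ro_def using C1_on_inverse[OF qC q0] qe by auto
 \<comment> \<open>F is evaluated at ro ph. Since ro and th_i are constant along e they pass through
   the derivative, and the factors combine to q ro = 1.\<close>
 have bE: "bf D (I e e)"
 proof (rule bf_cong[OF bf_mult[OF D roC(1) bF]])
  fix ph :: "'a => complex" assume p: "C1c D ph"
  have rp: "C1c D (%x. ro x * ph x)" by (rule C1c_mult(1)[OF D(1) C1_on_subset[OF roC(1) subset_UNIV] p])
  have e3: "I e e (%x. th i x * (th i x * (ro x * ph x))) = (LBINT x. dirG G e x * ((th i x * th i x * ro x) * pd ph e x))"
   "intgl (%x. dirG G e x * ((th i x * th i x * ro x) * pd ph e x))" for i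
  proof -
   note m1 = C1_on_mult[OF thC[of i] thC[of i]]
   note m2 = C1_on_mult[OF m1(1) roC(1)]
   have z: "pd (%x. th i x * th i x * ro x) e x = 0" for x using m2(2)[of x e] m1(2)[of x e] the roC(2) by simp
   have "I e e (%x. (th i x * th i x * ro x) * ph x) = (LBINT x. dirG G e x * ((th i x * th i x * ro x) * pd ph e x))"
    by (rule Im[OF p m2(1) z])
   then show "I e e (%x. th i x * (th i x * (ro x * ph x))) = (LBINT x. dirG G e x * ((th i x * th i x * ro x) * pd ph e x))"
    by (simp add: mult.assoc)
   have "C1c D (%x. (th i x * th i x * ro x) * ph x)" by (rule C1c_mult(1)[OF D(1) C1_on_subset[OF m2(1) subset_UNIV] p])
   from sqi_mult[OF dGs C1c_int(4)[OF this], of e e]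
   show "intgl (%x. dirG G e x * ((th i x * th i x * ro x) * pd ph e x))"
    using C1_on_mult(2)[OF m2(1) C1c_C1[OF p] UNIV_I] z by simp
  qed
  have i2: "intgl (%x. dirG G e x * (ro x * pd ph e x))"
   using sqi_mult[OF dGs C1c_int(4)[OF rp], of e e] C1_on_mult(2)[OF roC(1) C1c_C1[OF p] UNIV_I] roC(2) by simp
  have "F (%x. ro x * ph x) = (LBINT x. dirG G e x * (ro x * pd ph e x)) + (SB i. LBINT x. dirG G e x * ((th i x * th i x * ro x) * pd ph e x))"
   unfolding F_def e3 Im[OF p roC] ..
  also have "... = (LBINT x. dirG G e x * (ro x * pd ph e x) + (SB i. dirG G e x * ((th i x * th i x * ro x) * pd ph e x)))"
   using i2 e3(2) by simp
  also have "... = (LBINT x. dirG G e x * ((q x * ro x) * pd ph e x))"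
   by (rule bint_cong) (auto simp: q_def algebra_simps sum_distrib_left)
  also have "... = I e e ph" unfolding I_def ro_def using q0 by simp
  finally show "I e e ph = F (%x. ro x * ph x)" by simp
 qed
 have bte: "bf D (I (ta k) e)" if k: "k : Basis" for k
  by (rule bf_cong[OF bf_diff[OF s3[OF k] bf_mult[OF D thC bE, of k]]]) simp
 have split: "k = ta k + (k *. e) *R e" for k by (simp add: ta_def)
 have bke: "bf D (I k e)" if k: "k : Basis" for k
 proof (rule bf_cong[OF bf_add[OF bte[OF k] bf_cmult[OF bE, of "of_real (k *. e)"]]])
  fix ph :: "'a => complex" assume p: "C1c D ph"
  have "I k e ph = I e (ta k + (k *. e) *R e) ph" using Is[OF p, of k e] split[of k] by simp
  then show "I k e ph = I (ta k) e ph + of_real (k *. e) * I e e ph" by (simp add: Ia[OF p] Is[OF p, of e "ta k"])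
 qed
 have bit: "bf D (I i (ta j))"
  by (rule bf_cong[OF bf_diff[OF s1[OF ij(2), of i] bf_mult[OF D thC bke[OF ij(1)], of j]]]) simp
 show ?thesis
 proof (rule bf_cong[OF bf_add[OF bit bf_cmult[OF bke[OF ij(1)], of "of_real (j *. e)"]]])
  fix ph :: "'a => complex" assume p: "C1c D ph"
  have "(LBINT x. G i x * pd ph j x) = I i (ta j + (j *. e) *R e) ph"
   unfolding I_def split[symmetric] by (simp add: dirG_Basis[OF ij(1)])
  then show "(LBINT x. G i x * pd ph j x) = I i (ta j) ph + of_real (j *. e) * I i e ph" by (simp add: Ia[OF p])
 qed
qed

section \<open>Localization and regularity near C^2 graphs\<close>

text \<open>The product rule for the Laplacian in weak form: the equation for u is tested with
  \<open>ze x * ph x\<close>, and the weak derivative of u with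
  \<open>pd ze i x * ph x\<close>.\<close>

lemma wlap_mult:
 assumes D: "open D" "bounded D" and ze: "C1u ze" "!!i. i : Basis ==> C1u (pd ze i)"
  and u: "W D u G" and f: "sqi f" "!!x. x ~: D ==> f x = 0" and wl: "wlap D G f"
 shows "wlap D (%i x. ze x * G i x + pd ze i x * u x)
   (%x. ze x * f x + 2 * (SB i. pd ze i x * G i x) + (SB i. pd (pd ze i) i x) * u x)"
  and "sqi (%x. ze x * f x + 2 * (SB i. pd ze i x * G i x) + (SB i. pd (pd ze i) i x) * u x)"
proof -
 have sq: "sqi (%x. th x * a x)" if c: "continuous_on UNIV th" and a: "sqi a" "!!x. x ~: D ==> a x = 0" for th a
 proof -
  obtain B where "B >= 0" "!!x. x : D ==> norm (th x) <= B" using C1_on_bounded_set[OF c D(2)] by metis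
  then show ?thesis using sqi_cont_mult(1)[OF D(1) cont_sub[OF c] a] by auto
 qed
 note cze = C1_on_cont[OF ze(1)] C1_on_cont_pd[OF ze(1)]
 have cze2: "continuous_on UNIV (%x. SB i. pd (pd ze i) i x)"
  by (intro continuous_on_sum C1_on_cont_pd ze(2))
 have s1: "sqi (%x. ze x * f x)" by (rule sq[OF cze(1) f])
 have s2: "sqi (%x. pd ze i x * G i x)" "sqi (%x. ze x * G i x)" if "i : Basis" for i
  using sq[OF cze(2) WD(2)[OF u that] WD(4)[OF u _ that]] sq[OF cze(1) WD(2)[OF u that] WD(4)[OF u _ that]] by auto
 have s3: "sqi (%x. (SB i. pd (pd ze i) i x) * u x)" by (rule sq[OF cze2 WD(1,3)[OF u]])
 have s4: "sqi (%x. pd ze i x * u x)" "i : Basis ==> sqi (%x. pd (pd ze i) i x * u x)" for i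
  using sq[OF cze(2) WD(1,3)[OF u]] sq[OF C1_on_cont_pd[OF ze(2)] WD(1,3)[OF u]] by auto
 show "sqi (%x. ze x * f x + 2 * (SB i. pd ze i x * G i x) + (SB i. pd (pd ze i) i x) * u x)"
  by (intro sqi_add sqi_cmult sqi_sum s1 s2 s3)
 show "wlap D (%i x. ze x * G i x + pd ze i x * u x)
   (%x. ze x * f x + 2 * (SB i. pd ze i x * G i x) + (SB i. pd (pd ze i) i x) * u x)"
  unfolding wlap_def
 proof (intro allI impI)
  fix ph :: "'a => complex" assume p: "C1c D ph"
  note ps = C1c_int[OF p]
  have c1: "C1c D (%x. ze x * ph x)" by (rule C1c_mult(1)[OF D(1) C1_on_subset[OF ze(1) subset_UNIV] p])
  have c2: "C1c D (%x. pd ze i x * ph x)" if "i : Basis" for i by (rule C1c_mult(1)[OF D(1) C1_on_subset[OF ze(2)[OF that] subset_UNIV] p])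
  have each: "(LBINT x. (ze x * G i x + pd ze i x * u x) * pd ph i x) =
    (LBINT x. G i x * pd (%x. ze x * ph x) i x) - 2 * (LBINT x. (pd ze i x * G i x) * ph x) - (LBINT x. (pd (pd ze i) i x * u x) * ph x)"
   if i: "i : Basis" for i
  proof -
   have i1: "intgl (%x. (ze x * G i x) * pd ph i x)" "intgl (%x. (pd ze i x * u x) * pd ph i x)"
    "intgl (%x. (pd ze i x * G i x) * ph x)" "intgl (%x. (pd (pd ze i) i x * u x) * ph x)"
    by (intro sqi_mult s2 s4 i ps)+
   have "(LBINT x. G i x * pd (%x. ze x * ph x) i x) = (LBINT x. (ze x * G i x) * pd ph i x + (pd ze i x * G i x) * ph x)"
    by (intro bint_cong refl) (subst C1_on_mult(2)[OF ze(1) C1c_C1[OF p] UNIV_I], simp add: algebra_simps)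
   then have a: "(LBINT x. (ze x * G i x) * pd ph i x) = (LBINT x. G i x * pd (%x. ze x * ph x) i x) - (LBINT x. (pd ze i x * G i x) * ph x)"
    using i1 by simp
   have "(LBINT x. u x * pd (%x. pd ze i x * ph x) i x) = (LBINT x. (pd ze i x * u x) * pd ph i x + (pd (pd ze i) i x * u x) * ph x)"
    by (intro bint_cong refl) (subst C1_on_mult(2)[OF ze(2)[OF i] C1c_C1[OF p] UNIV_I], simp add: algebra_simps)
   moreover have "(LBINT x. u x * pd (%x. pd ze i x * ph x) i x) = - (LBINT x. (pd ze i x * G i x) * ph x)"
    using W_weak_derivative[OF D(1) u c2[OF i], of i] by (simp add: dirG_Basis[OF i] algebra_simps)
   ultimately have b: "(LBINT x. (pd ze i x * u x) * pd ph i x) = - (LBINT x. (pd ze i x * G i x) * ph x) - (LBINT x. (pd (pd ze i) i x * u x) * ph x)"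
    using i1 by (simp add: eq_diff_eq)
   have "(LBINT x. (ze x * G i x + pd ze i x * u x) * pd ph i x) = (LBINT x. (ze x * G i x) * pd ph i x) + (LBINT x. (pd ze i x * u x) * pd ph i x)"
    unfolding distrib_right by (rule bint_add[OF i1(1,2)])
   then show ?thesis unfolding a b by simp
  qed
  have S: "(SB i. LBINT x. G i x * pd (%x. ze x * ph x) i x) = - (LBINT x. (ze x * f x) * ph x)"
   using wl c1 unfolding wlap_def by (simp add: mult_ac)
  have i2: "intgl (%x. (ze x * f x) * ph x)" "!!i. i : Basis ==> intgl (%x. (pd ze i x * G i x) * ph x)"
   "!!i. i : Basis ==> intgl (%x. (pd (pd ze i) i x * u x) * ph x)"
   by (intro sqi_mult s1 s2 s4 ps; assumption)+
  have "(LBINT x. (ze x * f x + 2 * (SB i. pd ze i x * G i x) + (SB i. pd (pd ze i) i x) * u x) * ph x)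
   = (LBINT x. (ze x * f x) * ph x + 2 * (SB i. (pd ze i x * G i x) * ph x) + (SB i. (pd (pd ze i) i x * u x) * ph x))"
   by (rule bint_cong) (auto simp: distrib_right sum_distrib_right mult.assoc)
  also have "... = (LBINT x. (ze x * f x) * ph x) + 2 * (SB i. LBINT x. (pd ze i x * G i x) * ph x) + (SB i. LBINT x. (pd (pd ze i) i x * u x) * ph x)"
   using i2 by simp
  finally show "(SB i. LBINT x. (ze x * G i x + pd ze i x * u x) * pd ph i x) =
   - (LBINT x. (ze x * f x + 2 * (SB i. pd ze i x * G i x) + (SB i. pd (pd ze i) i x) * u x) * ph x)"
   using S by (simp add: each sum_subtractf sum_distrib_left[symmetric])
 qed
qed

text \<open>The condition of \<open>C2_boundary\<close> at a single, arbitrary point. Interior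
  points, and boundary points of a polytope on only one face plane, satisfy it with a constant g, so
  one regularity argument covers all cases.\<close>

definition graph_at :: "'a::euclidean_space set => 'a => bool" where
 "graph_at D p \<longleftrightarrow> (EX r>0. EX e g. norm e = 1 & C2_fun g \<and>
   D \<inter> ball p r = {x : ball p r. (x - p) *. e < g ((x - p) - ((x - p) *. e) *R e)})"

lemma C2_fun_const: "C2_fun (%x. c)"
 unfolding C2_fun_def by (intro exI[of _ "%x. 0"]) (auto simp: zero_blinfun.rep_eq)

text \<open>Near an interior point the graph condition holds with a constant height \<open>g = r\<close>.\<close>
lemma graph_at_interior:
 assumes "open D" "p : D" shows "graph_at D p"
proof -
 obtain r where r: "r > 0" "ball p r <= D" using assms open_contains_ball by blast
 obtain e :: 'a where e: "e : Basis" using nonempty_Basis by blast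
 have "(x - p) *. e < r" if "x : ball p r" for x
  using that Basis_le_norm[OF e, of "x - p"] by (simp add: dist_norm norm_minus_commute)
 then have "D \<inter> ball p r = {x : ball p r. (x - p) *. e < r}" using r by auto
 then show ?thesis unfolding graph_at_def using r(1) e C2_fun_const[of r]
  by (intro exI[of _ r] conjI exI[of _ e] exI[of _ "%x. r"]) auto
qed

text \<open>The height is g composed with the projection along e, hence constant along e, as the
  shear flow requires.\<close>

lemma C2_graph_height:
 fixes e p :: "'a::euclidean_space"
 assumes g: "C2_fun g" and e: "norm e = 1"
 defines "ga \<equiv> %x. g ((x - p) - ((x - p) *. e) *R e)"
 shows "C1u ga" "C1u (pd ga v)" "ga (x + s *R e) = ga x"
proof -
 obtain g' :: "'a => ('a \<Rightarrow>\<^sub>L real)" and g'' where g': "!!x. (g has_derivative blinfun_apply (g' x)) (at x)"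
  "!!x. (g' has_derivative blinfun_apply (g'' x)) (at x)" "continuous_on UNIV g''"
  using g unfolding C2_fun_def by blast
 define P where "P = (%v::'a. v - (v *. e) *R e)"
 have P: "bounded_linear P" unfolding P_def by (intro bounded_linear_sub bounded_linear_ident bounded_linear_scaleR_left
   bounded_linear_compose[OF bounded_linear_scaleR_left bounded_linear_inner_left])
 have Pd: "((%x. P (x - p)) has_derivative P) (at x)" for x
  by (auto intro!: bounded_linear.has_derivative[OF P] derivative_eq_intros)
 have cP: "continuous_on UNIV (%x. P (x - p))" by (intro continuous_intros bounded_linear.continuous_on[OF P])
 have cg': "continuous_on UNIV g'" using g'(2) by (meson continuous_at_imp_continuous_on has_derivative_continuous)
 have gaP: "ga = (%x. g (P (x - p)))" by (simp add: ga_def P_def)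
 have d: "(ga has_derivative (%v. blinfun_apply (g' (P (x - p))) (P v))) (at x)" for x
  unfolding gaP using has_derivative_compose[OF Pd g'(1)] .
 note * = C1_onI[of UNIV ga "%x v. blinfun_apply (g' (P (x - p))) (P v)", OF d]
 have c1: "continuous_on UNIV (%x. blinfun_apply (g' (P (x - p))) (P v))" for v
  by (intro continuous_intros continuous_on_compose2[OF cg' cP]) auto
 show "C1u ga" using *(1) c1 by blast
 have pdv: "pd ga v = (%x. blinfun_apply (g' (P (x - p))) (P v))" using *(2) c1 by blast
 have d2: "((%x. blinfun_apply (g' (P (x - p))) (P v)) has_derivative (%w. blinfun_apply (blinfun_apply (g'' (P (x - p))) (P w)) (P v))) (at x)" for x
 proof -
  have "((%x. g' (P (x - p))) has_derivative (%w. blinfun_apply (g'' (P (x - p))) (P w))) (at x)"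
   using has_derivative_compose[OF Pd g'(2)] .
  from bounded_linear.has_derivative[OF bounded_bilinear.bounded_linear_left[OF bounded_bilinear_blinfun_apply] this] show ?thesis by simp
 qed
 show "C1u (pd ga v)" unfolding pdv
  by (rule C1_onI(1)[OF d2]) (intro continuous_intros continuous_on_compose2[OF g'(3) cP], auto)
 have "P (x + s *R e - p) = P (x - p)"
  using e by (simp add: P_def inner_diff_left inner_add_left norm_eq_1 algebra_simps)
 then show "ga (x + s *R e) = ga x" unfolding gaP by simp
qed

lemma graph_at_regularity:
 fixes D :: "'a::euclidean_space set"
 assumes D: "open D" "bounded D" and u: "W D u G" and f: "sqi f" "!!x. x ~: D ==> f x = 0" and wl: "wlap D G f"
  and p: "graph_at D p"
 obtains r where "r > 0" "!!ze i j. smooth ze ==> (!!x. norm (x - p) >= r ==> ze x = 0) ==> i : Basis ==> j : Basis ==>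
   bf D (%ph. LBINT x. (ze x * G i x + pd ze i x * u x) * pd ph j x)"
proof -
 obtain r e g where r: "r > 0" and e: "norm e = 1" and g: "C2_fun g" and
  gr: "D \<inter> ball p r = {x : ball p r. (x - p) *. e < g ((x - p) - ((x - p) *. e) *R e)}"
  using p unfolding graph_at_def by blast
 define ga where "ga = (%x. g ((x - p) - ((x - p) *. e) *R e))"
 have ga3: "ga (x + s *R e) = ga x" for x s unfolding ga_def by (rule C2_graph_height(3)[OF g e])
 note ga = C2_graph_height(1,2)[OF g e, where p = p, folded ga_def] ga3
 \<comment> \<open>Three radii: the cutoff lives in the ball of radius r/2, \<open>E\<close> in that
   of radius 3r/4, and a flow step shorter than r/4 stays in the ball of radius r, where the graph
   describes \<open>D\<close>.\<close>
 define E where "E = D \<inter> ball p (3 * r / 4)"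
 have ED: "E <= D" by (simp add: E_def)
 have gr': "x : D \<longleftrightarrow> (x - p) *. e < ga x" if "x : ball p r" for x
  using gr that unfolding ga_def by blast
 have stab: "EX h0>0. ALL h x. \<bar>h\<bar> <= h0 --> x : E --> shear_flow.Fl ga e (i - (i *. e) *R e) h x : D" for i
 proof -
  define ta where "ta = i - (i *. e) *R e"
  interpret shear_flow ga e ta by standard (use ga in auto)
  have te: "ta *. e = 0" "e *. e = 1" using e by (simp_all add: ta_def inner_diff_left norm_eq_1)
  obtain L where L: "L >= 0" "!!x y. norm x <= norm p + r + norm ta ==> norm y <= norm p + r + norm ta ==> norm (ga x - ga y) <= L * norm (x - y)"
   using C1_on_Lipschitz_bounded[OF ga(1)] by metis
  \<comment> \<open>A flow step h moves a point by at most |h| (1 + L) times the norm of ta, L being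
    a Lipschitz constant of the height; the summand 1 keeps the denominator positive when ta =
    0.\<close>
  define h0 where "h0 = min 1 (r / (4 * (norm ta + L * norm ta + 1)))"
  have pos: "norm ta + L * norm ta + 1 > 0" using L(1) by (simp add: add_nonneg_pos)
  have h0: "h0 > 0" "h0 <= 1" "h0 * (norm ta + L * norm ta) < r / 4"
  proof -
   show "h0 > 0" "h0 <= 1" unfolding h0_def using r pos by auto
   have "h0 * (norm ta + L * norm ta + 1) <= r / (4 * (norm ta + L * norm ta + 1)) * (norm ta + L * norm ta + 1)"
    unfolding h0_def using pos by (intro mult_right_mono) auto
   also have "... = r / 4" using pos by (simp add: field_simps)
   finally show "h0 * (norm ta + L * norm ta) < r / 4" using \<open>h0 > 0\<close> by (simp add: distrib_left)
  qed
  have "Fl h x : D" if h: "\<bar>h\<bar> <= h0" and x: "x : E" for h x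
  proof -
   have xb: "dist p x < 3 * r / 4" "x : D" using x by (auto simp: E_def)
   have xr: "x : ball p r" using xb r by simp
   have nx: "norm x <= norm p + r" using xb r norm_triangle_ineq2[of x p] by (simp add: dist_norm norm_minus_commute)
   have "norm (h *R ta) <= norm ta" using h h0 by (simp add: mult_left_le_one_le)
   then have "norm (x + h *R ta) <= norm p + r + norm ta" "norm x <= norm p + r + norm ta"
    using nx norm_triangle_ineq[of x "h *R ta"] norm_ge_zero[of ta] by linarith+
   from L(2)[OF this] have lg: "\<bar>ga (x + h *R ta) - ga x\<bar> <= \<bar>h\<bar> * (L * norm ta)" by (simp add: mult_ac)
   have "dist x (Fl h x) <= norm (h *R ta) + norm ((ga (x + h *R ta) - ga x) *R e)"
    using norm_triangle_ineq[of "h *R ta" "(ga (x + h *R ta) - ga x) *R e"]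
    by (subst dist_commute) (simp add: Fl_def dist_norm add.assoc)
   also have "... <= \<bar>h\<bar> * (norm ta + L * norm ta)" using lg e by (simp add: distrib_left)
   also have "... <= h0 * (norm ta + L * norm ta)" using h L(1) by (intro mult_right_mono) auto
   finally have "dist x (Fl h x) < r / 4" using h0(3) by linarith
   then have Flr: "Fl h x : ball p r" using xb dist_triangle[of p "Fl h x" x] by simp
   have g1: "ga (Fl h x) = ga (x + h *R ta)" unfolding Fl_def by (rule ge)
   \<comment> \<open>The height relative to the graph is the same before and after the step, so the
     point stays strictly below the graph.\<close>
   have "(Fl h x - p) *. e = (x - p) *. e + ga (x + h *R ta) - ga x"
    by (simp add: Fl_def inner_diff_left inner_add_left te)
   also have "... < ga (x + h *R ta)" using gr'[OF xr] xb(2) by simp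
   finally show "Fl h x : D" using gr'[OF Flr] g1 by simp
  qed
  then show ?thesis unfolding ta_def using h0(1) by blast
 qed
 show ?thesis
 proof (rule that[of "r / 2"])
  show "r / 2 > 0" using r by simp
  fix ze :: "'a => complex" and i j :: 'a
  assume ze: "smooth ze" "!!x. norm (x - p) >= r / 2 ==> ze x = 0" and ij: "i : Basis" "j : Basis"
  have zeC: "C1u ze" "!!i. i : Basis ==> C1u (pd ze i)" using ze(1) smooth_C1_on smooth_pd by blast+
  obtain B where B: "B >= 0" "!!x. x : D ==> norm (ze x) <= B" using C1_on_bounded_set[OF C1_on_cont[OF zeC(1)] D(2)] by metis
  have "ALL i. EX B>=0. ALL x:D. norm (pd ze i x) <= B" using C1_on_bounded_set[OF C1_on_cont_pd[OF zeC(1)] D(2)] by metis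
  from choice[OF this] obtain B' where B': "!!i. B' i >= 0" "!!i x. x : D ==> norm (pd ze i x) <= B' i" by blast
  have Wz: "W E (%x. ze x * u x) (%i x. ze x * G i x + pd ze i x * u x)"
  proof (rule W_mult[OF D(1) C1_on_subset[OF zeC(1) subset_UNIV] u, where B = "B + (SB i. B' i)" and C = "cball p (r/2)"])
   have S: "(SB i. B' i) >= 0" by (intro sum_nonneg B')
   show "cmod (ze x) <= B + (SB i. B' i)" if "x : D" for x using B(2)[OF that] S by simp
   show "cmod (pd ze i x) <= B + (SB i. B' i)" if "x : D" "i : Basis" for x i
    using B'(2)[OF that(1), of i] member_le_sum[OF that(2), of B'] B'(1) B(1) by (smt (verit) finite_Basis)
   show "0 <= B + (SB i. B' i)" using S B by simp
   show "cball p (r/2) \<inter> D <= E" unfolding E_def using r by auto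
   show "ze x = 0" if "x ~: cball p (r/2)" for x using ze(2)[of x] that by (simp add: dist_norm norm_minus_commute)
  qed (use ED in auto)
  note wl' = wlap_mult[OF D zeC u f wl]
  show "bf D (%ph. LBINT x. (ze x * G i x + pd ze i x * u x) * pd ph j x)"
   using local_second_derivatives[OF D e ga Wz ED wl'(2,1) stab ij] .
 qed
qed

text \<open>The plateaus c_q of a finite cover are combined as 1 - prod (1 - c_q), which is 1 on
  \<open>D\<close> without normalization. Each new q adds c_q times the product over the previous
  ones, a function supported where the local estimate at q applies. The factor et switches off
  neighbourhoods of the points at which the boundary is not a graph.\<close>

lemma smooth_cover_regularity:
 fixes D :: "'a::euclidean_space set"
 assumes D: "open D" "bounded D" and u: "W D u G" and f: "sqi f" "!!x. x ~: D ==> f x = 0" and wl: "wlap D G f"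
  and et: "smooth (et :: 'a => real)"
  and p: "!!p. p : closure D ==> graph_at D p \<or> (EX r>0. ALL x. norm (x - p) < r --> et x = 0)"
  and ij: "i : Basis" "j : Basis"
 shows "bf D (%ph. LBINT x. (cor (et x) * G i x + pd (%x. cor (et x)) i x * u x) * pd ph j x)"
proof -
 define Z where "Z = (%(ze::'a => real) x. cor (ze x) * G i x + pd (%x. cor (ze x)) i x * u x)"
 define BF where "BF = (%ze. bf D (%ph. LBINT x. Z ze x * pd ph j x))"
 have smc: "smooth (%x. cor (ze x))" if "smooth ze" for ze :: "'a => real" by (rule smooth_bl[OF that bounded_linear_of_real])
 have Zs: "sqi (Z ze)" if "smooth ze" for ze
 proof -
  have C: "C1u (%x. cor (ze x))" by (rule smooth_C1_on[OF smc[OF that]])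
  obtain B B' where B: "B >= 0" "!!x. x : D ==> norm (cor (ze x)) <= B" "B' >= 0" "!!x. x : D ==> norm (pd (%x. cor (ze x)) i x) <= B'"
   using C1_on_bounded_set[OF C1_on_cont[OF C] D(2)] C1_on_bounded_set[OF C1_on_cont_pd[OF C] D(2)] by metis
  show ?thesis unfolding Z_def
   by (intro sqi_add sqi_cont_mult(1)[OF D(1) cont_sub[OF C1_on_cont[OF C]] _ _ B(2,1)]
     sqi_cont_mult(1)[OF D(1) cont_sub[OF C1_on_cont_pd[OF C]] _ _ B(4,3)])
     (use WD[OF u] ij in auto)
 qed
 have Zadd: "Z (%x. ze x + xi x) x = Z ze x + Z xi x" if "smooth ze" "smooth xi" for ze xi x
  unfolding Z_def using C1_on_add(2)[OF smooth_C1_on[OF smc[OF that(1)]] smooth_C1_on[OF smc[OF that(2)]] UNIV_I, of x i]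
  by (simp add: algebra_simps)
 have BFadd: "BF (%x. ze x + xi x)" if z: "BF ze" "BF xi" "smooth ze" "smooth xi" for ze xi
  unfolding BF_def
 proof (rule bf_cong[OF bf_add[OF z(1,2)[unfolded BF_def]]])
  fix ph assume "C1c D ph"
  then have "intgl (%x. Z ze x * pd ph j x)" "intgl (%x. Z xi x * pd ph j x)"
   using z Zs sqi_mult C1c_int(4) by blast+
  then show "(LBINT x. Z (%x. ze x + xi x) x * pd ph j x) = (LBINT x. Z ze x * pd ph j x) + (LBINT x. Z xi x * pd ph j x)"
   using Zadd[OF z(3,4)] by (simp add: distrib_right)
 qed
 have local: "EX r>0. ALL xi. smooth xi --> (ALL x. norm (x - q) >= r --> xi x = 0) --> BF (%x. xi x * et x)" if q: "q : closure D" for q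
  using p[OF q]
 proof
  assume gq: "graph_at D q"
  show ?thesis
  proof (rule graph_at_regularity[OF D u f wl gq])
   fix r assume r: "r > 0" "!!ze i j. smooth ze ==> (!!x. norm (x - q) >= r ==> ze x = 0) ==> i : Basis ==> j : Basis ==>
    bf D (%ph. LBINT x. (ze x * G i x + pd ze i x * u x) * pd ph j x)"
   have "BF (%x. xi x * et x)" if "smooth xi" "!!x. norm (x - q) >= r ==> xi x = 0" for xi
    unfolding BF_def Z_def
    by (rule r(2)) (use smc[OF smooth_mult[OF that(1) et]] that(2) ij in auto)
   then show "EX r>0. ALL xi. smooth xi --> (ALL x. norm (x - q) >= r --> xi x = 0) --> BF (%x. xi x * et x)" using r(1) by blast
  qed
 next
  assume "EX r>0. ALL x. norm (x - q) < r --> et x = 0"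
  then obtain r where r: "r > 0" "!!x. norm (x - q) < r ==> et x = 0" by blast
  have "BF (%x. xi x * et x)" if "!!x. norm (x - q) >= r ==> xi x = 0" for xi
  proof -
   have "(%x. xi x * et x) = (%x. 0)" using that r(2) by (metis mult_eq_0_iff not_less)
   then have "BF (%x. xi x * et x) = BF (%x. 0)" by (simp only:)
   then show ?thesis unfolding BF_def Z_def by (simp add: bf_zero)
  qed
  then show ?thesis using r(1) by blast
 qed
 then have "ALL q. EX r. q : closure D --> r > 0 & (ALL xi. smooth xi --> (ALL x. norm (x - q) >= r --> xi x = 0) --> BF (%x. xi x * et x))" by blast
 from choice[OF this] obtain r where r: "!!q. q : closure D ==> r q > 0"
  "!!q xi. q : closure D ==> smooth xi ==> (!!x. norm (x - q) >= r q ==> xi x = 0) ==> BF (%x. xi x * et x)" by blast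
 have "ALL q. EX c. q : closure D --> smooth c & (ALL x. norm (x - q) <= r q / 2 --> c x = 1) & (ALL x. norm (x - q) >= r q --> c x = (0::real))"
 proof (intro allI)
  fix q
  show "EX c. q : closure D --> smooth c & (ALL x. norm (x - q) <= r q / 2 --> c x = 1) & (ALL x. norm (x - q) >= r q --> c x = (0::real))"
  proof (cases "q : closure D")
   case True
   then have pos: "r q / 2 > 0" using r(1) by simp
   show ?thesis
   proof (rule plateau[OF pos, of q])
    fix c :: "'a => real" assume "smooth c" "!!x. norm (x - q) <= r q / 2 ==> c x = 1" "!!x. norm (x - q) >= 2 * (r q / 2) ==> c x = 0"
    then show ?thesis by (intro exI[of _ c]) auto
   qed
  qed auto
 qed
 from choice[OF this] obtain c where c: "!!q. q : closure D ==> smooth (c q)" "!!q x. q : closure D ==> norm (x - q) <= r q / 2 ==> c q x = (1::real)"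
  "!!q x. q : closure D ==> norm (x - q) >= r q ==> c q x = 0" by blast
 have cl: "compact (closure D)" using D(2) by simp
 obtain A where A: "A <= closure D" "finite A" "closure D <= (\<Union>q\<in>A. ball q (r q / 2))"
  by (rule compactE_image[OF cl, of "closure D" "%q. ball q (r q / 2)"]) (use r(1) in \<open>auto intro: that\<close>)
 have fin: "smooth (%x. \<Prod>q\<in>A. 1 - c q x) & BF (%x. et x * (1 - (\<Prod>q\<in>A. 1 - c q x)))" if "finite A" "A <= closure D" for A
  using that
 proof (induction A)
  case empty
  show ?case unfolding BF_def Z_def by (simp add: bf_zero)
 next
  case (insert q A)
  let ?P = "%x. \<Prod>q\<in>A. 1 - c q x"
  have q: "q : closure D" and sP: "smooth ?P" and bP: "BF (%x. et x * (1 - ?P x))" using insert by auto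
  have 1: "smooth (%x. \<Prod>q\<in>insert q A. 1 - c q x)"
   using insert(1,2) smooth_mult[OF smooth_diff[OF smooth_const c(1)[OF q]] sP] by simp
  have "BF (%x. (c q x * ?P x) * et x)"
   by (rule r(2)[OF q smooth_mult[OF c(1)[OF q] sP]]) (simp add: c(3)[OF q])
  then have "BF (%x. et x * (1 - ?P x) + (c q x * ?P x) * et x)"
   by (rule BFadd[OF bP]) (intro smooth_mult smooth_diff smooth_const sP et c(1)[OF q])+
  moreover have "(%x. et x * (1 - ?P x) + (c q x * ?P x) * et x) = (%x. et x * (1 - (\<Prod>q\<in>insert q A. 1 - c q x)))"
   using insert(1,2) by (simp add: algebra_simps)
  ultimately show ?case using 1 by simp
 qed
 have one: "et x * (1 - (\<Prod>q\<in>A. 1 - c q x)) = et x" if xD: "x : D" for x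
 proof -
  obtain q where q: "q : A" "x : ball q (r q / 2)" using xD closure_subset[of D] A(3) by blast
  then have "c q x = 1" using A(1) by (intro c(2)) (auto simp: dist_norm norm_minus_commute)
  then have "(\<Prod>q\<in>A. 1 - c q x) = 0" using q(1) A(2) by (intro prod_zero) auto
  then show ?thesis by simp
 qed
 have "Z (%x. et x * (1 - (\<Prod>q\<in>A. 1 - c q x))) x = Z et x" for x
 proof (cases "x : D")
  case True
  have "pd (%x. cor (et x * (1 - (\<Prod>q\<in>A. 1 - c q x)))) i x = pd (%x. cor (et x)) i x"
   by (rule pd_eq_of_open[OF D(1) True]) (simp add: one)
  then show ?thesis unfolding Z_def by (simp only: one[OF True])
 qed (simp add: Z_def WD(3)[OF u] WD(4)[OF u _ ij(1)])
 then have "BF et" using fin[OF A(2,1)] unfolding BF_def by simp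
 then show ?thesis unfolding BF_def Z_def .
qed

section \<open>Passage between the given function spaces and Borel representatives\<close>

text \<open>The bridge from functions on \<open>lebesgue_on D\<close> to \<open>sqi\<close> and
  \<open>W\<close>. Integrals over \<open>D\<close> become integrals over the whole space because f0
  is 0 at every point outside \<open>D\<close>.\<close>

definition rep :: "'a::euclidean_space set => ('a => 'b::{banach,second_countable_topology}) => ('a => 'b) => bool" where
 "rep D f f0 \<longleftrightarrow> f : borel_measurable (lebesgue_on D) & f0 : mbl & (ALL x. x ~: D --> f0 x = 0) \<and>
   (AEL x. x : D --> f x = f0 x)"

lemma rep_D:
 assumes "rep D f f0"
 shows "f : borel_measurable (lebesgue_on D)" "f0 : mbl" "x ~: D ==> f0 x = 0" "AEL x. x : D --> f x = f0 x"
 using assms by (auto simp: rep_def)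

lemma AE_lebesgue_on_lborel:
 assumes "open D" shows "(AE x in lebesgue_on D. P x) \<longleftrightarrow> (AEL x. x : D --> P x)"
proof -
 have "D \<inter> space lebesgue : sets lebesgue" using assms by (simp add: sets_completionI_sets)
 then show ?thesis by (simp add: AE_restrict_space_iff AE_completion_iff)
qed

lemma borel_measurable_lebesgue_onI: "f : mbl ==> f : borel_measurable (lebesgue_on D)"
 by (simp add: measurable_completion measurable_restrict_space1)

lemma rep_self: "f : mbl ==> (!!x. x ~: D ==> f x = 0) ==> rep D f f"
 by (simp add: rep_def borel_measurable_lebesgue_onI)

lemma rep_AE: "rep D f f0 ==> f1 : mbl ==> (!!x. x ~: D ==> f1 x = 0) ==> AEL x. x : D --> f0 x = f1 x ==> rep D f f1"
 unfolding rep_def by (auto elim: eventually_elim2)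

lemma rep_integral:
 assumes D: "open D" and r: "rep D f f0"
 shows "integrable (lebesgue_on D) f \<longleftrightarrow> intgl f0" "integral\<^sup>L (lebesgue_on D) f = integral\<^sup>L lborel f0"
proof -
 note r = rep_D[OF r]
 have D': "D : sets lebesgue" using D by (simp add: sets_completionI_sets)
 have m: "f0 : borel_measurable (lebesgue_on D)" by (rule borel_measurable_lebesgue_onI[OF r(2)])
 have ae: "AE x in lebesgue_on D. f x = f0 x" using r(4) by (simp add: AE_lebesgue_on_lborel[OF D])
 have ind: "(%x. indicator D x *R f0 x) = f0" using r(3) by (auto simp: indicator_def)
 have m0: "f0 : lmbl" using r(2) by simp
 have "integrable (lebesgue_on D) f \<longleftrightarrow> integrable (lebesgue_on D) f0" by (rule integrable_cong_AE[OF r(1) m ae])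
 also have "... \<longleftrightarrow> integrable lebesgue f0" using D' integrable_restrict_space[of D lebesgue f0] by (simp add: ind)
 finally show "integrable (lebesgue_on D) f \<longleftrightarrow> intgl f0" by (simp add: integrable_completion[OF m0])
 have "integral\<^sup>L (lebesgue_on D) f = integral\<^sup>L (lebesgue_on D) f0" by (rule integral_cong_AE[OF r(1) m ae])
 also have "... = integral\<^sup>L lebesgue f0" using D' integral_restrict_space[of D lebesgue f0] by (simp add: ind)
 finally show "integral\<^sup>L (lebesgue_on D) f = integral\<^sup>L lborel f0" by (simp add: integral_completion[OF m0])
qed

text \<open>A Lebesgue measurable function agrees almost everywhere with a Borel one; real and
  imaginary parts are treated separately.\<close>

lemma rep_exists:
 fixes u :: "'a::euclidean_space => complex"
 assumes D: "open D" and u: "u : borel_measurable (lebesgue_on D)"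
 obtains u0 where "rep D u u0"
proof -
 have Ds: "D : sets lebesgue" "D : sets borel" using D by (auto simp: sets_completionI_sets)
 have "(%x. if x : D then u x else 0) : borel_measurable lebesgue"
  using u Ds by (simp add: borel_measurable_if)
 then have "(%x. Re (if x : D then u x else 0)) : borel_measurable (completion lborel)" "(%x. Im (if x : D then u x else 0)) : borel_measurable (completion lborel)"
  by measurable
 note c = this
 obtain a where a: "a : lmbl" "AEL x. Re (if x : D then u x else 0) = a x"
  using completion_ex_borel_measurable_real[OF c(1)] by blast
 obtain b where b: "b : lmbl" "AEL x. Im (if x : D then u x else 0) = b x"
  using completion_ex_borel_measurable_real[OF c(2)] by blast
 note ab = a b
 have [measurable]: "a : mbl" "b : mbl" "D : sets borel" using ab Ds by auto
 have "rep D u (%x. indicator D x * Complex (a x) (b x))"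
  unfolding rep_def
 proof (intro conjI u)
  show "(%x. indicator D x * Complex (a x) (b x)) : mbl" unfolding Complex_eq by measurable
  show "AEL x. x : D --> u x = indicator D x * Complex (a x) (b x)"
   using ab(2,4) by eventually_elim (auto simp: complex_eq_iff)
 qed auto
 then show ?thesis by (rule that)
qed

text \<open>The condition h 0 0 = 0 keeps the composed representative zero off \<open>D\<close>.
  Products, conjugate products and squared moduli are instances.\<close>

lemma rep_comp2:
 fixes h :: "complex => complex => 'b::{banach,second_countable_topology}"
 assumes f: "rep D f f0" "rep D g g0" and h: "h 0 0 = 0" "continuous_on UNIV (%x. h (fst x) (snd x))"
 shows "rep D (%x. h (f x) (g x)) (%x. h (f0 x) (g0 x))"
proof -
 note r = rep_D[OF f(1)] rep_D[OF f(2)]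
 have "(%x. (f x, g x)) : borel_measurable (lebesgue_on D)" by (rule borel_measurable_Pair[OF r(1) r(5)])
 moreover have "(%x. (f0 x, g0 x)) : mbl" by (rule borel_measurable_Pair[OF r(2) r(6)])
 ultimately have this: "(%x. (f x, g x)) : borel_measurable (lebesgue_on D)" "(%x. (f0 x, g0 x)) : mbl" by auto
 from measurable_compose[OF this(1) mbl_cont[OF h(2)]] measurable_compose[OF this(2) mbl_cont[OF h(2)]]
 have "(%x. h (f x) (g x)) : borel_measurable (lebesgue_on D)" "(%x. h (f0 x) (g0 x)) : mbl" by simp_all
 then show ?thesis unfolding rep_def using r h(1) by auto
qed

lemma rep_mult: "rep D f f0 ==> rep D g g0 ==> rep D (%x. f x * g x) (%x. f0 x * g0 x :: complex)"
 by (rule rep_comp2[where h = "%a b. a * b"]) (auto intro!: continuous_intros)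

lemma rep_mult_cnj: "rep D f f0 ==> rep D g g0 ==> rep D (%x. f x * cnj (g x)) (%x. f0 x * cnj (g0 x))"
 by (rule rep_comp2[where h = "%a b. a * cnj b"]) (auto intro!: continuous_intros)

lemma rep_diff_sq: "rep D f f0 ==> rep D g g0 ==> rep D (%x. (cmod (f x - g x))^2) (%x. (cmod (f0 x - g0 x))^2)"
 by (rule rep_comp2[where h = "%a b. (cmod (a - b))^2"]) (auto intro!: continuous_intros)

lemma rep_sq: "rep D f f0 ==> rep D (%x. (cmod (f x))^2) (%x. (cmod (f0 x))^2)"
 by (rule rep_comp2[where h = "%a b. (cmod a)^2"]) (auto intro!: continuous_intros)

lemma rep_L2:
 assumes D: "open D" and r: "rep D u u0"
 shows "u : L2 D \<longleftrightarrow> sqi u0" "L2norm D u = nrm u0"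
 using rep_D(1,2)[OF r] rep_integral[OF D rep_sq[OF r]] by (auto simp: L2_def sqiM_def L2norm_def nrmM_def)

lemma rep_L2inner:
 assumes D: "open D" and "rep D u u0" "rep D v v0"
 shows "L2inner D u v = (LBINT x. u0 x * cnj (v0 x))"
 unfolding L2inner_def by (rule rep_integral(2)[OF D rep_mult_cnj[OF assms(2,3)]])

lemma L2_rep:
 assumes "open D" "u : L2 D" obtains u0 where "rep D u u0" "sqi u0"
proof (rule rep_exists[OF assms(1), of u])
 show "u : borel_measurable (lebesgue_on D)" using assms(2) by (simp add: L2_def)
 fix u0 assume r: "rep D u u0"
 show thesis by (rule that[OF r]) (rule iffD1[OF rep_L2(1)[OF assms(1) r] assms(2)])
qed

lemma test_fun_off: "test_fun D ph ==> x ~: tsupp ph ==> ph x = 0"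
 unfolding tsupp_def using subsetD[OF closure_subset, of x "{x. ph x ~= 0}"] by auto

lemma test_fun_C1c: assumes "test_fun D ph" shows "C1c D ph"
 unfolding C1c_def using assms test_fun_off[OF assms] by (auto simp: test_fun_def intro: smooth_C1_on)

lemma test_fun_pd: assumes t: "test_fun D ph" and i: "i : Basis" shows "test_fun D (pd ph i)"
proof -
 have cl: "closed (tsupp ph)" by (simp add: tsupp_def)
 have "pd ph i x = 0" if "x ~: tsupp ph" for x by (rule pd_zero_off_closed[OF cl test_fun_off[OF t] that])
 then have s: "tsupp (pd ph i) <= tsupp ph" unfolding tsupp_def[of "pd ph i"] by (intro closure_minimal cl) auto
 moreover have "compact (tsupp (pd ph i))"
 proof -
  have "compact (tsupp ph \<inter> tsupp (pd ph i))" using t by (intro compact_Int_closed) (auto simp: test_fun_def tsupp_def)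
  then show ?thesis using s by (simp add: Int_absorb1)
 qed
 ultimately show ?thesis using t smooth_pd[OF _ i] by (auto simp: test_fun_def)
qed

lemma rep_C1c: "C1c D ph ==> rep D ph ph"
 using C1c_mbl C1c_off by (intro rep_self) auto

text \<open>Smooth test functions are C^1, and C^1 test functions are L^2 limits of smooth ones
  together with their gradients, so both classes define the same weak derivative.\<close>

lemma weak_deriv_rep:
 assumes D: "open D" and r: "rep D u u0" "rep D g g0" and s: "sqi u0" "sqi g0" and i: "i : Basis"
 shows "weak_deriv D u i g \<longleftrightarrow> (ALL ph. C1c D ph --> (LBINT x. u0 x * pd ph i x) = - (LBINT x. g0 x * ph x))"
proof
 assume wd: "weak_deriv D u i g"
 have t: "(LBINT x. u0 x * pd ph i x) = - (LBINT x. g0 x * ph x)" if "test_fun D ph" for ph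
  using wd that rep_integral(2)[OF D rep_mult[OF r(1) rep_C1c[OF test_fun_C1c[OF test_fun_pd[OF that i]]]]]
   rep_integral(2)[OF D rep_mult[OF r(2) rep_C1c[OF test_fun_C1c[OF that]]]]
  by (simp add: weak_deriv_def)
 show "ALL ph. C1c D ph --> (LBINT x. u0 x * pd ph i x) = - (LBINT x. g0 x * ph x)"
 proof (intro allI impI)
  fix ph assume p: "C1c D ph"
  show "(LBINT x. u0 x * pd ph i x) = - (LBINT x. g0 x * ph x)"
  proof (rule C1c_mollify[OF D p])
   fix psi assume psi: "!!n. test_fun D (psi n)" "!!n. C1c D (psi n)" "null (%n. nrm (%x. psi n x - ph x))"
    "!!i. i : Basis ==> (%n. nrm (%x. pd (psi n) i x - pd ph i x)) \<longlonglongrightarrow> 0"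
   have 1: "(%n. LBINT x. u0 x * pd (psi n) i x) \<longlonglongrightarrow> (LBINT x. u0 x * pd ph i x)"
    by (rule tendsto_nrm_mult) (simp_all add: s C1c_int[OF psi(2)] C1c_int[OF p] psi(4)[OF i])
   have 2: "(%n. LBINT x. g0 x * psi n x) \<longlonglongrightarrow> (LBINT x. g0 x * ph x)"
    by (rule tendsto_nrm_mult) (simp_all add: s C1c_int[OF psi(2)] C1c_int[OF p] psi(3))
   show ?thesis using LIMSEQ_unique[OF 1[unfolded t[OF psi(1)]] tendsto_minus[OF 2]] .
  qed
 qed
next
 assume h: "ALL ph. C1c D ph --> (LBINT x. u0 x * pd ph i x) = - (LBINT x. g0 x * ph x)"
 show "weak_deriv D u i g" unfolding weak_deriv_def
 proof (intro allI impI)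
  fix ph assume t: "test_fun D ph"
  note c = test_fun_C1c[OF t]
  note a = rep_integral[OF D rep_mult[OF r(1) rep_C1c[OF test_fun_C1c[OF test_fun_pd[OF t i]]]]]
   and b = rep_integral[OF D rep_mult[OF r(2) rep_C1c[OF c]]]
  have "intgl (%x. u0 x * pd ph i x)" "intgl (%x. g0 x * ph x)"
   by (intro sqi_mult s C1c_int[OF c])+
  then show "integrable (lebesgue_on D) (%x. u x * dderiv [i] ph x) & integrable (lebesgue_on D) (%x. g x * ph x) \<and>
   (LINT x|lebesgue_on D. u x * dderiv [i] ph x) = - (LINT x|lebesgue_on D. g x * ph x)"
   using a b h c by simp
 qed
qed

text \<open>\<open>weak_laplacian\<close> puts two derivatives on the test function. One of them is
  moved to u by testing its weak gradient with \<open>pd ph i\<close>; mollification then admits C^1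
  test functions.\<close>

lemma weak_laplacian_W:
 assumes D: "open D" and r: "rep D u u0" "rep D f f0" and W: "W D u0 G" and s: "sqi f0"
  and wl: "weak_laplacian D u f"
 shows "wlap D G f0"
 unfolding wlap_def
proof (intro allI impI)
 have t: "(SB i. LBINT x. G i x * pd ph i x) = - (LBINT x. f0 x * ph x)" if t: "test_fun D ph" for ph
 proof -
  note p = test_fun_pd[OF t] and c = test_fun_C1c[OF t]
  have m: "C1c D (pd (pd ph i) i)" if "i : Basis" for i by (rule test_fun_C1c[OF test_fun_pd[OF p[OF that] that]])
  have i: "intgl (%x. u0 x * pd (pd ph i) i x)" if "i : Basis" for i
   by (intro sqi_mult WD(1)[OF W] C1c_int(3)[OF m[OF that]])
  have "rep D (lapc ph) (lapc ph)"
  proof (rule rep_self)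
   show "lapc ph : mbl" unfolding lapc_def[abs_def] dderiv.simps by (intro borel_measurable_sum C1c_mbl[OF m])
   show "lapc ph x = 0" if "x ~: D" for x using that C1c_off[OF m] by (simp add: lapc_def)
  qed
  from rep_integral(2)[OF D rep_mult[OF r(1) this]]
  have "(LINT x|lebesgue_on D. u x * lapc ph x) = (LBINT x. u0 x * lapc ph x)" .
  also have "... = (SB i. LBINT x. u0 x * pd (pd ph i) i x)"
   unfolding lapc_def dderiv.simps sum_distrib_left by (rule bint_sum[OF i])
  also have "... = (SB i. - (LBINT x. G i x * pd ph i x))"
   using W_weak_derivative[OF D W test_fun_C1c[OF p]] by (intro sum.cong) (auto simp: dirG_Basis)
  finally have A: "(LINT x|lebesgue_on D. u x * lapc ph x) = - (SB i. LBINT x. G i x * pd ph i x)" by (simp add: sum_negf)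
  have B: "(LINT x|lebesgue_on D. u x * lapc ph x) = (LBINT x. f0 x * ph x)"
   using wl t rep_integral(2)[OF D rep_mult[OF r(2) rep_C1c[OF c]]] by (simp add: weak_laplacian_def)
  show ?thesis by (rule sym, rule iffD1[OF minus_equation_iff], rule trans[OF sym[OF A] B])
 qed
 fix ph assume p: "C1c D ph"
 show "(SB i. LBINT x. G i x * pd ph i x) = - (LBINT x. f0 x * ph x)"
 proof (rule C1c_mollify[OF D p])
  fix psi assume psi: "!!n. test_fun D (psi n)" "!!n. C1c D (psi n)" "null (%n. nrm (%x. psi n x - ph x))"
   "!!i. i : Basis ==> (%n. nrm (%x. pd (psi n) i x - pd ph i x)) \<longlonglongrightarrow> 0"
  have 1: "(%n. SB i. LBINT x. G i x * pd (psi n) i x) \<longlonglongrightarrow> (SB i. LBINT x. G i x * pd ph i x)"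
   by (intro tendsto_sum tendsto_nrm_mult) (simp_all add: WD(2)[OF W] C1c_int[OF psi(2)] C1c_int[OF p] psi(4))
  have 2: "(%n. LBINT x. f0 x * psi n x) \<longlonglongrightarrow> (LBINT x. f0 x * ph x)"
   by (rule tendsto_nrm_mult) (simp_all add: s C1c_int[OF psi(2)] C1c_int[OF p] psi(3))
  show ?thesis using LIMSEQ_unique[OF 1[unfolded t[OF psi(1)]] tendsto_minus[OF 2]] .
 qed
qed

lemma H10_E:
 assumes D: "open D" and u: "u : H10 D"
 obtains u0 G where "rep D u u0" "W D u0 G"
proof -
 obtain psi where psi: "!!n. test_fun D (psi n)" "null (%n. LINT x|lebesgue_on D. (cmod (psi n x - u x))^2)"
  and gg: "ALL i:Basis. EX g:L2 D. (%n. LINT x|lebesgue_on D. (cmod (dderiv [i] (psi n) x - g x))^2) \<longlonglongrightarrow> 0"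
  using u unfolding H10_def by blast
 have "u : L2 D" using u by (auto simp: H10_def H1_def)
 then obtain u0 where u0: "rep D u u0" "sqi u0" using L2_rep[OF D] by blast
 have n: "null (%n. nrm (%x. a n x - b0 x))"
  if "!!n. rep D (a n) (a n)" "rep D b b0" "null (%n. LINT x|lebesgue_on D. (cmod (a n x - b x))^2)" for a b b0
  using tendsto_real_sqrt[OF that(3)] unfolding nrmM_def
  by (simp add: rep_integral(2)[OF D rep_diff_sq[OF that(1,2)]])
 have "EX g0. sqi g0 & (ALL x. x ~: D --> g0 x = 0) & (%n. nrm (%x. pd (psi n) i x - g0 x)) \<longlonglongrightarrow> 0"
  if i: "i : Basis" for i
 proof -
  obtain g where g: "g : L2 D" "null (%n. LINT x|lebesgue_on D. (cmod (dderiv [i] (psi n) x - g x))^2)" using gg i by blast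
  obtain g0 where g0: "rep D g g0" "sqi g0" using L2_rep[OF D g(1)] by blast
  have "null (%n. nrm (%x. pd (psi n) i x - g0 x))"
   by (rule n[OF rep_C1c[OF test_fun_C1c[OF test_fun_pd[OF psi(1) i]]] g0(1)]) (use g(2) in simp)
  then show ?thesis using g0 rep_D(3)[OF g0(1)] by blast
 qed
 then have "ALL i. EX g0. i : Basis --> sqi g0 & (ALL x. x ~: D --> g0 x = 0) & (%n. nrm (%x. pd (psi n) i x - g0 x)) \<longlonglongrightarrow> 0" by blast
 from choice[OF this] obtain G where G: "!!i. i : Basis ==> sqi (G i)" "!!i x. i : Basis ==> x ~: D ==> G i x = 0"
  "!!i. i : Basis ==> (%n. nrm (%x. pd (psi n) i x - G i x)) \<longlonglongrightarrow> 0" by blast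
 have "W D u0 G"
  by (rule WI[OF u0(2) G(1) rep_D(3)[OF u0(1)] G(2) test_fun_C1c[OF psi(1)] n[OF rep_C1c[OF test_fun_C1c[OF psi(1)]] u0(1) psi(2)] G(3)])
 then show ?thesis using that u0(1) by blast
qed

lemma W_rep: "W D u G ==> rep D u u" and W_rep_grad: "W D u G ==> i : Basis ==> rep D (G i) (G i)"
 using WD[of D u G] sqi_meas[of lborel u] sqi_meas[of lborel "G i"] by (auto intro!: rep_self)

lemma W_weak_deriv:
 assumes D: "open D" and W: "W D u G" and i: "i : Basis"
 shows "weak_deriv D u i (G i)"
 using W_weak_derivative[OF D W, where v = i] by (subst weak_deriv_rep[OF D W_rep[OF W] W_rep_grad[OF W i] WD(1)[OF W] WD(2)[OF W i] i]) (simp add: dirG_Basis[OF i])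

text \<open>The n-th C^1 approximant is replaced by a smooth one within 1 / (n + 1) in function and
  gradient.\<close>

lemma W_test_fun_approx:
 assumes D: "open D" and W: "W D u G"
 obtains om where "!!n. test_fun D (om n)" "null (%n. nrm (%x. om n x - u x))"
  "!!i. i : Basis ==> (%n. nrm (%x. pd (om n) i x - G i x)) \<longlonglongrightarrow> 0"
proof -
 obtain psi where psi: "!!n. C1c D (psi n)" "null (%n. nrm (%x. psi n x - u x))"
  "!!v. (%n. nrm (%x. pd (psi n) v x - dirG G v x)) \<longlonglongrightarrow> 0" by (rule W_E[OF W]) (rule that; assumption)
 have "EX om. test_fun D om & nrm (%x. om x - psi n x) < 1 / real (Suc n) & (ALL i:Basis. nrm (%x. pd om i x - pd (psi n) i x) < 1 / real (Suc n))" for n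
 proof (rule C1c_mollify[OF D psi(1)[of n]])
  fix xi assume xi: "!!m. test_fun D (xi m)" "(%m. nrm (%x. xi m x - psi n x)) \<longlonglongrightarrow> 0"
   "!!i. i : Basis ==> (%m. nrm (%x. pd (xi m) i x - pd (psi n) i x)) \<longlonglongrightarrow> 0"
  have p: "1 / real (Suc n) > 0" by simp
  have "EV m. nrm (%x. xi m x - psi n x) < 1 / real (Suc n)" using order_tendstoD(2)[OF xi(2) p] .
  moreover have "EV m. ALL i:Basis. nrm (%x. pd (xi m) i x - pd (psi n) i x) < 1 / real (Suc n)"
   using order_tendstoD(2)[OF xi(3) p] by (intro eventually_ball_finite) auto
  ultimately have "EV m. nrm (%x. xi m x - psi n x) < 1 / real (Suc n) & (ALL i:Basis. nrm (%x. pd (xi m) i x - pd (psi n) i x) < 1 / real (Suc n))"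
   by (rule eventually_conj)
  then obtain m where "nrm (%x. xi m x - psi n x) < 1 / real (Suc n) & (ALL i:Basis. nrm (%x. pd (xi m) i x - pd (psi n) i x) < 1 / real (Suc n))"
   using eventually_happens sequentially_bot by blast
  then show ?thesis using xi(1)[of m] by blast
 qed
 then have "ALL n. EX om. test_fun D om & nrm (%x. om x - psi n x) < 1 / real (Suc n) & (ALL i:Basis. nrm (%x. pd om i x - pd (psi n) i x) < 1 / real (Suc n))" by blast
 from choice[OF this] obtain om where om: "!!n. test_fun D (om n)" "!!n. nrm (%x. om n x - psi n x) < 1 / real (Suc n)"
  "!!n i. i : Basis ==> nrm (%x. pd (om n) i x - pd (psi n) i x) < 1 / real (Suc n)" by blast
 have lim: "null (%n. nrm (%x. a n x - c x))"
  if "!!n. sqi (a n)" "!!n. sqi (b n)" "sqi c" "!!n. nrm (%x. a n x - b n x) < 1 / real (Suc n)" "null (%n. nrm (%x. b n x - c x))" for a b c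
 proof (rule tendsto_sandwich[OF _ _ tendsto_const])
  show "EV n. nrm (%x. a n x - c x) <= 1 / real (Suc n) + nrm (%x. b n x - c x)"
  proof (intro always_eventually allI)
   fix n show "nrm (%x. a n x - c x) <= 1 / real (Suc n) + nrm (%x. b n x - c x)"
    by (rule order_trans[OF nrm_triangle4[OF that(1,2,3)] add_right_mono[OF less_imp_le[OF that(4)]]])
  qed
  show "null (%n. 1 / real (Suc n) + nrm (%x. b n x - c x))"
   using tendsto_add[OF LIMSEQ_Suc[OF lim_1_over_n] that(5)] by simp
 qed auto
 show ?thesis
 proof (rule that[OF om(1)])
  show "null (%n. nrm (%x. om n x - u x))"
   by (rule lim[OF C1c_int(3)[OF test_fun_C1c[OF om(1)]] C1c_int(3)[OF psi(1)] WD(1)[OF W] om(2) psi(2)])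
  show "null (%n. nrm (%x. pd (om n) i x - G i x))" if "i : Basis" for i
   using lim[OF C1c_int(4)[OF test_fun_C1c[OF om(1)]] C1c_int(4)[OF psi(1)] WD(2)[OF W that] om(3)[OF that]] psi(3)[of i] that
   by (simp add: dirG_Basis)
 qed
qed

lemma W_H10:
 assumes D: "open D" and W: "W D u G"
 shows "u : H10 D"
proof (rule W_test_fun_approx[OF D W])
 fix om assume om: "!!n. test_fun D (om n)" "null (%n. nrm (%x. om n x - u x))"
  "!!i. i : Basis ==> (%n. nrm (%x. pd (om n) i x - G i x)) \<longlonglongrightarrow> 0"
 have L: "u : L2 D" "!!i. i : Basis ==> G i : L2 D"
  using rep_L2(1)[OF D W_rep[OF W]] rep_L2(1)[OF D W_rep_grad[OF W]] WD[OF W] by auto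
 have n: "null (%n. LINT x|lebesgue_on D. (cmod (a n x - b x))^2)"
  if "!!n. rep D (a n) (a n)" "rep D b b" "null (%n. nrm (%x. a n x - b x))" for a b
  using tendsto_power[OF that(3), of 2] by (simp add: nrm_sq rep_integral(2)[OF D rep_diff_sq[OF that(1,2)]])
 have "null (%n. LINT x|lebesgue_on D. (cmod (om n x - u x))^2)"
  by (rule n[OF rep_C1c[OF test_fun_C1c[OF om(1)]] W_rep[OF W] om(2)])
 moreover have "null (%n. LINT x|lebesgue_on D. (cmod (dderiv [i] (om n) x - G i x))^2)" if "i : Basis" for i
  using n[OF rep_C1c[OF test_fun_C1c[OF test_fun_pd[OF om(1) that]]] W_rep_grad[OF W that] om(3)[OF that]] by simp
 ultimately show ?thesis unfolding H10_def H1_def using L om(1) W_weak_deriv[OF D W] by blast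
qed

text \<open>Riesz representation turns each bounded functional, the integral of \<open>G i\<close>
  against \<open>pd ph j\<close>, into a weak second derivative in L^2.\<close>

lemma W_XD:
 assumes D: "open D" "bounded D" and W: "W D u G"
  and b: "!!i j. i : Basis ==> j : Basis ==> bf D (%ph. LBINT x. G i x * pd ph j x)"
 shows "u : XD D"
proof -
 have L: "u : L2 D" "!!i. i : Basis ==> G i : L2 D"
  using rep_L2(1)[OF D(1) W_rep[OF W]] rep_L2(1)[OF D(1) W_rep_grad[OF W]] WD[OF W] by auto
 have "EX h:L2 D. weak_deriv D (G i) j h" if ij: "i : Basis" "j : Basis" for i j
 proof -
  obtain C where C: "!!ph. C1c D ph ==> cmod (LBINT x. G i x * pd ph j x) <= C * nrm ph"
   using b[OF ij] unfolding bf_def by blast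
  have lin: "(LBINT x. G i x * pd (%x. u x + c * v x) j x) = (LBINT x. G i x * pd u j x) + c * (LBINT x. G i x * pd v j x)"
   if "C1c D u" "C1c D v" for u v c
  proof -
   have p: "pd (%x. u x + c * v x) j x = pd u j x + c * pd v j x" for x
    using C1_on_add(2)[OF C1c_C1[OF that(1)] C1c_C1[OF C1c_cmult[OF that(2)]] UNIV_I] C1_cmult_pd[OF C1c_C1[OF that(2)]] by simp
   have "intgl (%x. G i x * pd u j x)" "intgl (%x. G i x * pd v j x)"
    by (intro sqi_mult WD(2)[OF W] ij C1c_int(4)[OF that(1)] C1c_int(4)[OF that(2)])+
   then show ?thesis unfolding p by (simp add: distrib_left mult.left_commute[of _ c])
  qed
  show ?thesis
  proof (rule C1c_Riesz[OF D lin C])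
   fix h assume h: "sqi h" "!!x. x ~: D ==> h x = 0" "!!u. C1c D u ==> (LBINT x. G i x * pd u j x) = (LBINT x. h x * u x)"
   have s: "sqi (%x. - h x)" by (rule sqi_uminus[OF h(1)])
   have r: "rep D (%x. - h x) (%x. - h x)" using sqi_meas[OF s] h(2) by (intro rep_self) auto
   have "weak_deriv D (G i) j (%x. - h x)"
    by (subst weak_deriv_rep[OF D(1) W_rep_grad[OF W ij(1)] r WD(2)[OF W ij(1)] s ij(2)]) (simp add: h(3))
   then show ?thesis using rep_L2(1)[OF D(1) r] s by blast
  qed
 qed
 then have "u : H2 D" unfolding H2_def using L W_weak_deriv[OF D(1) W] by blast
 then show ?thesis using W_H10[OF D(1) W] by (simp add: XD_def)
qed

text \<open>The sum of the pure second weak derivatives is a witness for the choice in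
  \<open>Lap\<close>.\<close>

lemma XD_Lap:
 assumes D: "open D" and u: "u : XD D"
 shows "Lap D u : L2 D" "weak_laplacian D u (Lap D u)"
proof -
 have "ALL i. EX g h. i : Basis --> g : L2 D & weak_deriv D u i g & h : L2 D & weak_deriv D g i h" using u unfolding XD_def H2_def by blast
 then obtain g h where gh: "!!i. i : Basis ==> weak_deriv D u i (g i)" "!!i. i : Basis ==> h i : L2 D" "!!i. i : Basis ==> weak_deriv D (g i) i (h i)"
  unfolding choice_iff by blast
 let ?h = "%x. SB i. h i x"
 have "?h : L2 D"
 proof -
  have "ALL i. EX h0. i : Basis --> rep D (h i) h0 & sqi h0" proof (intro allI)
   fix i show "EX h0. i : Basis --> rep D (h i) h0 & sqi h0"
    using L2_rep[OF D, of "h i"] gh(2)[of i] by blast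
  qed
  from choice[OF this] obtain h0 where h0: "!!i. i : Basis ==> rep D (h i) (h0 i)" "!!i. i : Basis ==> sqi (h0 i)" by blast
  have "rep D ?h (%x. SB i. h0 i x)" unfolding rep_def
  proof (intro conjI)
   show "?h : borel_measurable (lebesgue_on D)" "(%x. SB i. h0 i x) : mbl" using rep_D(1,2)[OF h0(1)] by (auto intro!: borel_measurable_sum)
   show "ALL x. x ~: D --> (SB i. h0 i x) = 0" using rep_D(3)[OF h0(1)] by simp
   have "AEL x. ALL i:Basis. x : D --> h i x = h0 i x" using rep_D(4)[OF h0(1)] by (intro AE_finite_allI) auto
   then show "AEL x. x : D --> ?h x = (SB i. h0 i x)" by eventually_elim simp
  qed
  from rep_L2(1)[OF D this] show ?thesis using h0(2) by (simp add: sqi_sum)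
 qed
 moreover have "weak_laplacian D u ?h" unfolding weak_laplacian_def
 proof (intro allI impI)
  fix ph assume t: "test_fun D ph"
  have a: "integrable (lebesgue_on D) (%x. u x * dderiv [i] (pd ph i) x)"
   "(LINT x|lebesgue_on D. u x * dderiv [i] (pd ph i) x) = - (LINT x|lebesgue_on D. g i x * pd ph i x)" if "i : Basis" for i
   using gh(1)[OF that] test_fun_pd[OF t that] unfolding weak_deriv_def by blast+
  have b: "integrable (lebesgue_on D) (%x. h i x * ph x)"
   "(LINT x|lebesgue_on D. g i x * dderiv [i] ph x) = - (LINT x|lebesgue_on D. h i x * ph x)" if "i : Basis" for i
   using gh(3)[OF that] t unfolding weak_deriv_def by blast+
  have l: "(%x. u x * lapc ph x) = (%x. SB i. u x * dderiv [i] (pd ph i) x)" by (simp add: lapc_def sum_distrib_left)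
  have r: "(%x. ?h x * ph x) = (%x. SB i. h i x * ph x)" by (simp add: sum_distrib_right)
  have e: "(SB i. LINT x|lebesgue_on D. u x * dderiv [i] (pd ph i) x) = (SB i. LINT x|lebesgue_on D. h i x * ph x)"
  proof (rule sum.cong[OF refl])
   fix i :: 'a assume i: "i : Basis"
   show "(LINT x|lebesgue_on D. u x * dderiv [i] (pd ph i) x) = (LINT x|lebesgue_on D. h i x * ph x)"
    using a(2)[OF i] b(2)[OF i] by simp
  qed
  show "integrable (lebesgue_on D) (%x. u x * lapc ph x) & integrable (lebesgue_on D) (%x. ?h x * ph x) \<and>
   (LINT x|lebesgue_on D. u x * lapc ph x) = (LINT x|lebesgue_on D. ?h x * ph x)"
   unfolding l r
   using bint_sum[where I = Basis and f = "%i x. u x * dderiv [i] (pd ph i) x", OF a(1)] bint_sum[where I = Basis and f = "%i x. h i x * ph x", OF b(1)]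
    bintgl_sum[where I = Basis and f = "%i x. u x * dderiv [i] (pd ph i) x", OF a(1)] bintgl_sum[where I = Basis and f = "%i x. h i x * ph x", OF b(1)] e
   by (simp only: simp_thms)
 qed
 ultimately have "Lap D u : L2 D & weak_laplacian D u (Lap D u)" unfolding Lap_def by (metis (mono_tags, lifting) someI_ex)
 then show "Lap D u : L2 D" "weak_laplacian D u (Lap D u)" by auto
qed

lemma XD_E:
 assumes D: "open D" and u: "u : XD D"
 obtains u0 G f where "rep D u u0" "W D u0 G" "rep D (Lap D u) f" "sqi f" "wlap D G f"
proof -
 obtain u0 G where uG: "rep D u u0" "W D u0 G" using H10_E[OF D] u unfolding XD_def by blast
 obtain f where f: "rep D (Lap D u) f" "sqi f" using L2_rep[OF D XD_Lap(1)[OF D u]] by blast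
 show ?thesis using that[OF uG f weak_laplacian_W[OF D uG(1) f(1) uG(2) f(2) XD_Lap(2)[OF D u]]] .
qed

lemma wlap_unique:
 assumes D: "open D" and f: "sqi f" "sqi h" and w: "wlap D G f" "wlap D G h"
 shows "AEL x. x : D --> f x = h x"
proof -
 have "AEL x. x : D --> f x - h x = 0"
 proof (rule fundamental_lemma[OF D sqi_diff[OF f]])
  fix ph assume p: "C1c D ph"
  have "intgl (%x. f x * ph x)" "intgl (%x. h x * ph x)" by (intro sqi_mult f C1c_int[OF p])+
  moreover have "(LBINT x. f x * ph x) = (LBINT x. h x * ph x)" 
  proof -
   have "- (LBINT x. f x * ph x) = - (LBINT x. h x * ph x)"
    using w[unfolded wlap_def, THEN spec[of _ ph], THEN mp, OF p] by (rule trans[OF sym])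
   then show ?thesis by simp
  qed
  ultimately show "(LBINT x. (f x - h x) * ph x) = 0" by (simp add: left_diff_distrib)
 qed
 then show ?thesis by simp
qed

text \<open>\<open>Lap\<close> is an arbitrary choice, but all candidates agree almost everywhere,
  so a known weak Laplacian represents it.\<close>

lemma Lap_W:
 assumes D: "open D" and u: "u : XD D" "W D u G" and f: "sqi f" "!!x. x ~: D ==> f x = 0" "wlap D G f"
 shows "rep D (Lap D u) f"
proof -
 obtain h where h: "rep D (Lap D u) h" "sqi h" using L2_rep[OF D XD_Lap(1)[OF D u(1)]] by blast
 have "wlap D G h" by (rule weak_laplacian_W[OF D W_rep[OF u(2)] h(1) u(2) h(2) XD_Lap(2)[OF D u(1)]])
 note ae = wlap_unique[OF D h(2) f(1) this f(3)]
 have m: "f : mbl" using sqi_meas[OF f(1)] by simp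
 show ?thesis by (rule rep_AE[OF h(1) m f(2) ae])
qed

section \<open>Barrier estimate and Caccioppoli inequality\<close>

text \<open>A C^1 substitute for the positive part, nonzero exactly for s > 0 and with slope between
  0 and 1. The slope bound gives |grad trunc(w)|^2 <= grad w . grad trunc(w).\<close>

definition trunc :: "real => real" where "trunc s = (max 0 s)^2 / (1 + (max 0 s)^2)"

definition trunc' :: "real => real" where "trunc' s = 2 * max 0 s / (1 + (max 0 s)^2)^2"

lemma trunc_deriv: "(trunc has_real_derivative trunc' s) (at s)"
proof -
 define m where "m = max 0 s"
 have p: "1 + m^2 ~= 0" using zero_le_power2[of m] by linarith
 have "((%s. (max 0 s)^2 / (1 + (max 0 s)^2)) has_real_derivative (2 * m * (1 + m^2) - (m^2) * (0 + 2 * m)) / ((1 + m^2) * (1 + m^2))) (at s)"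
  unfolding m_def
  by (rule DERIV_divide[OF has_real_derivative_max0_sq DERIV_add[OF DERIV_const has_real_derivative_max0_sq]]) (use p in \<open>simp add: m_def\<close>)
 moreover have "(2 * m * (1 + m^2) - (m^2) * (0 + 2 * m)) / ((1 + m^2) * (1 + m^2)) = trunc' s"
  unfolding trunc'_def m_def[symmetric] by (simp add: power2_eq_square algebra_simps)
 ultimately show ?thesis unfolding trunc_def[abs_def] by simp
qed

lemma trunc'_bounds: "0 <= trunc' s" "trunc' s <= 1"
proof -
 define m where "m = max 0 s"
 have "0 <= m" by (simp add: m_def)
 moreover have "2 * m <= (1 + m^2)^2"
 proof -
  have "0 <= (1 - m)^2 + m^2 + m^2 * m^2" by (intro add_nonneg_nonneg mult_nonneg_nonneg) auto
  then show ?thesis by (simp add: power2_eq_square algebra_simps)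
 qed
 moreover have "(1 + m^2)^2 > 0" using zero_le_power2[of m] by (intro zero_less_power) linarith
 ultimately show "0 <= trunc' s" "trunc' s <= 1" unfolding trunc'_def m_def[symmetric] by auto
qed

lemma trunc_cont: "continuous_on S trunc" "continuous_on S trunc'"
proof -
 show "continuous_on S trunc" using trunc_deriv by (meson DERIV_isCont continuous_at_imp_continuous_on)
 have "1 + (max 0 s)^2 ~= 0" for s :: real using zero_le_power2[of "max 0 s"] by linarith
 then show "continuous_on S trunc'" unfolding trunc'_def[abs_def] by (auto intro!: continuous_intros)
qed

lemma trunc_nonneg: "0 <= trunc s" and trunc_zero: "trunc s = 0 \<longleftrightarrow> s <= 0"
proof -
 have "1 + (max 0 s)^2 > 0" using zero_le_power2[of "max 0 s"] by linarith
 then show "0 <= trunc s" "trunc s = 0 \<longleftrightarrow> s <= 0" unfolding trunc_def by (auto simp: max_def)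
qed

lemma trunc_lip: "\<bar>trunc s - trunc t\<bar> <= \<bar>s - t\<bar>"
 using field_differentiable_bound[of UNIV trunc trunc' 1 s t] trunc_deriv trunc'_bounds by auto

lemma nrm_indicator_bound:
 assumes g: "g : lmbl" and N: "N : sets lborel" "emeasure lborel N < \<infinity>" and c: "0 <= c"
  and le: "AEL x. cmod (g x) <= c * indicator N x"
 shows "sqi g" "nrm g <= c * sqrt (measure lborel N)"
proof -
 have "AEL x. cmod (g x) <= c * cmod (indicator N x)" 
  using le
 proof eventually_elim
  fix x assume "cmod (g x) <= c * indicator N x"
  then show "cmod (g x) <= c * cmod (indicator N x)" by (cases "x : N") auto
 qed
 note b = sqi_bound[OF sqi_indicator[OF N] g this c]
 show "sqi g" using b by simp
 have "(%x. (cmod (indicator N x))^2) = (%x. indicator N x :: real)" by (auto simp: indicator_def)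
 then have "nrm (indicator N) = sqrt (measure lborel N)" unfolding nrmM_def using N by simp
 then show "nrm g <= c * sqrt (measure lborel N)" using b by (simp add: indicator_def[abs_def])
qed

text \<open>Serves to absorb the term of an energy inequality that is linear in the square root of
  the energy.\<close>

lemma le_of_sq_le:
 fixes X a b :: real assumes "X^2 <= a * X + b" "0 <= X" "0 <= a" "0 <= b" shows "X <= a + sqrt b"
proof (rule ccontr)
 assume "\<not> X <= a + sqrt b"
 then have h: "X - a > sqrt b" "X >= sqrt b" "sqrt b >= 0" using assms by auto
 have "X > 0" using h assms(3) \<open>\<not> X <= a + sqrt b\<close> by linarith
 have "b = sqrt b * sqrt b" using assms(4) by simp
 also have "... <= sqrt b * X" using h by (intro mult_left_mono) auto
 also have "... < (X - a) * X" using h \<open>X > 0\<close> by (intro mult_strict_right_mono) auto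
 finally show False using assms(1) by (simp add: power2_eq_square algebra_simps)
qed

text \<open>\<open>M (L \<ell> - \<ell>\<^sup>2) / 2\<close> with \<open>\<ell> = \<beta> - a \<bullet> x\<close> is a supersolution; its comparison with \<open>u\<close> is tested
  with \<open>trunc (Re (c u) - b)\<close>.\<close>
lemma barrier_Re:
 fixes D :: "'a::euclidean_space set"
 assumes D: "open D" "bounded D" and u: "W D u G" and f: "sqi f" "!!x. cmod (f x) <= M" and wl: "wlap D G f"
  and a: "norm a = 1" and L: "!!x. x : D ==> 0 < \<beta> - a *. x" "!!x. x : D ==> \<beta> - a *. x < L" and c: "cmod c = 1"
 shows "AEL x. x : D --> Re (c * u x) <= M / 2 * (L * (\<beta> - a *. x) - (\<beta> - a *. x)^2)"
proof -
 define b where "b = (%x. M / 2 * (L * (\<beta> - a *. x) - (\<beta> - a *. x)^2))"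
 define b' where "b' = (%v x. M * ((\<beta> - a *. x) - L / 2) * (a *. v))"
 have M0: "M >= 0" using f(2)[of undefined] norm_ge_zero order_trans by blast
 have bd: "(b has_derivative (%v. b' v x)) (at x)" for x
  unfolding b_def b'_def by (auto intro!: derivative_eq_intros simp: algebra_simps power2_eq_square fun_eq_iff)
 have b'c: "continuous_on UNIV (b' v)" for v unfolding b'_def by (intro continuous_intros)
 have bC: "C1u b" "pd b v x = b' v x" for v x using C1_onI[of UNIV b "%x v. b' v x", OF bd] b'c by auto
 have b'd: "(b' v has_derivative (%w. - M * (a *. w) * (a *. v))) (at x)" for x v
  unfolding b'_def by (auto intro!: derivative_eq_intros simp: algebra_simps fun_eq_iff)
 have b'C: "C1u (b' v)" "pd (b' v) w x = - M * (a *. w) * (a *. v)" for v w x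
  using C1_onI[of UNIV "b' v" "%x w. - M * (a *. w) * (a *. v)", OF b'd] by auto
 have b0: "0 <= b x" if "x : D" for x
 proof -
  have "b x = M / 2 * ((\<beta> - a *. x) * (L - (\<beta> - a *. x)))" by (simp add: b_def algebra_simps power2_eq_square)
  also have "... >= 0" using M0 L[OF that] by (intro mult_nonneg_nonneg) auto
  finally show ?thesis .
 qed
 obtain psi where psi: "!!n. C1c D (psi n)" "null (%n. nrm (%x. psi n x - u x))"
  "!!v. (%n. nrm (%x. pd (psi n) v x - dirG G v x)) \<longlonglongrightarrow> 0" by (rule W_E[OF u]) (rule that; assumption)
 define w where "w = (%n x. Re (c * psi n x) - b x)"
 have bl: "bounded_linear (%z. Re (c * z))" by (rule bounded_linear_compose[OF bounded_linear_Re bounded_linear_mult_right])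
 have wC: "C1u (w n)" "pd (w n) v x = Re (c * pd (psi n) v x) - b' v x" for n v x
  unfolding w_def using C1_on_diff[OF C1_on_bl(1)[OF C1c_C1[OF psi(1)] bl] bC(1)] C1_on_bl(2)[OF C1c_C1[OF psi(1)] bl UNIV_I] bC(2) by simp_all
 \<comment> \<open>Since u need not be C^1, its approximants psi n are truncated instead. The result
   has compact support, because off the support of psi n the argument of \<open>trunc\<close> is -
   b, which is nonpositive on \<open>D\<close>.\<close>
 define om where "om = (%n x. if x : D then cor (trunc (w n x)) else 0)"
 define p where "p = (%n v x. Re (c * pd (psi n) v x) - b' v x)"
 have tC: "C1_on D (%x. cor (trunc (w n x)))" "x : D ==> pd (%x. cor (trunc (w n x))) v x = of_real (trunc' (w n x) * p n v x)" for n v x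
 proof -
  note t = C1_on_comp_real[OF C1_on_subset[OF wC(1) subset_UNIV], of D trunc trunc' n, OF trunc_deriv trunc_cont(2)]
  show "C1_on D (%x. cor (trunc (w n x)))" by (rule C1_on_bl(1)[OF t(1) bounded_linear_of_real])
  show "pd (%x. cor (trunc (w n x))) v x = of_real (trunc' (w n x) * p n v x)" if "x : D"
   unfolding C1_on_bl(2)[OF t(1) bounded_linear_of_real that] t(2)[OF that] wC(2) p_def ..
 qed
 have om: "C1c D (om n)" "pd (om n) v x = (if x : D then of_real (trunc' (w n x) * p n v x) else 0)" for n v x
 proof -
  obtain K where K: "compact K" "K <= D" "!!x. x ~: K ==> psi n x = 0" using C1c_E[OF psi(1)[of n]] by metis
  have z: "cor (trunc (w n x)) = 0" if "x : D - K" for x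
   using that K(3)[of x] b0[of x] trunc_zero[of "- b x"] by (simp add: w_def)
  show "C1c D (om n)" unfolding om_def by (rule C1c_glue(1)[OF D(1) tC(1) K(1,2) z])
  show "pd (om n) v x = (if x : D then of_real (trunc' (w n x) * p n v x) else 0)"
   unfolding om_def by (subst C1c_glue(2)[OF D(1) tC(1) K(1,2) z]) (simp_all add: tC(2))
 qed
 note oms = C1c_int[OF om(1)]
 define s where "s = (%n. SB i. nrm (%x. pd (psi n) i x - G i x))"
 have s0: "s n >= 0" for n unfolding s_def by (intro sum_nonneg) simp
 \<comment> \<open>If psi n had the gradient G, the supersolution property would leave no energy in
   om n; what remains is the error s n of the gradient approximation.\<close>
 have est: "nrm (pd (om n) i) <= s n" if i: "i : Basis" for n i
 proof -
  define A where "A = (SB i. (nrm (pd (om n) i))^2)"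
  define X where "X = (%i x. (c * pd (psi n) i x - of_real (b' i x)) * pd (om n) i x)"
  have bi: "intgl (%x. of_real (b' i x) * pd (om n) i x)" for i
  proof -
   obtain K where K: "compact K" "!!x. x ~: K ==> pd (om n) i x = 0" using C1c_E[OF om(1)[of n]] by metis
   show ?thesis
    by (rule intgl_of_cont_supp[of _ K])
      (use K in \<open>auto intro!: continuous_intros C1_on_cont_pd[OF C1c_C1[OF om(1)]] b'c simp: compact_imp_bounded\<close>)
  qed
  have pi: "intgl (%x. pd (psi n) i x * pd (om n) i x)" for i by (intro sqi_mult oms C1c_int[OF psi(1)])
  have Gi: "intgl (%x. G i x * pd (om n) i x)" if "i : Basis" for i by (intro sqi_mult oms WD(2)[OF u that])
  have Xe: "X i = (%x. c * (pd (psi n) i x * pd (om n) i x) - of_real (b' i x) * pd (om n) i x)" for i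
   unfolding X_def by (simp add: fun_eq_iff algebra_simps)
  have Xi: "intgl (X i)" for i unfolding Xe using pi bi by simp
  have pw: "(cmod (pd (om n) i x))^2 <= Re (X i x)" for i x
  proof (cases "x : D")
   case True
   let ?t = "trunc' (w n x)" and ?p = "p n i x"
   have e: "Re ((c * pd (psi n) i x - of_real (b' i x)) * of_real r) = ?p * r" for r by (simp add: p_def)
   have "(?t * ?p)^2 = ?t * (?t * (?p * ?p))" by (simp add: power2_eq_square mult_ac)
   also have "... <= 1 * (?t * (?p * ?p))" by (intro mult_right_mono mult_nonneg_nonneg[OF trunc'_bounds(1) zero_le_square] trunc'_bounds)
   finally have "(?t * ?p)^2 <= ?p * (?t * ?p)" by (simp add: mult_ac)
   then show ?thesis unfolding X_def om(2) using True e[of "?t * ?p"] by (simp only: if_True norm_of_real power2_abs)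
  qed (simp add: X_def om(2))
  have "A <= (SB i. Re (LBINT x. X i x))" unfolding A_def nrm_sq
  proof (rule sum_mono)
   fix i :: 'a
   have "(LBINT x. (cmod (pd (om n) i x))^2) <= (LBINT x. Re (X i x))"
    by (rule integral_mono[OF sqi_integrable[OF oms(4)] integrable_Re[OF Xi] pw])
   then show "(LBINT x. (cmod (pd (om n) i x))^2) <= Re (LBINT x. X i x)" using integral_Re[OF Xi] by simp
  qed
  also have "... = Re (SB i. c * (LBINT x. pd (psi n) i x * pd (om n) i x) - (LBINT x. of_real (b' i x) * pd (om n) i x))"
   unfolding Xe using pi bi by simp
  also have "... = Re (c * (SB i. LBINT x. (pd (psi n) i x - G i x) * pd (om n) i x)) - Re (c * (LBINT x. f x * om n x)) - M * Re (LBINT x. om n x)"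
  proof -
   \<comment> \<open>The second derivative of b along i is - M times the square of
     \<open>a *. i\<close>; summed over the basis this is - M, because a is a unit vector.\<close>
   have 1: "(LBINT x. of_real (b' i x) * pd (om n) i x) = of_real (M * (a *. i)^2) * (LBINT x. om n x)" for i
   proof -
    have p: "pd (%x. cor (b' i x)) i x = - of_real (M * (a *. i)^2)" for x
     by (subst C1_on_bl(2)[OF b'C(1) bounded_linear_of_real UNIV_I]) (simp add: b'C(2) power2_eq_square)
    show ?thesis using integral_by_parts[OF open_UNIV C1_on_bl(1)[OF b'C(1) bounded_linear_of_real] C1c_mono[OF om(1) subset_UNIV], of i n i]
     unfolding p by simp
   qed
   have 2: "(SB i. of_real (M * (a *. i)^2) * (LBINT x. om n x)) = of_real M * (LBINT x. om n x)"
   proof -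
    have "(SB i. (a *. i)^2) = a *. a" unfolding power2_eq_square by (rule euclidean_inner[symmetric])
    then have "(SB i. (a *. i)^2) = 1" using a by (simp add: norm_eq_1)
    then have "(SB i. M * (a *. i)^2) = M" by (simp add: sum_distrib_left[symmetric])
    then show ?thesis unfolding sum_distrib_right[symmetric] of_real_sum[symmetric] by simp
   qed
   have 3: "(LBINT x. pd (psi n) i x * pd (om n) i x) = (LBINT x. (pd (psi n) i x - G i x) * pd (om n) i x) + (LBINT x. G i x * pd (om n) i x)" if "i : Basis" for i
    using pi Gi[OF that] by (simp add: left_diff_distrib)
   have 4: "(SB i. LBINT x. G i x * pd (om n) i x) = - (LBINT x. f x * om n x)" using wl om(1) by (simp add: wlap_def)
   have "(SB i. c * (LBINT x. pd (psi n) i x * pd (om n) i x) - (LBINT x. of_real (b' i x) * pd (om n) i x))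
    = c * ((SB i. LBINT x. (pd (psi n) i x - G i x) * pd (om n) i x) + - (LBINT x. f x * om n x)) - of_real M * (LBINT x. om n x)"
    unfolding 1 sum_subtractf 2 sum_distrib_left[symmetric] 4[symmetric] sum.distrib[symmetric] using 3 by simp
   then show ?thesis by (simp only: distrib_left mult_minus_right minus_complex.sel plus_complex.sel uminus_complex.sel Re_complex_of_real Im_complex_of_real times_complex.sel)
  qed
  also have "... <= s n * sqrt A + M * Re (LBINT x. om n x) - M * Re (LBINT x. om n x)"
  proof -
   have nA: "nrm (pd (om n) i) <= sqrt A" if "i : Basis" for i
    using member_le_sum[OF that, of "%i. (nrm (pd (om n) i))^2"] unfolding A_def by (intro real_le_rsqrt) auto
   have "cmod (SB i. LBINT x. (pd (psi n) i x - G i x) * pd (om n) i x) <= (SB i. nrm (%x. pd (psi n) i x - G i x) * sqrt A)"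
   proof (intro sum_norm_le)
    fix i :: 'a assume i: "i : Basis"
    have "cmod (LBINT x. (pd (psi n) i x - G i x) * pd (om n) i x) <= nrm (%x. pd (psi n) i x - G i x) * nrm (pd (om n) i)"
     by (rule Cauchy_Schwarz_nrm[OF sqi_diff[OF C1c_int(4)[OF psi(1)] WD(2)[OF u i]] oms(4)])
    also have "... <= nrm (%x. pd (psi n) i x - G i x) * sqrt A" by (intro mult_left_mono nA[OF i]) simp
    finally show "cmod (LBINT x. (pd (psi n) i x - G i x) * pd (om n) i x) <= nrm (%x. pd (psi n) i x - G i x) * sqrt A" .
   qed
   then have 1: "cmod (c * (SB i. LBINT x. (pd (psi n) i x - G i x) * pd (om n) i x)) <= s n * sqrt A"
    by (simp add: norm_mult c s_def sum_distrib_right)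
   have e: "cmod (om n x) = Re (om n x)" for x using trunc_nonneg by (simp add: om_def)
   have i1: "intgl (%x. f x * om n x)" by (intro sqi_mult f oms)
   have "cmod (LBINT x. f x * om n x) <= (LBINT x. cmod (f x * om n x))" by (rule integral_norm_bound)
   also have "... <= (LBINT x. M * Re (om n x))"
    by (rule integral_mono[OF integrable_norm[OF i1]]) (use oms(1) f(2) in \<open>auto simp: norm_mult e[symmetric] intro!: mult_right_mono integrable_norm\<close>)
   also have "... = M * Re (LBINT x. om n x)" using integral_Re[OF oms(1)] by simp
   finally have "cmod (c * (LBINT x. f x * om n x)) <= M * Re (LBINT x. om n x)" by (simp add: norm_mult c)
   then show ?thesis using 1 complex_Re_le_cmod[of "c * (SB i. LBINT x. (pd (psi n) i x - G i x) * pd (om n) i x)"]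
     abs_Re_le_cmod[of "c * (LBINT x. f x * om n x)"] by linarith
  qed
  finally have le: "A <= s n * sqrt A" by simp
  have A0: "A >= 0" unfolding A_def by (intro sum_nonneg) simp
  have "sqrt A <= s n + sqrt 0" by (rule le_of_sq_le) (use le A0 s0 in simp_all)
  moreover have "nrm (pd (om n) i) <= sqrt A"
   using member_le_sum[OF i, of "%i. (nrm (pd (om n) i))^2"] unfolding A_def by (intro real_le_rsqrt) auto
  ultimately show ?thesis by simp
 qed
 have slim: "s \<longlonglongrightarrow> 0" unfolding s_def
  by (rule tendsto_null_sum) (use psi(3) in \<open>metis (no_types, lifting) dirG_Basis ext\<close>)
 obtain C where C: "C > 0" "!!u G i. W D u G ==> i : Basis ==> nrm u <= C * nrm (G i)"
  using W_Poincare[OF D(2)] by blast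
 obtain i0 :: 'a where i0: "i0 : Basis" using nonempty_Basis by blast
 have n1: "nrm (om n) <= C * s n" for n
  using C(2)[OF W_C1c[OF om(1)] i0, of n] mult_left_mono[OF est[OF i0, of n], of C] C(1) by linarith
 define w0 where "w0 = (%x. if x : D then cor (trunc (Re (c * u x) - b x)) else 0)"
 have [measurable]: "D : sets borel" "u : mbl" "b : mbl" "trunc : mbl"
  using D(1) sqi_meas[OF WD(1)[OF u]] C1_on_cont[OF bC(1)] trunc_cont(1) by (auto intro: mbl_cont)
 have w0m: "w0 : lmbl" unfolding w0_def by measurable
 have lip: "cmod (w0 x - (if x : D then cor (trunc (Re (c * z) - b x)) else 0)) <= 1 * cmod (u x - z)" for x z
 proof -
  have "\<bar>trunc (Re (c * u x) - b x) - trunc (Re (c * z) - b x)\<bar> <= \<bar>Re (c * (u x - z))\<bar>"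
   using trunc_lip[of "Re (c * u x) - b x" "Re (c * z) - b x"] by (simp add: algebra_simps)
  also have "... <= cmod (u x - z)" using abs_Re_le_cmod[of "c * (u x - z)"] by (simp add: norm_mult c)
  finally show ?thesis by (auto simp: w0_def simp flip: of_real_diff)
 qed
 have w0s: "sqi w0"
 proof (rule sqi_bound(1)[OF WD(1)[OF u] w0m, of 1])
  have "cmod (w0 x) <= 1 * cmod (u x)" for x
   using lip[of x 0] b0[of x] trunc_zero[of "- b x"] by (cases "x : D") (auto simp: w0_def)
  then show "AEL x. cmod (w0 x) <= 1 * cmod (u x)" by simp
 qed simp
 \<comment> \<open>\<open>trunc\<close> is 1-Lipschitz, so w0 differs from om n by at most |u - psi
   n|, and the norm of w0 is bounded by quantities that tend to 0.\<close>
 have n2: "nrm w0 <= nrm (%x. psi n x - u x) + C * s n" for n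
 proof -
  have "nrm (%x. w0 x - om n x) <= 1 * nrm (%x. u x - psi n x)"
  proof (rule sqi_bound(2)[OF sqi_diff[OF WD(1)[OF u] C1c_int(3)[OF psi(1)]]])
   show "(%x. w0 x - om n x) : lmbl" using w0m sqi_meas[OF oms(3)] by (rule borel_measurable_diff)
   have "cmod (w0 x - om n x) <= 1 * cmod (u x - psi n x)" for x
    using lip[of x "psi n x"] unfolding om_def w_def .
   then show "AEL x. cmod (w0 x - om n x) <= 1 * cmod (u x - psi n x)" by simp
  qed simp
  moreover have "nrm w0 <= nrm (%x. w0 x - om n x) + nrm (om n)"
   using nrm_triangle[OF sqi_diff[OF w0s oms(3)] oms(3), of n n] by simp
  ultimately show ?thesis using n1[of n] nrm_minus_commute[of lborel u "psi n"] by simp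
 qed
 have "nrm w0 <= 0"
 proof (rule LIMSEQ_le_const[of "%n. nrm (%x. psi n x - u x) + C * s n"])
  show "null (%n. nrm (%x. psi n x - u x) + C * s n)"
   using tendsto_add[OF psi(2) tendsto_mult_right_zero[OF slim, of C]] by simp
 qed (use n2 in blast)
 then have "AEL x. w0 x = 0" using nrm_eq_0_AE[OF w0s] nrm_nonneg[of lborel w0] by linarith
 then show ?thesis
 proof eventually_elim
  fix x assume h: "w0 x = 0"
  show "x : D --> Re (c * u x) <= M / 2 * (L * (\<beta> - a *. x) - (\<beta> - a *. x)^2)"
   using h trunc_zero[of "Re (c * u x) - b x"] by (auto simp: w0_def b_def)
 qed
qed

text \<open>The one-sided bound for c = 1, -1, i, -i controls real and imaginary parts; dropping the
  quadratic term leaves a bound linear in the distance to the hyperplane.\<close>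

lemma barrier:
 fixes D :: "'a::euclidean_space set"
 assumes D: "open D" "bounded D" and u: "W D u G" and f: "sqi f" "!!x. cmod (f x) <= M" and wl: "wlap D G f"
  and a: "norm a = 1" and L: "!!x. x : D ==> 0 < \<beta> - a *. x" "!!x. x : D ==> \<beta> - a *. x < L"
 shows "AEL x. x : D --> cmod (u x) <= M * L * (\<beta> - a *. x)"
proof -
 have M0: "M >= 0" using f(2)[of undefined] norm_ge_zero order_trans by blast
 have b: "AEL x. x : D --> Re (c * u x) <= M / 2 * (L * (\<beta> - a *. x) - (\<beta> - a *. x)^2)" if "cmod c = 1" for c
  by (rule barrier_Re[OF D u f wl a L that])
 have "AEL x. x : D --> Re (u x) <= M * (L * (\<beta> - a *. x) - (\<beta> - a *. x)^2) / 2"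
  "AEL x. x : D --> - Re (u x) <= M * (L * (\<beta> - a *. x) - (\<beta> - a *. x)^2) / 2"
  "AEL x. x : D --> - Im (u x) <= M * (L * (\<beta> - a *. x) - (\<beta> - a *. x)^2) / 2"
  "AEL x. x : D --> Im (u x) <= M * (L * (\<beta> - a *. x) - (\<beta> - a *. x)^2) / 2"
  using b[of 1] b[of "-1"] b[of \<i>] b[of "-\<i>"] by simp_all
 then show ?thesis
 proof eventually_elim
  fix x
  assume h: "x : D --> Re (u x) <= M * (L * (\<beta> - a *. x) - (\<beta> - a *. x)^2) / 2"
   "x : D --> - Re (u x) <= M * (L * (\<beta> - a *. x) - (\<beta> - a *. x)^2) / 2"
   "x : D --> - Im (u x) <= M * (L * (\<beta> - a *. x) - (\<beta> - a *. x)^2) / 2"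
   "x : D --> Im (u x) <= M * (L * (\<beta> - a *. x) - (\<beta> - a *. x)^2) / 2"
  show "x : D --> cmod (u x) <= M * L * (\<beta> - a *. x)"
  proof
   assume x: "x : D"
   have "cmod (u x) <= \<bar>Re (u x)\<bar> + \<bar>Im (u x)\<bar>" by (rule cmod_le)
   also have "... <= M * (L * (\<beta> - a *. x) - (\<beta> - a *. x)^2)" using h x by linarith
   also have "... <= M * (L * (\<beta> - a *. x))" using M0 by (intro mult_left_mono) auto
   finally show "cmod (u x) <= M * L * (\<beta> - a *. x)" by (simp add: mult.assoc)
  qed
 qed
qed

text \<open>The equation is tested with xi^2 times the conjugate of u. The mixed term is absorbed by
  \<open>le_of_sq_le\<close>; both remaining terms live on \<open>N\<close>, where u is at most
  m.\<close>

lemma Caccioppoli: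
 fixes D :: "'a::euclidean_space set"
 assumes D: "open D" "bounded D" and u: "W D u G" and f: "sqi f" "!!x. cmod (f x) <= M" and wl: "wlap D G f"
  and xi: "C1u xi" "!!x. x : D ==> \<bar>xi x\<bar> <= B" "!!x i. x : D ==> i : Basis ==> \<bar>pd xi i x\<bar> <= E"
  and N: "N : sets lborel" "N <= D" "!!x. x : D - N ==> xi x = 0" "!!x i. x : D - N ==> pd xi i x = 0"
  and m: "AEL x. x : N --> cmod (u x) <= m" and pos: "0 <= B" "0 <= E" "0 <= m" and i: "i : Basis"
 shows "nrm (%x. of_real (xi x) * G i x) <= 2 * real DIM('a) * (E * m * sqrt (measure lborel N)) + sqrt (M * B^2 * m * measure lborel N)"
proof -
 let ?x = "%x. cor (xi x)" and ?\<mu> = "measure lborel N"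
 have M0: "M >= 0" using f(2)[of undefined] norm_ge_zero order_trans by blast
 have Nf: "emeasure lborel N < \<infinity>" using emeasure_bounded_finite[OF bounded_subset[OF D(2) N(2)]] by simp
 have xC: "C1u ?x" "pd ?x v x = of_real (pd xi v x)" for v x
  using C1_on_bl[OF xi(1) bounded_linear_of_real] by auto
 have Wm: "W D (%x. ?x x * v x) (%i x. ?x x * V i x + pd ?x i x * v x)" if "W D v V" for v V
  by (rule W_mult[OF D(1) C1_on_subset[OF xC(1) subset_UNIV] that, where C = UNIV and B = "B + E"])
    (use xi(2,3) pos in \<open>auto simp: xC(2) intro: add_increasing add_increasing2\<close>)
 note W1 = Wm[OF W_cnj[OF u]] note W2 = Wm[OF W1]
 define X where "X = (%i. nrm (%x. ?x x * G i x))"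
 have xs: "sqi (%x. ?x x * G i x)" if "i : Basis" for i
  using sqi_cont_mult(1)[OF D(1) cont_sub[OF C1_on_cont[OF xC(1)]] WD(2)[OF u that] WD(4)[OF u _ that], of B] xi(2) pos by auto
 have um: "u : lmbl" using sqi_meas[OF WD(1)[OF u]] .
 have [measurable]: "?x : mbl" "(%x. pd ?x i x) : mbl" "u : mbl" for i
  using C1_on_cont[OF xC(1)] C1_on_cont_pd[OF xC(1)] um by (auto intro: mbl_cont)
 have us: "sqi (%x. pd ?x i x * cnj (u x))" "nrm (%x. pd ?x i x * cnj (u x)) <= E * m * sqrt ?\<mu>" if "i : Basis" for i
 proof -
  have "(%x. pd ?x i x) : mbl" using C1_on_cont_pd[OF xC(1)] by (rule mbl_cont)
  from borel_measurable_times[OF this] sqi_meas[OF sqi_cnj[OF WD(1)[OF u]]]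
  have mm: "(%x. pd ?x i x * cnj (u x)) : mbl" by simp
  have "AEL x. cmod (pd ?x i x * cnj (u x)) <= (E * m) * indicator N x" using m
  proof eventually_elim
   case (elim x)
   consider "x : N" | "x : D - N" | "x ~: D" by blast
   then show ?case
   proof cases
    case 1 then show ?thesis using elim xi(3)[of x i] N(2) that pos by (auto simp: norm_mult xC(2) intro!: mult_mono)
   next
    case 2 then show ?thesis using N(4)[of x i] pos by (simp add: xC(2))
   next
    case 3 then show ?thesis using WD(3)[OF u] pos by simp
   qed
  qed
  then show "sqi (%x. pd ?x i x * cnj (u x))" "nrm (%x. pd ?x i x * cnj (u x)) <= E * m * sqrt ?\<mu>"
   using nrm_indicator_bound[OF _ N(1) Nf, of "%x. pd ?x i x * cnj (u x)" "E * m"] pos mm by auto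
 qed
 have id: "(LBINT x. G i x * (?x x * (?x x * cnj (G i x) + pd ?x i x * cnj (u x)) + pd ?x i x * (?x x * cnj (u x))))
  = of_real ((X i)^2) + 2 * (LBINT x. (?x x * G i x) * (pd ?x i x * cnj (u x)))" if i: "i : Basis" for i
 proof -
  have 1: "intgl (%x. cor ((cmod (?x x * G i x))^2))" using sqi_integrable[OF xs[OF i]] by (intro integrable_of_real)
  have 2: "intgl (%x. (?x x * G i x) * (pd ?x i x * cnj (u x)))" by (intro sqi_mult xs us i)
  have e: "G i x * (?x x * (?x x * cnj (G i x) + pd ?x i x * cnj (u x)) + pd ?x i x * (?x x * cnj (u x)))
   = cor ((cmod (?x x * G i x))^2) + 2 * ((?x x * G i x) * (pd ?x i x * cnj (u x)))" for x
   unfolding mult_cnj_cmod_sq[symmetric] by (simp add: algebra_simps)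
  have "(LBINT x. cor ((cmod (?x x * G i x))^2) + 2 * ((?x x * G i x) * (pd ?x i x * cnj (u x))))
   = (LBINT x. cor ((cmod (?x x * G i x))^2)) + (LBINT x. 2 * ((?x x * G i x) * (pd ?x i x * cnj (u x))))"
   by (rule bint_add[OF 1]) (use 2 in simp)
  then show ?thesis unfolding e X_def nrm_sq
   by (simp only: integral_complex_of_real bint_mult_right_zero)
 qed
 have v2m: "AEL x. cmod (f x * (?x x * (?x x * cnj (u x)))) <= (M * B^2 * m) * indicator N x" using m
 proof eventually_elim
  case (elim x)
  consider "x : N" | "x : D - N" | "x ~: D" by blast
  then show ?case
  proof cases
   case 1
   have "cmod (f x * (?x x * (?x x * cnj (u x)))) = cmod (f x) * (\<bar>xi x\<bar> * (\<bar>xi x\<bar> * cmod (u x)))" by (simp add: norm_mult)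
   also have "... <= M * (B * (B * m))" using 1 elim f(2)[of x] xi(2)[of x] N(2) pos M0 by (intro mult_mono) auto
   finally show ?thesis using 1 by (simp add: power2_eq_square mult_ac)
  next
   case 2 then show ?thesis using N(3)[of x] pos M0 by simp
  next
   case 3 then show ?thesis using WD(3)[OF u] pos M0 by simp
  qed
 qed
 have f2: "cmod (LBINT x. f x * (?x x * (?x x * cnj (u x)))) <= M * B^2 * m * ?\<mu>"
 proof -
  have i1: "intgl (%x. f x * (?x x * (?x x * cnj (u x))))" by (intro sqi_mult f WD(1)[OF W2])
  have i2: "intgl (%x. (M * B^2 * m) * indicator N x)" using N Nf by simp
  have "cmod (LBINT x. f x * (?x x * (?x x * cnj (u x)))) <= (LBINT x. cmod (f x * (?x x * (?x x * cnj (u x)))))" by (rule integral_norm_bound)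
  also have "... <= (LBINT x. (M * B^2 * m) * indicator N x)" by (rule integral_mono_AE[OF integrable_norm[OF i1] i2 v2m])
  finally show ?thesis using N Nf by simp
 qed
 define A where "A = (SB i. (X i)^2)"
 have A0: "A >= 0" unfolding A_def by (intro sum_nonneg) simp
 have XA: "X i <= sqrt A" if "i : Basis" for i
  using member_le_sum[OF that, of "%i. (X i)^2"] unfolding A_def by (intro real_le_rsqrt) auto
 have "(SB i. LBINT x. G i x * (?x x * (?x x * cnj (G i x) + pd ?x i x * cnj (u x)) + pd ?x i x * (?x x * cnj (u x))))
  = - (LBINT x. f x * (?x x * (?x x * cnj (u x))))"
  by (rule wlap_W[OF WD(2)[OF u] f(1) wl W2])
 then have "of_real A + 2 * (SB i. LBINT x. (?x x * G i x) * (pd ?x i x * cnj (u x))) = - (LBINT x. f x * (?x x * (?x x * cnj (u x))))"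
  by (simp add: id sum.distrib sum_distrib_left A_def)
 then have "cor A = - (LBINT x. f x * (?x x * (?x x * cnj (u x)))) - 2 * (SB i. LBINT x. (?x x * G i x) * (pd ?x i x * cnj (u x)))"
  by (simp add: eq_diff_eq)
 then have "A = cmod (- (LBINT x. f x * (?x x * (?x x * cnj (u x)))) - 2 * (SB i. LBINT x. (?x x * G i x) * (pd ?x i x * cnj (u x))))"
  using A0 by (metis abs_of_nonneg norm_of_real)
 also have "... <= M * B^2 * m * ?\<mu> + 2 * (\<Sum>i\<in>(Basis::'a set). sqrt A * (E * m * sqrt ?\<mu>))"
 proof -
  have "cmod (SB i. LBINT x. (?x x * G i x) * (pd ?x i x * cnj (u x))) <= (\<Sum>i\<in>(Basis::'a set). sqrt A * (E * m * sqrt ?\<mu>))"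
  proof (rule sum_norm_le)
   fix i :: 'a assume i: "i : Basis"
   show "cmod (LBINT x. (?x x * G i x) * (pd ?x i x * cnj (u x))) <= sqrt A * (E * m * sqrt ?\<mu>)"
    using Cauchy_Schwarz_nrm[OF xs[OF i] us(1)[OF i]] mult_mono[OF XA[OF i] us(2)[OF i]] A0 unfolding X_def by fastforce
  qed
  then show ?thesis using f2 norm_triangle_ineq4[of "- (LBINT x. f x * (?x x * (?x x * cnj (u x))))" "2 * (SB i. LBINT x. (?x x * G i x) * (pd ?x i x * cnj (u x)))"]
   by (simp add: norm_mult)
 qed
 finally have "A <= (2 * real DIM('a) * (E * m * sqrt ?\<mu>)) * sqrt A + M * B^2 * m * ?\<mu>" by (simp add: mult_ac)
 then have "(sqrt A)^2 <= (2 * real DIM('a) * (E * m * sqrt ?\<mu>)) * sqrt A + M * B^2 * m * ?\<mu>" using A0 by simp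
 from le_of_sq_le[OF this] XA[OF i] show ?thesis unfolding X_def using A0 pos M0 by fastforce
qed

section \<open>Cutoffs around the edges of a polytope\<close>

text \<open>Cutoffs at length scale e, with bounds uniform in e: each derivative costs a factor 1/e.
  Of the second derivatives the pure ones are controlled, since the cutoff enters through its
  Laplacian.\<close>

definition scaled_cutoff :: "(real => 'a::euclidean_space => real) => bool" where
 "scaled_cutoff f \<longleftrightarrow> (ALL e>0. smooth (f e)) & (EX B>=0. ALL e>0. ALL x. ALL i:Basis.
   \<bar>f e x\<bar> <= B & \<bar>pd (f e) i x\<bar> <= B / e & \<bar>pd (pd (f e) i) i x\<bar> <= B / e^2)"

lemma scaled_cutoff_D:
 assumes "scaled_cutoff f"
 obtains B where "B >= 0" "!!e x. e > 0 ==> \<bar>f e x\<bar> <= B" "!!e x i. e > 0 ==> i : Basis ==> \<bar>pd (f e) i x\<bar> <= B / e"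
  "!!e x i. e > 0 ==> i : Basis ==> \<bar>pd (pd (f e) i) i x\<bar> <= B / e^2"
 using assms nonempty_Basis unfolding scaled_cutoff_def by blast

lemma scaled_cutoff_smooth: "scaled_cutoff f ==> e > 0 ==> smooth (f e)" by (simp add: scaled_cutoff_def)

lemma scaled_cutoff_const: "scaled_cutoff (%e x. c)"
 unfolding scaled_cutoff_def by (auto intro!: exI[of _ "\<bar>c\<bar>"])

lemma scaled_cutoff_one_minus:
 assumes f: "scaled_cutoff f" shows "scaled_cutoff (%e x. 1 - f e x)"
proof -
 obtain B where B: "B >= 0" "!!e x. e > 0 ==> \<bar>f e x\<bar> <= B" "!!e x i. e > 0 ==> i : Basis ==> \<bar>pd (f e) i x\<bar> <= B / e"
  "!!e x i. e > 0 ==> i : Basis ==> \<bar>pd (pd (f e) i) i x\<bar> <= B / e^2" using scaled_cutoff_D[OF f] by blast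
 have "\<bar>1 - f e x\<bar> <= 1 + B & \<bar>pd (%x. 1 - f e x) i x\<bar> <= (1 + B) / e & \<bar>pd (pd (%x. 1 - f e x) i) i x\<bar> <= (1 + B) / e^2"
  if e: "e > 0" and i: "i : Basis" for e x i
 proof -
  note s = scaled_cutoff_smooth[OF f e]
  have p: "pd (%x. 1 - f e x) i = (%x. 0 - pd (f e) i x)" using C1_on_diff(2)[OF C1_on_const smooth_C1_on[OF s] UNIV_I] by auto
  have pp: "pd (pd (%x. 1 - f e x) i) i x = 0 - pd (pd (f e) i) i x"
   unfolding p by (rule C1_on_diff(2)[OF C1_on_const smooth_C1_on[OF smooth_pd[OF s i]] UNIV_I, unfolded pd_const])
  have "B / e <= (1 + B) / e" "B / e^2 <= (1 + B) / e^2" using e by (auto intro!: divide_right_mono)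
  then show ?thesis using B(2)[OF e, of x] B(3,4)[OF e i, of x] unfolding pp fun_cong[OF p, of x] by auto
 qed
 then show ?thesis unfolding scaled_cutoff_def using smooth_diff[OF smooth_const scaled_cutoff_smooth[OF f]] B(1) by (intro conjI allI impI exI[of _ "1 + B"]) auto
qed

lemma scaled_cutoff_mult:
 assumes f: "scaled_cutoff f" and g: "scaled_cutoff g" shows "scaled_cutoff (%e x. f e x * g e x)"
proof -
 obtain B where B: "B >= 0" "!!e x. e > 0 ==> \<bar>f e x\<bar> <= B" "!!e x i. e > 0 ==> i : Basis ==> \<bar>pd (f e) i x\<bar> <= B / e"
  "!!e x i. e > 0 ==> i : Basis ==> \<bar>pd (pd (f e) i) i x\<bar> <= B / e^2" using scaled_cutoff_D[OF f] by blast
 obtain C where C: "C >= 0" "!!e x. e > 0 ==> \<bar>g e x\<bar> <= C" "!!e x i. e > 0 ==> i : Basis ==> \<bar>pd (g e) i x\<bar> <= C / e"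
  "!!e x i. e > 0 ==> i : Basis ==> \<bar>pd (pd (g e) i) i x\<bar> <= C / e^2" using scaled_cutoff_D[OF g] by blast
 have "\<bar>f e x * g e x\<bar> <= 4 * (B * C) & \<bar>pd (%x. f e x * g e x) i x\<bar> <= 4 * (B * C) / e & \<bar>pd (pd (%x. f e x * g e x) i) i x\<bar> <= 4 * (B * C) / e^2"
  if e: "e > 0" and i: "i : Basis" for e x i
 proof -
  note sf = scaled_cutoff_smooth[OF f e] note sg = scaled_cutoff_smooth[OF g e]
  note Cf = smooth_C1_on[OF sf, of UNIV] smooth_C1_on[OF smooth_pd[OF sf i], of UNIV]
  note Cg = smooth_C1_on[OF sg, of UNIV] smooth_C1_on[OF smooth_pd[OF sg i], of UNIV]
  have p: "pd (%x. f e x * g e x) i = (%x. f e x * pd (g e) i x + pd (f e) i x * g e x)"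
   using C1_on_mult(2)[OF Cf(1) Cg(1) UNIV_I] by auto
  have pp: "pd (pd (%x. f e x * g e x) i) i x = (f e x * pd (pd (g e) i) i x + pd (f e) i x * pd (g e) i x) + (pd (f e) i x * pd (g e) i x + pd (pd (f e) i) i x * g e x)"
   unfolding p C1_on_add(2)[OF C1_on_mult(1)[OF Cf(1) Cg(2)] C1_on_mult(1)[OF Cf(2) Cg(1)] UNIV_I] C1_on_mult(2)[OF Cf(1) Cg(2) UNIV_I] C1_on_mult(2)[OF Cf(2) Cg(1) UNIV_I] ..
  note b = B(2)[OF e, of x] B(3,4)[OF e i, of x] and c = C(2)[OF e, of x] C(3,4)[OF e i, of x]
  have BC: "0 <= B * C" using B(1) C(1) by simp
  have m: "\<bar>s * t\<bar> <= S * T" if "\<bar>s\<bar> <= S" "\<bar>t\<bar> <= T" for s t S T :: real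
   unfolding abs_mult using that abs_ge_zero order_trans by (intro mult_mono) blast+
  have e1: "B * (C / e) = B * C / e" "B / e * C = B * C / e" "B * (C / e^2) = B * C / e^2" "B / e * (C / e) = B * C / e^2" "B / e^2 * C = B * C / e^2"
   by (simp_all add: power2_eq_square)
  have q: "0 <= B * C / e" using BC e by simp
  have "\<bar>f e x * g e x\<bar> <= B * C" by (rule m[OF b(1) c(1)])
  moreover have "\<bar>f e x * pd (g e) i x\<bar> <= B * C / e" "\<bar>pd (f e) i x * g e x\<bar> <= B * C / e"
   using m[OF b(1) c(2)] m[OF b(2) c(1)] unfolding e1 by auto
  moreover have "\<bar>f e x * pd (pd (g e) i) i x\<bar> <= B * C / e^2" "\<bar>pd (f e) i x * pd (g e) i x\<bar> <= B * C / e^2" "\<bar>pd (pd (f e) i) i x * g e x\<bar> <= B * C / e^2"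
   using m[OF b(1) c(3)] m[OF b(2) c(2)] m[OF b(3) c(1)] unfolding e1 by auto
  moreover have "4 * (B * C) / e = 4 * (B * C / e)" "4 * (B * C) / e^2 = 4 * (B * C / e^2)" by simp_all
  ultimately show ?thesis unfolding pp fun_cong[OF p, of x] using BC q by linarith
 qed
 then show ?thesis unfolding scaled_cutoff_def using smooth_mult[OF scaled_cutoff_smooth[OF f] scaled_cutoff_smooth[OF g]] B(1) C(1)
  by (intro conjI allI impI exI[of _ "4 * (B * C)"]) auto
qed

lemma scaled_cutoff_prod: "finite A ==> (!!q. q : A ==> scaled_cutoff (f q)) ==> scaled_cutoff (%e x. \<Prod>q\<in>A. f q e x)"
 by (induction A rule: finite_induct) (auto intro: scaled_cutoff_const scaled_cutoff_mult)

text \<open>Each derivative brings out a factor of modulus at most 1/e from the linear argument, and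
  the profile and its derivatives are bounded because they vanish outside a compact
  interval.\<close>

lemma scaled_cutoff_bump:
 fixes sgm :: "real => real"
 assumes sgm: "smooth sgm" "!!t. \<bar>t\<bar> >= 2 ==> sgm t = 0" and a: "norm (a::'a::euclidean_space) = 1"
 shows "scaled_cutoff (%e x. sgm ((b - a *. x) / e))"
proof -
 note r1 = smooth_real_deriv[OF sgm(1)] note r2 = smooth_real_deriv[OF r1(2)]
 have bdd: "EX B>=0. ALL t. \<bar>h t\<bar> <= B" if "continuous_on UNIV h" "!!t. \<bar>t\<bar> > 2 ==> h t = 0" for h :: "real => real"
 proof (rule C1_on_bounded_set[OF that(1) bounded_cball, of 0 2])
  fix B assume B: "B >= 0" "!!t. t : cball 0 2 ==> norm (h t) <= B"
  then have "\<bar>h t\<bar> <= B" for t using that(2)[of t] by (cases "\<bar>t\<bar> <= 2") auto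
  then show ?thesis using B(1) by blast
 qed
 have z1: "pd sgm 1 t = 0" if "\<bar>t\<bar> > 2" for t
  by (rule pd_zero_off_closed[of "{-2..2}"]) (use sgm(2) that in auto)
 have z2: "pd (pd sgm 1) 1 t = 0" if "\<bar>t\<bar> > 2" for t
  by (rule pd_zero_off_closed[of "{-2..2}"]) (use z1 that in auto)
 obtain B0 where B0: "B0 >= 0" "!!t. \<bar>sgm t\<bar> <= B0" using bdd[OF C1_on_cont[OF smooth_C1_on[OF sgm(1)]]] sgm(2) by force
 obtain B1 where B1: "B1 >= 0" "!!t. \<bar>pd sgm 1 t\<bar> <= B1" using bdd[OF r1(3)] z1 by blast
 obtain B2 where B2: "B2 >= 0" "!!t. \<bar>pd (pd sgm 1) 1 t\<bar> <= B2" using bdd[OF r2(3)] z2 by blast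
 define l where "l = (%e x. (b - a *. x) / e)"
 have ld: "(l e has_derivative (%v. - (a *. v) / e)) (at x)" for e x
  unfolding l_def by (auto intro!: derivative_eq_intros simp: divide_inverse)
 have lC: "C1u (l e)" "pd (l e) v x = - (a *. v) / e" for e v x
  using C1_onI[of UNIV "l e" "%x v. - (a *. v) / e", OF ld] by auto
 have ls: "smooth (l e)" for e
 proof -
  have "l e = (%x. b / e - (x - 0) *. (a /\<^sub>R e))" by (simp add: l_def fun_eq_iff inner_commute divide_inverse algebra_simps)
  then show ?thesis using smooth_diff[OF smooth_const smooth_inner, of "b / e" 0 "a /\<^sub>R e"] by simp
 qed
 have sm: "smooth (%x. sgm (l e x))" for e by (rule smooth_comp[OF ls sgm(1)])
 have d1: "pd (%x. sgm (l e x)) i = (%x. pd sgm 1 (l e x) * (- (a *. i) / e))" for e i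
  using C1_on_comp_real(2)[OF lC(1), of sgm "pd sgm 1" e, OF r1(1) r1(3) UNIV_I] lC(2) by auto
 have d2: "pd (pd (%x. sgm (l e x)) i) i x = pd (pd sgm 1) 1 (l e x) * (- (a *. i) / e) * (- (a *. i) / e)" for e i x
 proof -
  note c = C1_on_comp_real[OF lC(1), of "pd sgm 1" "pd (pd sgm 1) 1" e, OF r2(1) r2(3)]
  show ?thesis unfolding d1
   by (rule trans[OF C1_on_mult(2)[OF c(1) C1_on_const UNIV_I]]) (simp add: c(2)[OF UNIV_I] lC(2))
 qed
 define B where "B = B0 + B1 + B2"
 have ai: "\<bar>a *. i\<bar> <= 1" if "i : Basis" for i using Basis_le_norm[OF that, of a] a by simp
 have "\<bar>sgm (l e x)\<bar> <= B & \<bar>pd (%x. sgm (l e x)) i x\<bar> <= B / e & \<bar>pd (pd (%x. sgm (l e x)) i) i x\<bar> <= B / e^2"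
  if e: "e > 0" and i: "i : Basis" for e x i
 proof (intro conjI)
  show "\<bar>sgm (l e x)\<bar> <= B" using B0(2)[of "l e x"] B1(1) B2(1) by (simp add: B_def)
  have "\<bar>pd (%x. sgm (l e x)) i x\<bar> = \<bar>pd sgm 1 (l e x)\<bar> * \<bar>a *. i\<bar> / e" unfolding fun_cong[OF d1] using e by (simp add: abs_mult)
  also have "... <= B1 * 1 / e" using e by (intro divide_right_mono mult_mono B1 ai[OF i]) auto
  also have "... <= B / e" using e B0(1) B2(1) by (intro divide_right_mono) (auto simp: B_def)
  finally show "\<bar>pd (%x. sgm (l e x)) i x\<bar> <= B / e" .
  have "\<bar>pd (pd (%x. sgm (l e x)) i) i x\<bar> = \<bar>pd (pd sgm 1) 1 (l e x)\<bar> * (\<bar>a *. i\<bar> * \<bar>a *. i\<bar>) / e^2" unfolding d2 using e by (simp add: abs_mult power2_eq_square)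
  also have "... <= B2 * (1 * 1) / e^2" using e by (intro divide_right_mono mult_mono B2 ai[OF i]) auto
  also have "... <= B / e^2" using e B0(1) B1(1) by (intro divide_right_mono) (auto simp: B_def)
  finally show "\<bar>pd (pd (%x. sgm (l e x)) i) i x\<bar> <= B / e^2" .
 qed
 moreover have "0 <= B" using B0 B1 B2 by (simp add: B_def)
 ultimately have "scaled_cutoff (%e x. sgm (l e x))" unfolding scaled_cutoff_def using sm by (intro conjI allI impI exI[of _ B]) auto
 then show ?thesis unfolding l_def .
qed

locale polytope_domain =
 fixes D :: "'a::euclidean_space set" and F :: "'i set" and a :: "'i => 'a" and b :: "'i => real"
 assumes F: "finite F" and a1: "k : F ==> norm (a k) = 1" and D: "D = {x. ALL k:F. a k *. x < b k}"
  and bd: "bounded D" and ne: "D ~= {}" and inj: "k : F ==> l : F ==> k ~= l ==> a k ~= a l \<or> b k ~= b l"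
begin

text \<open>The signed distance to the k-th face plane, as \<open>a k\<close> is a unit vector;
  positive inside \<open>D\<close>.\<close>

definition de where "de k x = b k - a k *. x"

definition Q where "Q = {(k, l). k : F & l : F & \<bar>a k *. a l\<bar> < 1}"

text \<open>The region that is cut away near the edges. Being close to two nonparallel planes makes
  its volume of order d^2, see \<open>N_volume\<close>.\<close>

definition N where "N d = {x\<in>D. EX (k, l):Q. de k x <= d & de l x <= d}"

lemma Q: "finite Q" "(k, l) : Q ==> k : F & l : F"
 using finite_subset[of Q "F \<times> F"] F by (auto simp: Q_def)

lemma openD: "open D"
proof -
 have "D = (\<Inter>k\<in>F. {x. a k *. x < b k})" by (auto simp: D)
 then show ?thesis using F by (auto intro!: open_INT open_halfspace_lt)
qed

lemma de_pos: "x : D ==> k : F ==> de k x > 0" by (simp add: D de_def)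

lemma de_cont: "continuous_on S (de k)" unfolding de_def by (intro continuous_intros)

text \<open>Unit vectors whose inner product has modulus at least 1 are equal or opposite. Equal
  normals at a common point give the same half-space, which \<open>inj\<close> excludes; opposite
  ones leave no room for \<open>D\<close>.\<close>

lemma edge_pair:
 assumes k: "k : F" "l : F" "k ~= l" and p: "de k p = 0" "de l p = 0"
 shows "(k, l) : Q"
proof (rule ccontr)
 assume "(k, l) ~: Q"
 then have g: "\<bar>a k *. a l\<bar> >= 1" using k by (simp add: Q_def)
 have n: "a k *. a k = 1" "a l *. a l = 1" using a1 k by (simp_all add: norm_eq_1[symmetric])
 consider "a k *. a l >= 1" | "a k *. a l <= -1" using g by linarith
 then show False
 proof cases
  case 1
  have "(a k - a l) *. (a k - a l) <= 0" using 1 n by (simp add: inner_diff_left inner_diff_right inner_commute)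
  then have "a k = a l" using inner_ge_zero[of "a k - a l"] inner_eq_zero_iff[of "a k - a l"] by simp
  then show False using inj[OF k] p by (simp add: de_def)
 next
  case 2
  have "(a k + a l) *. (a k + a l) <= 0" using 2 n by (simp add: inner_add_left inner_add_right inner_commute)
  then have e: "a l = - a k" using inner_ge_zero[of "a k + a l"] inner_eq_zero_iff[of "a k + a l"] by (simp add: add_eq_0_iff)
  obtain x where "x : D" using ne by blast
  then have "a k *. x < b k" "a l *. x < b l" using k by (auto simp: D)
  then show False using p e by (simp add: de_def)
 qed
qed

text \<open>A boundary point on exactly one face plane has a neighbourhood in which \<open>D\<close>
  is a half-space, that is, lies below the graph of g = 0.\<close>

lemma graph_or_edge:
 assumes p: "p : closure D"
 shows "graph_at D p \<or> (EX (k, l):Q. de k p = 0 & de l p = 0)"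
proof (cases "p : D")
 case True then show ?thesis using graph_at_interior[OF openD] by blast
next
 case False
 have "D <= {x. a k *. x <= b k}" if "k : F" for k using that by (auto simp: D less_imp_le)
 then have "p : {x. a k *. x <= b k}" if "k : F" for k using that p closure_minimal[OF _ closed_halfspace_le] by blast
 then have ge: "de k p >= 0" if "k : F" for k using that by (simp add: de_def)
 obtain k where k: "k : F" "de k p = 0" using False ge unfolding D de_def by (auto simp: not_less) (metis antisym diff_ge_0_iff_ge)
 show ?thesis
 proof (cases "EX l:F - {k}. de l p = 0")
  case True then show ?thesis using edge_pair k by blast
 next
  case False
  define U where "U = (\<Inter>l\<in>F - {k}. {x. a l *. x < b l})"
  have "open U" unfolding U_def using F by (auto intro!: open_INT open_halfspace_lt)
  moreover have "p : U" using False ge by (force simp: U_def de_def)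
  ultimately obtain r where r: "r > 0" "ball p r <= U" using open_contains_ball by blast
  have "D \<inter> ball p r = {x : ball p r. (x - p) *. a k < 0}"
  proof -
   have "x : D \<longleftrightarrow> (x - p) *. a k < 0" if "x : ball p r" for x
   proof -
    have "x : D \<longleftrightarrow> a k *. x < b k" using that r(2) k(1) unfolding D U_def by auto
    then show ?thesis using k(2) by (simp add: de_def inner_diff_right inner_commute[of _ "a k"])
   qed
   then show ?thesis by blast
  qed
  then show ?thesis unfolding graph_at_def using r(1) a1[OF k(1)] C2_fun_const[of 0]
   by (intro disjI1 exI[of _ r] conjI exI[of _ "a k"] exI[of _ "%x. 0"]) auto
 qed
qed

text \<open>The translates of the set by \<open>2 d (i v + j w)\<close>, with \<open>v, w\<close> dual to the two normals, are disjoint.\<close>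
lemma edge_volume:
 assumes q: "(k, l) : Q"
 obtains V where "V >= 0" "!!d. 0 < d ==> d <= 1/2 ==> measure lborel {x\<in>D. de k x <= d & de l x <= d} <= V * d^2"
proof -
 have kl: "k : F" "l : F" using Q(2)[OF q] by auto
 define c where "c = a k *. a l"
 have c: "\<bar>c\<bar> < 1" "c * c ~= 1" using q unfolding c_def Q_def by (auto simp: square_eq_1_iff)
 have n: "a k *. a k = 1" "a l *. a l = 1" "a l *. a k = c" using a1 kl by (simp_all add: norm_eq_1[symmetric] c_def inner_commute)
 \<comment> \<open>v and w form the dual basis of the two normals in their span: moving along v
   changes only the k-th distance, along w only the l-th.\<close>
 define v where "v = (1 / (1 - c * c)) *R (a k - c *R a l)"
 define w where "w = (1 / (1 - c * c)) *R (a l - c *R a k)"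
 have vw: "a k *. v = 1" "a l *. v = 0" "a k *. w = 0" "a l *. w = 1"
  using c n by (simp_all add: v_def w_def inner_diff_right c_def[symmetric])
 obtain R where R: "!!x. x : D ==> norm x <= R" using bd by (auto simp: bounded_iff)
 define Z where "Z = cball (0::'a) (R + norm v + norm w)"
 define V where "V = 16 * measure lebesgue Z"
 have "measure lborel {x\<in>D. de k x <= d & de l x <= d} <= V * d^2" if d: "0 < d" "d <= 1/2" for d
 proof -
  define A where "A = {x\<in>D. de k x <= d & de l x <= d}"
  have "A = D \<inter> ({x. de k x <= d} \<inter> {x. de l x <= d})" by (auto simp: A_def)
  moreover have "closed {x. de k x <= d}" for k by (intro closed_Collect_le de_cont continuous_on_const)
  ultimately have Ab: "A : sets borel" using openD by (auto intro!: sets.Int borel_open borel_closed)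
  then have Al: "A : lmeasurable" using bd by (intro bounded_set_imp_lmeasurable bounded_subset[OF bd]) (auto simp: A_def)
  \<comment> \<open>m steps of length 2 d fit into a unit length. As d <= 1/2 there is at least one,
    and m >= 1 / (4 d); squaring this gives the factor 16 in V.\<close>
  define m where "m = nat \<lfloor>1 / (2 * d)\<rfloor>"
  have y: "1 / (2 * d) >= 1" using d by simp
  have m1: "real m <= 1 / (2 * d)" "real m >= 1 / (2 * d) / 2" 
  proof -
   define Y where "Y = 1 / (2 * d)"
   have fl: "\<lfloor>Y\<rfloor> >= 1" using y by (simp add: le_floor_iff Y_def)
   then have "real m = of_int \<lfloor>Y\<rfloor>" unfolding m_def Y_def[symmetric] by (intro of_nat_nat) linarith
   moreover have "real_of_int \<lfloor>Y\<rfloor> >= 1" using fl by simp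
   ultimately show "real m <= 1 / (2 * d)" "real m >= 1 / (2 * d) / 2"
    using of_int_floor_le[of Y] real_of_int_floor_add_one_gt[of Y] unfolding Y_def[symmetric] by linarith+
  qed
  define T where "T = (%(i, j). (+) ((2 * d * real i) *R v + (2 * d * real j) *R w) ` A)"
  have disj: "disjoint_family_on T ({..<m} \<times> {..<m})"
   unfolding disjoint_family_on_def
  proof (intro ballI impI)
   fix s t :: "nat \<times> nat" assume st: "s : {..<m} \<times> {..<m}" "t : {..<m} \<times> {..<m}" "s ~= t"
   obtain i j i' j' where ij: "s = (i, j)" "t = (i', j')" by (cases s, cases t) auto
   show "T s \<inter> T t = {}"
   proof (rule ccontr)
    assume "T s \<inter> T t ~= {}"
    then obtain x x' where x: "x : A" "x' : A" "(2 * d * real i) *R v + (2 * d * real j) *R w + x = (2 * d * real i') *R v + (2 * d * real j') *R w + x'"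
     unfolding T_def ij by auto
    have b: "b k - d <= a k *. y" "a k *. y < b k" "b l - d <= a l *. y" "a l *. y < b l" if "y : A" for y
     using that kl de_pos[of y] by (auto simp: A_def de_def)
    have eq: "2 * d * real i + a k *. x = 2 * d * real i' + a k *. x'" "2 * d * real j + a l *. x = 2 * d * real j' + a l *. x'"
     using arg_cong[OF x(3), of "%y. a k *. y"] arg_cong[OF x(3), of "%y. a l *. y"] vw by (simp_all add: inner_add_right)
    \<comment> \<open>Within A each of the two coordinates varies by less than d, while translates
      with different indices are at least 2 d apart in one of them.\<close>
    have same: "i = i'" if "2 * d * real i + s = 2 * d * real i' + s'" "\<bar>s - s'\<bar> < d" for i i' :: nat and s s' :: real
    proof (rule ccontr)
     assume "i ~= i'"
     then have "\<bar>real i - real i'\<bar> >= 1" by linarith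
     then have "2 * d * 1 <= 2 * d * \<bar>real i - real i'\<bar>" using d by (intro mult_left_mono) auto
     also have "... = \<bar>2 * d * real i - 2 * d * real i'\<bar>" using d by (simp add: abs_mult right_diff_distrib[symmetric])
     also have "... = \<bar>s - s'\<bar>" using that(1) by linarith
     finally show False using that(2) d by linarith
    qed
    have "i = i'" by (rule same[OF eq(1)]) (use b[OF x(1)] b[OF x(2)] in linarith)
    moreover have "j = j'" by (rule same[OF eq(2)]) (use b[OF x(1)] b[OF x(2)] in linarith)
    ultimately show False using st(3) ij by simp
   qed
  qed
  have Tl: "T s : lmeasurable" "measure lebesgue (T s) = measure lebesgue A" for s
   unfolding T_def by (cases s; simp add: measurable_translation Al measure_translation)+
  have TZ: "T s <= Z" if s: "s : {..<m} \<times> {..<m}" for s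
  proof -
   obtain i j where ij: "s = (i, j)" "i < m" "j < m" using s by (cases s) auto
   have le: "2 * d * real i <= 1" if "i < m" for i :: nat
   proof -
    have "2 * d * real i <= 2 * d * (1 / (2 * d))" using m1(1) that d by (intro mult_left_mono) auto
    then show ?thesis using d by simp
   qed
   have "norm ((2 * d * real i) *R v + (2 * d * real j) *R w + x) <= R + norm v + norm w" if x: "x : A" for x
   proof -
    have "norm ((2 * d * real i) *R v) <= norm v" "norm ((2 * d * real j) *R w) <= norm w"
     using le[OF ij(2)] le[OF ij(3)] d by (auto simp: abs_mult intro!: mult_left_le_one_le)
    moreover have "norm x <= R" using R x by (simp add: A_def)
    ultimately show ?thesis using norm_triangle_ineq[of "(2 * d * real i) *R v + (2 * d * real j) *R w" x] norm_triangle_ineq[of "(2 * d * real i) *R v" "(2 * d * real j) *R w"] by linarith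
   qed
   then show ?thesis unfolding T_def ij(1) Z_def by auto
  qed
  have "measure lebesgue (\<Union>s\<in>{..<m} \<times> {..<m}. T s) = (\<Sum>s\<in>{..<m} \<times> {..<m}. measure lebesgue (T s))"
   by (rule measure_finite_Union[OF _ _ disj]) (use fmeasurableD[OF Tl(1)] fmeasurableD2[OF Tl(1)] in \<open>(simp; fail | blast)+\<close>)
  moreover have "measure lebesgue (\<Union>s\<in>{..<m} \<times> {..<m}. T s) <= measure lebesgue Z"
   by (rule measure_mono_fmeasurable) (use TZ Tl(1) in \<open>auto simp: Z_def intro!: fmeasurableD\<close>)
  ultimately have "(real m)^2 * measure lebesgue A <= measure lebesgue Z" by (simp add: Tl(2) power2_eq_square)
  moreover have "(1 / (2 * d) / 2)^2 * measure lebesgue A <= (real m)^2 * measure lebesgue A"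
   using m1(2) d by (intro mult_right_mono power_mono) auto
  moreover have "(1 / (2 * d) / 2)^2 * measure lebesgue A = measure lebesgue A / (16 * d^2)" by (simp add: power2_eq_square)
  ultimately have "measure lebesgue A / (16 * d^2) <= measure lebesgue Z" by linarith
  then have "measure lebesgue A <= V * d^2" unfolding V_def using d by (simp add: divide_le_eq mult_ac)
  then show ?thesis using Ab unfolding A_def by simp
 qed
 then show ?thesis using that[of V] by (simp add: V_def)
qed

lemma N_sets: "N d : sets borel"
proof -
 have "N d = (\<Union>(k, l)\<in>Q. D \<inter> ({x. de k x <= d} \<inter> {x. de l x <= d}))" by (auto simp: N_def)
 moreover have "closed {x. de k x <= d}" for k by (intro closed_Collect_le de_cont continuous_on_const)
 then have "D \<inter> ({x. de k x <= d} \<inter> {x. de l x <= d}) : sets borel" for k l using openD by (auto intro!: sets.Int borel_open borel_closed)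
 ultimately show ?thesis using sets.finite_UN[OF Q(1), of "%(k, l). D \<inter> ({x. de k x <= d} \<inter> {x. de l x <= d})" borel] by auto
qed

lemma N_volume:
 obtains V where "V >= 0" "!!d. 0 < d ==> d <= 1/2 ==> measure lborel (N d) <= V * d^2"
proof -
 have "ALL q. EX V. q : Q --> V >= 0 & (ALL d. 0 < d & d <= 1/2 --> measure lborel {x\<in>D. de (fst q) x <= d & de (snd q) x <= d} <= V * d^2)"
 proof
  fix q
  show "EX V. q : Q --> V >= 0 & (ALL d. 0 < d & d <= 1/2 --> measure lborel {x\<in>D. de (fst q) x <= d & de (snd q) x <= d} <= V * d^2)"
  proof (cases "q : Q")
   case True
   show ?thesis by (rule edge_volume[of "fst q" "snd q"]) (use True in auto)
  qed auto
 qed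
 from choice[OF this] obtain V where V: "!!q. q : Q ==> V q >= 0"
  "!!q d. q : Q ==> 0 < d ==> d <= 1/2 ==> measure lborel {x\<in>D. de (fst q) x <= d & de (snd q) x <= d} <= V q * d^2" by blast
 show ?thesis
 proof (rule that[of "\<Sum>q\<in>Q. V q"])
  show "(\<Sum>q\<in>Q. V q) >= 0" by (intro sum_nonneg V)
  fix d :: real assume d: "0 < d" "d <= 1/2"
  have e: "N d = (\<Union>q\<in>Q. {x\<in>D. de (fst q) x <= d & de (snd q) x <= d})" by (auto simp: N_def split: prod.splits)
  have s: "{x\<in>D. de k x <= d & de l x <= d} : sets borel" for k l
  proof -
   have "{x\<in>D. de k x <= d & de l x <= d} = D \<inter> ({x. de k x <= d} \<inter> {x. de l x <= d})" by auto
   moreover have "closed {x. de k x <= d}" for k by (intro closed_Collect_le de_cont continuous_on_const)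
   ultimately show ?thesis using openD by (auto intro!: sets.Int borel_open borel_closed)
  qed
  have "measure lborel (N d) <= (\<Sum>q\<in>Q. measure lborel {x\<in>D. de (fst q) x <= d & de (snd q) x <= d})"
   unfolding e by (rule measure_UNION_le[OF Q(1)]) (simp add: s)
  also have "... <= (\<Sum>q\<in>Q. V q * d^2)" by (intro sum_mono V(2) d)
  finally show "measure lborel (N d) <= (\<Sum>q\<in>Q. V q) * d^2" by (simp add: sum_distrib_right)
 qed
qed

text \<open>The product over all pairs of 1 - sgm (de k / e) sgm (de l / e): a factor is 0 where
  both distances have modulus at most e, and 1 where one of them exceeds 2 e. The last property is
  not restricted to \<open>D\<close>, so the cutoff vanishes in a full neighbourhood of every edge
  point.\<close>

lemma edge_cutoff:
 obtains et where "scaled_cutoff et" "!!e x. e > 0 ==> x : D - N (2 * e) ==> et e x = 1"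
  "!!e x. e > 0 ==> x : N e ==> et e x = 0"
  "!!e x k l. e > 0 ==> (k, l) : Q ==> \<bar>de k x\<bar> <= e ==> \<bar>de l x\<bar> <= e ==> et e x = 0"
proof -
 obtain sgm :: "real => real" where sgm: "smooth sgm" "!!t. \<bar>t\<bar> <= 1 ==> sgm t = 1" "!!t. \<bar>t\<bar> >= 2 ==> sgm t = 0"
 proof (rule plateau[of 1 "0::real"])
  fix ze :: "real => real" assume "smooth ze" "!!x. norm (x - 0) <= 1 ==> ze x = 1" "!!x. norm (x - 0) >= 2 * 1 ==> ze x = 0"
  then show thesis using that[of ze] by simp
 qed simp
 define et where "et = (%e x. \<Prod>q\<in>Q. 1 - sgm ((b (fst q) - a (fst q) *. x) / e) * sgm ((b (snd q) - a (snd q) *. x) / e))"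
 have z: "et e x = 0" if "e > 0" "(k, l) : Q" "\<bar>de k x\<bar> <= e" "\<bar>de l x\<bar> <= e" for e x k l
 proof -
  have "sgm ((b k - a k *. x) / e) = 1" "sgm ((b l - a l *. x) / e) = 1" using that by (auto intro!: sgm(2) simp: de_def)
  then show ?thesis unfolding et_def using that(2) Q(1) by (intro prod_zero) (auto intro!: bexI[of _ "(k, l)"])
 qed
 show ?thesis
 proof (rule that[OF _ _ _ z])
  show "scaled_cutoff et" unfolding et_def
   by (intro scaled_cutoff_prod Q scaled_cutoff_one_minus scaled_cutoff_mult scaled_cutoff_bump sgm a1) (use Q(2) in \<open>auto simp: split_paired_all\<close>)
  show "et e x = 1" if "e > 0" "x : D - N (2 * e)" for e x
   unfolding et_def
  proof (rule prod.neutral, intro ballI)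
   fix q assume q: "q : Q"
   obtain k l where kl: "q = (k, l)" by (cases q)
   have "de k x > 2 * e \<or> de l x > 2 * e" using that(2) q kl by (auto simp: N_def)
   then have "sgm ((b k - a k *. x) / e) = 0 \<or> sgm ((b l - a l *. x) / e) = 0"
    using that(1) by (auto intro!: sgm(3) simp: de_def le_divide_eq)
   then show "1 - sgm ((b (fst q) - a (fst q) *. x) / e) * sgm ((b (snd q) - a (snd q) *. x) / e) = 1" using kl by auto
  qed
  show "et e x = 0" if e: "e > 0" and x: "x : N e" for e x
  proof -
   obtain k l where "(k, l) : Q" "de k x <= e" "de l x <= e" "x : D" using x by (auto simp: N_def)
   then show ?thesis using de_pos[of x k] de_pos[of x l] Q(2) by (intro z[OF e, of k l]) auto
  qed
 qed
qed

end

section \<open>Density of Laplacians in L^2\<close>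

text \<open>Functions v of X(D) with Laplacian f, on the level of representatives. The last clause
  expresses H^2 regularity through bounded functionals, so that no second derivatives have to be
  named.\<close>

definition XW :: "'a::euclidean_space set => ('a => complex) => ('a => 'a => complex) => ('a => complex) => bool" where
 "XW D v V f \<longleftrightarrow> W D v V & sqi f & (ALL x. x ~: D --> f x = 0) & wlap D V f \<and>
   (ALL i:Basis. ALL j:Basis. bf D (%ph. LBINT x. V i x * pd ph j x))"

text \<open>Density in its dual form, which is how it is applied: a function orthogonal to all
  Laplacians is shown to vanish.\<close>

definition Lap_dense :: "'a::euclidean_space set => bool" where
 "Lap_dense D \<longleftrightarrow> (ALL g. sqi g --> (ALL v V f. XW D v V f --> (LBINT x. g x * cnj (f x)) = 0) -->
   (AEL x. x : D --> g x = 0))"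

text \<open>By the fundamental lemma g need only be paired with C^1 functions ph of compact support.
  Each such ph is the Laplacian of some u in H^1_0, and what remains is to pass from u to functions
  of X(D).\<close>

lemma Lap_denseI:
 fixes D :: "'a::euclidean_space set"
 assumes D: "open D" "bounded D"
  and h: "!!g u U ph. sqi g ==> (!!v V f. XW D v V f ==> (LBINT x. g x * cnj (f x)) = 0) ==>
   C1c D ph ==> W D u U ==> wlap D U ph ==> (LBINT x. g x * cnj (ph x)) = 0"
 shows "Lap_dense D"
 unfolding Lap_dense_def
proof (intro allI impI)
 fix g assume g: "sqi g" "ALL v V f. XW D v V f --> (LBINT x. g x * cnj (f x)) = 0"
 show "AEL x. x : D --> g x = 0"
 proof (rule fundamental_lemma[OF D(1) g(1)])
  fix ph assume p: "C1c D ph"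
  note p' = C1c_cnj[OF p]
  show "(LBINT x. g x * ph x) = 0"
  proof (rule Dirichlet_solve[OF D])
   fix C assume "!!F. sqi F ==> EX q Q. W D q Q & wlap D Q F & nrm q <= C * nrm F & (ALL i:Basis. nrm (Q i) <= C * nrm F)"
   from this[OF C1c_int(3)[OF p']] obtain u U where u: "W D u U" "wlap D U (%x. cnj (ph x))" by blast
   have "(LBINT x. g x * cnj (cnj (ph x))) = 0" by (rule h[OF g(1) _ p' u]) (use g(2) in blast)
   then show ?thesis by simp
  qed
 qed
qed

text \<open>With a graph available at every point the cutoff is the constant 1, and u itself lies in
  X(D).\<close>

lemma Lap_dense_graph:
 fixes D :: "'a::euclidean_space set"
 assumes D: "open D" "bounded D" and p: "!!p. p : closure D ==> graph_at D p"
 shows "Lap_dense D"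
proof (rule Lap_denseI[OF D])
 fix g u ph :: "'a => complex" and U
 assume h: "!!v V f. XW D v V f ==> (LBINT x. g x * cnj (f x)) = 0" and ph: "C1c D ph" and u: "W D u U" "wlap D U ph"
 have "bf D (%ph. LBINT x. U i x * pd ph j x)" if "i : Basis" "j : Basis" for i j
  using smooth_cover_regularity[OF D u(1) C1c_int(3)[OF ph] C1c_off[OF ph] u(2) smooth_const[of 1] disjI1[OF p] that] by simp
 then have "XW D u U ph" unfolding XW_def using u C1c_int(3)[OF ph] C1c_off[OF ph] by blast
 then show "(LBINT x. g x * cnj (ph x)) = 0" by (rule h)
qed

context polytope_domain
begin

lemma open_diff_N: "open (D - N d)"
proof -
 have "D - N d = D \<inter> (\<Inter>q\<in>Q. {x. de (fst q) x > d} \<union> {x. de (snd q) x > d})"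
 proof -
  have "N d = {x\<in>D. EX q:Q. de (fst q) x <= d & de (snd q) x <= d}" unfolding N_def by (simp add: case_prod_unfold)
  then show ?thesis by (auto simp: not_le[symmetric])
 qed
 moreover have "open {x. de k x > d}" for k by (intro open_Collect_less de_cont continuous_on_const)
 ultimately show ?thesis using openD Q(1) by (auto intro!: open_Int open_INT)
qed

text \<open>The function et u lies in X(D) and has Laplacian et ph + err. In err the gradient term
  costs 1/e, compensated by the Caccioppoli bound of order e for the gradient of u near the edges;
  the other term costs 1/e^2, compensated by |u| = O(e) and a volume of order e^2. So err stays
  bounded in L^2, while g restricted to the support of err tends to 0.\<close>

lemma Lap_dense: "Lap_dense D"
proof (rule Lap_denseI[OF openD bd])
 fix g u ph :: "'a => complex" and U
 assume g: "sqi g" and h: "!!v V f. XW D v V f ==> (LBINT x. g x * cnj (f x)) = 0"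
  and ph: "C1c D ph" and u: "W D u U" and wl: "wlap D U ph"
 note phs = C1c_int(3)[OF ph]
 obtain M where M: "M >= 0" "!!x. cmod (ph x) <= M" using C1c_bounded[OF ph] by metis
 obtain R where R: "!!x. x : D ==> norm x <= R" using bd by (auto simp: bounded_iff)
 \<comment> \<open>L exceeds the distance of any point of \<open>D\<close> to any face plane, as the
   barrier demands.\<close>
 define L where "L = (\<Sum>k\<in>F. \<bar>b k\<bar>) + R + 1"
 have deL: "de k x < L" if "x : D" "k : F" for k x
 proof -
  have "\<bar>b k\<bar> <= (\<Sum>k\<in>F. \<bar>b k\<bar>)" using that(2) F by (intro member_le_sum) auto
  moreover have "\<bar>a k *. x\<bar> <= R" using Cauchy_Schwarz_ineq2[of "a k" x] a1[OF that(2)] R[OF that(1)] by simp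
  ultimately show ?thesis by (simp add: de_def L_def)
 qed
 have L0: "L >= 0"
 proof -
  obtain x where "x : D" using ne by blast
  then have "R >= 0" using R[of x] norm_ge_zero[of x] by linarith
  then show ?thesis unfolding L_def by (simp add: sum_nonneg)
 qed
 define K where "K = M * L"
 have K0: "K >= 0" using M(1) L0 by (simp add: K_def)
 have uK: "AEL x. ALL k:F. x : D --> cmod (u x) <= K * de k x"
 proof (rule AE_finite_allI[OF F])
  fix k assume k: "k : F"
  show "AEL x. x : D --> cmod (u x) <= K * de k x"
   unfolding K_def de_def by (rule barrier[OF openD bd u phs M(2) wl a1[OF k]]) (use de_pos[OF _ k] deL[OF _ k] in \<open>auto simp: de_def\<close>)
 qed
 have uN: "AEL x. x : N d --> cmod (u x) <= K * d" for d using uK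
 proof eventually_elim
  fix x assume u: "ALL k:F. x : D --> cmod (u x) <= K * de k x"
  show "x : N d --> cmod (u x) <= K * d"
  proof
   assume "x : N d"
   then obtain k l where kl: "(k, l) : Q" "de k x <= d" "x : D" by (auto simp: N_def)
   have "cmod (u x) <= K * de k x" using u kl Q(2) by blast
   also have "... <= K * d" using kl K0 by (intro mult_left_mono) auto
   finally show "cmod (u x) <= K * d" .
  qed
 qed
 obtain et where et: "scaled_cutoff et" "!!e x. e > 0 ==> x : D - N (2 * e) ==> et e x = 1"
  "!!e x. e > 0 ==> x : N e ==> et e x = 0"
  "!!e x k l. e > 0 ==> (k, l) : Q ==> \<bar>de k x\<bar> <= e ==> \<bar>de l x\<bar> <= e ==> et e x = 0"
  using edge_cutoff by blast
 obtain B where B: "B >= 0" "!!e x. e > 0 ==> \<bar>et e x\<bar> <= B" "!!e x i. e > 0 ==> i : Basis ==> \<bar>pd (et e) i x\<bar> <= B / e"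
  "!!e x i. e > 0 ==> i : Basis ==> \<bar>pd (pd (et e) i) i x\<bar> <= B / e^2" using scaled_cutoff_D[OF et(1)] by blast
 \<comment> \<open>The complement of the cutoff at scale 2 e: it is 1 on \<open>N (2 * e)\<close>,
   the part of \<open>D\<close> where \<open>et e\<close> may vary, and it vanishes on
   \<open>D\<close> outside \<open>N (4 * e)\<close>.\<close>
 define xi where "xi = (%e x. 1 - et (2 * e) x)"
 have scxi: "scaled_cutoff (%e x. 1 - et e x)" by (rule scaled_cutoff_one_minus[OF et(1)])
 obtain B' where BB: "B' >= 0" "ALL e>0. ALL x. ALL i:Basis. \<bar>1 - et e x\<bar> <= B' & \<bar>pd (%x. 1 - et e x) i x\<bar> <= B' / e & \<bar>pd (pd (%x. 1 - et e x) i) i x\<bar> <= B' / e^2"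
  using scxi[unfolded scaled_cutoff_def, THEN conjunct2] by (elim exE conjE)
 obtain i0 :: 'a where i0: "i0 : Basis" using nonempty_Basis by blast
 have B': "B' >= 0" "!!e x. e > 0 ==> \<bar>1 - et e x\<bar> <= B'" "!!e x i. e > 0 ==> i : Basis ==> \<bar>pd (%x. 1 - et e x) i x\<bar> <= B' / e"
  using BB(1) BB(2)[rule_format, OF _ i0] BB(2)[rule_format] by simp_all
 obtain V where V: "V >= 0" "!!d. 0 < d ==> d <= 1/2 ==> measure lborel (N d) <= V * d^2" using N_volume by blast
 have V': "sqrt (measure lborel (N d)) <= sqrt V * d" if "0 < d" "d <= 1/2" for d
 proof -
  have "sqrt (measure lborel (N d)) <= sqrt (V * d^2)" using V(2)[OF that] by (rule real_sqrt_le_mono)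
  then show ?thesis using that by (simp add: real_sqrt_mult)
 qed
 have NsD: "N d : sets lborel" "N d <= D" "emeasure lborel (N d) < \<infinity>" for d
  using N_sets emeasure_bounded_finite[OF bounded_subset[OF bd], of "N d"] by (auto simp: N_def)
 \<comment> \<open>The constant that Caccioppoli produces with |u| <= 4 K e, gradient bound B' / (2
   e) for the cutoff and volume at most V (4 e)^2.\<close>
 define C1 where "C1 = 2 * real DIM('a) * (8 * (B' * K * sqrt V)) + sqrt (64 * (M * B'^2 * K * V))"
 have C10: "C1 >= 0" unfolding C1_def using B'(1) K0 V(1) M(1) by simp
 have cacc: "nrm (%x. of_real (xi e x) * U i x) <= C1 * e" if e: "0 < e" "e <= 1/8" and i: "i : Basis" for e i
 proof -
  have e2: "2 * e > 0" using e by simp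
  have s: "smooth (xi e)" unfolding xi_def using scaled_cutoff_smooth[OF scxi e2] .
  have "nrm (%x. of_real (xi e x) * U i x) <= 2 * real DIM('a) * ((B' / (2 * e)) * (K * (4 * e)) * sqrt (measure lborel (N (4 * e)))) + sqrt (M * B'^2 * (K * (4 * e)) * measure lborel (N (4 * e)))"
  proof (rule Caccioppoli[OF openD bd u phs M(2) wl smooth_C1_on[OF s] _ _ NsD(1,2) _ _ uN])
   show "\<bar>xi e x\<bar> <= B'" for x unfolding xi_def by (rule B'(2)[OF e2])
   show "\<bar>pd (xi e) i x\<bar> <= B' / (2 * e)" if "i : Basis" for i x unfolding xi_def by (rule B'(3)[OF e2 that])
   have z: "xi e x = 0" if "x : D - N (4 * e)" for x using et(2)[OF e2, of x] that by (simp add: xi_def)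
   show "xi e x = 0" if "x : D - N (4 * e)" for x by (rule z[OF that])
   show "pd (xi e) i x = 0" if "x : D - N (4 * e)" for x i
    using pd_eq_of_open[OF open_diff_N that, of "xi e" "%x. 0" i] z by simp
  qed (use B'(1) K0 e i in auto)
  also have "... <= 2 * real DIM('a) * ((B' / (2 * e)) * (K * (4 * e)) * (sqrt V * (4 * e))) + sqrt (M * B'^2 * (K * (4 * e)) * (V * (4 * e)^2))"
   using V'[of "4 * e"] V(2)[of "4 * e"] e B'(1) K0 M(1)
   by (intro add_mono mult_left_mono real_sqrt_le_mono mult_nonneg_nonneg) auto
  also have "... <= C1 * e"
  proof -
   have "M * B'^2 * (K * (4 * e)) * (V * (4 * e)^2) = (64 * (M * B'^2 * K * V)) * (e^2 * e)" by (simp add: power2_eq_square)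
   also have "... <= (64 * (M * B'^2 * K * V)) * (e^2 * 1)" using e M(1) K0 V(1) by (intro mult_left_mono) auto
   finally have "sqrt (M * B'^2 * (K * (4 * e)) * (V * (4 * e)^2)) <= sqrt ((64 * (M * B'^2 * K * V)) * e^2)"
    by (intro real_sqrt_le_mono) simp
   also have "... = sqrt (64 * (M * B'^2 * K * V)) * e" using e unfolding real_sqrt_mult[of "64 * (M * B'^2 * K * V)"] by simp
   finally have 1: "sqrt (M * B'^2 * (K * (4 * e)) * (V * (4 * e)^2)) <= sqrt (64 * (M * B'^2 * K * V)) * e" .
   have 2: "(B' / (2 * e)) * (K * (4 * e)) * (sqrt V * (4 * e)) = 8 * (B' * K * sqrt V) * e" using e by simp
   show ?thesis using add_left_mono[OF 1, of "2 * real DIM('a) * (8 * (B' * K * sqrt V) * e)"]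
    unfolding 2 C1_def distrib_right by (simp only: mult.assoc)
  qed
  finally show ?thesis .
 qed
 define err where "err = (%e x. 2 * (SB i. of_real (pd (et e) i x) * U i x) + (SB i. of_real (pd (pd (et e) i) i x)) * u x)"
 define C2 where "C2 = 2 * (real DIM('a) * (B * C1)) + real DIM('a) * (4 * (B * K * sqrt V))"
 have step: "sqi (err e) & nrm (err e) <= C2 & (ALL x. x ~: N (2 * e) --> err e x = 0) \<and>
   (LBINT x. g x * cnj (of_real (et e x) * ph x)) = - (LBINT x. g x * cnj (err e x))" if e: "0 < e" "e <= 1/8" for e
 proof -
  let ?z = "%x. cor (et e x)"
  note s = scaled_cutoff_smooth[OF et(1) e(1)]
  have sC: "C1u (et e)" "!!i. i : Basis ==> C1u (pd (et e) i)" using s smooth_pd smooth_C1_on by blast+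
  have zC: "C1u ?z" "pd ?z i = (%x. of_real (pd (et e) i x))" for i
   using C1_on_bl[OF sC(1) bounded_linear_of_real] by auto
  have zC2: "C1u (pd ?z i)" "pd (pd ?z i) i x = of_real (pd (pd (et e) i) i x)" if "i : Basis" for i x
   unfolding zC(2) using C1_on_bl[OF sC(2)[OF that] bounded_linear_of_real] by auto
  have off1: "pd (et e) i x = 0" if "x : D - N (2 * e)" for x i
   using pd_eq_of_open[OF open_diff_N that, of "et e" "%x. 1" i] et(2)[OF e(1)] by simp
  have off2: "pd (pd (et e) i) i x = 0" if "x : D - N (2 * e)" for x i
   using pd_eq_of_open[OF open_diff_N that, of "pd (et e) i" "%x. 0" i] off1 by simp
  have off: "err e x = 0" if "x ~: N (2 * e)" for x
  proof (cases "x : D")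
   case True then show ?thesis using off1[of x] off2[of x] that by (simp add: err_def)
  next
   case False then show ?thesis using WD(3,4)[OF u] by (simp add: err_def)
  qed
  have ms: "(%x. cor (pd (pd (et e) i) i x) * u x) : lmbl" "(%x. cor (pd (et e) i x) * U i x) : lmbl"
   if i: "i : Basis" for i
  proof -
   have "pd (pd (et e) i) i : mbl" "pd (et e) i : mbl"
    using C1_on_cont_pd[OF sC(2)[OF i]] C1_on_cont_pd[OF sC(1)] by (auto intro: mbl_cont)
   then show "(%x. cor (pd (pd (et e) i) i x) * u x) : lmbl" "(%x. cor (pd (et e) i x) * U i x) : lmbl"
    using sqi_meas[OF WD(1)[OF u]] sqi_meas[OF WD(2)[OF u i]] by (auto intro!: borel_measurable_times borel_measurable_of_real)
  qed
  have a: "sqi (%x. of_real (pd (et e) i x) * U i x)" "nrm (%x. of_real (pd (et e) i x) * U i x) <= B * C1" if i: "i : Basis" for i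
  proof -
   have xs: "sqi (%x. cor (xi e x) * U i x)"
   proof (rule sqi_cont_mult(1)[OF openD _ WD(2)[OF u i] WD(4)[OF u _ i], of _ B'])
    have "smooth (xi e)" unfolding xi_def using scaled_cutoff_smooth[OF scxi, of "2 * e"] e by simp
    then show "continuous_on D (%x. cor (xi e x))" using C1_on_cont[OF smooth_C1_on] by (intro continuous_on_of_real)
    show "cmod (cor (xi e x)) <= B'" for x using B'(2)[of "2 * e" x] e unfolding norm_of_real xi_def by simp
   qed (use B'(1) in auto)
   have "cmod (of_real (pd (et e) i x) * U i x) <= (B / e) * cmod (of_real (xi e x) * U i x)" for x
   proof -
    consider "x ~: D" | "x : D - N (2 * e)" | "x : N (2 * e)" by blast
    then show ?thesis
    proof cases
     case 1 then show ?thesis using WD(4)[OF u _ i] by simp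
    next
     case 2 then show ?thesis using off1[OF 2] B(1) e by simp
    next
     case 3
     then have "xi e x = 1" using et(3)[of "2 * e" x] e by (simp add: xi_def)
     then show ?thesis using mult_right_mono[OF B(3)[OF e(1) i, of x] norm_ge_zero[of "U i x"]] by (simp add: norm_mult)
    qed
   qed
   then have ae: "AEL x. cmod (of_real (pd (et e) i x) * U i x) <= (B / e) * cmod (of_real (xi e x) * U i x)" by simp
   have Be: "B / e >= 0" using B(1) e by simp
   note b = sqi_bound[OF xs ms(2)[OF i] ae Be]
   show "sqi (%x. of_real (pd (et e) i x) * U i x)" by (rule b(1))
   note b(2)
   also have "(B / e) * nrm (%x. of_real (xi e x) * U i x) <= (B / e) * (C1 * e)" by (intro mult_left_mono cacc[OF e i] Be)
   finally show "nrm (%x. of_real (pd (et e) i x) * U i x) <= B * C1" using e by simp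
  qed
  have c: "sqi (%x. of_real (pd (pd (et e) i) i x) * u x)" "nrm (%x. of_real (pd (pd (et e) i) i x) * u x) <= 4 * (B * K * sqrt V)" if i: "i : Basis" for i
  proof -
   have ae: "AEL x. cmod (of_real (pd (pd (et e) i) i x) * u x) <= (B / e^2 * (K * (2 * e))) * indicator (N (2 * e)) x"
    using uN[of "2 * e"]
   proof eventually_elim
    fix x assume un: "x : N (2 * e) --> cmod (u x) <= K * (2 * e)"
    consider "x ~: D" | "x : D - N (2 * e)" | "x : N (2 * e)" by blast
    then show "cmod (of_real (pd (pd (et e) i) i x) * u x) <= (B / e^2 * (K * (2 * e))) * indicator (N (2 * e)) x"
    proof cases
     case 1 then show ?thesis using WD(3)[OF u] NsD(2)[of "2 * e"] by (auto simp: indicator_def)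
    next
     case 2 then show ?thesis using off2[OF 2] by simp
    next
     case 3
     have "cmod (of_real (pd (pd (et e) i) i x) * u x) = \<bar>pd (pd (et e) i) i x\<bar> * cmod (u x)" by (simp add: norm_mult)
     also have "... <= B / e^2 * (K * (2 * e))" using 3 un B(1) by (intro mult_mono B(4)[OF e(1) i]) auto
     finally show ?thesis using 3 by simp
    qed
   qed
   have pos: "0 <= B / e^2 * (K * (2 * e))" using B(1) K0 e by simp
   note nb = nrm_indicator_bound[OF ms(1)[OF i] NsD(1) NsD(3) pos ae]
   show "sqi (%x. of_real (pd (pd (et e) i) i x) * u x)" by (rule nb(1))
   note nb(2)
   also have "(B / e^2 * (K * (2 * e))) * sqrt (measure lborel (N (2 * e))) <= (B / e^2 * (K * (2 * e))) * (sqrt V * (2 * e))"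
    using e by (intro mult_left_mono pos V') auto
   also have "... = 4 * (B * K * sqrt V)" using e by (simp add: power2_eq_square)
   finally show "nrm (%x. of_real (pd (pd (et e) i) i x) * u x) <= 4 * (B * K * sqrt V)" .
  qed
  have es: "sqi (err e)" unfolding err_def sum_distrib_right by (intro sqi_add sqi_cmult sqi_sum a c)
  have en: "nrm (err e) <= C2"
  proof -
   have "nrm (err e) <= nrm (%x. 2 * (SB i. of_real (pd (et e) i x) * U i x)) + nrm (%x. SB i. of_real (pd (pd (et e) i) i x) * u x)"
    unfolding err_def sum_distrib_right by (intro nrm_triangle sqi_cmult sqi_sum a c)
   also have "... = 2 * nrm (%x. SB i. of_real (pd (et e) i x) * U i x) + nrm (%x. SB i. of_real (pd (pd (et e) i) i x) * u x)"
    by (simp add: nrm_cmult)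
   also have "... <= 2 * (\<Sum>i\<in>(Basis::'a set). B * C1) + (\<Sum>i\<in>(Basis::'a set). 4 * (B * K * sqrt V))"
    by (intro add_mono mult_left_mono order_trans[OF nrm_sum_le] sum_mono a c) auto
   finally show ?thesis by (simp add: C2_def)
  qed
  have "XW D (%x. ?z x * u x) (%i x. ?z x * U i x + pd ?z i x * u x)
   (%x. ?z x * ph x + 2 * (SB i. pd ?z i x * U i x) + (SB i. pd (pd ?z i) i x) * u x)"
   unfolding XW_def
  proof (intro conjI ballI allI impI)
   show "W D (%x. ?z x * u x) (%i x. ?z x * U i x + pd ?z i x * u x)"
   proof (rule W_mult[OF openD C1_on_subset[OF zC(1) subset_UNIV] u, where C = UNIV and B = "B + B / e"])
    show "cmod (?z x) <= B + B / e" for x using B(2)[OF e(1), of x] B(1) e by (simp add: add_increasing2)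
    show "cmod (pd ?z i x) <= B + B / e" if "i : Basis" for x i using B(3)[OF e(1) that, of x] B(1) fun_cong[OF zC(2), of x i] by (simp add: add_increasing)
   qed (use B(1) e in auto)
   note wm = wlap_mult[OF openD bd zC(1) zC2(1) u phs C1c_off[OF ph] wl]
   show "sqi (%x. ?z x * ph x + 2 * (SB i. pd ?z i x * U i x) + (SB i. pd (pd ?z i) i x) * u x)" by (rule wm(2))
   show "wlap D (%i x. ?z x * U i x + pd ?z i x * u x) (%x. ?z x * ph x + 2 * (SB i. pd ?z i x * U i x) + (SB i. pd (pd ?z i) i x) * u x)" by (rule wm(1))
   show "?z x * ph x + 2 * (SB i. pd ?z i x * U i x) + (SB i. pd (pd ?z i) i x) * u x = 0" if "x ~: D" for x
    using C1c_off[OF ph that] WD(3)[OF u that] WD(4)[OF u that] by simp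
   fix i j :: 'a assume ij: "i : Basis" "j : Basis"
   show "bf D (%ph. LBINT x. (?z x * U i x + pd ?z i x * u x) * pd ph j x)"
   proof (rule smooth_cover_regularity[OF openD bd u phs C1c_off[OF ph] wl s _ ij])
    fix p assume "p : closure D"
    then consider "graph_at D p" | k l where "(k, l) : Q" "de k p = 0" "de l p = 0" using graph_or_edge by blast
    then show "graph_at D p \<or> (EX r>0. ALL x. norm (x - p) < r --> et e x = 0)"
    proof cases
     case 2
     have "\<bar>de k x\<bar> <= e" if "norm (x - p) < e" "de k p = 0" "k : F" for x k
     proof -
      have "de k x = - (a k *. (x - p))" using that(2) by (simp add: de_def inner_diff_right)
      then show ?thesis using Cauchy_Schwarz_ineq2[of "a k" "x - p"] a1[OF that(3)] that(1) by simp
     qed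
     then have "ALL x. norm (x - p) < e --> et e x = 0" using et(4)[OF e(1) 2(1)] 2 Q(2)[OF 2(1)] by blast
     then show ?thesis using e(1) by blast
    qed auto
   qed
  qed
  note hx = h[OF this]
  have zpp: "pd (%x. cor (pd (et e) i x)) i x = of_real (pd (pd (et e) i) i x)" if "i : Basis" for i x
   using C1_on_bl(2)[OF sC(2)[OF that] bounded_linear_of_real UNIV_I] .
  have "?z x * ph x + 2 * (SB i. pd ?z i x * U i x) + (SB i. pd (pd ?z i) i x) * u x = ?z x * ph x + err e x" for x
   unfolding err_def zC(2) by (simp add: fun_cong[OF zC(2)] zpp add.assoc cong: sum.cong)
  then have "(LBINT x. g x * cnj (?z x * ph x + err e x)) = 0" using hx by (simp only:)
  moreover have "intgl (%x. g x * cnj (?z x * ph x))"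
   by (intro sqi_mult g sqi_cnj C1c_int(3)[OF C1c_mult(1)[OF openD C1_on_subset[OF zC(1) subset_UNIV] ph]])
  moreover have "intgl (%x. g x * cnj (err e x))" by (intro sqi_mult g sqi_cnj es)
  ultimately have "(LBINT x. g x * cnj (?z x * ph x)) = - (LBINT x. g x * cnj (err e x))"
   by (simp add: distrib_left eq_neg_iff_add_eq_0)
  then show ?thesis using es en off by blast
 qed
 \<comment> \<open>The bound e n <= 1/8 makes 4 e n <= 1/2, the range in which the volume estimate
   holds.\<close>
 define e where "e = (%n::nat. 1 / (8 * (real n + 1)))"
 have e: "0 < e n" "e n <= 1/8" for n unfolding e_def by (auto simp: field_simps)
 have elim: "e \<longlonglongrightarrow> 0"
 proof -
  have "(%n. (1/8) * (1 / real (Suc n))) \<longlonglongrightarrow> (1/8) * 0" by (intro tendsto_mult tendsto_const LIMSEQ_Suc[OF lim_1_over_n])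
  then show ?thesis unfolding e_def by (simp add: add.commute)
 qed
 have ev: "EV n. x ~: N (2 * e n)" for x
 proof (cases "x : D")
  case True
  have "EV n. 2 * e n < de (fst q) x" if "q : Q" for q
  proof -
   have "(%n. 2 * e n) \<longlonglongrightarrow> 2 * 0" by (intro tendsto_mult tendsto_const elim)
   then show ?thesis using order_tendstoD(2)[of "%n. 2 * e n" "2 * 0"] de_pos[OF True, of "fst q"] Q(2)[of "fst q" "snd q"] that by simp
  qed
  then have "EV n. ALL q:Q. 2 * e n < de (fst q) x" using Q(1) by (intro eventually_ball_finite) auto
  then show ?thesis by eventually_elim (auto simp: N_def)
 qed (auto simp: N_def)
 note [measurable] = sqi_meas[OF g] sqi_meas[OF phs]
 have Nm[measurable]: "N d : sets borel" for d by (rule N_sets)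
 \<comment> \<open>The error vanishes off the edge region, so g may be cut down to it; the regions
   eventually leave every point behind, and the restriction tends to 0 by dominated
   convergence.\<close>
 define G where "G = (%n x. indicator (N (2 * e n)) x * g x)"
 have Gs: "sqi (G n)" for n
  by (rule sqi_bound(1)[OF g, of _ 1]) (auto simp: G_def indicator_def)
 have Glim: "null (%n. nrm (G n))"
 proof -
  have "(%n. LBINT x. (cmod (G n x))^2) \<longlonglongrightarrow> integral\<^sup>L lborel (%x::'a. 0)"
  proof (rule integral_dominated_convergence[where M = lborel and s = "%n x. (cmod (G n x))^2" and f = "%x::'a. 0::real" and w = "%x. (cmod (g x))^2"])
   show "AEL x. (%n. (cmod (G n x))^2) \<longlonglongrightarrow> 0"
   proof (intro AE_I2)
    fix x show "null (%n. (cmod (G n x))^2)"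
     by (rule tendsto_eventually) (use ev[of x] in \<open>eventually_elim, simp add: G_def\<close>)
   qed
   show "AEL x. norm ((cmod (G n x))^2) <= (cmod (g x))^2" for n by (auto simp: G_def indicator_def)
   show "(%x. (cmod (G n x))^2) : lmbl" for n using sqi_meas[OF Gs[of n]] by measurable
  qed (use sqi_integrable[OF g] in auto)
  from tendsto_real_sqrt[OF this] show ?thesis by (simp add: nrmM_def)
 qed
 have C20: "C2 >= 0" unfolding C2_def using B(1) C10 K0 V(1) by simp
 have lim0: "null (%n. LBINT x. g x * cnj (of_real (et (e n) x) * ph x))"
 proof (rule Lim_null_comparison)
  show "EV n. norm (LBINT x. g x * cnj (of_real (et (e n) x) * ph x)) <= nrm (G n) * C2"
  proof (intro always_eventually allI)
   fix n
   note st = step[OF e]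
   have "(%x. g x * cnj (err (e n) x)) = (%x. G n x * cnj (err (e n) x))" using st[of n] by (auto simp: G_def fun_eq_iff indicator_def)
   then have "norm (LBINT x. g x * cnj (of_real (et (e n) x) * ph x)) = norm (LBINT x. G n x * cnj (err (e n) x))" using st[of n] by simp
   also have "... <= nrm (G n) * nrm (%x. cnj (err (e n) x))" using st[of n] by (intro Cauchy_Schwarz_nrm Gs sqi_cnj) auto
   also have "... <= nrm (G n) * C2" unfolding nrm_cnj using st[of n] by (intro mult_left_mono) auto
   finally show "norm (LBINT x. g x * cnj (of_real (et (e n) x) * ph x)) <= nrm (G n) * C2" .
  qed
  show "null (%n. nrm (G n) * C2)" using tendsto_mult_left_zero[OF Glim] .
 qed
 have "(%n. LBINT x. g x * cnj (of_real (et (e n) x) * ph x)) \<longlonglongrightarrow> (LBINT x. g x * cnj (ph x))"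
 proof (rule integral_dominated_convergence[where w = "%x. B * cmod (g x * cnj (ph x))"])
  show "(%x. g x * cnj (of_real (et (e n) x) * ph x)) : lmbl" for n
  proof -
   note s = C1c_int(3)[OF C1c_mult(1)[OF openD C1_on_bl(1)[OF smooth_C1_on[OF scaled_cutoff_smooth[OF et(1) e(1)[of n]]] bounded_linear_of_real] ph]]
   show ?thesis by (rule borel_measurable_times[OF sqi_meas[OF g] sqi_meas[OF sqi_cnj[OF s]]])
  qed
  show "(%x. g x * cnj (ph x)) : lmbl" by (rule borel_measurable_times[OF sqi_meas[OF g] sqi_meas[OF sqi_cnj[OF phs]]])
  show "intgl (%x. B * cmod (g x * cnj (ph x)))" by (intro integrable_mult_right integrable_norm sqi_mult g sqi_cnj phs)
  show "AEL x. (%n. g x * cnj (of_real (et (e n) x) * ph x)) \<longlonglongrightarrow> g x * cnj (ph x)"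
  proof (intro AE_I2 tendsto_eventually)
   fix x show "EV n. g x * cnj (of_real (et (e n) x) * ph x) = g x * cnj (ph x)"
    using ev[of x]
   proof eventually_elim
    fix n assume "x ~: N (2 * e n)"
    then show "g x * cnj (of_real (et (e n) x) * ph x) = g x * cnj (ph x)"
     using et(2)[OF e(1), of x n] C1c_off[OF ph, of x] by (cases "x : D") auto
   qed
  qed
  show "AEL x. norm (g x * cnj (of_real (et (e n) x) * ph x)) <= B * cmod (g x * cnj (ph x))" for n
  proof (intro AE_I2)
   fix x
   have "norm (g x * cnj (of_real (et (e n) x) * ph x)) = \<bar>et (e n) x\<bar> * cmod (g x * cnj (ph x))" by (simp add: norm_mult)
   also have "... <= B * cmod (g x * cnj (ph x))" by (intro mult_right_mono B(2)[OF e(1)]) auto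
   finally show "norm (g x * cnj (of_real (et (e n) x) * ph x)) <= B * cmod (g x * cnj (ph x))" .
  qed
 qed
 then show "(LBINT x. g x * cnj (ph x)) = 0" using LIMSEQ_unique lim0 by blast
qed

end

text \<open>An open convex set is the interior of its closure, here a finite intersection of closed
  half-spaces. The half-spaces serve as their own indices, so distinct indices have distinct normals
  or offsets.\<close>

lemma polygonal_Lap_dense:
 fixes D :: "'a::euclidean_space set"
 assumes D: "open D" "bounded D" "D ~= {}" and p: "polygonal_no_reentrant D"
 shows "Lap_dense D"
proof -
 have cv: "convex D" "polyhedron (closure D)" using p polytope_imp_polyhedron by (auto simp: polygonal_no_reentrant_def)
 then obtain F where F: "finite F" "closure D = \<Inter>F" "ALL h:F. EX a b. a ~= 0 & h = {x. a *. x <= b}" unfolding polyhedron_def by blast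
 have "ALL h. EX a. EX b. h : F --> norm a = 1 & h = {x. a *. x <= b}"
 proof
  fix h
  show "EX a. EX b. h : F --> norm a = 1 & h = {x. a *. x <= b}"
  proof (cases "h : F")
   case True
   then obtain a b where ab: "a ~= 0" "h = {x. a *. x <= b}" using F(3) by blast
   have "h = {x. (a /\<^sub>R norm a) *. x <= b / norm a}" using ab by (auto simp: field_simps)
   then show ?thesis using ab(1) by (intro exI[of _ "a /\<^sub>R norm a"] exI[of _ "b / norm a"]) simp
  qed auto
 qed
 from choice[OF this] obtain a where "ALL h. EX b. h : F --> norm (a h) = 1 & h = {x. a h *. x <= b}" by blast
 from choice[OF this] obtain b where ab: "!!h. h : F ==> norm (a h) = 1" "!!h. h : F ==> h = {x. a h *. x <= b h}" by blast
 have int: "interior h = {x. a h *. x < b h}" if "h : F" for h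
 proof -
  have "a h ~= 0" using ab(1)[OF that] by auto
  then show ?thesis using ab(2)[OF that] interior_halfspace_le by metis
 qed
 have Di: "D = (\<Inter>h\<in>F. interior h)"
 proof
  have "D <= h" if "h : F" for h using closure_subset[of D] F(2) that by blast
  then show "D <= (\<Inter>h\<in>F. interior h)" using D(1) by (auto intro: interior_maximal[THEN subsetD])
  have "(\<Inter>h\<in>F. interior h) <= closure D" unfolding F(2) using interior_subset by blast
  then have "(\<Inter>h\<in>F. interior h) <= interior (closure D)" using F(1) by (intro interior_maximal open_INT) auto
  then show "(\<Inter>h\<in>F. interior h) <= D" using convex_interior_closure[OF cv(1)] D(1) by (simp add: interior_open)
 qed
 have "polytope_domain D F a b"
 proof
  show "D = {x. ALL k:F. a k *. x < b k}" by (subst Di) (auto simp: int)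
  show "a k ~= a l \<or> b k ~= b l" if "k : F" "l : F" "k ~= l" for k l using ab(2)[OF that(1)] ab(2)[OF that(2)] that(3) by metis
 qed (use F(1) ab(1) D in auto)
 then show ?thesis by (rule polytope_domain.Lap_dense)
qed

section \<open>Classical representatives of W^{2,infinity} coefficients\<close>

text \<open>The preimage of \<open>S\<close> in \<open>D\<close> is open and a null set, hence
  empty.\<close>

lemma AE_continuous_imp:
 fixes D :: "'a::euclidean_space set" and f :: "'a => 'b::metric_space"
 assumes D: "open D" and f: "continuous_on D f" and S: "open S" and ae: "AEL x. x : D --> f x ~: S" and x: "x : D"
 shows "f x ~: S"
proof
 assume "f x : S"
 define U where "U = f -` S \<inter> D"
 have U: "open U" "x : U" using continuous_open_preimage[OF f D S] x \<open>f x : S\<close> by (auto simp: U_def Int_commute)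
 have "AEL x. x ~: U" using ae by eventually_elim (auto simp: U_def)
 then have "U : null_sets lborel" using U(1) by (subst AE_iff_null_sets) auto
 then have "negligible U" by (simp add: negligible_iff_null_sets null_sets_completionI)
 then show False using open_not_negligible[OF U(1)] U(2) by blast
qed

lemma integrable_complex_indicator:
 assumes "A : sets M" "emeasure M A < \<infinity>" shows "integrable M (%x. indicator A x :: complex)"
proof -
 have "(%x. indicator A x :: complex) = (%x. of_real (indicator A x))" by (auto simp: indicator_def)
 then show ?thesis using integrable_of_real[OF integrable_real_indicator[OF assms]] by simp
qed

lemma sqi_bounded:
 assumes D: "open D" "bounded D" and f: "f : lmbl" "!!x. x ~: D ==> f x = 0" "!!x. x : D ==> cmod (f x) <= M" and M: "0 <= M"
 shows "sqi f"
proof (rule nrm_indicator_bound(1)[OF f(1) _ _ M])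
 show "D : sets lborel" "emeasure lborel D < \<infinity>" using D emeasure_bounded_finite by auto
 have "cmod (f x) <= M * indicator D x" for x using f(2,3)[of x] by (cases "x : D") auto
 then show "AEL x. cmod (f x) <= M * indicator D x" by simp
qed

text \<open>The mollifications of \<open>u\<close> are locally equi-Lipschitz and converge weakly to \<open>u\<close>, hence they
  converge locally uniformly.\<close>
lemma bounded_weak_gradient_rep:
 fixes D :: "'a::euclidean_space set"
 assumes D: "open D" "bounded D" and u: "u : mbl" "!!x. cmod (u x) <= M" "!!x. x ~: D ==> u x = 0"
  and G: "!!i. i : Basis ==> G i : mbl" "!!i x. i : Basis ==> cmod (G i x) <= M" "!!i x. i : Basis ==> x ~: D ==> G i x = 0"
  and wd: "!!i ph. i : Basis ==> C1c D ph ==> (LBINT x. u x * pd ph i x) = - (LBINT x. G i x * ph x)"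
 obtains v where "continuous_on D v" "!!x. x : D ==> cmod (v x) <= M" "AEL x. x : D --> u x = v x"
  "(!!i. i : Basis ==> continuous_on D (G i)) ==> C1_on D v"
  "!!i x. (!!i. i : Basis ==> continuous_on D (G i)) ==> i : Basis ==> x : D ==> pd v i x = G i x"
proof -
 have M0: "M >= 0" using u(2)[of undefined] norm_ge_zero order_trans by blast
 have us: "sqi u" and Gs: "!!i. i : Basis ==> sqi (G i)" using u G M0 by (auto intro!: sqi_bounded[OF D])
 have Di: "intgl (%x. indicator D x :: complex)" using D emeasure_bounded_finite[OF D(2)] by (intro integrable_complex_indicator) auto
 have int: "intgl v" if "v : mbl" "!!x. cmod (v x) <= M" "!!x. x ~: D ==> v x = 0" for v :: "'a => complex"
 proof (rule bintgl_bound[of lborel "%x. M *R indicator D x :: complex"])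
  show "AEL x. cmod (v x) <= cmod (M *R indicator D x :: complex)"
  proof (intro AE_I2)
   fix x show "cmod (v x) <= cmod (M *R indicator D x :: complex)" using that(2,3)[of x] M0 by (cases "x : D") auto
  qed
 qed (use Di that(1) in auto)
 have ui: "intgl u" by (rule int[OF u])
 have "ALL n. EX ro::'a => real. smooth ro & (ALL x. ro x >= 0) & (ALL x. norm x > 1 / real (Suc n) --> ro x = 0) & (LBINT x. ro x) = 1 & intgl ro & (ALL x. ro (- x) = ro x)"
 proof
  fix n show "EX ro::'a => real. smooth ro & (ALL x. ro x >= 0) & (ALL x. norm x > 1 / real (Suc n) --> ro x = 0) & (LBINT x. ro x) = 1 & intgl ro & (ALL x. ro (- x) = ro x)"
   by (rule mollifier[of "1 / real (Suc n)"]) auto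
 qed
 from choice[OF this] obtain ro :: "nat => 'a => real" where ro: "!!n. smooth (ro n)" "!!n x. ro n x >= 0" "!!n x. norm x > 1 / real (Suc n) ==> ro n x = 0"
  "!!n. (LBINT x. ro n x) = 1" "!!n. intgl (ro n)" "!!n x. ro n (- x) = ro n x" by blast
 define c where "c = (%n x. cor (ro n x))"
 have cs: "smooth (c n)" for n unfolding c_def by (rule smooth_bl[OF ro(1) bounded_linear_of_real])
 have coff: "c n x = 0" if "x ~: cball 0 (1 / real (Suc n))" for n x using ro(3)[of n x] that by (simp add: c_def)
 have cC: "C1c UNIV (c n)" for n by (rule smooth_compact_C1c[OF cs compact_cball subset_UNIV coff])
 have shift: "C1c D (%y. c n (x - y))" "pd (%y. c n (x - y)) i y = - pd (c n) i (x - y)" if "cball x (1 / real (Suc n)) <= D" for n x i y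
 proof -
  note cp = C1_on_compose[OF C1c_C1[OF cC], of "%y. x - y" "%_ v. - v" n]
  have d: "((%y. x - y) has_derivative (%v. - v)) (at y)" for y by (auto intro!: derivative_eq_intros)
  show "C1c D (%y. c n (x - y))" unfolding C1c_def
  proof (intro conjI exI[of _ "cball x (1 / real (Suc n))"])
   show "C1u (%y. c n (x - y))" by (rule cp(1)[OF d]) (rule continuous_on_const)
   show "ALL y. y ~: cball x (1 / real (Suc n)) --> c n (x - y) = 0"
   proof (intro allI impI coff)
    fix y assume "y ~: cball x (1 / real (Suc n))"
    then show "x - y ~: cball 0 (1 / real (Suc n))" unfolding mem_cball dist_0_norm unfolding dist_norm .
   qed
  qed (use that in auto)
  have "pd (%y. c n (x - y)) i y = pd (c n) (- i) (x - y)" by (rule cp(2)[OF d]) (rule continuous_on_const)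
  then show "pd (%y. c n (x - y)) i y = - pd (c n) i (x - y)" using linear_neg[OF pd_linear[OF C1c_C1[OF cC] UNIV_I]] by simp
 qed
 define a where "a = (%n. conv u (c n))"
 note sc = smooth_conv[OF ui cs compact_cball coff]
 have aC: "C1_on S (a n)" for S n unfolding a_def by (rule smooth_C1_on[OF sc(1)])
 have sc2: "pd (a n) i x = conv u (pd (c n) i) x" for n i x unfolding a_def by (rule sc(2))
 \<comment> \<open>Where the ball of radius 1 / (n + 1) lies in \<open>D\<close>, the reflected
   kernel is an admissible test function for the weak derivative.\<close>
 have apd: "pd (a n) i x = conv (G i) (c n) x" if i: "i : Basis" and x: "cball x (1 / real (Suc n)) <= D" for n i x
 proof -
  have "- (LBINT y. u y * pd (c n) i (x - y)) = - (LBINT y. G i y * c n (x - y))"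
   using wd[OF i shift(1)[OF x]] shift(2)[OF x] by simp
  then show ?thesis unfolding sc2 by (simp add: conv_def)
 qed
 have cM: "cmod (conv v (c n) x) <= M" if "v : mbl" "!!x. cmod (v x) <= M" for v n x
  using conv_approx[OF that(1), of "ro n" "1 / real (Suc n)" x 0 M] ro that(2) by (simp add: c_def[abs_def])
 have aM: "cmod (a n x) <= M" for n x unfolding a_def by (rule cM[OF u(1,2)])
 have apdM: "norm (pd (a n) w x) <= real DIM('a) * M * norm w" if x: "cball x (1 / real (Suc n)) <= D" for n x w
 proof -
  have "norm (pd (a n) w x) <= (SB i. norm ((w *. i) *R pd (a n) i x))" by (subst pd_Basis_sum[OF aC UNIV_I]) (rule norm_sum)
  also have "... <= (\<Sum>i\<in>(Basis::'a set). norm w * M)" unfolding norm_scaleR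
  proof (intro sum_mono mult_mono)
   fix i :: 'a assume i: "i : Basis"
   show "\<bar>w *. i\<bar> <= norm w" by (rule Basis_le_norm[OF i])
   show "cmod (pd (a n) i x) <= M" unfolding apd[OF i x] by (rule cM[OF G(1,2)[OF i]])
  qed auto
  finally show ?thesis by (simp add: mult_ac)
 qed
 define L where "L = real DIM('a) * M"
 have L0: "L >= 0" unfolding L_def using M0 by simp
 have lip: "cmod (a n x - a n y) <= L * norm (x - y)" if r: "ball x0 r <= D" and n: "1 / real (Suc n) < r / 2" and xy: "x : ball x0 (r / 2)" "y : ball x0 (r / 2)" for x0 r n x y
 proof (rule differentiable_bound[of "ball x0 (r / 2)" "a n" "%x v. pd (a n) v x"])
  fix z assume z: "z : ball x0 (r / 2)"
  show "(a n has_derivative (%v. pd (a n) v z)) (at z within ball x0 (r / 2))"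
   by (rule has_derivative_at_withinI[OF C1_on_has_derivative[OF aC UNIV_I]])
  have "cball z (1 / real (Suc n)) <= ball x0 r"
  proof
   fix y assume "y : cball z (1 / real (Suc n))"
   then show "y : ball x0 r" using z n dist_triangle[of x0 y z] unfolding mem_ball mem_cball by linarith
  qed
  then show "onorm (%v. pd (a n) v z) <= L" unfolding L_def using apdM r M0 by (intro onorm_bound) auto
 qed (use xy in auto)
 \<comment> \<open>By Fubini and evenness of the kernel the mollification moves to ph, which it
   approximates uniformly.\<close>
 have weak: "(%n. LBINT x. a n x * ph x) \<longlonglongrightarrow> (LBINT x. u x * ph x)" if p: "C1c D ph" for ph
 proof -
  obtain B where B: "B >= 0" "!!x. cmod (ph x) <= B" using C1c_bounded[OF p] by metis
  obtain l where l: "l >= 0" "!!x y. cmod (ph x - ph y) <= l * norm (x - y)" using C1c_Lipschitz[OF p] by metis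
  have pm: "ph : mbl" by (rule C1c_mbl[OF p])
  note [measurable] = u(1) pm C1c_mbl[OF cC]
  have e: "(LBINT x. a n x * ph x) = (LBINT y. u y * conv ph (c n) y)" for n
  proof -
   obtain C where C: "C >= 0" "!!x. cmod (c n x) <= C" using C1c_bounded[OF cC[of n]] by metis
   have "integrable (lborel \<Otimes>\<^sub>M lborel) (case_prod (%x y. u y * c n (x - y) * ph x))"
   proof (rule bintgl_bound[of _ "%z. (M * C * B) *R indicator (D \<times> D) z :: complex"])
    have "emeasure (lborel :: ('a \<times> 'a) measure) (D \<times> D) < \<infinity>" using D(2) by (intro emeasure_bounded_finite bounded_Times)
    then show "integrable (lborel \<Otimes>\<^sub>M lborel) (%z. (M * C * B) *R indicator (D \<times> D) z :: complex)"
     using D(1) unfolding lborel_prod by (intro integrable_scaleR_right integrable_complex_indicator) (auto simp: open_Times borel_open)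
    show "case_prod (%x y. u y * c n (x - y) * ph x) : borel_measurable (lborel \<Otimes>\<^sub>M lborel)" by measurable
    show "AE z in lborel \<Otimes>\<^sub>M lborel. cmod (case z of (x, y) => u y * c n (x - y) * ph x) <= cmod ((M * C * B) *R indicator (D \<times> D) z :: complex)"
    proof (intro AE_I2)
     fix z :: "'a \<times> 'a"
     obtain x y where z: "z = (x, y)" by (cases z)
     have "cmod (u y * c n (x - y) * ph x) <= M * C * B"
      unfolding norm_mult using u(2) C B M0 by (intro mult_mono) auto
     then show "cmod (case z of (x, y) => u y * c n (x - y) * ph x) <= cmod ((M * C * B) *R indicator (D \<times> D) z :: complex)"
      using u(3)[of y] C1c_off[OF p, of x] M0 C(1) B(1) by (cases "x : D & y : D") (auto simp: z)
    qed
   qed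
   from lborel_pair.Fubini_integral[OF this]
   have A: "(LBINT y. LBINT x. u y * c n (x - y) * ph x) = (LBINT x. LBINT y. u y * c n (x - y) * ph x)" .
   have B: "(LBINT y. u y * c n (x - y) * ph x) = a n x * ph x" for x unfolding a_def conv_def by simp
   have C: "(LBINT x. u y * c n (x - y) * ph x) = u y * conv ph (c n) y" for y
   proof -
    have "c n (x - y) = c n (y - x)" for x using ro(6)[of n "x - y"] by (simp add: c_def)
    then have "(%x. u y * c n (x - y) * ph x) = (%x. u y * (ph x * c n (y - x)))" by (simp add: mult_ac)
    then show ?thesis unfolding conv_def by simp
   qed
   show ?thesis using A unfolding B C by (rule sym)
  qed
  have appr: "cmod (conv ph (c n) y - ph y) <= l * (1 / real (Suc n))" for n y
   unfolding c_def
  proof (rule conv_approx[OF pm ro(2,3,4,5)])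
   fix z :: 'a assume "norm z <= 1 / real (Suc n)"
   then show "cmod (ph (y - z) - ph y) <= l * (1 / real (Suc n))" using l(2)[of "y - z" y] mult_left_mono[OF _ l(1)] by fastforce
  qed
  have cm: "conv ph (c n) : mbl" for n
   using C1_on_cont[OF smooth_C1_on[OF smooth_conv(1)[OF C1c_int(1)[OF p] cs compact_cball coff]]] by (rule mbl_cont)
  have cb: "cmod (conv ph (c n) y) <= B" for n y
   using conv_approx[OF pm, of "ro n" "1 / real (Suc n)" y 0 B] ro B(2) by (simp add: c_def[abs_def])
  have "(%n. LBINT y. u y * conv ph (c n) y) \<longlonglongrightarrow> (LBINT x. u x * ph x)"
  proof (rule integral_dominated_convergence[where w = "%x. B * cmod (u x)"])
   show "intgl (%x. B * cmod (u x))" using ui by auto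
   show "AEL x. (%n. u x * conv ph (c n) x) \<longlonglongrightarrow> u x * ph x"
   proof (intro AE_I2 tendsto_mult tendsto_const)
    fix x
    have "null (%n. conv ph (c n) x - ph x)"
     by (rule Lim_null_comparison[OF always_eventually[OF allI[OF appr]]])
       (use tendsto_mult_right_zero[OF LIMSEQ_Suc[OF lim_1_over_n], of l] in simp)
    then show "(%n. conv ph (c n) x) \<longlonglongrightarrow> ph x" by (simp add: LIM_zero_iff)
   qed
   show "AEL x. norm (u x * conv ph (c n) x) <= B * cmod (u x)" for n
   proof (intro AE_I2)
    fix x show "norm (u x * conv ph (c n) x) <= B * cmod (u x)" unfolding norm_mult using mult_left_mono[OF cb norm_ge_zero] by (simp add: mult.commute)
   qed
  qed (use cm u pm in \<open>auto intro!: borel_measurable_times\<close>)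
  then show ?thesis unfolding e .
 qed
 have ball: "EX r>0. ball x r <= D" if "x : D" for x using D(1) that open_contains_ball by blast
 have small: "EV n. 1 / real (Suc n) < r" if "r > 0" for r using order_tendstoD(2)[OF LIMSEQ_Suc[OF lim_1_over_n] that] .
 \<comment> \<open>For a fixed small scale 1 / (k + 1), the Lipschitz bound keeps
   \<open>a n x\<close> close to the average of \<open>a n\<close> against the k-th kernel. By weak
   convergence these averages tend to \<open>a k x\<close> as n grows, so eventually all
   \<open>a n x\<close> are close to \<open>a k x\<close>.\<close>
 have conv: "convergent (%n. a n x)" if x: "x : D" for x
 proof (rule Cauchy_convergent, rule CauchyI)
  fix e :: real assume e: "e > 0"
  obtain r where r: "r > 0" "ball x r <= D" using ball[OF x] by blast
  have "EV k. 1 / real (Suc k) < r / 2 & 1 / real (Suc k) < e / (4 * (L + 1))"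
   using e L0 r by (intro eventually_conj small) auto
  then obtain k where k: "1 / real (Suc k) < r / 2" "1 / real (Suc k) < e / (4 * (L + 1))" by (auto dest: eventually_happens)
  have Lk: "L * (1 / real (Suc k)) <= e / 4"
  proof -
   have "L * (1 / real (Suc k)) <= (L + 1) * (1 / real (Suc k))" by (intro mult_right_mono) auto
   also have "... <= (L + 1) * (e / (4 * (L + 1)))" using k(2) L0 by (intro mult_left_mono) auto
   also have "... = e / 4" using L0 by (simp add: field_simps)
   finally show ?thesis .
  qed
  have sub: "cball x (1 / real (Suc k)) <= D"
  proof
   fix y assume "y : cball x (1 / real (Suc k))"
   then have "y : ball x r" using k(1) r(1) unfolding mem_ball mem_cball by linarith
   then show "y : D" using r(2) by blast
  qed
  have w: "(%n. conv (a n) (c k) x) \<longlonglongrightarrow> a k x" using weak[OF shift(1)[OF sub]] unfolding conv_def[of _ "c k"] a_def[of] by (simp add: a_def conv_def)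
  have "EV n. dist (conv (a n) (c k) x) (a k x) < e / 4" using tendstoD[OF w, of "e / 4"] e by simp
  moreover have "EV n. 1 / real (Suc n) < r / 2" by (rule small[OF half_gt_zero[OF r(1)]])
  ultimately have "EV n. cmod (a n x - a k x) < e / 2"
  proof eventually_elim
   fix n assume n: "dist (conv (a n) (c k) x) (a k x) < e / 4" "1 / real (Suc n) < r / 2"
   have am: "a n : mbl" using C1_on_cont[OF aC] by (rule mbl_cont)
   have "cmod (conv (a n) (c k) x - a n x) <= L * (1 / real (Suc k))" unfolding c_def
   proof (rule conv_approx[OF am ro(2,3,4,5)])
    fix y :: 'a assume y: "norm y <= 1 / real (Suc k)"
    have "cmod (a n (x - y) - a n x) <= L * norm (x - y - x)" using y k(1) r(1) by (intro lip[OF r(2) n(2)]) (auto simp: dist_norm)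
    also have "... <= L * (1 / real (Suc k))" using y L0 by (intro mult_left_mono) auto
    finally show "cmod (a n (x - y) - a n x) <= L * (1 / real (Suc k))" .
   qed
   moreover have "cmod (a n x - a k x) <= cmod (conv (a n) (c k) x - a k x) + cmod (conv (a n) (c k) x - a n x)"
    using norm_triangle_ineq4[of "conv (a n) (c k) x - a k x" "conv (a n) (c k) x - a n x"] by simp
   ultimately show "cmod (a n x - a k x) < e / 2" using n(1)[unfolded dist_norm] Lk by linarith
  qed
  then obtain N where N: "!!n. n >= N ==> cmod (a n x - a k x) < e / 2" unfolding eventually_sequentially by blast
  show "EX N. ALL m>=N. ALL n>=N. norm (a m x - a n x) < e"
  proof (intro exI[of _ N] allI impI)
   fix m n assume "m >= N" "n >= N"
   from N[OF this(1)] N[OF this(2)] show "norm (a m x - a n x) < e"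
    using norm_triangle_ineq4[of "a m x - a k x" "a n x - a k x"] by simp
  qed
 qed
 define v where "v = (%x. if x : D then lim (%n. a n x) else 0)"
 have av: "(%n. a n x) \<longlonglongrightarrow> v x" if "x : D" for x
  using conv[OF that] that unfolding v_def by (simp add: convergent_LIMSEQ_iff)
 have vM: "cmod (v x) <= M" if "x : D" for x
  by (rule Lim_norm_ubound[OF _ av[OF that]]) (use aM in auto)
 have vc: "continuous_on D v"
 proof (rule continuous_at_imp_continuous_on, intro ballI)
  fix x assume x: "x : D"
  obtain r where r: "r > 0" "ball x r <= D" using ball[OF x] by blast
  have le: "cmod (v y - v z) <= L * norm (y - z)" if yz: "y : ball x (r / 2)" "z : ball x (r / 2)" for y z
  proof (rule Lim_norm_ubound[OF sequentially_bot])
   have "y : D" "z : D" using yz r by auto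
   then show "(%n. a n y - a n z) \<longlonglongrightarrow> v y - v z" by (intro tendsto_diff av)
   show "EV n. cmod (a n y - a n z) <= L * norm (y - z)"
    using small[of "r / 2"] r(1) by (auto elim!: eventually_mono intro: lip[OF r(2) _ yz])
  qed
  have "continuous_on (ball x (r / 2)) v"
   by (rule lipschitz_on_continuous_on[of L]) (use le L0 in \<open>auto intro!: lipschitz_onI simp: dist_norm\<close>)
  then show "isCont v x" using r(1) by (simp add: continuous_on_eq_continuous_at)
 qed
 have vm: "v : lmbl"
 proof (rule borel_measurable_LIMSEQ_metric[of "%n x. indicator D x * a n x"])
  have "a n : mbl" for n using C1_on_cont[OF aC] by (rule mbl_cont)
  then show "(%x. indicator D x * a n x) : lmbl" for n using D(1) by (auto intro!: borel_measurable_times borel_measurable_indicator)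
  show "(%n. indicator D x * a n x) \<longlonglongrightarrow> v x" for x using av[of x] by (cases "x : D") (auto simp: v_def)
 qed
 have vs: "sqi v" by (rule sqi_bounded[OF D vm _ vM M0]) (simp add: v_def)
 have "AEL x. x : D --> u x - v x = 0"
 proof (rule fundamental_lemma[OF D(1) sqi_diff[OF us vs]])
  fix ph assume p: "C1c D ph"
  have "(%n. LBINT x. a n x * ph x) \<longlonglongrightarrow> (LBINT x. v x * ph x)"
  proof (rule integral_dominated_convergence[where w = "%x. M * cmod (ph x)"])
   show "intgl (%x. M * cmod (ph x))" using C1c_int(1)[OF p] by auto
   have "a n : mbl" for n using C1_on_cont[OF aC] by (rule mbl_cont)
   then show "(%x. a n x * ph x) : lmbl" for n using C1c_mbl[OF p] by auto
   show "(%x. v x * ph x) : lmbl" using vm C1c_mbl[OF p] by auto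
   show "AEL x. (%n. a n x * ph x) \<longlonglongrightarrow> v x * ph x"
   proof (intro AE_I2)
    fix x show "(%n. a n x * ph x) \<longlonglongrightarrow> v x * ph x"
     using C1c_off[OF p, of x] by (cases "x : D") (auto intro!: tendsto_mult av)
   qed
   show "AEL x. norm (a n x * ph x) <= M * cmod (ph x)" for n
    unfolding norm_mult by (intro AE_I2 mult_right_mono aM) simp
  qed
  then have "(LBINT x. v x * ph x) = (LBINT x. u x * ph x)" using LIMSEQ_unique weak[OF p] by blast
  moreover have "intgl (%x. u x * ph x)" "intgl (%x. v x * ph x)" by (intro sqi_mult us vs C1c_int[OF p])+
  ultimately show "(LBINT x. (u x - v x) * ph x) = 0" by (simp add: left_diff_distrib)
 qed
 then have ae: "AEL x. x : D --> u x = v x" by simp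
 \<comment> \<open>When \<open>G\<close> is continuous the gradients of \<open>a n\<close> converge
   locally uniformly to it, so differentiation passes to the limit.\<close>
 have der: "(v has_derivative (%h. SB i. (h *. i) *R G i x)) (at x)"
  if Gc: "!!i. i : Basis ==> continuous_on D (G i)" and x: "x : D" for x
 proof -
  obtain r0 where r0: "r0 > 0" "ball x r0 <= D" using ball[OF x] by blast
  define r where "r = r0 / 2"
  have r: "r > 0" "cball x r <= D" using r0 by (auto simp: r_def)
  define S where "S = ball x (r / 2)"
  have conv: "convex S" unfolding S_def by simp
  have d1: "(a n has_derivative (%h. pd (a n) h y)) (at y within S)" for n y
   by (rule has_derivative_at_withinI[OF C1_on_has_derivative[OF aC UNIV_I]])
  have d2: "EV n. ALL y:S. ALL h. norm (pd (a n) h y - (SB i. (h *. i) *R G i y)) <= e * norm h" if e: "e > 0" for e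
  proof -
   define e' where "e' = e / real DIM('a)"
   have e': "e' > 0" using e by (simp add: e'_def)
   have "EV n. ALL y:S. cmod (conv (G i) (c n) y - G i y) <= e'" if i: "i : Basis" for i
   proof -
    have "uniformly_continuous_on (cball x r) (G i)" using compact_uniformly_continuous[OF cont_sub[OF Gc[OF i] r(2)] compact_cball] .
    then obtain d where d: "d > 0" "!!y z. y : cball x r ==> z : cball x r ==> dist z y < d ==> dist (G i z) (G i y) < e'"
     using e' unfolding uniformly_continuous_on_def by metis
    have "EV n. 1 / real (Suc n) < d & 1 / real (Suc n) < r / 2" using d(1) r(1) by (intro eventually_conj small) auto
    then show ?thesis
    proof eventually_elim
     fix n assume n: "1 / real (Suc n) < d & 1 / real (Suc n) < r / 2"
     show "ALL y:S. cmod (conv (G i) (c n) y - G i y) <= e'"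
     proof
      fix y assume y: "y : S"
      show "cmod (conv (G i) (c n) y - G i y) <= e'" unfolding c_def
      proof (rule conv_approx[OF G(1)[OF i] ro(2,3,4,5)])
       fix z :: 'a assume z: "norm z <= 1 / real (Suc n)"
       have dz: "dist (y - z) y < d" "dist (y - z) y < r / 2" using z n by (auto simp: dist_norm)
       have "y : cball x r" "y - z : cball x r"
        using y r(1) dz(2) dist_triangle[of x "y - z" y] unfolding S_def mem_ball mem_cball by (auto simp: dist_commute)
       from d(2)[OF this dz(1)] show "cmod (G i (y - z) - G i y) <= e'" by (simp add: dist_norm)
      qed
     qed
    qed
   qed
   then have "EV n. ALL i:Basis. ALL y:S. cmod (conv (G i) (c n) y - G i y) <= e'" by (intro eventually_ball_finite) auto
   moreover have "EV n. 1 / real (Suc n) < r / 2" by (rule small[OF half_gt_zero[OF r(1)]])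
   ultimately show ?thesis
   proof eventually_elim
    fix n assume n: "ALL i:Basis. ALL y:S. cmod (conv (G i) (c n) y - G i y) <= e'" "1 / real (Suc n) < r / 2"
    show "ALL y:S. ALL h. norm (pd (a n) h y - (SB i. (h *. i) *R G i y)) <= e * norm h"
    proof (intro ballI allI)
     fix y h assume y: "y : S"
     have sub: "cball y (1 / real (Suc n)) <= D"
     proof
      fix z assume "z : cball y (1 / real (Suc n))"
      then have "z : cball x r" using y n(2) dist_triangle[of x z y] unfolding S_def mem_ball mem_cball by linarith
      then show "z : D" using r(2) by blast
     qed
     have "pd (a n) h y - (SB i. (h *. i) *R G i y) = (SB i. (h *. i) *R (conv (G i) (c n) y - G i y))"
      by (subst pd_Basis_sum[OF aC UNIV_I]) (simp add: sum_subtractf[symmetric] scaleR_diff_right apd[OF _ sub])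
     also have "norm ... <= (\<Sum>i\<in>(Basis::'a set). norm h * e')"
     proof (rule sum_norm_le)
      fix i :: 'a assume i: "i : Basis"
      show "norm ((h *. i) *R (conv (G i) (c n) y - G i y)) <= norm h * e'"
       unfolding norm_scaleR using n(1) i y Basis_le_norm[OF i, of h] by (intro mult_mono) auto
     qed
     also have "... = e * norm h" by (simp add: e'_def)
     finally show "norm (pd (a n) h y - (SB i. (h *. i) *R G i y)) <= e * norm h" .
    qed
   qed
  qed
  have xS: "x : S" using r(1) by (simp add: S_def)
  have "EX g. ALL y:S. (%n. a n y) \<longlonglongrightarrow> g y & (g has_derivative (%h. SB i. (h *. i) *R G i y)) (at y within S)"
   by (rule has_derivative_sequence[OF conv d1 d2 xS av[OF x]])
  then obtain g where g: "!!y. y : S ==> (%n. a n y) \<longlonglongrightarrow> g y" "!!y. y : S ==> (g has_derivative (%h. SB i. (h *. i) *R G i y)) (at y within S)" by blast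
  have So: "open S" by (simp add: S_def)
  have "S <= D" using r unfolding S_def by (auto simp: subset_iff)
  then have gv: "g y = v y" if "y : S" for y using LIMSEQ_unique[OF g(1)[OF that] av] that by blast
  have "(g has_derivative (%h. SB i. (h *. i) *R G i x)) (at x)" using g(2)[OF xS] at_within_open[OF xS So] by simp
  then show ?thesis by (rule has_derivative_transform_within_open[OF _ So xS]) (rule gv)
 qed
 show ?thesis
 proof (rule that[OF vc vM ae])
  assume Gc: "!!i. i : Basis ==> continuous_on D (G i)"
  have co: "continuous_on D (%x. SB i. (h *. i) *R G i x)" for h by (intro continuous_intros Gc)
  show "C1_on D v" by (rule C1_onI(1)[OF der[OF Gc] co])
  fix i x :: 'a assume i: "i : Basis" and x: "x : D"
  have "pd v i x = (SB k. (i *. k) *R G k x)" by (rule C1_onI(2)[OF der[OF Gc] co x])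
  also have "... = (SB k. if k = i then G i x else 0)" by (rule sum.cong) (auto simp: inner_Basis i)
  finally show "pd v i x = G i x" using i by simp
 qed
qed

text \<open>Values beyond the essential bound are replaced by 0, so that the bound holds at every
  point.\<close>

lemma Linf_rep:
 assumes D: "open D" "bounded D" and u: "Linf D u"
 shows "EX u0 M. rep D u u0 & (ALL x. cmod (u0 x) <= M) & 0 <= M"
proof -
 obtain M where M: "u : borel_measurable (lebesgue_on D)" "AE x in lebesgue_on D. cmod (u x) <= M" using u unfolding Linf_def by blast
 obtain u0 where u0: "rep D u u0" using rep_exists[OF D(1) M(1)] by blast
 define M' where "M' = max M 0"
 define u1 where "u1 = (%x. if cmod (u0 x) <= M' then u0 x else 0)"
 have [measurable]: "u0 : mbl" using rep_D(2)[OF u0] .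
 have "AEL x. x : D --> cmod (u x) <= M" using M(2) by (simp add: AE_lebesgue_on_lborel[OF D(1)])
 then have "AEL x. x : D --> u0 x = u1 x" using rep_D(4)[OF u0] by eventually_elim (auto simp: u1_def M'_def)
 then have "rep D u u1" by (intro rep_AE[OF u0]) (auto simp: u1_def rep_D(3)[OF u0])
 moreover have "ALL x. cmod (u1 x) <= M'" by (simp add: u1_def M'_def)
 ultimately show ?thesis by (intro exI[of _ u1] exI[of _ M']) (simp add: M'_def)
qed

text \<open>The first derivatives of \<alpha> have bounded weak gradients, so
  \<open>bounded_weak_gradient_rep\<close> makes them continuous; a second use, for \<alpha> itself
  with these continuous derivatives, makes it C^1. Of the second derivatives the pure ones are kept,
  since their sum is the divergence of the gradient.\<close>

lemma W2inf_rep: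
 fixes D :: "'a::euclidean_space set"
 assumes D: "open D" "bounded D" and \<alpha>: "W2inf D \<alpha>"
 obtains s A h M where "C1_on D s" "!!i x. i : Basis ==> x : D ==> pd s i x = A i x"
  "!!i. i : Basis ==> A i : mbl" "!!i x. i : Basis ==> cmod (A i x) <= M" "!!i x. i : Basis ==> x ~: D ==> A i x = 0"
  "!!i. i : Basis ==> h i : mbl" "!!i x. i : Basis ==> cmod (h i x) <= M" "!!i x. i : Basis ==> x ~: D ==> h i x = 0"
  "!!i ph. i : Basis ==> C1c D ph ==> (LBINT x. A i x * pd ph i x) = - (LBINT x. h i x * ph x)"
  "rep D (%x. cor (\<alpha> x)) (%x. indicator D x * s x)" "0 <= M"
proof -
 let ?a = "%x. cor (\<alpha> x)"
 obtain a0 Ma where a0: "rep D ?a a0" "!!x. cmod (a0 x) <= Ma" "0 <= Ma" using Linf_rep[OF D] \<alpha> unfolding W2inf_def by blast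
 have "ALL i. EX g h. i : Basis --> Linf D g & weak_deriv D ?a i g & (ALL j:Basis. Linf D (h j) & weak_deriv D g j (h j))"
 proof
  fix i
  show "EX g h. i : Basis --> Linf D g & weak_deriv D ?a i g & (ALL j:Basis. Linf D (h j) & weak_deriv D g j (h j))"
  proof (cases "i : Basis")
   case True
   then obtain g where g: "Linf D g" "weak_deriv D ?a i g" "ALL j:Basis. EX h. Linf D h & weak_deriv D g j h" using \<alpha> unfolding W2inf_def by blast
   from bchoice[OF g(3)] show ?thesis using g by blast
  qed auto
 qed
 from choice[OF this] obtain g where "ALL i. EX h. i : Basis --> Linf D (g i) & weak_deriv D ?a i (g i) & (ALL j:Basis. Linf D (h j) & weak_deriv D (g i) j (h j))" by blast
 from choice[OF this] obtain k where gk: "!!i. i : Basis ==> Linf D (g i)" "!!i. i : Basis ==> weak_deriv D ?a i (g i)"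
  "!!i j. i : Basis ==> j : Basis ==> Linf D (k i j)" "!!i j. i : Basis ==> j : Basis ==> weak_deriv D (g i) j (k i j)" by blast
 have "ALL i. EX g0 Mg. i : Basis --> rep D (g i) g0 & (ALL x. cmod (g0 x) <= Mg) & 0 <= Mg" using Linf_rep[OF D gk(1)] by blast
 from choice[OF this] obtain g0 where "ALL i. EX Mg. i : Basis --> rep D (g i) (g0 i) & (ALL x. cmod (g0 i x) <= Mg) & 0 <= Mg" by blast
 from choice[OF this] obtain Mg where g0: "!!i. i : Basis ==> rep D (g i) (g0 i)" "!!i x. i : Basis ==> cmod (g0 i x) <= Mg i" "!!i. i : Basis ==> 0 <= Mg i" by blast
 have "ALL p. EX k0 Mk. fst p : Basis & snd p : Basis --> rep D (k (fst p) (snd p)) k0 & (ALL x. cmod (k0 x) <= Mk) & 0 <= Mk" using Linf_rep[OF D gk(3)] by blast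
 from choice[OF this] obtain k0 where "ALL p. EX Mk. fst p : Basis & snd p : Basis --> rep D (k (fst p) (snd p)) (k0 p) & (ALL x. cmod (k0 p x) <= Mk) & 0 <= Mk" by blast
 from choice[OF this] obtain Mk where k0': "ALL p. fst p : Basis & snd p : Basis --> rep D (k (fst p) (snd p)) (k0 p) & (ALL x. cmod (k0 p x) <= Mk p) & 0 <= Mk p" by blast
 have k0: "rep D (k i j) (k0 (i, j))" "cmod (k0 (i, j) x) <= Mk (i, j)" "0 <= Mk (i, j)" if "i : Basis" "j : Basis" for i j x
  using k0'[rule_format, of "(i, j)"] that by auto
 \<comment> \<open>The sum of all bounds, so that one constant serves for \<alpha> and its
   derivatives up to order two.\<close>
 define M where "M = Ma + (SB i. Mg i) + (SB i. SB j. Mk (i, j))"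
 have sg: "0 <= (SB i. Mg i)" "Mg i <= (SB i. Mg i)" if "i : Basis" for i using g0(3) that by (auto intro!: sum_nonneg member_le_sum)
 have sg0: "0 <= (SB i. Mg i)" using g0(3) by (intro sum_nonneg)
 have sk0: "0 <= (SB i. SB j. Mk (i, j))" using k0(3) by (intro sum_nonneg)
 have sk: "Mk (i, j) <= (SB i. SB j. Mk (i, j))" if ij: "i : Basis" "j : Basis" for i j
 proof -
  have "Mk (i, j) <= (SB j. Mk (i, j))" using ij k0(3)[OF ij(1)] by (intro member_le_sum) auto
  also have "... <= (SB i. SB j. Mk (i, j))" using ij(1) k0(3) by (intro member_le_sum[of i Basis "%i. SB j. Mk (i, j)"]) (auto intro!: sum_nonneg)
  finally show ?thesis .
 qed
 have M0: "0 <= M" using a0(3) sg0 sk0 by (simp add: M_def)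
 have aM: "cmod (a0 x) <= M" for x using a0(2)[of x] sg0 sk0 by (simp add: M_def)
 have gM: "cmod (g0 i x) <= M" if "i : Basis" for i x using g0(2)[OF that, of x] sg(2)[OF that] a0(3) sk0 by (simp add: M_def)
 have kM: "cmod (k0 (i, j) x) <= M" if "i : Basis" "j : Basis" for i j x using k0(2)[OF that, of x] sk[OF that] a0(3) sg0 by (simp add: M_def)
 have ss: "sqi a0" "!!i. i : Basis ==> sqi (g0 i)" "!!i j. i : Basis ==> j : Basis ==> sqi (k0 (i, j))"
  using sqi_bounded[OF D _ _ _ M0] aM gM kM rep_D(2,3)[OF a0(1)] rep_D(2,3)[OF g0(1)] rep_D(2,3)[OF k0(1)] by simp_all
 have wda: "(LBINT x. a0 x * pd ph i x) = - (LBINT x. g0 i x * ph x)" if "i : Basis" "C1c D ph" for i ph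
  using iffD1[OF weak_deriv_rep[OF D(1) a0(1) g0(1)[OF that(1)] ss(1) ss(2)[OF that(1)] that(1)] gk(2)[OF that(1)]] that(2) by blast
 have wdg: "(LBINT x. g0 i x * pd ph j x) = - (LBINT x. k0 (i, j) x * ph x)" if "i : Basis" "j : Basis" "C1c D ph" for i j ph
  using iffD1[OF weak_deriv_rep[OF D(1) g0(1)[OF that(1)] k0(1)[OF that(1,2)] ss(2)[OF that(1)] ss(3)[OF that(1,2)] that(2)] gk(4)[OF that(1,2)]] that(3) by blast
 have "EX v. i : Basis --> continuous_on D v & (ALL x:D. cmod (v x) <= M) & (AEL x. x : D --> g0 i x = v x)" for i
 proof (cases "i : Basis")
  case True
  show ?thesis
  proof (rule bounded_weak_gradient_rep[OF D rep_D(2)[OF g0(1)[OF True]] gM[OF True] rep_D(3)[OF g0(1)[OF True]] rep_D(2)[OF k0(1)[OF True]] kM[OF True] rep_D(3)[OF k0(1)[OF True]] wdg[OF True]])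
   fix v assume "continuous_on D v" "!!x. x : D ==> cmod (v x) <= M" "AEL x. x : D --> g0 i x = v x"
   then show ?thesis by (intro exI[of _ v]) auto
  qed
 qed auto
 then have "ALL i. EX v. i : Basis --> continuous_on D v & (ALL x:D. cmod (v x) <= M) & (AEL x. x : D --> g0 i x = v x)" by blast
 from choice[OF this] obtain v where v: "!!i. i : Basis ==> continuous_on D (v i)" "!!i x. i : Basis ==> x : D ==> cmod (v i x) <= M"
  "!!i. i : Basis ==> AEL x. x : D --> g0 i x = v i x" by blast
 define A where "A = (%i x. indicator D x * v i x)"
 have Db: "D : sets borel" using D(1) by simp
 have ind: "(%x. indicator D x * w x) : mbl" if "continuous_on D w" for w :: "'a => complex"
  using borel_measurable_continuous_on_indicator[OF Db that] by (simp add: indicator_scaleR_eq_if indicator_times_eq_if)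
 have Am: "A i : mbl" if "i : Basis" for i unfolding A_def by (rule ind[OF v(1)[OF that]])
 have AM: "cmod (A i x) <= M" if "i : Basis" for i x using v(2)[OF that, of x] M0 by (cases "x : D") (auto simp: A_def)
 have Ao: "A i x = 0" if "x ~: D" for i x using that by (simp add: A_def)
 have gA: "AEL x. g0 i x = A i x" if "i : Basis" for i using v(3)[OF that]
 proof eventually_elim
  fix x assume "x : D --> g0 i x = v i x" then show "g0 i x = A i x" using rep_D(3)[OF g0(1)[OF that], of x] by (cases "x : D") (auto simp: A_def)
 qed
 have Aint: "(LBINT x. g0 i x * ph x) = (LBINT x. A i x * ph x)" if "i : Basis" "ph : mbl" for i ph
  by (rule integral_cong_AE) (use gA[OF that(1)] rep_D(2)[OF g0(1)[OF that(1)]] Am[OF that(1)] that(2) in \<open>auto intro!: borel_measurable_times\<close>)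
 have Ac: "continuous_on D (A i)" if "i : Basis" for i
  by (rule continuous_on_eq[OF v(1)[OF that]]) (simp add: A_def)
 have wdA: "(LBINT x. a0 x * pd ph i x) = - (LBINT x. A i x * ph x)" if "i : Basis" "C1c D ph" for i ph
  using wda[OF that] Aint[OF that(1) C1c_mbl[OF that(2)]] by simp
 show ?thesis
 proof (rule bounded_weak_gradient_rep[OF D rep_D(2)[OF a0(1)] aM rep_D(3)[OF a0(1)] Am AM Ao wdA])
  fix s assume s: "continuous_on D s" "!!x. x : D ==> cmod (s x) <= M" "AEL x. x : D --> a0 x = s x"
   "(!!i. i : Basis ==> continuous_on D (A i)) ==> C1_on D s"
   "!!i x. (!!i. i : Basis ==> continuous_on D (A i)) ==> i : Basis ==> x : D ==> pd s i x = A i x"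
  show ?thesis
  proof (rule that[of s A M "%i. k0 (i, i)"])
   show "C1_on D s" by (rule s(4)[OF Ac])
   show "pd s i x = A i x" if "i : Basis" "x : D" for i x by (rule s(5)[OF Ac that])
   show "(LBINT x. A i x * pd ph i x) = - (LBINT x. k0 (i, i) x * ph x)" if "i : Basis" "C1c D ph" for i ph
    using wdg[OF that(1,1,2)] Aint[OF that(1) C1c_pd_mbl[OF that(2)], of i] by simp
   show "rep D ?a (%x. indicator D x * s x)"
    by (rule rep_AE[OF a0(1) ind[OF s(1)]]) (use s(3) in auto)
   show "k0 (i, i) : mbl" "x ~: D ==> k0 (i, i) x = 0" if "i : Basis" for i x using rep_D(2,3)[OF k0(1)[OF that that]] by auto
  qed (use Am AM Ao kM M0 in auto)
 qed auto
qed

section \<open>Green's formula, Bessel's inequality and division by the coefficient\<close>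

lemma W_test_weak_deriv:
 assumes A: "sqi A" and h: "sqi h" and i: "i : Basis"
  and wd: "!!ph. C1c D ph ==> (LBINT x. A x * pd ph i x) = - (LBINT x. h x * ph x)" and v: "W D v V"
 shows "(LBINT x. A x * V i x) = - (LBINT x. h x * v x)"
proof -
 obtain psi where psi: "!!n. C1c D (psi n)" "null (%n. nrm (%x. psi n x - v x))"
  "!!i. (%n. nrm (%x. pd (psi n) i x - dirG V i x)) \<longlonglongrightarrow> 0" by (rule W_E[OF v]) (rule that; assumption)
 have 1: "(%n. LBINT x. A x * pd (psi n) i x) \<longlonglongrightarrow> (LBINT x. A x * dirG V i x)"
  by (rule tendsto_nrm_mult) (simp_all add: A C1c_int[OF psi(1)] W_sqi_dirG[OF v] psi(3))
 have 2: "(%n. LBINT x. h x * psi n x) \<longlonglongrightarrow> (LBINT x. h x * v x)"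
  by (rule tendsto_nrm_mult) (simp_all add: h C1c_int[OF psi(1)] WD(1)[OF v] psi(2))
 have "(LBINT x. A x * dirG V i x) = - (LBINT x. h x * v x)"
  using LIMSEQ_unique[OF 1[unfolded wd[OF psi(1)]] tendsto_minus[OF 2]] .
 then show ?thesis by (simp add: dirG_Basis[OF i])
qed

lemma wlap_cnj:
 assumes "wlap D G f" shows "wlap D (%i x. cnj (G i x)) (%x. cnj (f x))"
 unfolding wlap_def
proof (intro allI impI)
 fix ph assume p: "C1c D ph"
 have "(SB i. LBINT x. cnj (G i x) * pd ph i x) = cnj (SB i. LBINT x. G i x * pd (%x. cnj (ph x)) i x)"
  by (simp add: C1_cnj_pd[OF C1c_C1[OF p]] flip: bint_cnj)
 also have "... = cnj (- (LBINT x. f x * cnj (ph x)))" using assms C1c_cnj[OF p] by (simp add: wlap_def)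
 also have "... = - (LBINT x. cnj (f x) * ph x)" by (simp flip: bint_cnj)
 finally show "(SB i. LBINT x. cnj (G i x) * pd ph i x) = - (LBINT x. cnj (f x) * ph x)" .
qed

lemma wlap_Green:
 assumes u: "W D u U" "sqi f" "wlap D U f" and v: "W D v V" "sqi h" "wlap D V h"
 shows "(LBINT x. f x * cnj (v x)) = (LBINT x. u x * cnj (h x))"
proof -
 have 1: "(SB i. LBINT x. U i x * cnj (V i x)) = - (LBINT x. f x * cnj (v x))"
  by (rule wlap_W[OF WD(2)[OF u(1)] u(2,3) W_cnj[OF v(1)]])
 have 2: "(SB i. LBINT x. cnj (V i x) * U i x) = - (LBINT x. cnj (h x) * u x)"
  by (rule wlap_W[OF sqi_cnj[OF WD(2)[OF v(1)]] sqi_cnj[OF v(2)] wlap_cnj[OF v(3)] u(1)])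
 have "- (LBINT x. f x * cnj (v x)) = - (LBINT x. cnj (h x) * u x)" unfolding 1[symmetric] 2[symmetric] by (simp only: mult.commute)
 then show ?thesis by (simp add: mult.commute)
qed

text \<open>R n is what remains of r after n Fourier terms are subtracted; one more term lowers the
  squared norm by exactly |c n|^2.\<close>

lemma Bessel:
 assumes r: "sqi r" and e: "!!j::nat. sqi (e j)" and o: "!!j k. (LBINT x. e j x * cnj (e k x)) = (if j = k then 1 else 0)"
 shows "(\<Sum>j<n. (cmod (LBINT x. r x * cnj (e j x)))^2) <= (nrm r)^2"
proof -
 define c where "c = (%j. LBINT x. r x * cnj (e j x))"
 define R where "R = (%n x. r x - (\<Sum>j<n. c j * e j x))"
 have Rs: "sqi (R n)" for n unfolding R_def by (intro sqi_diff r sqi_sum sqi_cmult e)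
 have i: "intgl (%x. a x * cnj (b x))" if "sqi a" "sqi b" for a b by (intro sqi_mult sqi_cnj that)
 have Re: "(LBINT x. R n x * cnj (e n x)) = c n" for n
 proof -
  have "(LBINT x. R n x * cnj (e n x)) = (LBINT x. r x * cnj (e n x) - (\<Sum>j<n. c j * (e j x * cnj (e n x))))"
   by (simp add: R_def left_diff_distrib sum_distrib_right mult.assoc)
  also have "... = c n - (\<Sum>j<n. c j * (LBINT x. e j x * cnj (e n x)))" using i[OF r e] i[OF e e] by (simp add: c_def)
  also have "(\<Sum>j<n. c j * (LBINT x. e j x * cnj (e n x))) = 0" by (intro sum.neutral) (simp add: o)
  finally show ?thesis by simp
 qed
 have "(nrm (R n))^2 + (\<Sum>j<n. (cmod (c j))^2) = (nrm r)^2" for n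
 proof (induction n)
  case 0 show ?case by (simp add: R_def)
 next
  case (Suc n)
  have "cor ((nrm (R (Suc n)))^2) = (LBINT x. R (Suc n) x * cnj (R (Suc n) x))"
   unfolding nrm_sq mult_cnj_cmod_sq by (rule integral_complex_of_real[symmetric])
  also have "... = (LBINT x. (R n x * cnj (R n x) - cnj (c n) * (R n x * cnj (e n x))) - (c n * (e n x * cnj (R n x)) - c n * cnj (c n) * (e n x * cnj (e n x))))"
   by (rule bint_cong) (simp_all add: R_def algebra_simps)
  also have "... = ((LBINT x. R n x * cnj (R n x)) - cnj (c n) * (LBINT x. R n x * cnj (e n x))) - (c n * (LBINT x. e n x * cnj (R n x)) - c n * cnj (c n) * (LBINT x. e n x * cnj (e n x)))"
   using i[OF Rs Rs] i[OF Rs e] i[OF e Rs] i[OF e e] by simp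
  also have "(LBINT x. e n x * cnj (R n x)) = cnj (c n)"
   unfolding Re[symmetric] by (simp flip: bint_cnj add: mult.commute)
  also have "(LBINT x. R n x * cnj (R n x)) = cor ((nrm (R n))^2)"
   unfolding nrm_sq mult_cnj_cmod_sq by (rule integral_complex_of_real)
  finally have "cor ((nrm (R (Suc n)))^2) = cor ((nrm (R n))^2 - (cmod (c n))^2)"
   by (simp add: Re o mult_cnj_cmod_sq[symmetric] del: of_real_power)
  then have "(nrm (R (Suc n)))^2 = (nrm (R n))^2 - (cmod (c n))^2" by (rule of_real_eq_iff[THEN iffD1])
  then show ?case using Suc by simp
 qed
 from this[of n] have "(\<Sum>j<n. (cmod (c j))^2) <= (nrm r)^2" using zero_le_power2[of "nrm (R n)"] by linarith
 then show ?thesis by (simp add: c_def)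
qed

text \<open>The Laplacian of \<open>q / s\<close>: \<open>A\<close> is the gradient of \<open>s\<close> and only \<open>div A\<close> is needed weakly.\<close>
lemma wlap_divide:
 fixes D :: "'a::euclidean_space set"
 assumes D: "open D" "bounded D" and s: "C1_on D s" "!!i x. i : Basis ==> x : D ==> pd s i x = A i x"
  and A: "!!i. i : Basis ==> A i : mbl" "!!i x. i : Basis ==> cmod (A i x) <= M" "!!i x. i : Basis ==> x ~: D ==> A i x = 0"
  and h: "!!i. i : Basis ==> h i : mbl" "!!i x. i : Basis ==> cmod (h i x) <= M" "!!i x. i : Basis ==> x ~: D ==> h i x = 0"
  and wd: "!!i ph. i : Basis ==> C1c D ph ==> (LBINT x. A i x * pd ph i x) = - (LBINT x. h i x * ph x)"
  and m: "0 < m" "!!x. x : D ==> m <= cmod (s x)" and M: "0 <= M"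
 obtains C where "C >= 0" "!!q Q F. W D q Q ==> sqi F ==> wlap D Q F ==>
  EX R r. W D (%x. inverse (s x) * q x) R & sqi r & wlap D R r & nrm r <= C * (nrm F + nrm q + (SB i. nrm (Q i)))"
proof -
 define th where "th = (%x. inverse (s x))"
 have s0: "s x ~= 0" if "x : D" for x using m(2)[OF that] m(1) by auto
 note th' = C1_on_inverse[OF s(1) s0, folded th_def]
 have th: "C1_on D th" "!!i x. i : Basis ==> x : D ==> pd th i x = - (th x * A i x * th x)"
  using th'(1) th'(2) s(2) by (simp_all add: th_def)
 define t where "t = inverse m"
 have t: "0 <= t" "cmod (th x) <= t" if "x : D" for x using m(1) le_imp_inverse_le[OF m(2)[OF that] m(1)] by (simp_all add: t_def th_def norm_inverse)
 have t0: "0 <= t" using m(1) by (simp add: t_def)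
 define Th where "Th = (%x. indicator D x * th x)"
 have Thm: "Th : mbl" unfolding Th_def
  using borel_measurable_continuous_on_indicator[OF _ C1_on_cont[OF th(1)]] D(1) by (simp add: indicator_scaleR_eq_if indicator_times_eq_if)
 have Tht: "cmod (Th x) <= t" for x using t(2)[of x] t0 by (cases "x : D") (auto simp: Th_def)
 \<comment> \<open>With th = 1/s, grad th = - th^2 A and Delta th = - th^2 div A + 2 th^3 |A|^2.
   These are the resulting coefficients of \<open>Q i\<close> and q in the Laplacian of th q, with
   \<open>h i\<close> as the i-th term of div A.\<close>
 define c where "c = (%i x. - 2 * (A i x * (Th x * Th x)))"
 define d where "d = (%i x. - (h i x * (Th x * Th x)) + 2 * (A i x * A i x * (Th x * (Th x * Th x))))"
 define K where "K = t + 2 * (M * (t * t)) + (M * (t * t) + 2 * (M * M * (t * (t * t))))"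
 have cm: "c i : lmbl" "d i : lmbl" if "i : Basis" for i
  unfolding c_def d_def using A(1)[OF that] h(1)[OF that] Thm by (auto intro!: borel_measurable_times borel_measurable_add borel_measurable_uminus)
 have K: "t <= K" "0 <= K" "2 * (M * (t * t)) <= K" "M * (t * t) + 2 * (M * M * (t * (t * t))) <= K"
  unfolding K_def using t0 M by simp_all
 have cK: "cmod (c i x) <= K" if "i : Basis" for i x
 proof -
  have "cmod (c i x) <= 2 * (M * (t * t))" unfolding c_def norm_mult using A(2)[OF that] Tht t0 M by (auto intro!: mult_mono)
  then show ?thesis using K by linarith
 qed
 have dK: "cmod (d i x) <= K" if "i : Basis" for i x
 proof -
  have "cmod (d i x) <= cmod (h i x * (Th x * Th x)) + cmod (2 * (A i x * A i x * (Th x * (Th x * Th x))))" 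
   unfolding d_def using norm_triangle_ineq[of "- (h i x * (Th x * Th x))" "2 * (A i x * A i x * (Th x * (Th x * Th x)))"] unfolding norm_minus_cancel .
  moreover have "cmod (h i x * (Th x * Th x)) <= M * (t * t)" unfolding norm_mult using h(2)[OF that] Tht t0 M by (auto intro!: mult_mono)
  moreover have "cmod (2 * (A i x * A i x * (Th x * (Th x * Th x)))) <= 2 * (M * M * (t * (t * t)))"
   unfolding norm_mult using A(2)[OF that] Tht t0 M by (auto intro!: mult_mono mult_nonneg_nonneg)
  ultimately show ?thesis using K by linarith
 qed
 have As: "sqi (A i)" "sqi (h i)" if "i : Basis" for i
  using sqi_bounded[OF D, of "A i" M] sqi_bounded[OF D, of "h i" M] A h M that by auto
 have main: "EX R r. W D (%x. inverse (s x) * q x) R & sqi r & wlap D R r & nrm r <= (K * real DIM('a) + K) * (nrm F + nrm q + (SB i. nrm (Q i)))"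
  if q: "W D q Q" and F: "sqi F" and wl: "wlap D Q F" for q Q F
 proof -
  define r where "r = (%x. Th x * F x + (SB i. c i x * Q i x + d i x * q x))"
  have b1: "sqi (%x. Th x * F x)" "nrm (%x. Th x * F x) <= K * nrm F"
   using sqi_mult_bounded[OF F, of Th K] Thm order_trans[OF Tht K(1)] K(2) by auto
  have b2: "sqi (%x. c i x * Q i x)" "nrm (%x. c i x * Q i x) <= K * nrm (Q i)" if "i : Basis" for i
   using sqi_mult_bounded[OF WD(2)[OF q that] cm(1)[OF that], of K] cK[OF that] K(2) by auto
  have b3: "sqi (%x. d i x * q x)" "nrm (%x. d i x * q x) <= K * nrm q" if "i : Basis" for i
   using sqi_mult_bounded[OF WD(1)[OF q] cm(2)[OF that], of K] dK[OF that] K(2) by auto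
  have rs: "sqi r" unfolding r_def by (intro sqi_add b1 sqi_sum b2 b3)
  have rn: "nrm r <= (K * real DIM('a) + K) * (nrm F + nrm q + (SB i. nrm (Q i)))"
  proof -
   have "nrm r <= nrm (%x. Th x * F x) + nrm (%x. SB i. c i x * Q i x + d i x * q x)"
    unfolding r_def by (intro nrm_triangle b1 sqi_sum sqi_add b2 b3)
   also have "... <= K * nrm F + (SB i. K * nrm (Q i) + K * nrm q)"
   proof (intro add_mono b1(2) order_trans[OF nrm_sum_le] sum_mono)
    fix i :: 'a assume i: "i : Basis"
    show "sqi (%x. c i x * Q i x + d i x * q x)" by (intro sqi_add b2 b3 i)
    show "nrm (%x. c i x * Q i x + d i x * q x) <= K * nrm (Q i) + K * nrm q"
     using nrm_triangle[OF b2(1)[OF i] b3(1)[OF i]] b2(2)[OF i] b3(2)[OF i] by linarith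
   qed
   also have "... = K * nrm F + K * (SB i. nrm (Q i)) + K * real DIM('a) * nrm q"
    by (simp add: sum.distrib sum_distrib_left)
   also have "... <= (K * real DIM('a) + K) * (nrm F + nrm q + (SB i. nrm (Q i)))"
   proof -
    have al: "K * x + K * z + k * y <= (k + K) * (x + y + z)" if "0 <= x" "0 <= y" "0 <= z" "0 <= k" for x y z k :: real
    proof -
     have "(k + K) * (x + y + z) = K * x + K * z + k * y + (k * x + k * z + K * y)" by (simp add: algebra_simps)
     moreover have "0 <= k * x" "0 <= k * z" "0 <= K * y" using that K(2) by simp_all
     ultimately show ?thesis by linarith
    qed
    show ?thesis by (rule al) (auto intro!: sum_nonneg mult_nonneg_nonneg K(2))
   qed
   finally show ?thesis .
  qed
  define R where "R = (%i x. th x * Q i x + pd th i x * q x)"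
  have pt: "cmod (pd th i x) <= M * (t * t)" if "i : Basis" "x : D" for i x
  proof -
   have "cmod (pd th i x) = cmod (A i x) * (cmod (th x) * cmod (th x))" unfolding th(2)[OF that] by (simp add: norm_mult)
   also have "... <= M * (t * t)" using A(2)[OF that(1)] t(2)[OF that(2)] t0 M by (intro mult_mono) auto
   finally show ?thesis .
  qed
  have WR: "W D (%x. th x * q x) R" unfolding R_def
  proof (rule W_mult[OF D(1) th(1) q, where C = UNIV and B = "t + M * (t * t)"])
   have Mt: "0 <= M * (t * t)" using M t0 by simp
   show "cmod (th x) <= t + M * (t * t)" if "x : D" for x using t(2)[OF that] Mt by simp
   show "cmod (pd th i x) <= t + M * (t * t)" if "x : D" "i : Basis" for x i using pt[OF that(2,1)] t0 by simp
   show "0 <= t + M * (t * t)" using Mt t0 by simp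
  qed auto
  have "wlap D R r" unfolding wlap_def
  proof (intro allI impI)
   fix ph assume p: "C1c D ph"
   note ps = C1c_int[OF p]
   obtain B where B: "B >= 0" "!!x. cmod (ph x) <= B" "!!x v. cmod (pd ph v x) <= B * norm v" using C1c_bounded[OF p] by metis
   have thph: "C1c D (%x. th x * ph x)" by (rule C1c_mult(1)[OF D(1) th(1) p])
   have ththph: "C1c D (%x. th x * (th x * ph x))" by (rule C1c_mult(1)[OF D(1) th(1) thph])
   \<comment> \<open>The divergence of A exists only weakly. Its contribution comes from testing the
     weak derivative of \<open>A i\<close> with om q, where om = th^2 ph.\<close>
   define om where "om = (%x. th x * (th x * ph x))"
   obtain B2 where B2: "B2 >= 0" "!!x. cmod (om x) <= B2" "!!x v. cmod (pd om v x) <= B2 * norm v" unfolding om_def using C1c_bounded[OF ththph] by metis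
   have omC: "C1_on D om" unfolding om_def by (rule C1_on_subset[OF C1c_C1[OF ththph] subset_UNIV])
   have Wom: "W D (%x. om x * q x) (%i x. om x * Q i x + pd om i x * q x)"
   proof (rule W_mult[OF D(1) omC q, where C = UNIV and B = B2])
    show "cmod (pd om i x) <= B2" if "i : Basis" for x i using B2(3)[where x = x and v = i] that by simp
   qed (use B2(1,2) in auto)
   \<comment> \<open>By \<open>W_test_weak_deriv\<close> the contributions of the second and the
     last term cancel after integration; the others are the desired ones.\<close>
   have pw: "R i x * pd ph i x = Q i x * pd (%x. th x * ph x) i x - A i x * (om x * Q i x + pd om i x * q x) - (c i x * Q i x + d i x * q x) * ph x - (h i x * (om x * q x))"
    if i: "i : Basis" for i x
   proof (cases "x : D")
    case True
    have 1: "pd (%x. th x * ph x) i x = th x * pd ph i x + pd th i x * ph x" by (rule C1c_mult(2)[OF D(1) th(1) p True])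
    have 2: "pd om i x = th x * (th x * pd ph i x + pd th i x * ph x) + pd th i x * (th x * ph x)"
     unfolding om_def C1c_mult(2)[OF D(1) th(1) thph True] 1 ..
    have Thx: "Th x = th x" using True by (simp add: Th_def)
    show ?thesis unfolding R_def 1 2 th(2)[OF i True] c_def d_def Thx by (simp add: om_def algebra_simps)
   next
    case False
    then show ?thesis using WD(3)[OF q False] WD(4)[OF q False i] A(3)[OF i False] h(3)[OF i False] by (simp add: R_def)
   qed
   have I: "intgl (%x. Q i x * pd (%x. th x * ph x) i x)" "intgl (%x. A i x * (om x * Q i x + pd om i x * q x))"
    "intgl (%x. (c i x * Q i x + d i x * q x) * ph x)" "intgl (%x. h i x * (om x * q x))" if i: "i : Basis" for i
    by (intro sqi_mult WD(2)[OF q i] C1c_int(4)[OF thph] As i WD(2)[OF Wom i] WD(1)[OF Wom] sqi_add b2 b3 ps)+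
   have "(LBINT x. R i x * pd ph i x) = (LBINT x. Q i x * pd (%x. th x * ph x) i x) - (LBINT x. (c i x * Q i x + d i x * q x) * ph x)" if i: "i : Basis" for i
   proof -
    have "(LBINT x. R i x * pd ph i x) = (LBINT x. Q i x * pd (%x. th x * ph x) i x) - (LBINT x. A i x * (om x * Q i x + pd om i x * q x))
     - (LBINT x. (c i x * Q i x + d i x * q x) * ph x) - (LBINT x. h i x * (om x * q x))"
     unfolding pw[OF i] using I[OF i] by (simp only: bint_diff bintgl_diff)
    moreover have "(LBINT x. A i x * (om x * Q i x + pd om i x * q x)) = - (LBINT x. h i x * (om x * q x))"
     by (rule W_test_weak_deriv[OF As(1)[OF i] As(2)[OF i] i wd[OF i] Wom])
    ultimately show ?thesis by simp
   qed
   then have "(SB i. LBINT x. R i x * pd ph i x) = (SB i. LBINT x. Q i x * pd (%x. th x * ph x) i x) - (SB i. LBINT x. (c i x * Q i x + d i x * q x) * ph x)"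
    by (simp add: sum_subtractf)
   also have "(SB i. LBINT x. Q i x * pd (%x. th x * ph x) i x) = - (LBINT x. F x * (th x * ph x))"
    using wl thph unfolding wlap_def by blast
   also have "(%x. F x * (th x * ph x)) = (%x. (Th x * F x) * ph x)"
   proof
    fix x show "F x * (th x * ph x) = (Th x * F x) * ph x" using C1c_off[OF p, of x] by (cases "x : D") (auto simp: Th_def)
   qed
   finally have e: "(SB i. LBINT x. R i x * pd ph i x) = - (LBINT x. (Th x * F x) * ph x) - (SB i. LBINT x. (c i x * Q i x + d i x * q x) * ph x)" .
   have "(LBINT x. r x * ph x) = (LBINT x. (Th x * F x) * ph x + (SB i. (c i x * Q i x + d i x * q x) * ph x))"
    by (rule bint_cong) (simp_all add: r_def distrib_right sum_distrib_right)
   also have "... = (LBINT x. (Th x * F x) * ph x) + (SB i. LBINT x. (c i x * Q i x + d i x * q x) * ph x)"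
   proof -
    have "intgl (%x. (Th x * F x) * ph x)" by (intro sqi_mult b1 ps)
    then show ?thesis using bint_sum[where I = Basis and f = "%i x. (c i x * Q i x + d i x * q x) * ph x", OF I(3)]
     bintgl_sum[where I = Basis and f = "%i x. (c i x * Q i x + d i x * q x) * ph x", OF I(3)] by (simp only: bint_add)
   qed
   finally show "(SB i. LBINT x. R i x * pd ph i x) = - (LBINT x. r x * ph x)" using e by simp
  qed
  then show ?thesis using WR rs rn unfolding th_def by blast
 qed
 have "0 <= K * real DIM('a) + K" using K(2) by simp
 then show ?thesis using main by (rule that)
qed

section \<open>The regularity estimate for the solution operator\<close>

theorem theorem3p1:
  fixes D :: "'a::euclidean_space set"
    and \<alpha> \<beta> :: "'a \<Rightarrow> real"
    and amin amax bmin bmax :: real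
    and T :: "('a \<Rightarrow> complex) \<Rightarrow> ('a \<Rightarrow> complex)"
    and lam :: "nat \<Rightarrow> real"
    and phi :: "nat \<Rightarrow> 'a \<Rightarrow> complex"
  assumes "DIM('a) = 2 \<or> DIM('a) = 3"
    and "open D" and "bounded D" and "simply_connected D"
    and "polygonal_no_reentrant D \<or> C2_boundary D"
    and "bounded_coeff D \<alpha> amin amax"
    and "bounded_coeff D \<beta> bmin bmax"
    and "W2inf D \<alpha>"
    and "solution_operator D \<alpha> \<beta> T"
    and "dirichlet_eigensystem D lam phi"
  shows "(\<forall>f\<in>XD D. T f \<in> DomLap D lam phi 2) \<and>
         (\<exists>C>0. \<forall>f\<in>XD D. DomLap_norm D lam phi 2 (T f) \<le> C * L2norm D f)"
proof -
 note D = \<open>open D\<close> \<open>bounded D\<close>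
 have ld: "Lap_dense D"
 proof (cases "D = {}")
  case True then show ?thesis by (simp add: Lap_dense_def)
 next
  case False
  show ?thesis using \<open>polygonal_no_reentrant D \<or> C2_boundary D\<close>
  proof
   assume "polygonal_no_reentrant D" then show ?thesis by (rule polygonal_Lap_dense[OF D False])
  next
   assume b: "C2_boundary D"
   show ?thesis
   proof (rule Lap_dense_graph[OF D])
    fix p assume p: "p : closure D"
    show "graph_at D p"
    proof (cases "p : D")
     case True then show ?thesis by (rule graph_at_interior[OF D(1)])
    next
     case False
     then have "p : frontier D" using p D(1) by (simp add: frontier_def interior_open)
     then show ?thesis using b unfolding C2_boundary_def graph_at_def by blast
    qed
   qed
  qed
 qed
 have \<alpha>: "0 < amin" "AEL x. x : D --> amin <= \<alpha> x & \<alpha> x <= amax"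
  using \<open>bounded_coeff D \<alpha> amin amax\<close> unfolding bounded_coeff_def AE_lebesgue_on_lborel[OF D(1)] by blast+
 have \<beta>: "0 < bmin" "\<beta> : borel_measurable (lebesgue_on D)" "AEL x. x : D --> bmin <= \<beta> x & \<beta> x <= bmax"
  using \<open>bounded_coeff D \<beta> bmin bmax\<close> unfolding bounded_coeff_def AE_lebesgue_on_lborel[OF D(1)] by blast+
 note T = \<open>solution_operator D \<alpha> \<beta> T\<close>[unfolded solution_operator_def, rule_format]
 note ev = \<open>dirichlet_eigensystem D lam phi\<close>[unfolded dirichlet_eigensystem_def]
 have "ALL j. EX e E. rep D (phi j) e & W D e E"
 proof
  fix j
  have "phi j : H10 D" using ev by blast
  then show "EX e E. rep D (phi j) e & W D e E" using H10_E[OF D(1)] by blast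
 qed
 from choice[OF this] obtain e where "ALL j. EX E. rep D (phi j) (e j) & W D (e j) E" by blast
 from choice[OF this] obtain E where e: "!!j. rep D (phi j) (e j)" "!!j. W D (e j) (E j)" by blast
 have es: "sqi (e j)" for j by (rule WD(1)[OF e(2)])
 define k where "k = (%j x. - (cor (lam j) * e j x))"
 have ks: "sqi (k j)" for j unfolding k_def by (intro sqi_uminus sqi_cmult es)
 have ke: "wlap D (E j) (k j)" for j
 proof (rule weak_laplacian_W[OF D(1) e(1)[of j] _ e(2)[of j] ks])
  show "rep D (%x. - (cor (lam j) * phi j x)) (k j)"
   unfolding k_def using rep_comp2[OF e(1)[of j] e(1)[of j], of "%a b. - (cor (lam j) * a)"] by (simp add: continuous_intros)
  show "weak_laplacian D (phi j) (%x. - (cor (lam j) * phi j x))" using ev by blast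
 qed
 have ortho: "(LBINT x. e j x * cnj (e i x)) = (if j = i then 1 else 0)" for j i
 proof (cases "j = i")
  case True
  have "L2norm D (phi j) = 1" using ev by blast
  then have "nrm (e j) = 1" using rep_L2(2)[OF D(1) e(1)] by simp
  then have "(LBINT x. (cmod (e j x))^2) = 1" using nrm_sq[of lborel "e j"] by simp
  then show ?thesis using True unfolding mult_cnj_cmod_sq by (simp only: integral_complex_of_real refl if_True of_real_1 mult_cnj_cmod_sq)
 next
  case False
  then have "L2inner D (phi j) (phi i) = 0" using ev by blast
  then show ?thesis using rep_L2inner[OF D(1) e(1) e(1)] False by simp
 qed
 obtain s A h M where s: "C1_on D s" "!!i x. i : Basis ==> x : D ==> pd s i x = A i x"
  and A: "!!i. i : Basis ==> A i : mbl" "!!i x. i : Basis ==> cmod (A i x) <= M" "!!i x. i : Basis ==> x ~: D ==> A i x = 0"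
  and h: "!!i. i : Basis ==> h i : mbl" "!!i x. i : Basis ==> cmod (h i x) <= M" "!!i x. i : Basis ==> x ~: D ==> h i x = 0"
  and wd: "!!i ph. i : Basis ==> C1c D ph ==> (LBINT x. A i x * pd ph i x) = - (LBINT x. h i x * ph x)"
  and s0: "rep D (%x. cor (\<alpha> x)) (%x. indicator D x * s x)" and M0: "0 <= M"
  by (rule W2inf_rep[OF D \<open>W2inf D \<alpha>\<close>]) (rule that; assumption)
 have sb: "AEL x. cmod (indicator D x * s x) <= max amax 0" using \<alpha>(2) rep_D(4)[OF s0]
 proof eventually_elim
  fix x assume h: "x : D --> amin <= \<alpha> x & \<alpha> x <= amax" "x : D --> cor (\<alpha> x) = indicator D x * s x"
  show "cmod (indicator D x * s x) <= max amax 0"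
  proof (cases "x : D")
   case True
   then have "cmod (indicator D x * s x) = \<bar>\<alpha> x\<bar>" using h(2) norm_of_real by metis
   then show ?thesis using h(1) True \<alpha>(1) by simp
  qed simp
 qed
 \<comment> \<open>The lower bound for \<alpha> holds almost everywhere; s is continuous, so |s|
   obeys it at every point of \<open>D\<close>.\<close>
 have sm: "amin <= cmod (s x)" if x: "x : D" for x
 proof -
  have "AEL x. x : D --> s x ~: ball 0 amin" using \<alpha>(2) rep_D(4)[OF s0]
  proof eventually_elim
   fix x assume h: "x : D --> amin <= \<alpha> x & \<alpha> x <= amax" "x : D --> cor (\<alpha> x) = indicator D x * s x"
   show "x : D --> s x ~: ball 0 amin"
   proof
    assume x: "x : D"
    then have "s x = cor (\<alpha> x)" using h(2) by simp
    then show "s x ~: ball 0 amin" using h(1) x \<alpha>(1) by simp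
   qed
  qed
  from AE_continuous_imp[OF D(1) C1_on_cont[OF s(1)] open_ball this x] show ?thesis by simp
 qed
 obtain C1 where C1: "C1 >= 0" "!!q Q F. W D q Q ==> sqi F ==> wlap D Q F ==>
  EX R r. W D (%x. inverse (s x) * q x) R & sqi r & wlap D R r & nrm r <= C1 * (nrm F + nrm q + (SB i. nrm (Q i)))"
  by (rule wlap_divide[OF D s A h wd \<alpha>(1) sm M0]) (assumption | (rule that; assumption))+
 obtain C2 where C2: "C2 > 0" "!!F. sqi F ==> EX q Q. W D q Q & wlap D Q F & nrm q <= C2 * nrm F \<and>
   (ALL i:Basis. nrm (Q i) <= C2 * nrm F)"
  by (rule Dirichlet_solve[OF D]) (rule that; assumption)
 have "(%x. cor (\<beta> x)) : borel_measurable (lebesgue_on D)" using \<beta>(2) by simp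
 from rep_exists[OF D(1) this] obtain B0 where B0: "rep D (%x. cor (\<beta> x)) B0" by blast
 define bm where "bm = max bmax 0"
 have B0b: "AEL x. cmod (B0 x) <= bm" using \<beta>(3) rep_D(4)[OF B0]
 proof eventually_elim
  fix x assume h: "x : D --> bmin <= \<beta> x & \<beta> x <= bmax" "x : D --> cor (\<beta> x) = B0 x"
  show "cmod (B0 x) <= bm"
  proof (cases "x : D")
   case True
   then have "cmod (B0 x) = \<bar>\<beta> x\<bar>" using h(2) norm_of_real by metis
   then show ?thesis using h(1) True \<beta>(1) by (simp add: bm_def)
  qed (simp add: rep_D(3)[OF B0] bm_def)
 qed
 \<comment> \<open>C2 bounds q and each of its derivatives by \<beta> f, C1 passes from these to the
   Laplacian of q / s, and bm bounds |\<beta>|.\<close>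
 define C where "C = C1 * (1 + C2 + real DIM('a) * C2) * bm"
 have main: "T f : L2 D & (ALL n. (\<Sum>j<n. lam j ^ (2 * 2) * (cmod (L2inner D (T f) (phi j)))^2) <= (C * L2norm D f)^2) & 0 <= C * L2norm D f"
  if f: "f : XD D" for f
 proof -
  have "f : L2 D" using f by (simp add: XD_def H2_def)
  then obtain f0 where f0: "rep D f f0" "sqi f0" using L2_rep[OF D(1)] by blast
  define F where "F = (%x. B0 x * f0 x)"
  have Fr: "rep D (%x. cor (\<beta> x) * f x) F" unfolding F_def by (rule rep_mult[OF B0 f0(1)])
  have bm0: "0 <= bm" by (simp add: bm_def)
  have Fs: "sqi F" "nrm F <= bm * nrm f0"
   unfolding F_def using sqi_mult_bounded[OF f0(2) _ B0b bm0] rep_D(2)[OF B0] by simp_all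
  define w where "w = T f"
  have wX: "w : XD D" and wT: "!!v. v : XD D ==> aform D \<alpha> w v = bform D \<beta> f v" using T[OF f] by (simp_all add: w_def)
  obtain w0 Gw l where w0: "rep D w w0" "W D w0 Gw" and l: "rep D (Lap D w) l" "sqi l" "wlap D Gw l"
   by (rule XD_E[OF D(1) wX]) (rule that; assumption)
  define p where "p = (%x. indicator D x * s x * l x)"
  have pr: "rep D (%x. cor (\<alpha> x) * Lap D w x) p" unfolding p_def by (rule rep_mult[OF s0 l(1)])
  have ps: "sqi p" unfolding p_def using sqi_mult_bounded(1)[OF l(2) _ sb] rep_D(2)[OF s0] by simp
  obtain q Q where q: "W D q Q" "wlap D Q F" "nrm q <= C2 * nrm F" "!!i. i : Basis ==> nrm (Q i) <= C2 * nrm F"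
   using C2(2)[OF Fs(1)] by blast
  have "AEL x. x : D --> p x - q x = 0"
  proof (rule ld[unfolded Lap_dense_def, rule_format])
   show "sqi (%x. p x - q x)" by (intro sqi_diff ps WD(1)[OF q(1)])
   fix v V fl assume "XW D v V fl"
   then have v: "W D v V" "sqi fl" "!!x. x ~: D ==> fl x = 0" "wlap D V fl"
    "!!i j. i : Basis ==> j : Basis ==> bf D (%ph. LBINT x. V i x * pd ph j x)" by (simp_all add: XW_def)
   have vX: "v : XD D" by (rule W_XD[OF D v(1) v(5)])
   have "aform D \<alpha> w v = (LBINT x. p x * cnj (fl x))"
    unfolding aform_def by (rule rep_integral(2)[OF D(1) rep_mult_cnj[OF pr Lap_W[OF D(1) vX v(1,2,3,4)]]])
   moreover have "bform D \<beta> f v = (LBINT x. F x * cnj (v x))"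
    unfolding bform_def by (rule rep_integral(2)[OF D(1) rep_mult_cnj[OF Fr W_rep[OF v(1)]]])
   moreover have "(LBINT x. F x * cnj (v x)) = (LBINT x. q x * cnj (fl x))"
    by (rule wlap_Green[OF q(1) Fs(1) q(2) v(1,2,4)])
   ultimately have "(LBINT x. p x * cnj (fl x)) = (LBINT x. q x * cnj (fl x))" using wT[OF vX] by simp
   moreover have "intgl (%x. p x * cnj (fl x))" "intgl (%x. q x * cnj (fl x))"
    by (intro sqi_mult ps WD(1)[OF q(1)] sqi_cnj v(2))+
   ultimately show "(LBINT x. (p x - q x) * cnj (fl x)) = 0" by (simp add: left_diff_distrib)
  qed
  then have lP: "AEL x. l x = inverse (s x) * q x"
  proof eventually_elim
   fix x assume pq: "x : D --> p x - q x = 0"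
   show "l x = inverse (s x) * q x"
   proof (cases "x : D")
    case True
    then have "s x * l x = q x" "s x ~= 0" using pq sm[OF True] \<alpha>(1) by (auto simp: p_def)
    then show ?thesis by (auto simp: field_simps)
   next
    case False
    then show ?thesis using rep_D(3)[OF l(1)] WD(3)[OF q(1)] by simp
   qed
  qed
  obtain R r where r: "W D (%x. inverse (s x) * q x) R" "sqi r" "wlap D R r"
   "nrm r <= C1 * (nrm F + nrm q + (SB i. nrm (Q i)))"
   using C1(2)[OF q(1) Fs(1) q(2)] by blast
  \<comment> \<open>Each of the two uses of Green's formula that carry \<open>k j\<close>
    contributes a factor - \<open>lam j\<close>; the signs cancel in the square.\<close>
  have coef: "(LBINT x. r x * cnj (e j x)) = (of_real (lam j))^2 * L2inner D w (phi j)" for j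
  proof -
   have kc: "(LBINT x. a x * cnj (k j x)) = - (of_real (lam j) * (LBINT x. a x * cnj (e j x)))" for a
   proof -
    have "a x * cnj (k j x) = - (of_real (lam j) * (a x * cnj (e j x)))" for x by (simp add: k_def)
    then show ?thesis by simp
   qed
   have "(LBINT x. l x * cnj (e j x)) = (LBINT x. w0 x * cnj (k j x))"
    by (rule wlap_Green[OF w0(2) l(2,3) e(2) ks ke])
   moreover have "(LBINT x. r x * cnj (e j x)) = (LBINT x. (inverse (s x) * q x) * cnj (k j x))"
    by (rule wlap_Green[OF r(1,2,3) e(2) ks ke])
   moreover have "(LBINT x. (inverse (s x) * q x) * cnj (e j x)) = (LBINT x. l x * cnj (e j x))"
   proof (rule integral_cong_AE)
    show "(%x. (inverse (s x) * q x) * cnj (e j x)) : lmbl"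
     by (rule borel_measurable_times[OF sqi_meas[OF WD(1)[OF r(1)]] sqi_meas[OF sqi_cnj[OF es]]])
    show "(%x. l x * cnj (e j x)) : lmbl"
     by (rule borel_measurable_times[OF sqi_meas[OF l(2)] sqi_meas[OF sqi_cnj[OF es]]])
    show "AEL x. (inverse (s x) * q x) * cnj (e j x) = l x * cnj (e j x)" using lP by eventually_elim simp
   qed
   ultimately have "(LBINT x. r x * cnj (e j x)) = (of_real (lam j))^2 * (LBINT x. w0 x * cnj (e j x))"
    unfolding kc by (simp add: power2_eq_square)
   then show ?thesis unfolding rep_L2inner[OF D(1) w0(1) e(1)] .
  qed
  have pw: "lam j ^ (2 * 2) * (cmod (L2inner D w (phi j)))^2 = (cmod (LBINT x. r x * cnj (e j x)))^2" for j
   unfolding coef norm_mult norm_power norm_of_real power_mult_distrib by (simp add: power_mult[symmetric])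
  have "nrm r <= C1 * (nrm F + C2 * nrm F + (\<Sum>i\<in>(Basis::'a set). C2 * nrm F))"
   by (rule order_trans[OF r(4)]) (intro mult_left_mono add_mono sum_mono q(3,4) C1(1) order_refl; assumption?)
  also have "... = C1 * (1 + C2 + real DIM('a) * C2) * nrm F" by (simp add: algebra_simps)
  also have "... <= C1 * (1 + C2 + real DIM('a) * C2) * (bm * nrm f0)" using C1(1) C2(1) by (intro mult_left_mono Fs(2)) simp
  also have "... = C * L2norm D f" unfolding C_def rep_L2(2)[OF D(1) f0(1)] by (simp only: mult.assoc)
  finally have rC: "nrm r <= C * L2norm D f" .
  have "(\<Sum>j<n. lam j ^ (2 * 2) * (cmod (L2inner D w (phi j)))^2) <= (C * L2norm D f)^2" for n
   unfolding pw by (rule order_trans[OF Bessel[OF r(2) es ortho] power_mono[OF rC nrm_nonneg]])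
  moreover have "w : L2 D" using wX by (simp add: XD_def H2_def)
  moreover have "0 <= C * L2norm D f" using rC nrm_nonneg[of lborel r] by linarith
  ultimately show ?thesis unfolding w_def by blast
 qed
 have nn: "0 <= lam j ^ (2 * 2) * (cmod (L2inner D (T f) (phi j)))^2" for f j by (intro mult_nonneg_nonneg zero_le_even_power) auto
 have sum: "summable (%j. lam j ^ (2 * 2) * (cmod (L2inner D (T f) (phi j)))^2)" if "f : XD D" for f
  by (rule summableI_nonneg_bounded[OF nn]) (use main[OF that] in blast)
 have bnd: "DomLap_norm D lam phi 2 (T f) <= C * L2norm D f" if "f : XD D" for f
 proof -
  have "(\<Sum>j. lam j ^ (2 * 2) * (cmod (L2inner D (T f) (phi j)))^2) <= (C * L2norm D f)^2"
   by (rule suminf_le_const[OF sum[OF that]]) (use main[OF that] in blast)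
  then have "DomLap_norm D lam phi 2 (T f) <= sqrt ((C * L2norm D f)^2)" unfolding DomLap_norm_def by (rule real_sqrt_le_mono)
  then show ?thesis using main[OF that] by (simp add: real_sqrt_abs)
 qed
 have nL: "0 <= L2norm D f" for f unfolding L2norm_def by (intro real_sqrt_ge_zero bint_nonneg) simp
 \<comment> \<open>The constant C may be 0, so the strictly positive one asked for is max C
   1.\<close>
 show ?thesis
 proof (intro conjI ballI exI[of _ "max C 1"])
  show "T f : DomLap D lam phi 2" if "f : XD D" for f using main[OF that] sum[OF that] by (simp add: DomLap_def)
  show "DomLap_norm D lam phi 2 (T f) <= max C 1 * L2norm D f" if "f : XD D" for f
   using bnd[OF that] mult_right_mono[OF max.cobounded1[of C 1] nL[of f]] by linarith
 qed simp
qed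

end
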